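(* For every knot $K$, the Reidemeister graphs $\mathcal{G}(K)$ and $\mathcal{G}_S(K)$, endowed with the path metric, are not (Gromov) hyperbolic.
   Context: Knots are unoriented knot types in $S^3$. $\mathcal{G}(K)$ (resp. $\mathcal{G}_S(K)$) is the graph whose vertices are the diagrams of $K$ on $\mathbb{R}^2$ up to planar isotopy (resp. on $S^2$ up to isotopy of $S^2$), with one edge for each single Reidemeister move (of type 1, 2 or 3, all variants allowed) relating two diagrams; different moves between the same diagrams give different edges, and moves coinciding up to isotopy give a single edge. The path distance between two diagrams is the minimal number of Reidemeister moves connecting them. *)

theory Defs
  imports "HOL-Analysis.Analysis"
begin

section \<open>Smooth maps, isotopies and circle reparametrisations\<close>

text \<open>Everything lives in the \<open>C\<^sup>1\<close> category, in which knot types (and diagrams up to isotopy) are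
  those of tame knots. A map on a subset of a Euclidean space is \<open>C\<^sup>1\<close> if it extends to a \<open>C\<^sup>1\<close> map on
  an open neighbourhood; a family is \<open>C\<^sup>1\<close> if maps and first derivatives depend continuously on
  the point and the parameter jointly.\<close>

definition C1_family ::
  "real set \<Rightarrow> 'a::euclidean_space set \<Rightarrow> (real \<Rightarrow> 'a \<Rightarrow> 'b::euclidean_space) \<Rightarrow> bool" where
  "C1_family T S H \<longleftrightarrow> (\<exists>U H'. open U \<and> S \<subseteq> U \<and>
     (\<forall>t\<in>T. \<forall>x\<in>U. (H t has_derivative blinfun_apply (H' (t, x))) (at x)) \<and>
     continuous_on (T \<times> U) (\<lambda>(t, x). H t x) \<and> continuous_on (T \<times> U) H')"

definition ambient_isotopy :: "'a::euclidean_space set \<Rightarrow> (real \<Rightarrow> 'a \<Rightarrow> 'a) \<Rightarrow> bool" where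
  "ambient_isotopy S H \<longleftrightarrow> C1_family {0..1} S H \<and>
     (\<exists>G. C1_family {0..1} S G \<and> (\<forall>t\<in>{0..1}. homeomorphism S S (H t) (G t))) \<and>
     (\<forall>x\<in>S. H 0 x = x)"

text \<open>The circle is \<open>\<real>/\<int>\<close>: closed curves are functions of period 1, and circle diffeomorphisms are
  given by their lifts to \<open>\<real>\<close>. Both directions are allowed since knots and diagrams are unoriented.\<close>

definition circle_reparam :: "(real \<Rightarrow> real) \<Rightarrow> bool" where
  "circle_reparam \<theta> \<longleftrightarrow> \<theta> C1_differentiable_on UNIV \<and> (\<forall>t. deriv \<theta> t \<noteq> 0) \<and>
     ((\<forall>t. \<theta> (t + 1) = \<theta> t + 1) \<or> (\<forall>t. \<theta> (t + 1) = \<theta> t - 1))"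

definition closed_immersion :: "(real \<Rightarrow> 'a::euclidean_space) \<Rightarrow> bool" where
  "closed_immersion c \<longleftrightarrow> c C1_differentiable_on UNIV \<and> (\<forall>t. c (t + 1) = c t) \<and>
     (\<forall>t. vector_derivative c (at t) \<noteq> 0)"

text \<open>Two different points of the circle with the same image.\<close>

definition double_pair :: "(real \<Rightarrow> 'a) \<Rightarrow> real \<Rightarrow> real \<Rightarrow> bool" where
  "double_pair c s t \<longleftrightarrow> c s = c t \<and> s - t \<notin> \<int>"


section \<open>Knot types in the 3-sphere\<close>

type_synonym R3 = "complex \<times> real"
type_synonym R4 = "R3 \<times> real"

definition is_knot :: "(real \<Rightarrow> R4) \<Rightarrow> bool" where
  "is_knot \<gamma> \<longleftrightarrow> closed_immersion \<gamma> \<and> range \<gamma> \<subseteq> sphere 0 1 \<and> (\<forall>s t. \<not> double_pair \<gamma> s t)"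

text \<open>Isotopy through \<open>C\<^sup>1\<close> embeddings of the circle in the 3-sphere. The velocity is required to be
  jointly continuous, so that knotted arcs cannot be shrunk to a point.\<close>

definition knot_equiv :: "((real \<Rightarrow> R4) \<times> (real \<Rightarrow> R4)) set" where
  "knot_equiv = {(\<gamma>, \<gamma>'). is_knot \<gamma> \<and> is_knot \<gamma>' \<and>
     (\<exists>\<Gamma> \<theta>. C1_family {0..1} UNIV \<Gamma> \<and> (\<forall>s\<in>{0..1}. is_knot (\<Gamma> s)) \<and> circle_reparam \<theta> \<and>
        \<Gamma> 0 = \<gamma> \<and> \<Gamma> 1 = \<gamma>' \<circ> \<theta>)}"

definition knot_types :: "(real \<Rightarrow> R4) set set" where
  "knot_types = Collect is_knot // knot_equiv"


section \<open>Knot diagrams on a surface\<close>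

text \<open>A diagram is a closed curve together with the set of those parameters at which the curve runs
  through a crossing as the over-strand. The surface \<open>S\<close> is the plane or the 2-sphere.\<close>

type_synonym 'a diagram = "(real \<Rightarrow> 'a) \<times> real set"

definition is_diagram :: "'a::euclidean_space set \<Rightarrow> 'a diagram \<Rightarrow> bool" where
  "is_diagram S D \<longleftrightarrow> (case D of (c, Ov) \<Rightarrow>
     closed_immersion c \<and> range c \<subseteq> S \<and>
     (\<forall>s t. double_pair c s t \<longrightarrow>
        vector_derivative c (at t) \<notin> span {vector_derivative c (at s)}) \<and>
     (\<forall>s t r. double_pair c s t \<and> double_pair c s r \<longrightarrow> t - r \<in> \<int>) \<and>
     finite {s\<in>{0..<1}. \<exists>t. double_pair c s t} \<and>
     Ov \<subseteq> {s. \<exists>t. double_pair c s t} \<and>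
     (\<forall>t. t + 1 \<in> Ov \<longleftrightarrow> t \<in> Ov) \<and>
     (\<forall>s t. double_pair c s t \<longrightarrow> (s \<in> Ov \<longleftrightarrow> t \<notin> Ov)))"

text \<open>The map \<open>emb\<close> embeds \<open>S \<times> \<real>\<close> into 3-space, the second factor being the height from which
  diagrams are viewed; 3-space is then embedded into the 3-sphere by inverse stereographic
  projection.\<close>

definition stereo_inv :: "R3 \<Rightarrow> R4" where
  "stereo_inv x = ((2 / ((norm x)\<^sup>2 + 1)) *\<^sub>R x, ((norm x)\<^sup>2 - 1) / ((norm x)\<^sup>2 + 1))"

definition represents :: "('a::euclidean_space \<Rightarrow> real \<Rightarrow> R3) \<Rightarrow> 'a diagram \<Rightarrow> (real \<Rightarrow> R4) set \<Rightarrow> bool"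
  where
  "represents emb D K \<longleftrightarrow> (case D of (c, Ov) \<Rightarrow>
     \<exists>h. h C1_differentiable_on UNIV \<and> (\<forall>t. h (t + 1) = h t) \<and>
        (\<forall>s t. double_pair c s t \<and> s \<in> Ov \<longrightarrow> h t < h s) \<and>
        (\<lambda>t. stereo_inv (emb (c t) (h t))) \<in> K)"

definition diagrams_of ::
  "'a::euclidean_space set \<Rightarrow> ('a \<Rightarrow> real \<Rightarrow> R3) \<Rightarrow> (real \<Rightarrow> R4) set \<Rightarrow> 'a diagram set" where
  "diagrams_of S emb K = {D. is_diagram S D \<and> represents emb D K}"

definition transports :: "('a \<Rightarrow> 'a) \<Rightarrow> 'a diagram \<Rightarrow> 'a diagram \<Rightarrow> bool" where
  "transports f D D' \<longleftrightarrow>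
     (\<exists>\<theta>. circle_reparam \<theta> \<and> fst D' = f \<circ> fst D \<circ> \<theta> \<and> snd D' = \<theta> -` snd D)"

definition diagram_isotopy :: "'a::euclidean_space set \<Rightarrow> ('a diagram \<times> 'a diagram) set" where
  "diagram_isotopy S = {(D, D'). \<exists>H. ambient_isotopy S H \<and> transports (H 1) D D'}"


section \<open>Reidemeister moves\<close>

text \<open>A move replaces, inside an embedded square, a standard tangle by another one. A local model
  lists for each strand its course before and after the move; strands are arcs in \<open>[-1,1]\<^sup>2\<close>
  parametrised by \<open>[-1,1]\<close>, and both courses agree to first order at the ends.

  R1: a straight strand becomes a strand with one kink, double at \<open>u = \<plusminus>1/\<surd>2\<close>.
  R2: the upper of two parallel strands is pushed across the lower one.
  R3: a strand is pushed across the crossing of two others.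

  Mirror images, strand directions and crossing choices are not fixed by the models but by the
  chart, the parametrisation and the over/under data in \<open>reid_step\<close>.\<close>

type_synonym local_model = "((real \<Rightarrow> complex) \<times> (real \<Rightarrow> complex)) list"

definition R1_model :: local_model where
  "R1_model =
    [(\<lambda>u. Complex u 0, \<lambda>u. Complex (u - 4 * u * (1 - u\<^sup>2)\<^sup>2) ((1 - u\<^sup>2)\<^sup>2 / 2))]"

definition R2_model :: local_model where
  "R2_model =
    [(\<lambda>u. Complex u (- 1/2), \<lambda>u. Complex u (- 1/2)),
     (\<lambda>u. Complex u (1/2), \<lambda>u. Complex u (1/2 - 5/4 * (1 - u\<^sup>2)\<^sup>2))]"

definition R3_model :: local_model where
  "R3_model =
    [(\<lambda>u. Complex u (u / 2), \<lambda>u. Complex u (u / 2)),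
     (\<lambda>u. Complex u (- u / 2), \<lambda>u. Complex u (- u / 2)),
     (\<lambda>u. Complex u ((1 - u\<^sup>2)\<^sup>2 / 2), \<lambda>u. Complex u (- ((1 - u\<^sup>2)\<^sup>2) / 2))]"

definition square :: "complex set" where
  "square = {z. \<bar>Re z\<bar> \<le> 1 \<and> \<bar>Im z\<bar> \<le> 1}"

definition square_chart :: "'a::euclidean_space set \<Rightarrow> (complex \<Rightarrow> 'a) \<Rightarrow> bool" where
  "square_chart S \<phi> \<longleftrightarrow> (\<exists>U \<phi>'. open U \<and> square \<subseteq> U \<and> \<phi> ` U \<subseteq> S \<and> inj_on \<phi> U \<and>
     (\<forall>z\<in>U. (\<phi> has_derivative blinfun_apply (\<phi>' z)) (at z) \<and> inj (blinfun_apply (\<phi>' z))) \<and>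
     continuous_on U \<phi>')"

text \<open>Strand \<open>i\<close> of the model is run through by the curve at the parameters
  \<open>m i + r i * u\<close>, \<open>u \<in> [-1,1]\<close>. The function \<open>ht\<close> gives the order of the strands by
  height, which is the same before and after the move; it does not restrict the self-crossing of the
  kink. Since vertices are classes of diagrams up to isotopy and reparametrisation, it is no
  restriction to ask that the two curves agree as parametrised curves outside the square.\<close>

definition reid_step_via ::
  "local_model \<Rightarrow> 'a::euclidean_space set \<Rightarrow> 'a diagram \<Rightarrow> 'a diagram \<Rightarrow> bool" where
  "reid_step_via M S D\<^sub>1 D\<^sub>2 \<longleftrightarrow> (\<exists>\<phi> m r (ht :: nat \<Rightarrow> nat).
     let k = length M; p = (\<lambda>i u. m i + r i * u :: real) in
     square_chart S \<phi> \<and> (\<forall>i<k. r i \<noteq> 0) \<and>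
     inj_on (\<lambda>(i, u). frac (p i u)) ({..<k} \<times> {-1..1}) \<and>
     (\<forall>i<k. \<forall>u\<in>{-1..1}. fst D\<^sub>1 (p i u) = \<phi> (fst (M ! i) u) \<and> fst D\<^sub>2 (p i u) = \<phi> (snd (M ! i) u)) \<and>
     (\<forall>t. (\<nexists>i u. i < k \<and> u \<in> {-1..1} \<and> t - p i u \<in> \<int>) \<longrightarrow>
        fst D\<^sub>1 t = fst D\<^sub>2 t \<and> fst D\<^sub>1 t \<notin> \<phi> ` square \<and> (t \<in> snd D\<^sub>1 \<longleftrightarrow> t \<in> snd D\<^sub>2)) \<and>
     inj_on ht {..<k} \<and>
     (\<forall>D\<in>{D\<^sub>1, D\<^sub>2}. \<forall>i<k. \<forall>j<k. \<forall>u\<in>{-1..1}. \<forall>v\<in>{-1..1}.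
        i \<noteq> j \<and> fst D (p i u) = fst D (p j v) \<longrightarrow> (p i u \<in> snd D \<longleftrightarrow> ht j < ht i)))"

definition reid_step :: "'a::euclidean_space set \<Rightarrow> 'a diagram \<Rightarrow> 'a diagram \<Rightarrow> bool" where
  "reid_step S D\<^sub>1 D\<^sub>2 \<longleftrightarrow> (\<exists>M\<in>{R1_model, R2_model, R3_model}. reid_step_via M S D\<^sub>1 D\<^sub>2)"

text \<open>Moves coincide up to isotopy if one ambient isotopy carries the diagrams before and after the
  first move to those of the second, possibly with the second move read backwards.\<close>

definition same_move ::
  "'a::euclidean_space set \<Rightarrow> (('a diagram \<times> 'a diagram) \<times> ('a diagram \<times> 'a diagram)) set" where
  "same_move S = {((D\<^sub>1, D\<^sub>2), (E\<^sub>1, E\<^sub>2)). \<exists>H. ambient_isotopy S H \<and>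
     (transports (H 1) D\<^sub>1 E\<^sub>1 \<and> transports (H 1) D\<^sub>2 E\<^sub>2 \<or>
      transports (H 1) D\<^sub>1 E\<^sub>2 \<and> transports (H 1) D\<^sub>2 E\<^sub>1)}"


section \<open>Undirected multigraphs, path metric, hyperbolicity\<close>

record ('v, 'e) multigraph =
  verts :: "'v set"
  edges :: "'e set"
  ends :: "'e \<Rightarrow> 'v set"

definition adjacency :: "('v, 'e) multigraph \<Rightarrow> 'v rel" where
  "adjacency G = {(v, w). \<exists>e\<in>edges G. ends G e = {v, w}}"

definition path_dist :: "('v, 'e) multigraph \<Rightarrow> 'v \<Rightarrow> 'v \<Rightarrow> enat" where
  "path_dist G v w = Inf {enat n | n. (v, w) \<in> adjacency G ^^ n}"

text \<open>Gromov's four-point condition. Values are extended reals, so that points in different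
  components (at infinite distance) never violate it.\<close>

definition Gromov_hyperbolic :: "'v set \<Rightarrow> ('v \<Rightarrow> 'v \<Rightarrow> ereal) \<Rightarrow> bool" where
  "Gromov_hyperbolic V d \<longleftrightarrow> (\<exists>\<delta>::real\<ge>0. \<forall>x\<in>V. \<forall>y\<in>V. \<forall>z\<in>V. \<forall>w\<in>V.
     d x y + d z w \<le> max (d x z + d y w) (d x w + d y z) + ereal (2 * \<delta>))"

definition hyperbolic_graph :: "('v, 'e) multigraph \<Rightarrow> bool" where
  "hyperbolic_graph G \<longleftrightarrow> Gromov_hyperbolic (verts G) (\<lambda>v w. ereal_of_enat (path_dist G v w))"


section \<open>Reidemeister graphs\<close>

definition reidemeister_graph ::
  "'a::euclidean_space set \<Rightarrow> ('a \<Rightarrow> real \<Rightarrow> R3) \<Rightarrow> (real \<Rightarrow> R4) set \<Rightarrow>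
     ('a diagram set, ('a diagram \<times> 'a diagram) set) multigraph" where
  "reidemeister_graph S emb K = \<lparr>
     verts = diagrams_of S emb K // diagram_isotopy S,
     edges = {(D\<^sub>1, D\<^sub>2). D\<^sub>1 \<in> diagrams_of S emb K \<and> D\<^sub>2 \<in> diagrams_of S emb K \<and> reid_step S D\<^sub>1 D\<^sub>2}
       // same_move S,
     ends = (\<lambda>e. \<Union>(D\<^sub>1, D\<^sub>2)\<in>e. {diagram_isotopy S `` {D\<^sub>1}, diagram_isotopy S `` {D\<^sub>2}})\<rparr>"

definition planar_reidemeister_graph ::
  "(real \<Rightarrow> R4) set \<Rightarrow> (complex diagram set, (complex diagram \<times> complex diagram) set) multigraph" where
  "planar_reidemeister_graph K = reidemeister_graph UNIV Pair K"

text \<open>The product of the 2-sphere with \<open>\<real>\<close> is 3-space without the origin; diagrams are viewed from outside.\<close>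

definition spherical_reidemeister_graph ::
  "(real \<Rightarrow> R4) set \<Rightarrow> (R3 diagram set, (R3 diagram \<times> R3 diagram) set) multigraph" where
  "spherical_reidemeister_graph K = reidemeister_graph (sphere 0 1) (\<lambda>u h. exp h *\<^sub>R u) K"

end

(* A Reidemeister move changes the writhe by at most 1 and the crossing number by at most 2, so both
   invariants bound the path distance from below. A diagram of K has an arc free of crossings; on 2n
   disjoint pieces of it kinks of writhe +1 and -1, n of each, can be inserted independently by moves
   of type 1. With x the original diagram, y carrying all kinks, z only the positive and w only the
   negative ones, d x z, d x w, d y z, d y w are at most n, while d x y >= n by the crossing number
   and d z w >= 2n by the writhe. The four-point condition would give 3n <= 2n + 2 delta for all n.

   Diagrams exist because a knot can be moved off the centre of stereographic projection, smoothed
   and sheared until its projection is generic. The diagrams on the sphere are the planar ones,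
   carried over by an inverse stereographic projection; the graph may have infinite distances, which
   does no harm since the four points lie in one component. *)

theory Submission
  imports Defs
begin

section \<open>Families of \<open>C\<^sup>1\<close> curves\<close>

text \<open>Two points need care beyond the counting. Writhe must be read off isotopy classes: an
  area form \<open>\<omega>\<close> on the surface gives signs to crossings, its value along an
  ambient isotopy is continuous and never zero on transverse tangents, and a reversed
  parametrisation reverses both strands at once. And every diagram of the family must represent
  \<open>K\<close> itself, that is, come from an isotopy of embeddings with continuous velocity. A
  growing kink makes the plane curve run through a cusp, so the arc is given beforehand a height
  profile steep enough to keep the space curve immersed there and the two branches of the later loop
  apart. A knot is only C^1. It is averaged once, because excluding stationary points of the
  projection requires the tangent direction to vary differentiably. Triple points are excluded by a
  quadratic term in the shear, which supplies two further parameters, whatever the position of the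
  knot. The inverse stereographic projection is scaled so that its derivative at 0 is the inclusion
  of the plane; zooming then joins the planar picture of the knot continuously to the spherical
  one.\<close>

definition curve_family :: "(real \<Rightarrow> real \<Rightarrow> 'a::euclidean_space) \<Rightarrow> (real \<Rightarrow> real \<Rightarrow> 'a) \<Rightarrow> bool" where
  "curve_family \<Gamma> \<Gamma>' \<longleftrightarrow> (\<forall>s\<in>{0..1}. \<forall>t. (\<Gamma> s has_vector_derivative \<Gamma>' s t) (at t)) \<and>
     continuous_on ({0..1} \<times> UNIV) (\<lambda>x. \<Gamma> (fst x) (snd x)) \<and>
     continuous_on ({0..1} \<times> UNIV) (\<lambda>x. \<Gamma>' (fst x) (snd x))"

definition C1_curve :: "(real \<Rightarrow> 'a::euclidean_space) \<Rightarrow> (real \<Rightarrow> 'a) \<Rightarrow> bool" where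
  "C1_curve c c' \<longleftrightarrow> (\<forall>t. (c has_vector_derivative c' t) (at t)) \<and> continuous_on UNIV c'"

lemma C1_curve_iff: "c C1_differentiable_on UNIV \<longleftrightarrow> (\<exists>c'. C1_curve c c')"
  by (auto simp: C1_differentiable_on_def C1_curve_def)

lemma C1_curve_vd: "C1_curve c c' \<Longrightarrow> vector_derivative c (at t) = c' t"
  by (auto simp: C1_curve_def vector_derivative_at)

lemma C1_curve_vdI: "c C1_differentiable_on UNIV \<Longrightarrow> C1_curve c (\<lambda>t. vector_derivative c (at t))"
  by (auto simp: C1_curve_def C1_differentiable_on_eq vector_derivative_works)

lemma C1_curve_cont: "C1_curve c c' \<Longrightarrow> continuous_on UNIV c"
  by (auto simp: C1_curve_def intro!: continuous_at_imp_continuous_on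
       dest: has_vector_derivative_continuous)

lemma curve_family_const: "C1_curve c c' \<Longrightarrow> curve_family (\<lambda>s. c) (\<lambda>s. c')"
  unfolding curve_family_def
  using C1_curve_cont[of c c']
  by (auto simp: C1_curve_def intro!: continuous_on_compose2[of UNIV _ _ snd] continuous_intros)

lemma curve_family_member: "curve_family \<Gamma> \<Gamma>' \<Longrightarrow> s \<in> {0..1} \<Longrightarrow> C1_curve (\<Gamma> s) (\<Gamma>' s)"
  unfolding curve_family_def C1_curve_def
  using continuous_on_compose2[of "{0..1} \<times> UNIV" "\<lambda>x. \<Gamma>' (fst x) (snd x)" UNIV "\<lambda>t. (s,t)"]
  by (auto simp: image_subset_iff continuous_on_Pair)

text \<open>Derivatives in \<open>C1_family\<close> are bounded linear maps; a velocity
  \<open>v\<close> corresponds to the map from \<open>h\<close> to \<open>h *\<^sub>R v\<close>,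
  which \<open>blinfun_scaleR_left\<close> supplies continuously.\<close>

lemma curve_family_C1_family:
  assumes "curve_family \<Gamma> \<Gamma>'" shows "C1_family {0..1} UNIV \<Gamma>"
proof -
  have "continuous_on ({0..1} \<times> UNIV) (\<lambda>x. blinfun_scaleR_left (\<Gamma>' (fst x) (snd x)))"
    using assms unfolding curve_family_def by (auto intro!: continuous_intros)
  then show ?thesis
    using assms unfolding curve_family_def C1_family_def
    by (intro exI[of _ UNIV] exI[of _ "\<lambda>x. blinfun_scaleR_left (\<Gamma>' (fst x) (snd x))"])
      (auto simp: has_vector_derivative_def case_prod_unfold)
qed

lemma curve_family_compose:
  assumes "curve_family \<Gamma> \<Gamma>'" "curve_family \<theta> \<theta>'"
  shows "curve_family (\<lambda>s t. \<Gamma> s (\<theta> s t)) (\<lambda>s t. \<theta>' s t *\<^sub>R \<Gamma>' s (\<theta> s t))"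
proof -
  have c: "continuous_on ({0..1} \<times> UNIV) (\<lambda>x. (fst x, \<theta> (fst x) (snd x)))"
    using assms(2) unfolding curve_family_def by (auto intro!: continuous_intros)
  have 1: "continuous_on ({0..1} \<times> UNIV) (\<lambda>x. f (fst x) (\<theta> (fst x) (snd x)))"
    if "continuous_on ({0..1} \<times> UNIV) (\<lambda>x. f (fst x) (snd x))" for f :: "real \<Rightarrow> real \<Rightarrow> 'a"
    using continuous_on_compose2[OF that c] by (simp add: image_subset_iff)
  have 2: "((\<lambda>t. \<Gamma> s (\<theta> s t)) has_vector_derivative \<theta>' s t *\<^sub>R \<Gamma>' s (\<theta> s t)) (at t)"
    if "s \<in> {0..1}" for s t
    using vector_diff_chain_at[of "\<theta> s" "\<theta>' s t" t "\<Gamma> s" "\<Gamma>' s (\<theta> s t)"] assms that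
    unfolding curve_family_def by (auto simp: o_def)
  show ?thesis using assms 1 2 unfolding curve_family_def
    by (auto intro!: continuous_intros)
qed

lemma curve_family_add:
  assumes "curve_family \<Gamma> \<Gamma>'" "curve_family \<Delta> \<Delta>'"
  shows "curve_family (\<lambda>s t. \<Gamma> s t + \<Delta> s t) (\<lambda>s t. \<Gamma>' s t + \<Delta>' s t)"
  using assms unfolding curve_family_def
  by (auto intro!: continuous_intros has_vector_derivative_add)

lemma curve_family_diff:
  assumes "curve_family \<Gamma> \<Gamma>'" "curve_family \<Delta> \<Delta>'"
  shows "curve_family (\<lambda>s t. \<Gamma> s t - \<Delta> s t) (\<lambda>s t. \<Gamma>' s t - \<Delta>' s t)"
  using assms unfolding curve_family_def
  by (auto intro!: continuous_intros has_vector_derivative_diff)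

lemma curve_family_bilinear:
  assumes "bounded_bilinear f" "curve_family \<Gamma> \<Gamma>'" "curve_family \<Delta> \<Delta>'"
  shows "curve_family (\<lambda>s t. f (\<Gamma> s t) (\<Delta> s t)) (\<lambda>s t. f (\<Gamma> s t) (\<Delta>' s t) + f (\<Gamma>' s t) (\<Delta> s t))"
  using assms unfolding curve_family_def
  by (intro conjI ballI allI bounded_bilinear.has_vector_derivative[OF assms(1)]
      continuous_on_add bounded_bilinear.continuous_on[OF assms(1)]) auto

lemmas curve_family_scaleR = curve_family_bilinear[OF bounded_bilinear_scaleR]
lemmas curve_family_mult = curve_family_bilinear[OF bounded_bilinear_mult]
lemmas curve_family_inner = curve_family_bilinear[OF bounded_bilinear_inner]

lemma curve_family_linear:
  assumes "bounded_linear f" "curve_family \<Gamma> \<Gamma>'"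
  shows "curve_family (\<lambda>s t. f (\<Gamma> s t)) (\<lambda>s t. f (\<Gamma>' s t))"
  using assms unfolding curve_family_def
  by (intro conjI ballI allI bounded_linear.has_vector_derivative[OF assms(1)]
      bounded_linear.continuous_on[OF assms(1)]) auto

lemma curve_family_Pair:
  assumes "curve_family \<Gamma> \<Gamma>'" "curve_family \<Delta> \<Delta>'"
  shows "curve_family (\<lambda>s t. (\<Gamma> s t, \<Delta> s t)) (\<lambda>s t. (\<Gamma>' s t, \<Delta>' s t))"
  using assms unfolding curve_family_def
  by (auto intro!: continuous_intros has_vector_derivative_Pair)

text \<open>The deformation parameter enters only continuously, so every continuous function of it
  counts as a family of constant curves. This is how interpolation weights and rotation angles
  become building blocks.\<close>

lemma curve_family_param:
  assumes "continuous_on {0..1} f"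
  shows "curve_family (\<lambda>s t. f s) (\<lambda>s t. 0)"
proof -
  have "continuous_on ({0..1} \<times> (UNIV::real set)) (\<lambda>x. f (fst x))"
    by (rule continuous_on_compose2[OF assms]) (auto intro!: continuous_intros)
  then show ?thesis unfolding curve_family_def by auto
qed

lemma curve_family_real_fun:
  fixes \<Gamma> :: "real \<Rightarrow> real \<Rightarrow> real"
  assumes "curve_family \<Gamma> \<Gamma>'" "\<And>s t. s \<in> {0..1} \<Longrightarrow> \<Gamma> s t \<in> X" "open X"
    "\<And>x. x \<in> X \<Longrightarrow> (f has_real_derivative f' x) (at x)" "continuous_on X f'"
  shows "curve_family (\<lambda>s t. f (\<Gamma> s t)) (\<lambda>s t. \<Gamma>' s t * f' (\<Gamma> s t))"
proof -
  have cf: "continuous_on X f"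
    using assms(4) by (auto intro!: continuous_at_imp_continuous_on DERIV_isCont)
  have 1: "continuous_on ({0..1} \<times> UNIV) (\<lambda>x. g (\<Gamma> (fst x) (snd x)))" if "continuous_on X g" for g :: "real \<Rightarrow> real"
    by (rule continuous_on_compose2[OF that]) (use assms in \<open>auto simp: curve_family_def\<close>)
  have 2: "((\<lambda>t. f (\<Gamma> s t)) has_vector_derivative \<Gamma>' s t * f' (\<Gamma> s t)) (at t)" if "s \<in> {0..1}" for s t
  proof -
    have "(\<Gamma> s has_real_derivative \<Gamma>' s t) (at t)"
      using assms(1) that unfolding curve_family_def has_real_derivative_iff_has_vector_derivative by auto
    from DERIV_chain2[OF assms(4) this] assms(2)[OF that] show ?thesis
      by (simp add: has_real_derivative_iff_has_vector_derivative mult.commute)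
  qed
  show ?thesis using 1[OF cf] 1[OF assms(5)] 2 assms(1) unfolding curve_family_def
    by (auto intro!: continuous_intros)
qed

lemma curve_family_inverse:
  fixes \<Gamma> :: "real \<Rightarrow> real \<Rightarrow> real"
  assumes "curve_family \<Gamma> \<Gamma>'" "\<And>s t. s \<in> {0..1} \<Longrightarrow> \<Gamma> s t \<noteq> 0"
  shows "curve_family (\<lambda>s t. inverse (\<Gamma> s t)) (\<lambda>s t. \<Gamma>' s t * (- (inverse (\<Gamma> s t))\<^sup>2))"
proof (rule curve_family_real_fun[OF assms(1), of "-{0}"])
  show "(inverse has_real_derivative - (inverse x)\<^sup>2) (at x)" if "x \<in> - {0}" for x :: real
    using DERIV_inverse[of x UNIV] that by (simp add: numeral_2_eq_2)
qed (use assms(2) in \<open>auto intro!: continuous_intros\<close>)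

lemma curve_family_exp:
  fixes \<Gamma> :: "real \<Rightarrow> real \<Rightarrow> real"
  assumes "curve_family \<Gamma> \<Gamma>'"
  shows "curve_family (\<lambda>s t. exp (\<Gamma> s t)) (\<lambda>s t. \<Gamma>' s t * exp (\<Gamma> s t))"
  by (rule curve_family_real_fun[OF assms(1), of UNIV])
    (auto intro: DERIV_exp continuous_on_exp continuous_on_id)

text \<open>A family is only continuous in its parameter, so two of them may be run one after the
  other at double speed without rounding the junction. The velocities match there because they are
  determined by the common curve.\<close>

lemma curve_family_concat:
  assumes "curve_family \<Gamma> \<Gamma>'" "curve_family \<Delta> \<Delta>'" "\<Gamma> 1 = \<Delta> 0"
  shows "\<exists>\<Theta> \<Theta>'. curve_family \<Theta> \<Theta>' \<and> \<Theta> 0 = \<Gamma> 0 \<and> \<Theta> 1 = \<Delta> 1 \<and> (\<forall>s\<in>{0..1}. \<Theta> s \<in> \<Gamma> ` {0..1} \<union> \<Delta> ` {0..1})"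
proof -
  have d: "\<Gamma>' 1 = \<Delta>' 0"
    using curve_family_member[OF assms(1), of 1] curve_family_member[OF assms(2), of 0] assms(3)
      C1_curve_vd[of "\<Gamma> 1"] by (metis atLeastAtMost_iff ext order_refl zero_le_one)
  have glue: "continuous_on ({0..1} \<times> UNIV) (\<lambda>x. (if fst x \<le> 1/2 then f (2 * fst x) else g (2 * fst x - 1)) (snd x))"
    if "continuous_on ({0..1} \<times> UNIV) (\<lambda>x. f (fst x) (snd x))" "continuous_on ({0..1} \<times> UNIV) (\<lambda>x. g (fst x) (snd x))"
      "f 1 = g 0" for f g :: "real \<Rightarrow> real \<Rightarrow> 'a"
  proof -
    have s: "{0..1::real} \<times> (UNIV::real set) = {0..1/2} \<times> UNIV \<union> {1/2..1} \<times> UNIV" by auto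
    have a: "continuous_on ({0..1/2} \<times> UNIV) (\<lambda>x. f (2 * fst x) (snd x))"
    proof -
      have "continuous_on ({0..1/2} \<times> UNIV) (\<lambda>x. f (fst (2 * fst x, snd x)) (snd (2 * fst x, snd x)))"
        by (rule continuous_on_compose2[OF that(1)]) (auto intro!: continuous_intros)
      then show ?thesis by simp
    qed
    have b: "continuous_on ({1/2..1} \<times> UNIV) (\<lambda>x. g (2 * fst x - 1) (snd x))"
    proof -
      have "continuous_on ({1/2..1} \<times> UNIV) (\<lambda>x. g (fst (2 * fst x - 1, snd x)) (snd (2 * fst x - 1, snd x)))"
        by (rule continuous_on_compose2[OF that(2)]) (auto intro!: continuous_intros)
      then show ?thesis by simp
    qed
    have e: "f (2 * fst x) (snd x) = g (2 * fst x - 1) (snd x)" if "2 * fst x = 1" for x :: "real \<times> real"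
      unfolding that using \<open>f 1 = g 0\<close> by simp
    have "continuous_on ({0..1/2} \<times> UNIV \<union> {1/2..1} \<times> UNIV)
       (\<lambda>x. if fst x \<le> 1/2 then f (2 * fst x) (snd x) else g (2 * fst x - 1) (snd x))"
      by (rule continuous_on_If[OF _ _ a b]) (auto intro: closed_Times intro!: e)
    moreover have "(\<lambda>x. if fst x \<le> 1/2 then f (2 * fst x) (snd x) else g (2 * fst x - 1) (snd x)) =
      (\<lambda>x. (if fst x \<le> 1/2 then f (2 * fst x) else g (2 * fst x - 1)) (snd x))"
      by (rule ext) simp
    ultimately show ?thesis unfolding s by metis
  qed
  let ?T = "\<lambda>s. if s \<le> 1/2 then \<Gamma> (2 * s) else \<Delta> (2 * s - 1)"
  let ?T' = "\<lambda>s. if s \<le> 1/2 then \<Gamma>' (2 * s) else \<Delta>' (2 * s - 1)"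
  have "(?T s has_vector_derivative ?T' s t) (at t)" if "s \<in> {0..1}" for s t
    using assms(1,2) that unfolding curve_family_def by (cases "s \<le> 1/2") simp_all
  then have "curve_family ?T ?T'"
    using glue[of \<Gamma> \<Delta>] glue[of \<Gamma>' \<Delta>'] d assms unfolding curve_family_def by blast
  moreover have "?T s \<in> \<Gamma> ` {0..1} \<union> \<Delta> ` {0..1}" if "s \<in> {0..1}" for s
    using that by (cases "s \<le> 1/2") simp_all
  moreover have "?T 0 = \<Gamma> 0" "?T 1 = \<Delta> 1" by simp_all
  ultimately show ?thesis by blast
qed

section \<open>Isotopies and circle reparametrisations\<close>

text \<open>The outer family is differentiable only on a neighbourhood \<open>V\<close> of
  \<open>S'\<close>, so the inner one has to be restricted to points whose whole track stays in
  \<open>V\<close>.\<close>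

lemma C1_family_compose:
  fixes H :: "real \<Rightarrow> 'a::euclidean_space \<Rightarrow> 'b::euclidean_space"
    and K :: "real \<Rightarrow> 'b \<Rightarrow> 'c::euclidean_space"
  assumes "C1_family {0..1} S H" "C1_family {0..1} S' K" "\<And>t. t \<in> {0..1} \<Longrightarrow> H t ` S \<subseteq> S'"
  shows "C1_family {0..1} S (\<lambda>t x. K t (H t x))"
proof -
  obtain U H' where U: "open U" "S \<subseteq> U"
    "\<And>t x. t\<in>{0..1} \<Longrightarrow> x\<in>U \<Longrightarrow> (H t has_derivative blinfun_apply (H' (t, x))) (at x)"
    "continuous_on ({0..1} \<times> U) (\<lambda>x. H (fst x) (snd x))" "continuous_on ({0..1} \<times> U) H'"
    using assms(1) unfolding C1_family_def case_prod_unfold by blast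
  obtain V K' where V: "open V" "S' \<subseteq> V"
    "\<And>t x. t\<in>{0..1} \<Longrightarrow> x\<in>V \<Longrightarrow> (K t has_derivative blinfun_apply (K' (t, x))) (at x)"
    "continuous_on ({0..1} \<times> V) (\<lambda>x. K (fst x) (snd x))" "continuous_on ({0..1} \<times> V) K'"
    using assms(2) unfolding C1_family_def case_prod_unfold by blast
  define W where "W = {x\<in>U. \<forall>t\<in>{0..1}. H t x \<in> V}"
  \<comment> \<open>Compactness of the parameter interval makes the projection of the closed set of
    bad pairs closed, hence \<open>W\<close> open in \<open>U\<close>.\<close>
  define B where "B = {z \<in> {0..1} \<times> U. H (fst z) (snd z) \<in> - V}"
  have "closedin (top_of_set ({0..1} \<times> U)) B"
  proof -
    have "B = ({0..1} \<times> U) \<inter> (\<lambda>x. H (fst x) (snd x)) -` (- V)" by (auto simp: B_def)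
    then show ?thesis using continuous_closedin_preimage[OF U(4), of "- V"] V(1) by (metis closed_Compl)
  qed
  then have "closedin (top_of_set U) {y. \<exists>x. x \<in> {0..1} \<and> (x, y) \<in> B}"
    by (rule closedin_compact_projection[OF compact_Icc])
  moreover have "{y. \<exists>x. x \<in> {0..1} \<and> (x, y) \<in> B} = U - W"
    by (auto simp: B_def W_def)
  ultimately have "closedin (top_of_set U) (U - W)" by simp
  then have "openin (top_of_set U) W"
    using openin_closedin_eq[of "top_of_set U" W] by (simp add: W_def)
  then have oW: "open W" using U(1) openin_open_eq by blast
  have SW: "S \<subseteq> W"
  proof
    fix x assume x: "x \<in> S"
    have "H t x \<in> V" if "t \<in> {0..1}" for t using assms(3)[OF that] x V(2) by auto
    then show "x \<in> W" using x U(2) by (auto simp: W_def)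
  qed
  have WU: "W \<subseteq> U" by (auto simp: W_def)
  have c1: "continuous_on ({0..1} \<times> W) (\<lambda>x. H (fst x) (snd x))"
    by (rule continuous_on_subset[OF U(4)]) (use WU in auto)
  have c2: "continuous_on ({0..1} \<times> W) H'"
    by (rule continuous_on_subset[OF U(5)]) (use WU in auto)
  have c3: "continuous_on ({0..1} \<times> W) (\<lambda>x. (fst x, H (fst x) (snd x)))"
    by (intro continuous_intros c1)
  have sub: "(\<lambda>x. (fst x, H (fst x) (snd x))) ` ({0..1} \<times> W) \<subseteq> {0..1} \<times> V"
    by (auto simp: W_def)
  have c4: "continuous_on ({0..1} \<times> W) (\<lambda>x. K' (fst x, H (fst x) (snd x)))"
    by (rule continuous_on_compose2[OF V(5) c3 sub])
  have c5: "continuous_on ({0..1} \<times> W) (\<lambda>x. K (fst x) (H (fst x) (snd x)))"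
    using continuous_on_compose2[OF V(4) c3 sub] by simp
  have c6: "continuous_on ({0..1} \<times> W) (\<lambda>x. K' (fst x, H (fst x) (snd x)) o\<^sub>L H' x)"
    by (intro continuous_intros c4 c2)
  have d: "((\<lambda>x. K t (H t x)) has_derivative blinfun_apply (K' (t, H t x) o\<^sub>L H' (t, x))) (at x)"
    if "t \<in> {0..1}" "x \<in> W" for t x
  proof -
    have "(K t \<circ> H t has_derivative blinfun_apply (K' (t, H t x)) \<circ> blinfun_apply (H' (t, x))) (at x)"
      by (rule diff_chain_at) (use that U V in \<open>auto simp: W_def\<close>)
    then show ?thesis by (simp add: o_def blinfun_compose.rep_eq)
  qed
  show ?thesis unfolding C1_family_def case_prod_unfold
    by (intro exI[of _ W] exI[of _ "\<lambda>x. K' (fst x, H (fst x) (snd x)) o\<^sub>L H' x"] conjI ballI oW SW c5 c6)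
      (simp add: d)
qed

lemma C1_family_id: "C1_family {0..1} S (\<lambda>t x. x)"
  unfolding C1_family_def
  by (intro exI[of _ UNIV] exI[of _ "\<lambda>x. id_blinfun"])
    (auto intro!: continuous_intros simp: case_prod_unfold id_blinfun.rep_eq)

lemma ambient_isotopy_id: "ambient_isotopy S (\<lambda>t x. x)"
  unfolding ambient_isotopy_def
  by (intro conjI exI[of _ "\<lambda>t x. x"] C1_family_id ballI) (auto simp: homeomorphism_def)

lemma ambient_isotopy_compose:
  assumes "ambient_isotopy S H" "ambient_isotopy S K"
  shows "ambient_isotopy S (\<lambda>t x. K t (H t x))"
proof -
  obtain G where G: "C1_family {0..1} S G" "\<And>t. t\<in>{0..1} \<Longrightarrow> homeomorphism S S (H t) (G t)"
    using assms(1) unfolding ambient_isotopy_def by blast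
  obtain L where L: "C1_family {0..1} S L" "\<And>t. t\<in>{0..1} \<Longrightarrow> homeomorphism S S (K t) (L t)"
    using assms(2) unfolding ambient_isotopy_def by blast
  have "homeomorphism S S (\<lambda>x. K t (H t x)) (\<lambda>x. G t (L t x))" if "t \<in> {0..1}" for t
    using homeomorphism_compose[OF G(2)[OF that] L(2)[OF that]] by (simp add: o_def)
  moreover have "C1_family {0..1} S (\<lambda>t x. K t (H t x))"
    by (rule C1_family_compose[of S H S K]) (use assms G(2) in \<open>auto simp: ambient_isotopy_def homeomorphism_def\<close>)
  moreover have "C1_family {0..1} S (\<lambda>t x. G t (L t x))"
    by (rule C1_family_compose[of S L S G]) (use G L in \<open>auto simp: homeomorphism_def\<close>)
  moreover have "\<forall>x\<in>S. K 0 (H 0 x) = x" using assms by (simp add: ambient_isotopy_def)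
  ultimately show ?thesis unfolding ambient_isotopy_def by blast
qed

lemma ambient_isotopy_inverse:
  assumes "ambient_isotopy S H"
  shows "\<exists>G. ambient_isotopy S G \<and> (\<forall>x\<in>S. G 1 (H 1 x) = x)"
proof -
  obtain G where G: "C1_family {0..1} S G" "\<And>t. t\<in>{0..1} \<Longrightarrow> homeomorphism S S (H t) (G t)"
    using assms(1) unfolding ambient_isotopy_def by blast
  have "G 0 x = x" if "x \<in> S" for x
  proof -
    have "H 0 x = x" using assms that by (simp add: ambient_isotopy_def)
    then show ?thesis using G(2)[of 0] that by (metis atLeastAtMost_iff homeomorphism_apply1 order_refl zero_le_one)
  qed
  then have "ambient_isotopy S G"
    using G assms unfolding ambient_isotopy_def by (meson homeomorphism_sym)
  then show ?thesis using G(2)[of 1] by (auto intro: homeomorphism_apply1)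
qed

lemma circle_reparam_deriv:
  assumes "circle_reparam \<theta>"
  shows "(\<theta> has_real_derivative deriv \<theta> t) (at t)" "continuous_on UNIV (deriv \<theta>)" "deriv \<theta> t \<noteq> 0"
    and "continuous_on UNIV \<theta>"
proof -
  obtain D where D: "C1_curve \<theta> D" using assms C1_curve_iff unfolding circle_reparam_def by blast
  then have d: "(\<theta> has_real_derivative D t) (at t)" for t
    by (simp add: C1_curve_def has_real_derivative_iff_has_vector_derivative)
  then have "deriv \<theta> = D" by (auto intro: DERIV_imp_deriv)
  then show "(\<theta> has_real_derivative deriv \<theta> t) (at t)" "continuous_on UNIV (deriv \<theta>)" "continuous_on UNIV \<theta>"
    using d D C1_curve_cont by (auto simp: C1_curve_def)
  show "deriv \<theta> t \<noteq> 0" using assms by (simp add: circle_reparam_def)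
qed

lemma circle_reparam_shift_int:
  assumes "circle_reparam \<theta>"
  obtains e :: real where "e = 1 \<or> e = -1" "\<And>t (n::int). \<theta> (t + of_int n) = \<theta> t + e * of_int n"
proof -
  obtain e :: real where e: "e = 1 \<or> e = -1" "\<And>t. \<theta> (t + 1) = \<theta> t + e"
    using assms unfolding circle_reparam_def by (metis diff_conv_add_uminus)
  have n: "\<theta> (t + of_nat n) = \<theta> t + e * of_nat n" for t n
  proof (induction n)
    case (Suc n)
    then show ?case using e(2)[of "t + of_nat n"] by (simp add: algebra_simps)
  qed simp
  have "\<theta> (t + of_int n) = \<theta> t + e * of_int n" for t and n :: int
  proof (cases "n \<ge> 0")
    case True
    then show ?thesis using n[of t "nat n"] by simp
  next
    case False
    then show ?thesis using n[of "t + of_int n" "nat (- n)"] by (simp add: algebra_simps)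
  qed
  then show ?thesis using that e by blast
qed

text \<open>A derivative without zeros gives injectivity by Rolle; the shift by integers makes the
  map unbounded in both directions, so the intermediate value theorem gives surjectivity.\<close>

lemma circle_reparam_bij:
  assumes "circle_reparam \<theta>" shows "bij \<theta>"
proof (rule bijI)
  note d = circle_reparam_deriv[OF assms]
  have *: "\<theta> x \<noteq> \<theta> y" if "x < y" for x y
  proof
    assume "\<theta> x = \<theta> y"
    then have "\<exists>z. x < z \<and> z < y \<and> DERIV \<theta> z :> 0"
      using that d(1,4) by (intro Rolle) (auto intro: continuous_on_subset simp: real_differentiable_def)
    then show False using d(1,3) DERIV_unique by blast
  qed
  show "inj \<theta>"
    by (rule injI) (metis * linorder_less_linear)
  obtain e where e: "e = 1 \<or> e = -1" "\<And>t (n::int). \<theta> (t + of_int n) = \<theta> t + e * of_int n"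
    using circle_reparam_shift_int[OF assms] by blast
  show "surj \<theta>"
    unfolding surj_def
  proof
    fix y
    \<comment> \<open>Going \<open>n\<close> turns either way moves \<open>\<theta> 0\<close> by
      \<open>n\<close>, far enough to enclose \<open>y\<close>.\<close>
    define n where "n = \<lceil>\<bar>y\<bar> + \<bar>\<theta> 0\<bar>\<rceil>"
    have n: "real_of_int n \<ge> \<bar>y\<bar> + \<bar>\<theta> 0\<bar>" unfolding n_def by linarith
    have "connected (range \<theta>)" using d(4) by (intro connected_continuous_image) auto
    moreover have "\<theta> (of_int n) = \<theta> 0 + e * n" "\<theta> (- of_int n) = \<theta> 0 - e * n"
      using e(2)[of 0 n] e(2)[of 0 "-n"] by auto
    ultimately have "y \<in> range \<theta>"
      using n e(1) connectedD_interval[of "range \<theta>" "\<theta> (of_int n)" "\<theta> (- of_int n)" y]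
        connectedD_interval[of "range \<theta>" "\<theta> (- of_int n)" "\<theta> (of_int n)" y]
      by (elim disjE) (fastforce simp: abs_le_iff)+
    then show "\<exists>x. y = \<theta> x" by blast
  qed
qed

lemma circle_reparam_inv:
  assumes "circle_reparam \<theta>" shows "circle_reparam (inv \<theta>)"
proof -
  note d = circle_reparam_deriv[OF assms]
  have b: "bij \<theta>" by (rule circle_reparam_bij[OF assms])
  have i1: "inv \<theta> (\<theta> x) = x" and i2: "\<theta> (inv \<theta> x) = x" for x
    using b by (auto simp: bij_is_inj bij_is_surj surj_f_inv_f)
  have ci: "isCont (inv \<theta>) y" for y
    using isCont_inverse_function[of 1 "inv \<theta> y" "inv \<theta>" \<theta>] i1 i2 d(4)
    by (auto simp: continuous_on_eq_continuous_at)
  have di: "(inv \<theta> has_real_derivative inverse (deriv \<theta> (inv \<theta> y))) (at y)" for y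
    by (rule DERIV_inverse_function[of \<theta> _ _ _ "y - 1" "y + 1"]) (use d ci i2 in auto)
  have "continuous_on UNIV (\<lambda>y. deriv \<theta> (inv \<theta> y))"
    by (rule continuous_on_compose2[OF d(2)]) (use ci in \<open>auto intro: continuous_at_imp_continuous_on\<close>)
  then have "continuous_on UNIV (\<lambda>y. inverse (deriv \<theta> (inv \<theta> y)))"
    using d(3) by (intro continuous_intros) auto
  then have C: "inv \<theta> C1_differentiable_on UNIV"
    unfolding C1_differentiable_on_def
    by (intro exI[of _ "\<lambda>y. inverse (deriv \<theta> (inv \<theta> y))"])
      (use di in \<open>simp add: has_real_derivative_iff_has_vector_derivative\<close>)
  have nz: "deriv (inv \<theta>) t \<noteq> 0" for t using DERIV_imp_deriv[OF di] d(3) by simp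
  have "(\<forall>t. inv \<theta> (t + 1) = inv \<theta> t + 1) \<or> (\<forall>t. inv \<theta> (t + 1) = inv \<theta> t - 1)"
  proof -
    consider "\<forall>t. \<theta> (t + 1) = \<theta> t + 1" | "\<forall>t. \<theta> (t + 1) = \<theta> t - 1"
      using assms unfolding circle_reparam_def by blast
    then show ?thesis
    proof cases
      case 1
      have "inv \<theta> (t + 1) = inv \<theta> t + 1" for t
        using 1[rule_format, of "inv \<theta> t"] i1 i2 by metis
      then show ?thesis by blast
    next
      case 2
      have "inv \<theta> (t + 1) = inv \<theta> t - 1" for t
        proof -
        have "\<theta> (inv \<theta> t - 1) = t + 1" using 2[rule_format, of "inv \<theta> t - 1"] i2[of t] by simp
        then show ?thesis using i1[of "inv \<theta> t - 1"] by simp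
      qed
      then show ?thesis by blast
    qed
  qed
  then show ?thesis using C nz unfolding circle_reparam_def by blast
qed

lemma circle_reparam_compose:
  assumes "circle_reparam \<theta>" "circle_reparam \<eta>" shows "circle_reparam (\<theta> \<circ> \<eta>)"
proof -
  note d = circle_reparam_deriv[OF assms(1)] and e = circle_reparam_deriv[OF assms(2)]
  have di: "(\<theta> \<circ> \<eta> has_real_derivative deriv \<theta> (\<eta> t) * deriv \<eta> t) (at t)" for t
    by (rule DERIV_chain) (use d e in auto)
  have "continuous_on UNIV (\<lambda>t. deriv \<theta> (\<eta> t) * deriv \<eta> t)"
    by (intro continuous_intros continuous_on_compose2[OF d(2)] e) auto
  then have C: "(\<theta> \<circ> \<eta>) C1_differentiable_on UNIV"
    unfolding C1_differentiable_on_def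
    by (intro exI[of _ "\<lambda>t. deriv \<theta> (\<eta> t) * deriv \<eta> t"])
      (use di in \<open>simp add: has_real_derivative_iff_has_vector_derivative\<close>)
  have nz: "deriv (\<theta> \<circ> \<eta>) t \<noteq> 0" for t using DERIV_imp_deriv[OF di] d(3) e(3) by simp
  obtain e where e1: "e = 1 \<or> e = -1" "\<And>t (n::int). \<theta> (t + of_int n) = \<theta> t + e * of_int n"
    using circle_reparam_shift_int[OF assms(1)] by blast
  have \<theta>: "(\<forall>t. \<theta> (t - 1) = \<theta> t - 1) \<or> (\<forall>t. \<theta> (t - 1) = \<theta> t + 1)"
    using e1(1) e1(2)[of _ "-1"] by auto
  have "(\<forall>t. (\<theta> \<circ> \<eta>) (t + 1) = (\<theta> \<circ> \<eta>) t + 1) \<or> (\<forall>t. (\<theta> \<circ> \<eta>) (t + 1) = (\<theta> \<circ> \<eta>) t - 1)"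
    using assms \<theta> unfolding circle_reparam_def by auto
  then show ?thesis using C nz unfolding circle_reparam_def by blast
qed

lemma circle_reparam_id: "circle_reparam (\<lambda>t. t)"
  by (simp add: circle_reparam_def)

lemma transports_refl: "transports (\<lambda>x. x) D D"
  unfolding transports_def by (intro exI[of _ "\<lambda>t. t"]) (auto simp: circle_reparam_id)

lemma transports_compose:
  assumes "transports f D D'" "transports g D' D''" shows "transports (\<lambda>x. g (f x)) D D''"
proof -
  obtain \<theta> where t: "circle_reparam \<theta>" "fst D' = f \<circ> fst D \<circ> \<theta>" "snd D' = \<theta> -` snd D"
    using assms(1) unfolding transports_def by blast
  obtain \<eta> where e: "circle_reparam \<eta>" "fst D'' = g \<circ> fst D' \<circ> \<eta>" "snd D'' = \<eta> -` snd D'"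
    using assms(2) unfolding transports_def by blast
  show ?thesis unfolding transports_def
    by (intro exI[of _ "\<theta> \<circ> \<eta>"]) (use t e in \<open>auto simp: circle_reparam_compose\<close>)
qed

lemma transports_inverse:
  assumes "transports f D D'" "\<And>x. x \<in> S \<Longrightarrow> g (f x) = x" "range (fst D) \<subseteq> S"
  shows "transports g D' D"
proof -
  obtain \<theta> where t: "circle_reparam \<theta>" "fst D' = f \<circ> fst D \<circ> \<theta>" "snd D' = \<theta> -` snd D"
    using assms(1) unfolding transports_def by blast
  have i: "\<theta> (inv \<theta> x) = x" for x
    using circle_reparam_bij[OF t(1)] by (simp add: bij_is_surj surj_f_inv_f)
  show ?thesis unfolding transports_def
    by (intro exI[of _ "inv \<theta>"])
      (use t i circle_reparam_inv[OF t(1)] assms(2,3) in \<open>auto simp: fun_eq_iff image_subset_iff\<close>)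
qed

lemma diagram_isotopy_refl: "(D, D) \<in> diagram_isotopy S"
  unfolding diagram_isotopy_def using ambient_isotopy_id transports_refl by blast

text \<open>Symmetry of the relation is available for curves inside \<open>S\<close>, since the
  inverse isotopy undoes \<open>H 1\<close> on \<open>S\<close> and possibly nowhere else.\<close>

lemma diagram_isotopy_class_eq:
  assumes "ambient_isotopy S H" "transports (H 1) D E" "range (fst D) \<subseteq> S"
  shows "diagram_isotopy S `` {E} = diagram_isotopy S `` {D}"
proof -
  have tr: "(A, C) \<in> diagram_isotopy S"
    if "(A, B) \<in> diagram_isotopy S" "(B, C) \<in> diagram_isotopy S" for A B C
    using that ambient_isotopy_compose transports_compose unfolding diagram_isotopy_def by blast
  have DE: "(D, E) \<in> diagram_isotopy S" using assms unfolding diagram_isotopy_def by blast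
  have ED: "(E, D) \<in> diagram_isotopy S"
    using ambient_isotopy_inverse[OF assms(1)] transports_inverse[OF assms(2) _ assms(3)]
    unfolding diagram_isotopy_def by blast
  show ?thesis using tr DE ED by blast
qed

section \<open>Oriented surfaces\<close>

lemma C1_familyD:
  assumes "C1_family T S H"
  shows "\<exists>U H'. open U \<and> S \<subseteq> U \<and>
     (\<forall>t\<in>T. \<forall>x\<in>U. (H t has_derivative blinfun_apply (H' (t, x))) (at x)) \<and>
     continuous_on (T \<times> U) (\<lambda>x. H (fst x) (snd x)) \<and> continuous_on (T \<times> U) H'"
  using assms unfolding C1_family_def case_prod_unfold .

lemma periodic_int:
  fixes f :: "real \<Rightarrow> 'b"
  assumes "\<And>t. f (t + 1) = f t" "s - t \<in> \<int>" shows "f s = f t"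
proof -
  have n: "f (t + of_nat n) = f t" for t n
  proof (induction n)
    case (Suc n)
    then show ?case using assms(1)[of "t + of_nat n"] by (simp add: algebra_simps)
  qed simp
  obtain k :: int where k: "s = t + of_int k" using assms(2) by (auto elim!: Ints_cases simp: algebra_simps)
  show ?thesis
  proof (cases "k \<ge> 0")
    case True
    then show ?thesis using n[of t "nat k"] k by simp
  next
    case False
    then show ?thesis using n[of s "nat (- k)"] k by simp
  qed
qed

lemma frac_eq_iff_Ints: "frac s = frac t \<longleftrightarrow> s - t \<in> \<int>"
proof
  assume "frac s = frac t"
  then have "s - t = of_int (\<lfloor>s\<rfloor> - \<lfloor>t\<rfloor>)" by (simp add: frac_def)
  then show "s - t \<in> \<int>" by (metis Ints_of_int)
next
  assume "s - t \<in> \<int>"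
  then obtain k :: int where "s = t + of_int k" by (auto elim!: Ints_cases simp: algebra_simps)
  then show "frac s = frac t" by (simp add: frac_def)
qed

lemma frac_diff_Ints: "frac t - t \<in> \<int>"
  by (simp add: frac_def)

lemma Ints_diff_sym: "(s::real) - t \<in> \<int> \<longleftrightarrow> t - s \<in> \<int>"
  by (metis Ints_minus minus_diff_eq)

lemma C1_curve_deriv_periodic:
  assumes "C1_curve c c'" "\<And>t. c (t + 1) = c t" shows "c' (t + 1) = c' t"
proof -
  have "((\<lambda>t. c (t + 1)) has_vector_derivative c' (t + 1)) (at t)"
  proof -
    have "((\<lambda>t. t + 1) has_vector_derivative 1) (at t)" by (auto intro!: derivative_eq_intros)
    from vector_diff_chain_at[OF this, of c "c' (t + 1)"] show ?thesis
      using assms(1) by (simp add: C1_curve_def o_def)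
  qed
  moreover have "(\<lambda>t. c (t + 1)) = c" using assms(2) by auto
  ultimately show ?thesis using assms(1) vector_derivative_at unfolding C1_curve_def by metis
qed

lemma double_pair_sym: "double_pair c s t \<Longrightarrow> double_pair c t s"
  unfolding double_pair_def by (metis Ints_diff_sym)

lemma double_pair_cong:
  assumes "\<And>t. c (t + 1) = c t" "s - s' \<in> \<int>" "t - t' \<in> \<int>"
  shows "double_pair c s t \<longleftrightarrow> double_pair c s' t'"
proof -
  have "c s = c s'" "c t = c t'" using periodic_int[of c] assms by blast+
  moreover have "s - t \<in> \<int> \<longleftrightarrow> s' - t' \<in> \<int>"
    using assms(2,3) frac_eq_iff_Ints by metis
  ultimately show ?thesis by (simp add: double_pair_def)
qed

text \<open>Linear independence of a pair rather than of the set \<open>{a, b}\<close>: equal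
  nonzero vectors count as dependent.\<close>

definition indep :: "'a::real_vector \<Rightarrow> 'a \<Rightarrow> bool" where
  "indep a b \<longleftrightarrow> (\<forall>x y. x *\<^sub>R a + y *\<^sub>R b = 0 \<longrightarrow> x = 0 \<and> y = 0)"

lemma indepI: assumes "a \<noteq> 0" "b \<notin> span {a}" shows "indep a b"
  unfolding indep_def
proof (intro allI impI)
  fix x y assume e: "x *\<^sub>R a + y *\<^sub>R b = 0"
  have "y = 0"
  proof (rule ccontr)
    assume "y \<noteq> 0"
    then have "b = (1 / y) *\<^sub>R (y *\<^sub>R b)" by simp
    also have "y *\<^sub>R b = - (x *\<^sub>R a)" using e by (simp add: eq_neg_iff_add_eq_0 add.commute)
    finally have "b = (- x / y) *\<^sub>R a" by simp
    then have "b \<in> span {a}" by (metis span_base span_scale singletonI)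
    then show False using assms(2) by blast
  qed
  then show "x = 0 \<and> y = 0" using e assms(1) by simp
qed

lemma indep_nz: "indep a b \<Longrightarrow> a \<noteq> 0"
  unfolding indep_def by (drule spec[of _ 1], drule spec[of _ 0]) auto

lemma indep_notin_span: "indep a b \<Longrightarrow> b \<notin> span {a}"
proof
  assume i: "indep a b" and "b \<in> span {a}"
  then obtain k where "b = k *\<^sub>R a" by (auto simp: span_singleton)
  then have "k *\<^sub>R a + (-1) *\<^sub>R b = 0" by simp
  then show False using i unfolding indep_def by (metis neg_equal_0_iff_equal zero_neq_one)
qed

lemma indep_linear_preimage:
  assumes "linear f" "indep (f a) (f b)" shows "indep a b"
proof -
  have "x *\<^sub>R f a + y *\<^sub>R f b = 0" if "x *\<^sub>R a + y *\<^sub>R b = 0" for x y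
    using arg_cong[OF that, of f] assms(1) by (simp add: linear_add linear_scale linear_0)
  then show ?thesis using assms(2) unfolding indep_def by blast
qed

lemma indep_linear_image:
  assumes "linear f" "inj f" "indep a b" shows "indep (f a) (f b)"
proof -
  have "x *\<^sub>R a + y *\<^sub>R b = 0" if "x *\<^sub>R f a + y *\<^sub>R f b = 0" for x y
    using that assms(1,2) by (intro injD[OF assms(2)]) (simp add: linear_add linear_scale linear_0)
  then show ?thesis using assms(3) unfolding indep_def by blast
qed

text \<open>Tangent vectors described by curves that run in \<open>S\<close> for times near 0; this
  avoids charts and treats the plane and the sphere alike.\<close>

definition surface_velocity :: "'a::euclidean_space set \<Rightarrow> 'a \<Rightarrow> 'a \<Rightarrow> bool" where
  "surface_velocity S p a \<longleftrightarrow> (\<exists>f. f 0 = p \<and> (f has_vector_derivative a) (at (0::real)) \<and> (\<forall>\<^sub>F t in nhds 0. f t \<in> S))"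

lemma surface_velocity_in: "surface_velocity S p a \<Longrightarrow> p \<in> S"
  unfolding surface_velocity_def by (auto dest: eventually_nhds_x_imp_x)

lemma surface_velocity_curve:
  assumes "C1_curve c c'" "range c \<subseteq> S" shows "surface_velocity S (c t) (c' t)"
proof -
  have "((\<lambda>u. c (t + u)) has_vector_derivative c' t) (at 0)"
  proof -
    have "((\<lambda>u. t + u) has_vector_derivative 1) (at 0)" by (auto intro!: derivative_eq_intros)
    from vector_diff_chain_at[OF this, of c "c' t"] show ?thesis
      using assms(1) by (simp add: C1_curve_def o_def)
  qed
  then show ?thesis unfolding surface_velocity_def
    by (intro exI[of _ "\<lambda>u. c (t + u)"]) (use assms(2) in \<open>auto intro!: always_eventually\<close>)
qed

lemma surface_velocity_image:
  assumes "surface_velocity S p a" "(h has_derivative h') (at p)" "h ` S \<subseteq> S'"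
  shows "surface_velocity S' (h p) (h' a)"
proof -
  obtain f where f: "f 0 = p" "(f has_vector_derivative a) (at 0)" "\<forall>\<^sub>F t in nhds 0. f t \<in> S"
    using assms(1) unfolding surface_velocity_def by blast
  have "((\<lambda>t. h (f t)) has_vector_derivative h' a) (at 0)"
    using vector_derivative_diff_chain_within[of f a 0 UNIV h h'] f(1,2) assms(2)
    by (auto simp: o_def intro: has_derivative_at_withinI)
  moreover have "\<forall>\<^sub>F t in nhds 0. h (f t) \<in> S'"
    using f(3) by eventually_elim (use assms(3) in auto)
  ultimately show ?thesis unfolding surface_velocity_def using f(1) by (intro exI[of _ "\<lambda>t. h (f t)"]) simp
qed

text \<open>A map that is the identity on \<open>S\<close> may have any derivative transversally to
  \<open>S\<close>; differentiating along a curve in \<open>S\<close> controls it on tangent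
  vectors. This applies to an isotopy at time 0 and to an isotopy followed by its inverse.\<close>

lemma surface_velocity_fixed:
  assumes "surface_velocity S p a" "(h has_derivative h') (at p)" "\<And>x. x \<in> S \<Longrightarrow> h x = x"
  shows "h' a = a"
proof -
  obtain f where f: "f 0 = p" "(f has_vector_derivative a) (at 0)" "\<forall>\<^sub>F t in nhds 0. f t \<in> S"
    using assms(1) unfolding surface_velocity_def by blast
  have "((\<lambda>t. h (f t)) has_vector_derivative h' a) (at 0)"
    using vector_derivative_diff_chain_within[of f a 0 UNIV h h'] f(1,2) assms(2)
    by (auto simp: o_def intro: has_derivative_at_withinI)
  moreover have "((\<lambda>t. h (f t)) has_vector_derivative a) (at 0)"
  proof -
    have ev: "\<forall>\<^sub>F t in nhds 0. f t = h (f t)" using f(3) by eventually_elim (use assms(3) in auto)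
    have "f 0 = h (f 0)" using ev eventually_nhds_x_imp_x by fast
    moreover have "\<forall>\<^sub>F t in nhds 0. t \<in> UNIV \<longrightarrow> f t = h (f t)" using ev by simp
    ultimately show ?thesis
      using f(2) has_vector_derivative_cong_ev[of UNIV f "\<lambda>t. h (f t)" 0 a] by simp
  qed
  ultimately show ?thesis using vector_derivative_at by metis
qed

lemma continuous_nonzero_sgn_const:
  fixes J :: "'b::topological_space \<Rightarrow> real"
  assumes "connected A" "continuous_on A J" "\<And>z. z \<in> A \<Longrightarrow> J z \<noteq> 0" "x \<in> A" "y \<in> A"
  shows "sgn (J x) = sgn (J y)"
proof (rule ccontr)
  assume "sgn (J x) \<noteq> sgn (J y)"
  then have *: "J x < 0 \<and> 0 < J y \<or> J y < 0 \<and> 0 < J x"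
    using assms(3)[OF assms(4)] assms(3)[OF assms(5)] by (auto simp: sgn_if split: if_splits)
  have "connected (J ` A)" using assms by (intro connected_continuous_image)
  then have "0 \<in> J ` A"
    using * assms(4,5) connectedD_interval[of "J ` A" "J x" "J y" 0] connectedD_interval[of "J ` A" "J y" "J x" 0]
    by (elim disjE conjE) simp_all
  then show False using assms(3) by auto
qed

text \<open>\<open>\<omega>\<close> is an area form. It is written on the whole ambient space so
  that continuity makes sense without a tangent bundle, but nondegeneracy is demanded for velocities
  of curves in the surface alone.\<close>

locale oriented_surface =
  fixes S :: "'a::euclidean_space set" and \<omega> :: "'a \<Rightarrow> 'a \<Rightarrow> 'a \<Rightarrow> real"
  assumes \<omega>_continuous: "continuous_on UNIV (\<lambda>x. \<omega> (fst x) (fst (snd x)) (snd (snd x)))"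
    and \<omega>_linear1: "linear (\<lambda>a. \<omega> p a b)" and \<omega>_linear2: "linear (\<omega> p a)"
    and \<omega>_alternating: "\<omega> p a a = 0"
    and \<omega>_nonzero: "surface_velocity S p a \<Longrightarrow> surface_velocity S p b \<Longrightarrow> indep a b \<Longrightarrow> \<omega> p a b \<noteq> 0"
begin

lemma \<omega>_swap: "\<omega> p b a = - \<omega> p a b"
proof -
  have "\<omega> p (a + b) (a + b) = \<omega> p a a + \<omega> p a b + (\<omega> p b a + \<omega> p b b)"
    using linear_add[OF \<omega>_linear1] linear_add[OF \<omega>_linear2] by simp
  then show ?thesis using \<omega>_alternating by simp
qed

lemma \<omega>_scale: "\<omega> p (x *\<^sub>R a) (y *\<^sub>R b) = x * y * \<omega> p a b"
  using linear_scale[OF \<omega>_linear1, of p x a "y *\<^sub>R b"] linear_scale[OF \<omega>_linear2, of p a y b] by simp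

lemma continuous_on_\<omega>:
  assumes "continuous_on A p" "continuous_on A a" "continuous_on A b"
  shows "continuous_on A (\<lambda>x. \<omega> (p x) (a x) (b x))"
  using continuous_on_compose2[OF \<omega>_continuous continuous_on_Pair[OF assms(1) continuous_on_Pair[OF assms(2,3)]]]
  by simp

text \<open>The value of \<open>\<omega>\<close> on the images of \<open>a\<close> and
  \<open>b\<close> at time \<open>t\<close> is continuous in \<open>t\<close> and never 0, so its
  sign at time 1 is the one at time 0, where the isotopy is the identity on
  \<open>S\<close>.\<close>

lemma ambient_isotopy_orientation:
  assumes "ambient_isotopy S H"
  obtains D where "\<And>p. p \<in> S \<Longrightarrow> (H 1 has_derivative D p) (at p)"
    "\<And>p a b. surface_velocity S p a \<Longrightarrow> surface_velocity S p b \<Longrightarrow> indep a b \<Longrightarrow>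
       sgn (\<omega> (H 1 p) (D p a) (D p b)) = sgn (\<omega> p a b)"
proof -
  obtain G where G: "C1_family {0..1} S G" "\<And>t. t\<in>{0..1} \<Longrightarrow> homeomorphism S S (H t) (G t)"
    using assms(1) unfolding ambient_isotopy_def by blast
  have CH: "C1_family {0..1} S H" using assms by (simp add: ambient_isotopy_def)
  obtain U H' where U: "open U" "S \<subseteq> U"
    "\<forall>t\<in>{0..1}. \<forall>x\<in>U. (H t has_derivative blinfun_apply (H' (t, x))) (at x)"
    "continuous_on ({0..1} \<times> U) (\<lambda>x. H (fst x) (snd x))" "continuous_on ({0..1} \<times> U) H'"
    using C1_familyD[OF CH] by (elim exE conjE) (rule that)
  obtain V G' where V: "open V" "S \<subseteq> V"
    "\<forall>t\<in>{0..1}. \<forall>x\<in>V. (G t has_derivative blinfun_apply (G' (t, x))) (at x)"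
    "continuous_on ({0..1} \<times> V) (\<lambda>x. G (fst x) (snd x))" "continuous_on ({0..1} \<times> V) G'"
    using C1_familyD[OF G(1)] by (elim exE conjE) (rule that)
  have "sgn (\<omega> (H 1 p) (H' (1, p) a) (H' (1, p) b)) = sgn (\<omega> p a b)"
    if v: "surface_velocity S p a" "surface_velocity S p b" "indep a b" for p a b
  proof -
    have p: "p \<in> S" using surface_velocity_in v by blast
    then have pU: "p \<in> U" using U(2) by blast
    have HS: "H t x \<in> S" if "t \<in> {0..1}" "x \<in> S" for t x
      using G(2)[OF that(1)] that(2) by (auto simp: homeomorphism_def)
    \<comment> \<open>The inverse isotopy gives a left inverse of the derivative on tangent vectors,
      which keeps the images of \<open>a\<close> and \<open>b\<close> independent.\<close>
    have retract: "G' (t, H t p) (H' (t, p) e) = e" if t: "t \<in> {0..1}" and e: "surface_velocity S p e" for t e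
    proof -
      have "((\<lambda>x. G t (H t x)) has_derivative (\<lambda>x. G' (t, H t p) (H' (t, p) x))) (at p)"
        using diff_chain_at[OF U(3)[rule_format, OF t pU] V(3)[rule_format, OF t subsetD[OF V(2) HS[OF t p]]]] by (simp add: o_def)
      then show ?thesis
        by (rule surface_velocity_fixed[OF e]) (use G(2)[OF t] in \<open>simp add: homeomorphism_def\<close>)
    qed
    have nz: "\<omega> (H t p) (H' (t, p) a) (H' (t, p) b) \<noteq> 0" if t: "t \<in> {0..1}" for t
    proof (rule \<omega>_nonzero)
      show "surface_velocity S (H t p) (H' (t, p) a)" "surface_velocity S (H t p) (H' (t, p) b)"
        using surface_velocity_image[OF v(1) U(3)[rule_format, OF t pU], of S] surface_velocity_image[OF v(2) U(3)[rule_format, OF t pU], of S]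
          HS[OF t] by (simp_all add: image_subset_iff)
      show "indep (H' (t, p) a) (H' (t, p) b)"
        by (rule indep_linear_preimage[of "blinfun_apply (G' (t, H t p))"])
          (simp_all add: retract[OF t] v bounded_linear.linear blinfun.bounded_linear_right)
    qed
    have c1: "continuous_on {0..1} (\<lambda>t. H t p)"
      using continuous_on_compose2[OF U(4), of "{0..1}" "\<lambda>t. (t, p)"] pU
      by (simp add: image_subset_iff continuous_on_Pair)
    have c2: "continuous_on {0..1} (\<lambda>t. H' (t, p))"
      by (rule continuous_on_compose2[OF U(5), of "{0..1}" "\<lambda>t. (t, p)"]) (use pU in \<open>simp_all add: continuous_on_Pair image_subset_iff\<close>)
    have c3: "continuous_on {0..1} (\<lambda>t. H' (t, p) e)" for e
      using blinfun.continuous_on[OF c2 continuous_on_const, of e] .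
    have "sgn (\<omega> (H 1 p) (H' (1, p) a) (H' (1, p) b)) = sgn (\<omega> (H 0 p) (H' (0, p) a) (H' (0, p) b))"
      by (rule continuous_nonzero_sgn_const[of "{0..1::real}" "\<lambda>t. \<omega> (H t p) (H' (t, p) a) (H' (t, p) b)"])
        (simp_all add: nz continuous_on_\<omega>[OF c1 c3 c3])
    moreover have H0: "H 0 x = x" if "x \<in> S" for x
      using assms that by (simp add: ambient_isotopy_def)
    moreover have "(H 0 has_derivative blinfun_apply (H' (0, p))) (at p)" using U(3)[rule_format, OF _ pU] by simp
    then have "H' (0, p) a = a" "H' (0, p) b = b"
      using surface_velocity_fixed[OF v(1) _ H0] surface_velocity_fixed[OF v(2) _ H0] by blast+
    moreover note p
    ultimately show ?thesis by simp
  qed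
  moreover have "(H 1 has_derivative blinfun_apply (H' (1, p))) (at p)" if "p \<in> S" for p
    using U(2,3) that by auto
  ultimately show ?thesis by (rule that[of "\<lambda>p. blinfun_apply (H' (1, p))", rotated])
qed

end

section \<open>Writhe and crossing number\<close>

lemma closed_immersionD:
  assumes "closed_immersion c"
  shows "C1_curve c (\<lambda>t. vector_derivative c (at t))" "c (t + 1) = c t" "vector_derivative c (at t) \<noteq> 0"
    "vector_derivative c (at (t + 1)) = vector_derivative c (at t)"
proof -
  show 1: "C1_curve c (\<lambda>t. vector_derivative c (at t))" and 2: "c (t + 1) = c t" "vector_derivative c (at t) \<noteq> 0" for t
    using assms C1_curve_vdI unfolding closed_immersion_def by blast+
  show "vector_derivative c (at (t + 1)) = vector_derivative c (at t)"
    by (rule C1_curve_deriv_periodic[OF 1 2(1)])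
qed

lemma closed_immersionI:
  assumes "C1_curve c c'" "\<And>t. c (t + 1) = c t" "\<And>t. c' t \<noteq> 0"
  shows "closed_immersion c"
  unfolding closed_immersion_def using assms C1_curve_iff C1_curve_vd by metis

lemma is_diagramD:
  assumes "is_diagram S (c, Ov)"
  shows "closed_immersion c" "range c \<subseteq> S"
    "double_pair c s t \<Longrightarrow> indep (vector_derivative c (at s)) (vector_derivative c (at t))"
    "double_pair c s t \<Longrightarrow> double_pair c s r \<Longrightarrow> t - r \<in> \<int>"
    "finite {s\<in>{0..<1}. \<exists>t. double_pair c s t}"
    "s \<in> Ov \<Longrightarrow> \<exists>t. double_pair c s t"
    "t + 1 \<in> Ov \<longleftrightarrow> t \<in> Ov"
    "double_pair c s t \<Longrightarrow> s \<in> Ov \<longleftrightarrow> t \<notin> Ov"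
proof -
  note d = assms[unfolded is_diagram_def prod.case]
  show ci: "closed_immersion c" and "range c \<subseteq> S" using d by blast+
  show "double_pair c s t \<Longrightarrow> indep (vector_derivative c (at s)) (vector_derivative c (at t))"
    using d closed_immersionD(3)[OF ci] indepI by blast
  show "double_pair c s t \<Longrightarrow> double_pair c s r \<Longrightarrow> t - r \<in> \<int>"
    "finite {s\<in>{0..<1}. \<exists>t. double_pair c s t}"
    "s \<in> Ov \<Longrightarrow> \<exists>t. double_pair c s t"
    "t + 1 \<in> Ov \<longleftrightarrow> t \<in> Ov"
    "double_pair c s t \<Longrightarrow> s \<in> Ov \<longleftrightarrow> t \<notin> Ov"
    using d by blast+
qed

text \<open>Each crossing of a diagram has exactly one over-passage modulo 1, so these parameters
  index the crossings.\<close>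

definition over_params :: "'a diagram \<Rightarrow> real set" where
  "over_params D = snd D \<inter> {0..<1}"

definition crossing_number :: "'a diagram \<Rightarrow> nat" where
  "crossing_number D = card (over_params D)"

text \<open>The over-strand comes first and \<open>SOME\<close> picks the under-passage, which is
  unique up to integers. Reversing the curve negates both tangents, so the sign does not depend on a
  direction of the knot.\<close>

definition crossing_sign ::
  "('a::euclidean_space \<Rightarrow> 'a \<Rightarrow> 'a \<Rightarrow> real) \<Rightarrow> (real \<Rightarrow> 'a) \<Rightarrow> real \<Rightarrow> real" where
  "crossing_sign \<omega> c s = sgn (\<omega> (c s) (vector_derivative c (at s))
     (vector_derivative c (at (SOME t. double_pair c s t))))"

definition writhe :: "('a::euclidean_space \<Rightarrow> 'a \<Rightarrow> 'a \<Rightarrow> real) \<Rightarrow> 'a diagram \<Rightarrow> real" where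
  "writhe \<omega> D = (\<Sum>s\<in>over_params D. crossing_sign \<omega> (fst D) s)"

lemma finite_over_params: "is_diagram S D \<Longrightarrow> finite (over_params D)"
  by (cases D) (auto simp: over_params_def dest: is_diagramD(6) intro!: finite_subset[OF _ is_diagramD(5)])

lemma frac_in_unit: "frac x \<in> {0..<1::real}"
  by (simp add: frac_lt_1)

context oriented_surface
begin

lemma crossing_sign_eq:
  assumes "is_diagram S (c, Ov)" "double_pair c s t"
  shows "crossing_sign \<omega> c s = sgn (\<omega> (c s) (vector_derivative c (at s)) (vector_derivative c (at t)))"
proof -
  note ci = closed_immersionD[OF is_diagramD(1)[OF assms(1)]]
  have "double_pair c s (SOME t. double_pair c s t)" using assms(2) by (rule someI)
  then have "(SOME t. double_pair c s t) - t \<in> \<int>" using is_diagramD(4)[OF assms(1)] assms(2) by blast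
  then have "vector_derivative c (at (SOME t. double_pair c s t)) = vector_derivative c (at t)"
    by (rule periodic_int[of "\<lambda>t. vector_derivative c (at t)", rotated]) (rule ci(4))
  then show ?thesis by (simp add: crossing_sign_def)
qed

text \<open>Over-passages correspond under \<open>x \<mapsto> frac (\<theta> x)\<close>. The two
  tangents at a crossing are multiplied by values of \<open>deriv \<theta>\<close>, which have equal
  signs, and mapped by a derivative that preserves the orientation of the surface.\<close>

lemma isotopy_invariance:
  assumes D: "is_diagram S D" and E: "is_diagram S E" and H: "ambient_isotopy S H" and tr: "transports (H 1) D E"
  shows "writhe \<omega> E = writhe \<omega> D" "crossing_number E = crossing_number D"
proof -
  obtain c Ov where Dc: "D = (c, Ov)" by fastforce
  obtain \<theta> where t: "circle_reparam \<theta>" "fst E = H 1 \<circ> c \<circ> \<theta>" "snd E = \<theta> -` Ov"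
    using tr Dc unfolding transports_def by auto
  define e where "e = fst E"
  have Ee: "E = (e, \<theta> -` Ov)" using t(3) by (simp add: e_def prod_eq_iff)
  have e: "e = (\<lambda>s. H 1 (c (\<theta> s)))" using t(2) by (simp add: e_def o_def)
  note Dd = is_diagramD[OF D[unfolded Dc]] and Ed = is_diagramD[OF E[unfolded Ee]]
  note ci = closed_immersionD[OF Dd(1)]
  have cS: "c x \<in> S" for x using Dd(2) by blast
  obtain f' where f': "\<And>p. p \<in> S \<Longrightarrow> (H 1 has_derivative f' p) (at p)"
    "\<And>p a b. surface_velocity S p a \<Longrightarrow> surface_velocity S p b \<Longrightarrow> indep a b \<Longrightarrow>
       sgn (\<omega> (H 1 p) (f' p a) (f' p b)) = sgn (\<omega> p a b)"
    using ambient_isotopy_orientation[OF H] by metis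
  have inj: "H 1 x = H 1 y \<longleftrightarrow> x = y" if "x \<in> S" "y \<in> S" for x y
    using ambient_isotopy_inverse[OF H] that by metis
  note \<theta>d = circle_reparam_deriv[OF t(1)]
  obtain \<epsilon> :: real where sh: "\<epsilon> = 1 \<or> \<epsilon> = -1" "\<And>t (n::int). \<theta> (t + of_int n) = \<theta> t + \<epsilon> * of_int n"
    using circle_reparam_shift_int[OF t(1)] by metis
  have bij: "bij \<theta>" by (rule circle_reparam_bij[OF t(1)])
  have Z: "\<theta> x - \<theta> y \<in> \<int> \<longleftrightarrow> x - y \<in> \<int>" for x y
  proof
    assume "x - y \<in> \<int>"
    then obtain n :: int where "x = y + of_int n" by (auto elim!: Ints_cases simp: algebra_simps)
    then show "\<theta> x - \<theta> y \<in> \<int>" using sh by auto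
  next
    assume "\<theta> x - \<theta> y \<in> \<int>"
    then obtain n :: int where n: "\<theta> x = \<theta> y + of_int n" by (auto elim!: Ints_cases simp: algebra_simps)
    obtain m :: int where m: "\<epsilon> * of_int m = of_int n"
      using sh(1) by (metis mult_1 mult_minus1 minus_minus of_int_minus)
    have "\<theta> x = \<theta> (y + of_int m)" using n m sh(2)[of y m] by simp
    then have "x = y + of_int m" using bij by (auto dest: injD[OF bij_is_inj])
    then show "x - y \<in> \<int>" by simp
  qed
  have dp: "double_pair e x y \<longleftrightarrow> double_pair c (\<theta> x) (\<theta> y)" for x y
    unfolding double_pair_def e using inj[OF cS cS] Z by simp
  have ed: "vector_derivative e (at x) = deriv \<theta> x *\<^sub>R f' (c (\<theta> x)) (vector_derivative c (at (\<theta> x)))" for x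
  proof (rule vector_derivative_at)
    have 1: "((\<lambda>s. c (\<theta> s)) has_vector_derivative deriv \<theta> x *\<^sub>R vector_derivative c (at (\<theta> x))) (at x)"
      using vector_diff_chain_at[of \<theta> "deriv \<theta> x" x c] \<theta>d(1)[of x] ci(1)
      by (simp add: o_def C1_curve_def has_real_derivative_iff_has_vector_derivative)
    have "linear (f' (c (\<theta> x)))" using f'(1)[OF cS] by (rule has_derivative_linear)
    then show "(e has_vector_derivative deriv \<theta> x *\<^sub>R f' (c (\<theta> x)) (vector_derivative c (at (\<theta> x)))) (at x)"
      using vector_derivative_diff_chain_within[OF 1 has_derivative_at_withinI[OF f'(1)[OF cS]]]
      by (simp add: e o_def linear_scale)
  qed
  have sgn\<theta>: "sgn (deriv \<theta> x) * sgn (deriv \<theta> y) = 1" for x y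
  proof -
    have "sgn (deriv \<theta> x) = sgn (deriv \<theta> y)"
      by (rule continuous_nonzero_sgn_const[of UNIV]) (use \<theta>d in auto)
    then show ?thesis using \<theta>d(3)[of y] by (simp add: sgn_if)
  qed
  have cs: "crossing_sign \<omega> e x = crossing_sign \<omega> c (\<theta> x)" if "double_pair e x y" for x y
  proof -
    have dc: "double_pair c (\<theta> x) (\<theta> y)" using that dp by blast
    have eq: "c (\<theta> x) = c (\<theta> y)" using dc by (simp add: double_pair_def)
    have v: "surface_velocity S (c (\<theta> x)) (vector_derivative c (at (\<theta> x)))"
      "surface_velocity S (c (\<theta> x)) (vector_derivative c (at (\<theta> y)))"
      using surface_velocity_curve[OF ci(1) Dd(2)] eq by metis+
    have "crossing_sign \<omega> e x = sgn (deriv \<theta> x) * sgn (deriv \<theta> y) *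
        sgn (\<omega> (H 1 (c (\<theta> x))) (f' (c (\<theta> x)) (vector_derivative c (at (\<theta> x)))) (f' (c (\<theta> x)) (vector_derivative c (at (\<theta> y)))))"
      unfolding crossing_sign_eq[OF E[unfolded Ee] that] ed by (simp add: e \<omega>_scale sgn_mult eq)
    also have "\<dots> = sgn (\<omega> (c (\<theta> x)) (vector_derivative c (at (\<theta> x))) (vector_derivative c (at (\<theta> y))))"
      using f'(2)[OF v Dd(3)[OF dc]] sgn\<theta> by simp
    also have "\<dots> = crossing_sign \<omega> c (\<theta> x)" using crossing_sign_eq[OF D[unfolded Dc] dc] by simp
    finally show ?thesis .
  qed
  have per: "crossing_sign \<omega> c x = crossing_sign \<omega> c y" if "double_pair c x z" "x - y \<in> \<int>" for x y z
  proof -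
    have "double_pair c y z" using that double_pair_cong[of c x y z z] ci(2) by simp
    moreover have "vector_derivative c (at x) = vector_derivative c (at y)" "c x = c y"
      using periodic_int[of "\<lambda>t. vector_derivative c (at t)"] periodic_int[of c] ci(2,4) that(2) by blast+
    ultimately show ?thesis using crossing_sign_eq[OF D[unfolded Dc]] that(1) by simp
  qed
  have Ovp: "x \<in> Ov \<longleftrightarrow> y \<in> Ov" if "x - y \<in> \<int>" for x y
    using periodic_int[of "\<lambda>x. x \<in> Ov"] Dd(7) that by blast
  have b: "bij_betw (\<lambda>x. frac (\<theta> x)) (over_params E) (over_params D)"
  proof (rule bij_betwI')
    fix x y assume xy: "x \<in> over_params E" "y \<in> over_params E"
    show "(frac (\<theta> x) = frac (\<theta> y)) = (x = y)"
      using xy Z[of x y] frac_eq_iff_Ints[of x y] frac_eq_iff_Ints[of "\<theta> x" "\<theta> y"]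
      by (auto simp: over_params_def frac_eq)
  next
    fix x assume "x \<in> over_params E"
    then have "\<theta> x \<in> Ov" by (simp add: over_params_def Ee)
    then show "frac (\<theta> x) \<in> over_params D"
      using Ovp[OF frac_diff_Ints, of "\<theta> x"] frac_in_unit[of "\<theta> x"] by (simp add: over_params_def Dc)
  next
    fix y assume y: "y \<in> over_params D"
    obtain x where x: "y = \<theta> x" using bij by (metis bij_pointE)
    have "\<theta> (frac x) - \<theta> x \<in> \<int>" using Z frac_diff_Ints by blast
    moreover from this have "\<theta> (frac x) \<in> Ov" using Ovp y x by (auto simp: over_params_def Dc)
    moreover have "frac y = y" using y by (auto simp: over_params_def frac_eq)
    ultimately show "\<exists>x\<in>over_params E. y = frac (\<theta> x)"
      using frac_in_unit[of x] x frac_eq_iff_Ints[of "\<theta> (frac x)" y]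
      by (intro bexI[of _ "frac x"]) (simp_all add: over_params_def Ee)
  qed
  then show "crossing_number E = crossing_number D"
    unfolding crossing_number_def by (rule bij_betw_same_card)
  have "writhe \<omega> D = (\<Sum>x\<in>over_params E. crossing_sign \<omega> c (frac (\<theta> x)))"
    unfolding writhe_def Dc fst_conv using sum.reindex_bij_betw[OF b, of "crossing_sign \<omega> c"] by (simp add: Dc)
  also have "\<dots> = (\<Sum>x\<in>over_params E. crossing_sign \<omega> e x)"
  proof (rule sum.cong[OF refl])
    fix x assume "x \<in> over_params E"
    then obtain y where y: "double_pair e x y" using Ed(6)[of x] by (auto simp: over_params_def Ee)
    have "crossing_sign \<omega> c (\<theta> x) = crossing_sign \<omega> c (frac (\<theta> x))"
      using per[of "\<theta> x" "\<theta> y" "frac (\<theta> x)"] y dp frac_diff_Ints Ints_diff_sym by blast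
    then show "crossing_sign \<omega> c (frac (\<theta> x)) = crossing_sign \<omega> e x" using cs[OF y] by simp
  qed
  finally show "writhe \<omega> E = writhe \<omega> D" unfolding writhe_def by (simp add: e_def)
qed

end

section \<open>Crossings inside a chart\<close>

text \<open>Tells whether the chart preserves orientation; the square is connected, so the centre
  decides for all of it.\<close>

definition chart_sign :: "('a::euclidean_space \<Rightarrow> 'a \<Rightarrow> 'a \<Rightarrow> real) \<Rightarrow> (complex \<Rightarrow> 'a) \<Rightarrow> real" where
  "chart_sign \<omega> \<phi> = sgn (\<omega> (\<phi> 0) (frechet_derivative \<phi> (at 0) 1) (frechet_derivative \<phi> (at 0) \<i>))"

text \<open>\<open>reid_step_via\<close> with its witnesses exposed: the change of writhe depends on
  the chart and on which passage is over.\<close>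

definition reid_at ::
  "local_model \<Rightarrow> 'a::euclidean_space set \<Rightarrow> 'a diagram \<Rightarrow> 'a diagram \<Rightarrow> (complex \<Rightarrow> 'a) \<Rightarrow>
     (nat \<Rightarrow> real) \<Rightarrow> (nat \<Rightarrow> real) \<Rightarrow> (nat \<Rightarrow> nat) \<Rightarrow> bool" where
  "reid_at M S D\<^sub>1 D\<^sub>2 \<phi> m r ht \<longleftrightarrow>
     square_chart S \<phi> \<and> (\<forall>i<length M. r i \<noteq> 0) \<and>
     inj_on (\<lambda>(i, u). frac (m i + r i * u)) ({..<length M} \<times> {-1..1}) \<and>
     (\<forall>i<length M. \<forall>u\<in>{-1..1}. fst D\<^sub>1 (m i + r i * u) = \<phi> (fst (M ! i) u) \<and>
        fst D\<^sub>2 (m i + r i * u) = \<phi> (snd (M ! i) u)) \<and>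
     (\<forall>t. (\<nexists>i u. i < length M \<and> u \<in> {-1..1} \<and> t - (m i + r i * u) \<in> \<int>) \<longrightarrow>
        fst D\<^sub>1 t = fst D\<^sub>2 t \<and> fst D\<^sub>1 t \<notin> \<phi> ` square \<and> (t \<in> snd D\<^sub>1 \<longleftrightarrow> t \<in> snd D\<^sub>2)) \<and>
     inj_on ht {..<length M} \<and>
     (\<forall>D\<in>{D\<^sub>1, D\<^sub>2}. \<forall>i<length M. \<forall>j<length M. \<forall>u\<in>{-1..1}. \<forall>v\<in>{-1..1}.
        i \<noteq> j \<and> fst D (m i + r i * u) = fst D (m j + r j * v) \<longrightarrow>
          (m i + r i * u \<in> snd D \<longleftrightarrow> ht j < ht i))"

lemma reid_step_via_iff: "reid_step_via M S D\<^sub>1 D\<^sub>2 \<longleftrightarrow> (\<exists>\<phi> m r ht. reid_at M S D\<^sub>1 D\<^sub>2 \<phi> m r ht)"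
  unfolding reid_step_via_def reid_at_def Let_def ..

definition strand_set :: "nat \<Rightarrow> (nat \<Rightarrow> real) \<Rightarrow> (nat \<Rightarrow> real) \<Rightarrow> real set" where
  "strand_set k m r = {t. \<exists>i u. i < k \<and> u \<in> {-1..1} \<and> t - (m i + r i * u) \<in> \<int>}"

text \<open>Closedness makes two curves that agree off the strands agree near every such parameter,
  so that their velocities agree too. For each strand the set is a compact interval plus the
  integers.\<close>

lemma closed_strand_set: "closed (strand_set k m r)"
proof -
  have "strand_set k m r = (\<Union>i<k. (\<Union>x\<in>(\<lambda>u. m i + r i * u) ` {-1..1}. \<Union>y\<in>\<int>. {x + y}))" (is "_ = (\<Union>i<k. ?A i)")
  proof (intro set_eqI iffI)
    fix t assume "t \<in> strand_set k m r"
    then obtain i u where "i < k" "u \<in> {-1..1}" "t - (m i + r i * u) \<in> \<int>" by (auto simp: strand_set_def)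
    then show "t \<in> (\<Union>i<k. ?A i)" by (intro UN_I[of i] UN_I[of "m i + r i * u"] UN_I[of "t - (m i + r i * u)"]) auto
  next
    fix t assume "t \<in> (\<Union>i<k. ?A i)"
    then obtain i u y where "i < k" "u \<in> {-1..1}" "y \<in> \<int>" "t = m i + r i * u + y" by auto
    then show "t \<in> strand_set k m r" unfolding strand_set_def mem_Collect_eq by (intro exI[of _ i] exI[of _ u]) simp
  qed
  moreover have "closed (?A i)" for i
    by (rule compact_closed_sums) (auto intro!: compact_continuous_image continuous_intros closed_Ints)
  ultimately show ?thesis by auto
qed

lemma square_connected: "connected square" "0 \<in> square"
proof -
  have "convex square"
    unfolding convex_def square_def
  proof clarsimp
    fix x y :: complex and u v :: real
    assume a: "\<bar>Re x\<bar> \<le> 1" "\<bar>Im x\<bar> \<le> 1" "\<bar>Re y\<bar> \<le> 1" "\<bar>Im y\<bar> \<le> 1" "0 \<le> u" "0 \<le> v" "u + v = 1"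
    have *: "\<bar>u * p + v * q\<bar> \<le> 1" if "\<bar>p\<bar> \<le> 1" "\<bar>q\<bar> \<le> 1" for p q :: real
    proof -
      have "\<bar>u * p + v * q\<bar> \<le> u * \<bar>p\<bar> + v * \<bar>q\<bar>" using a(5,6) by (metis abs_mult abs_of_nonneg abs_triangle_ineq)
      also have "\<dots> \<le> u * 1 + v * 1" using that a(5,6) by (intro add_mono mult_left_mono)
      finally show ?thesis using a(7) by simp
    qed
    show "\<bar>u * Re x + v * Re y\<bar> \<le> 1 \<and> \<bar>u * Im x + v * Im y\<bar> \<le> 1" using * a by blast
  qed
  then show "connected square" by (rule convex_connected)
qed (simp add: square_def)

context oriented_surface
begin

text \<open>\<open>Im (cnj v * w)\<close> is the determinant of \<open>v\<close> and
  \<open>w\<close>. The form pulled back by the chart is this determinant times a factor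
  \<open>J\<close>, continuous and nonzero on the connected set \<open>Q\<close>.\<close>

lemma chart_orientation:
  fixes \<phi>' :: "complex \<Rightarrow> complex \<Rightarrow>\<^sub>L 'a"
  assumes "open U" "Q \<subseteq> U" "connected Q" "\<phi> ` U \<subseteq> S" "continuous_on U \<phi>'"
    and d: "\<And>z. z \<in> U \<Longrightarrow> (\<phi> has_derivative blinfun_apply (\<phi>' z)) (at z)"
    and i: "\<And>z. z \<in> U \<Longrightarrow> inj (blinfun_apply (\<phi>' z))"
    and z: "z0 \<in> Q" "z \<in> Q"
  shows "sgn (\<omega> (\<phi> z) (\<phi>' z v) (\<phi>' z w)) = sgn (\<omega> (\<phi> z0) (\<phi>' z0 1) (\<phi>' z0 \<i>)) * sgn (Im (cnj v * w))"
    and "\<omega> (\<phi> z0) (\<phi>' z0 1) (\<phi>' z0 \<i>) \<noteq> 0"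
proof -
  define J where "J = (\<lambda>z. \<omega> (\<phi> z) (\<phi>' z 1) (\<phi>' z \<i>))"
  have vel: "surface_velocity S (\<phi> z) (\<phi>' z v)" if "z \<in> U" for z v
  proof -
    have "surface_velocity U z v" unfolding surface_velocity_def
    proof (intro exI[of _ "\<lambda>t. z + t *\<^sub>R v"] conjI)
      have "((\<lambda>t. z + t *\<^sub>R v) \<longlongrightarrow> z + 0 *\<^sub>R v) (nhds 0)" by (intro tendsto_intros) (simp add: filterlim_ident)
      then show "\<forall>\<^sub>F t in nhds 0. z + t *\<^sub>R v \<in> U" using assms(1) that by (intro topological_tendstoD) simp_all
    qed (auto intro!: derivative_eq_intros)
    then show ?thesis using surface_velocity_image d[OF that] assms(4) by blast
  qed
  have J: "J z \<noteq> 0" if "z \<in> U" for z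
    unfolding J_def
  proof (rule \<omega>_nonzero[OF vel[OF that] vel[OF that]])
    show "indep (\<phi>' z 1) (\<phi>' z \<i>)"
      by (rule indep_linear_image[OF _ i[OF that]])
        (auto simp: indep_def complex_eq_iff bounded_linear.linear blinfun.bounded_linear_right)
  qed
  have "isCont \<phi> z" if "z \<in> U" for z using d[OF that] has_derivative_continuous by blast
  then have c0: "continuous_on Q \<phi>" using assms(2) by (auto intro!: continuous_at_imp_continuous_on)
  have c1: "continuous_on Q (\<lambda>z. \<phi>' z v)" for v
    using blinfun.continuous_on[OF continuous_on_subset[OF assms(5,2)] continuous_on_const, of v] .
  have "sgn (J z) = sgn (J z0)"
    by (rule continuous_nonzero_sgn_const[OF assms(3)])
      (use J z assms(2) in \<open>auto simp: J_def intro!: continuous_on_\<omega> c0 c1\<close>)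
  moreover have "\<omega> (\<phi> z) (\<phi>' z v) (\<phi>' z w) = Im (cnj v * w) * J z"
  proof -
    have e: "\<phi>' z v = Re v *\<^sub>R \<phi>' z 1 + Im v *\<^sub>R \<phi>' z \<i>" for v
    proof -
      have "v = Re v *\<^sub>R 1 + Im v *\<^sub>R \<i>" by (simp add: complex_eq_iff)
      then have "\<phi>' z v = \<phi>' z (Re v *\<^sub>R 1 + Im v *\<^sub>R \<i>)" by simp
      then show ?thesis by (simp only: blinfun.add_right blinfun.scaleR_right)
    qed
    have "\<omega> (\<phi> z) (\<phi>' z v) (\<phi>' z w) = Re v * Im w * J z + Im v * Re w * \<omega> (\<phi> z) (\<phi>' z \<i>) (\<phi>' z 1)"
      unfolding e[of v] e[of w] J_def
      using linear_add[OF \<omega>_linear1] linear_add[OF \<omega>_linear2] by (simp add: \<omega>_scale \<omega>_alternating)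
    then show ?thesis using \<omega>_swap[of "\<phi> z" "\<phi>' z \<i>" "\<phi>' z 1"] by (simp add: J_def algebra_simps)
  qed
  ultimately show "sgn (\<omega> (\<phi> z) (\<phi>' z v) (\<phi>' z w)) = sgn (\<omega> (\<phi> z0) (\<phi>' z0 1) (\<phi>' z0 \<i>)) * sgn (Im (cnj v * w))"
    by (simp add: J_def sgn_mult)
  show "\<omega> (\<phi> z0) (\<phi>' z0 1) (\<phi>' z0 \<i>) \<noteq> 0" using J z(1) assms(2) unfolding J_def by blast
qed

lemma square_chart_sign:
  assumes "square_chart S \<phi>"
  shows "\<bar>chart_sign \<omega> \<phi>\<bar> = 1"
    and "(g has_vector_derivative v) (at s) \<Longrightarrow> (h has_vector_derivative w) (at t) \<Longrightarrow> g s \<in> square \<Longrightarrow> h t = g s \<Longrightarrow>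
      sgn (\<omega> (\<phi> (g s)) (vector_derivative (\<lambda>u. \<phi> (g u)) (at s)) (vector_derivative (\<lambda>u. \<phi> (h u)) (at t)))
        = chart_sign \<omega> \<phi> * sgn (Im (cnj v * w))"
    and "(g has_vector_derivative v) (at s) \<Longrightarrow> g s \<in> square \<Longrightarrow> (\<lambda>u. \<phi> (g u)) differentiable (at s)"
proof -
  obtain U \<phi>' where U: "open U" "square \<subseteq> U" "\<phi> ` U \<subseteq> S" "continuous_on U \<phi>'"
    and d: "\<And>z. z \<in> U \<Longrightarrow> (\<phi> has_derivative blinfun_apply (\<phi>' z)) (at z)"
    and i: "\<And>z. z \<in> U \<Longrightarrow> inj (blinfun_apply (\<phi>' z))"
    using assms unfolding square_chart_def by blast
  have "frechet_derivative \<phi> (at 0) = \<phi>' 0"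
    using frechet_derivative_at[OF d[of 0]] U(2) square_connected(2) by auto
  then have cs: "chart_sign \<omega> \<phi> = sgn (\<omega> (\<phi> 0) (\<phi>' 0 1) (\<phi>' 0 \<i>))" by (simp add: chart_sign_def)
  note co = chart_orientation[OF U(1,2) square_connected(1) U(3,4) d i square_connected(2), folded cs]
  show "\<bar>chart_sign \<omega> \<phi>\<bar> = 1" using co(2) square_connected(2) unfolding cs by (simp add: sgn_if)
  have vd: "((\<lambda>u. \<phi> (g u)) has_vector_derivative \<phi>' (g s) v) (at s)"
    if "(g has_vector_derivative v) (at s)" "g s \<in> square" for g v s
    using vector_derivative_diff_chain_within[OF that(1) has_derivative_at_withinI[OF d]] that(2) U(2) by (auto simp: o_def)
  show "sgn (\<omega> (\<phi> (g s)) (vector_derivative (\<lambda>u. \<phi> (g u)) (at s)) (vector_derivative (\<lambda>u. \<phi> (h u)) (at t)))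
        = chart_sign \<omega> \<phi> * sgn (Im (cnj v * w))"
    if "(g has_vector_derivative v) (at s)" "(h has_vector_derivative w) (at t)" "g s \<in> square" "h t = g s"
    using vector_derivative_at[OF vd[OF that(1,3)]] vector_derivative_at[OF vd[OF that(2)]] that(3,4) co(1) by simp
  show "(g has_vector_derivative v) (at s) \<Longrightarrow> g s \<in> square \<Longrightarrow> (\<lambda>u. \<phi> (g u)) differentiable (at s)"
    using vd by (auto intro: differentiableI_vector)
qed

text \<open>A point on a strand lies in the image of the square, which the curve enters along the
  strands only. Hence crossings on strands are coincidences of model strands, listed in
  \<open>X\<close> with the over-passage first. They are required to be interior because curve and
  model are compared on \<open>[-1,1]\<close>, which determines the velocity of the curve in the
  open interval.\<close>

lemma local_crossings:
  fixes g g' :: "nat \<Rightarrow> real \<Rightarrow> complex" and k :: nat and m r :: "nat \<Rightarrow> real" and Ov :: "real set"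
  defines "X \<equiv> {((i, u), (j, v)). i < k \<and> j < k \<and> u \<in> {-1..1} \<and> v \<in> {-1..1} \<and> (i, u) \<noteq> (j, v) \<and>
    g i u = g j v \<and> m i + r i * u \<in> Ov}"
  assumes D: "is_diagram S (c, Ov)" and ch: "square_chart S \<phi>" and r: "\<And>i. i < k \<Longrightarrow> r i \<noteq> 0"
    and inj: "inj_on (\<lambda>(i, u). frac (m i + r i * u)) ({..<k} \<times> {-1..1})"
    and cg: "\<And>i u. i < k \<Longrightarrow> u \<in> {-1..1} \<Longrightarrow> c (m i + r i * u) = \<phi> (g i u)"
    and gsq: "\<And>i u. i < k \<Longrightarrow> u \<in> {-1..1} \<Longrightarrow> g i u \<in> square"
    and gd: "\<And>i u. i < k \<Longrightarrow> (g i has_vector_derivative g' i u) (at u)"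
    and out: "\<And>t. t \<notin> strand_set k m r \<Longrightarrow> c t \<notin> \<phi> ` square"
    and interior: "\<And>i u j v. ((i, u), (j, v)) \<in> X \<Longrightarrow> u \<in> {-1<..<1} \<and> v \<in> {-1<..<1}"
  shows "bij_betw (\<lambda>((i, u), _). frac (m i + r i * u)) X (over_params (c, Ov) \<inter> strand_set k m r)" (is ?bij)
    and "(\<Sum>s\<in>over_params (c, Ov) \<inter> strand_set k m r. crossing_sign \<omega> c s) =
      (\<Sum>((i, u), (j, v))\<in>X. sgn (r i) * sgn (r j) * chart_sign \<omega> \<phi> * sgn (Im (cnj (g' i u) * g' j v)))" (is ?sum)
proof -
  note Dd = is_diagramD[OF D]
  note ci = closed_immersionD[OF Dd(1)]
  have inj\<phi>: "inj_on \<phi> square" using ch unfolding square_chart_def by (auto intro: inj_on_subset)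
  have g_eq: "g i u = g j v \<longleftrightarrow> c (m i + r i * u) = c (m j + r j * v)"
    if "i < k" "u \<in> {-1..1}" "j < k" "v \<in> {-1..1}" for i u j v
    using cg[OF that(1,2)] cg[OF that(3,4)] gsq[OF that(1,2)] gsq[OF that(3,4)] inj\<phi> by (auto dest: inj_onD)
  have int_eq: "(m i + r i * u) - (m j + r j * v) \<in> \<int> \<longleftrightarrow> (i, u) = (j, v)"
    if "i < k" "u \<in> {-1..1}" "j < k" "v \<in> {-1..1}" for i u j v
    using inj_onD[OF inj, of "(i,u)" "(j,v)"] that frac_eq_iff_Ints[of "m i + r i * u" "m j + r j * v"] by auto
  have dp: "double_pair c (m i + r i * u) (m j + r j * v)" if "((i, u), (j, v)) \<in> X" for i u j v
    using that g_eq[of i u j v] int_eq[of i u j v] unfolding X_def double_pair_def by auto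
  have Ovp: "x \<in> Ov \<longleftrightarrow> y \<in> Ov" if "x - y \<in> \<int>" for x y
    using periodic_int[of "\<lambda>x. x \<in> Ov"] Dd(7) that by blast
  show b: ?bij
  proof (rule bij_betwI')
    fix x y assume "x \<in> X" "y \<in> X"
    then obtain i u j v i' u' j' v' where xy: "x = ((i,u),(j,v))" "y = ((i',u'),(j',v'))"
      "((i,u),(j,v)) \<in> X" "((i',u'),(j',v')) \<in> X" by (metis surj_pair)
    show "((case x of (x, xa) \<Rightarrow> (case x of (i, u) \<Rightarrow> \<lambda>_. frac (m i + r i * u)) xa) =
      (case y of (x, xa) \<Rightarrow> (case x of (i, u) \<Rightarrow> \<lambda>_. frac (m i + r i * u)) xa)) = (x = y)"
    proof
      assume "(case x of (x, xa) \<Rightarrow> (case x of (i, u) \<Rightarrow> \<lambda>_. frac (m i + r i * u)) xa) =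
        (case y of (x, xa) \<Rightarrow> (case x of (i, u) \<Rightarrow> \<lambda>_. frac (m i + r i * u)) xa)"
      then have 1: "(i, u) = (i', u')"
        using xy int_eq[of i u i' u'] frac_eq_iff_Ints by (auto simp: X_def)
      then have "(m j + r j * v) - (m j' + r j' * v') \<in> \<int>"
        using dp[OF xy(3)] dp[OF xy(4)] Dd(4) by blast
      then have "(j, v) = (j', v')" using xy int_eq[of j v j' v'] by (auto simp: X_def)
      then show "x = y" using 1 xy by simp
    qed simp
  next
    fix x assume "x \<in> X"
    then obtain i u j v where x: "x = ((i,u),(j,v))" "((i,u),(j,v)) \<in> X" by (metis surj_pair)
    have "frac (m i + r i * u) \<in> Ov" using x Ovp[OF frac_diff_Ints] by (auto simp: X_def)
    moreover have "frac (m i + r i * u) \<in> strand_set k m r"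
      using x frac_diff_Ints unfolding strand_set_def X_def by blast
    ultimately show "(case x of (x, xa) \<Rightarrow> (case x of (i, u) \<Rightarrow> \<lambda>_. frac (m i + r i * u)) xa)
      \<in> over_params (c, Ov) \<inter> strand_set k m r"
      using frac_in_unit x by (simp add: over_params_def)
  next
    fix s assume s: "s \<in> over_params (c, Ov) \<inter> strand_set k m r"
    then obtain i u where iu: "i < k" "u \<in> {-1..1}" "s - (m i + r i * u) \<in> \<int>" by (auto simp: strand_set_def)
    have sOv: "s \<in> Ov" "s = frac s" using s by (auto simp: over_params_def frac_eq)
    then obtain t where t: "double_pair c s t" using Dd(6) by blast
    have "c s = c (m i + r i * u)" using periodic_int[of c] ci(2) iu(3) by blast
    then have "c t = \<phi> (g i u)" using t cg[OF iu(1,2)] by (simp add: double_pair_def)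
    then have "c t \<in> \<phi> ` square" using gsq[OF iu(1,2)] by blast
    then obtain j v where jv: "j < k" "v \<in> {-1..1}" "t - (m j + r j * v) \<in> \<int>"
      using out[of t] by (auto simp: strand_set_def)
    have "double_pair c (m i + r i * u) (m j + r j * v)"
      using t double_pair_cong[of c, OF ci(2) iu(3) jv(3)] by simp
    then have "((i,u),(j,v)) \<in> X"
      using iu jv sOv(1) Ovp[OF iu(3)] g_eq[of i u j v] int_eq[of i u j v]
      unfolding X_def double_pair_def by auto
    moreover have "s = frac (m i + r i * u)" using sOv(2) iu(3) frac_eq_iff_Ints by metis
    ultimately show "\<exists>x\<in>X. s = (case x of (x, xa) \<Rightarrow> (case x of (i, u) \<Rightarrow> \<lambda>_. frac (m i + r i * u)) xa)" by force
  qed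
  have cs: "crossing_sign \<omega> c (frac (m i + r i * u)) =
      sgn (r i) * sgn (r j) * chart_sign \<omega> \<phi> * sgn (Im (cnj (g' i u) * g' j v))"
    if x: "((i, u), (j, v)) \<in> X" for i u j v
  proof -
    have ij: "i < k" "j < k" and uv: "u \<in> {-1<..<1}" "v \<in> {-1<..<1}" and e: "g i u = g j v"
      using x interior[OF x] unfolding X_def by auto
    have vd: "vector_derivative (\<lambda>u. \<phi> (g i u)) (at u) = r i *\<^sub>R vector_derivative c (at (m i + r i * u))"
      if "i < k" "u \<in> {-1<..<1}" for i u
    proof (rule vector_derivative_at)
      have l: "((\<lambda>u. m i + r i * u) has_vector_derivative r i) (at u)" by (auto intro!: derivative_eq_intros)
      have "((\<lambda>u. c (m i + r i * u)) has_vector_derivative r i *\<^sub>R vector_derivative c (at (m i + r i * u))) (at u)"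
        using vector_diff_chain_at[OF l, of c "vector_derivative c (at (m i + r i * u))"] ci(1)
        by (simp add: C1_curve_def o_def)
      moreover have "\<forall>\<^sub>F u in nhds u. c (m i + r i * u) = \<phi> (g i u)"
        using eventually_nhds_in_open[of "{-1<..<1}" u] that(2)
        by (auto elim!: eventually_mono intro!: cg that(1))
      moreover have "c (m i + r i * u) = \<phi> (g i u)" using cg that by simp
      ultimately show "((\<lambda>u. \<phi> (g i u)) has_vector_derivative r i *\<^sub>R vector_derivative c (at (m i + r i * u))) (at u)"
        using has_vector_derivative_cong_ev[of UNIV "\<lambda>u. c (m i + r i * u)" "\<lambda>u. \<phi> (g i u)" u] by simp
    qed
    have per: "vector_derivative c (at (frac s)) = vector_derivative c (at s)" "c (frac s) = c s" for s
      using periodic_int[of "\<lambda>t. vector_derivative c (at t)", OF ci(4) frac_diff_Ints]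
        periodic_int[of c, OF ci(2) frac_diff_Ints] by simp_all
    have "double_pair c (frac (m i + r i * u)) (m j + r j * v)"
      using dp[OF x] double_pair_cong[of c "frac (m i + r i * u)" "m i + r i * u" "m j + r j * v" "m j + r j * v",
        OF ci(2) frac_diff_Ints] by simp
    then have 1: "crossing_sign \<omega> c (frac (m i + r i * u)) = sgn (\<omega> (c (m i + r i * u))
        (vector_derivative c (at (m i + r i * u))) (vector_derivative c (at (m j + r j * v))))"
      using crossing_sign_eq[OF D] per by simp
    have "chart_sign \<omega> \<phi> * sgn (Im (cnj (g' i u) * g' j v)) =
        sgn (\<omega> (\<phi> (g i u)) (vector_derivative (\<lambda>u. \<phi> (g i u)) (at u)) (vector_derivative (\<lambda>u. \<phi> (g j u)) (at v)))"
      by (rule square_chart_sign(2)[OF ch gd[OF ij(1)] gd[OF ij(2)], symmetric])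
        (use gsq ij uv e in auto)
    also have "\<dots> = sgn (r i) * sgn (r j) * crossing_sign \<omega> c (frac (m i + r i * u))"
      unfolding vd[OF ij(1) uv(1)] vd[OF ij(2) uv(2)] 1 \<omega>_scale
      using cg[of i u] ij uv by (simp add: sgn_mult)
    finally have 2: "chart_sign \<omega> \<phi> * sgn (Im (cnj (g' i u) * g' j v)) = \<dots>" .
    have s1: "sgn (r i) * sgn (r i) = 1" "sgn (r j) * sgn (r j) = 1" using r ij by (auto simp: sgn_if)
    have "sgn (r i) * sgn (r j) * chart_sign \<omega> \<phi> * sgn (Im (cnj (g' i u) * g' j v))
       = (sgn (r i) * sgn (r i)) * (sgn (r j) * sgn (r j)) * crossing_sign \<omega> c (frac (m i + r i * u))"
      using 2 by (simp add: mult.assoc mult.left_commute)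
    then show ?thesis using s1 by simp
  qed
  have "(\<Sum>s\<in>over_params (c, Ov) \<inter> strand_set k m r. crossing_sign \<omega> c s) =
    (\<Sum>x\<in>X. crossing_sign \<omega> c ((\<lambda>((i, u), _). frac (m i + r i * u)) x))"
    using sum.reindex_bij_betw[OF b, of "crossing_sign \<omega> c"] by simp
  also have "\<dots> = (\<Sum>((i, u), (j, v))\<in>X. sgn (r i) * sgn (r j) * chart_sign \<omega> \<phi> * sgn (Im (cnj (g' i u) * g' j v)))"
    by (rule sum.cong[OF refl]) (use cs in auto)
  finally show ?sum .
qed

text \<open>A crossing with one passage off the strands has both off them, because strands are
  mapped into \<open>P\<close> and the rest avoids it. Near such parameters the two curves
  coincide.\<close>

lemma outside_crossings:
  assumes D: "is_diagram S D\<^sub>1" "is_diagram S D\<^sub>2"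
    and out: "\<And>t. t \<notin> I \<Longrightarrow> fst D\<^sub>1 t = fst D\<^sub>2 t \<and> fst D\<^sub>1 t \<notin> P \<and> (t \<in> snd D\<^sub>1 \<longleftrightarrow> t \<in> snd D\<^sub>2)"
    and ins: "\<And>t. t \<in> I \<Longrightarrow> fst D\<^sub>1 t \<in> P" and I: "closed I"
  shows "over_params D\<^sub>1 - I = over_params D\<^sub>2 - I"
    and "(\<Sum>s\<in>over_params D\<^sub>1 - I. crossing_sign \<omega> (fst D\<^sub>1) s) = (\<Sum>s\<in>over_params D\<^sub>2 - I. crossing_sign \<omega> (fst D\<^sub>2) s)"
proof -
  show *: "over_params D\<^sub>1 - I = over_params D\<^sub>2 - I" using out by (auto simp: over_params_def)
  obtain c1 O1 c2 O2 where cO: "D\<^sub>1 = (c1, O1)" "D\<^sub>2 = (c2, O2)" by fastforce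
  have vd: "vector_derivative c1 (at s) = vector_derivative c2 (at s)" if "s \<notin> I" for s
  proof -
    have "\<forall>\<^sub>F x in nhds s. x \<in> - I" using I that by (intro eventually_nhds_in_open) auto
    then have "\<forall>\<^sub>F x in nhds s. x \<in> UNIV \<longrightarrow> c1 x = c2 x" by eventually_elim (use out cO in auto)
    moreover have "c1 s = c2 s" using out[OF that] cO by simp
    ultimately have "(c1 has_vector_derivative d) (at s) \<longleftrightarrow> (c2 has_vector_derivative d) (at s)" for d
      by (rule has_vector_derivative_cong_ev)
    then show ?thesis unfolding vector_derivative_def by simp
  qed
  have "crossing_sign \<omega> c1 s = crossing_sign \<omega> c2 s" if s: "s \<in> over_params D\<^sub>1 - I" for s
  proof -
    obtain t where t: "double_pair c1 s t"
      using s is_diagramD(6)[OF D(1)[unfolded cO]] by (auto simp: over_params_def cO)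
    have sI: "s \<notin> I" using s by simp
    have "c1 s \<notin> P" using out[OF sI] cO by (metis fst_conv)
    then have tI: "t \<notin> I" using ins[of t] t cO by (auto simp: double_pair_def)
    have "double_pair c2 s t" using t out[OF sI] out[OF tI] cO by (simp add: double_pair_def)
    then show ?thesis
      using crossing_sign_eq[OF D(1)[unfolded cO] t] crossing_sign_eq[OF D(2)[unfolded cO]] vd[OF sI] vd[OF tI]
        out[OF sI] cO by simp
  qed
  then show "(\<Sum>s\<in>over_params D\<^sub>1 - I. crossing_sign \<omega> (fst D\<^sub>1) s) = (\<Sum>s\<in>over_params D\<^sub>2 - I. crossing_sign \<omega> (fst D\<^sub>2) s)"
    unfolding *[symmetric] using cO by (intro sum.cong) auto
qed

end

section \<open>Effect of the moves on the invariants\<close>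

text \<open>Ordered pairs with the over-passage first, so that each crossing of a diagram is listed
  once.\<close>

definition tangle_doubles ::
  "nat \<Rightarrow> (nat \<Rightarrow> real \<Rightarrow> complex) \<Rightarrow> (nat \<Rightarrow> real) \<Rightarrow> (nat \<Rightarrow> real) \<Rightarrow> real set \<Rightarrow> ((nat \<times> real) \<times> (nat \<times> real)) set"
  where "tangle_doubles k g m r Ov =
    {((i, u), (j, v)). i < k \<and> j < k \<and> u \<in> {-1..1} \<and> v \<in> {-1..1} \<and> (i, u) \<noteq> (j, v) \<and>
      g i u = g j v \<and> m i + r i * u \<in> Ov}"

definition tangle_writhe ::
  "nat \<Rightarrow> (nat \<Rightarrow> real \<Rightarrow> complex) \<Rightarrow> (nat \<Rightarrow> real \<Rightarrow> complex) \<Rightarrow> (nat \<Rightarrow> real) \<Rightarrow> (nat \<Rightarrow> real) \<Rightarrow> real set \<Rightarrow> real"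
  where "tangle_writhe k g g' m r Ov = (\<Sum>((i, u), (j, v))\<in>tangle_doubles k g m r Ov.
    sgn (r i) * sgn (r j) * sgn (Im (cnj (g' i u) * g' j v)))"

text \<open>Strands that are graphs over the abscissa can meet only at equal parameters, so a
  crossing amounts to two indices and one number. If \<open>ht\<close> puts the larger index on top,
  the pair is listed in reverse order, which negates the determinant; this accounts for the factor 1
  or -1.\<close>

lemma graph_tangle:
  assumes re: "\<And>i u. i < k \<Longrightarrow> Re (g i u) = u"
    and inj: "inj_on ht {..<k}"
    and ov: "\<And>i j u. i < k \<Longrightarrow> j < k \<Longrightarrow> i \<noteq> j \<Longrightarrow> u \<in> {-1..1} \<Longrightarrow> g i u = g j u \<Longrightarrow> (m i + r i * u \<in> Ov \<longleftrightarrow> ht j < (ht i::nat))"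
    and Y: "Y = {(i, j, u). i < j \<and> j < k \<and> u \<in> {-1..1} \<and> g i u = g j u}"
  shows "card (tangle_doubles k g m r Ov) = card Y"
    and "tangle_writhe k g g' m r Ov = (\<Sum>(i, j, u)\<in>Y. (if ht j < ht i then 1 else -1) * sgn (r i) * sgn (r j) *
      sgn (Im (cnj (g' i u) * g' j u)))"
proof -
  define f where "f = (\<lambda>(i, j, u::real). if ht j < ht i then ((i, u), (j, u)) else ((j, u), (i, u)))"
  have hne: "ht i \<noteq> ht j" if "i < j" "j < k" for i j
    using inj that by (auto dest: inj_onD)
  have b: "bij_betw f Y (tangle_doubles k g m r Ov)"
  proof (rule bij_betwI')
    fix x y assume "x \<in> Y" "y \<in> Y"
    then show "(f x = f y) = (x = y)" by (auto simp: f_def Y split: if_splits)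
  next
    fix x assume "x \<in> Y"
    then obtain i j u where x: "x = (i, j, u)" "i < j" "j < k" "u \<in> {-1..1}" "g i u = g j u" by (auto simp: Y)
    then have "i < k" by simp
    then show "f x \<in> tangle_doubles k g m r Ov"
      using ov[of i j u] ov[of j i u] x hne[of i j] by (auto simp: f_def tangle_doubles_def)
  next
    fix y assume "y \<in> tangle_doubles k g m r Ov"
    then obtain i u j v where y: "y = ((i, u), (j, v))" "i < k" "j < k" "u \<in> {-1..1}" "v \<in> {-1..1}" "(i, u) \<noteq> (j, v)"
      "g i u = g j v" "m i + r i * u \<in> Ov" by (auto simp: tangle_doubles_def)
    have uv: "u = v" using re[of i u] re[of j v] y by simp
    then have ij: "i \<noteq> j" using y by simp
    have h: "ht j < ht i" using ov[of i j u] y uv ij by simp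
    show "\<exists>x\<in>Y. y = f x"
    proof (cases "i < j")
      case True
      then show ?thesis using y uv h by (intro bexI[of _ "(i, j, u)"]) (auto simp: f_def Y)
    next
      case False
      then show ?thesis using y uv h ij by (intro bexI[of _ "(j, i, u)"]) (auto simp: f_def Y)
    qed
  qed
  show "card (tangle_doubles k g m r Ov) = card Y" using bij_betw_same_card[OF b] by simp
  have "tangle_writhe k g g' m r Ov = (\<Sum>x\<in>Y. case f x of ((i, u), (j, v)) \<Rightarrow>
    sgn (r i) * sgn (r j) * sgn (Im (cnj (g' i u) * g' j v)))"
    unfolding tangle_writhe_def using sum.reindex_bij_betw[OF b, symmetric] by (simp add: case_prod_unfold)
  also have "\<dots> = (\<Sum>(i, j, u)\<in>Y. (if ht j < ht i then 1 else -1) * sgn (r i) * sgn (r j) *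
      sgn (Im (cnj (g' i u) * g' j u)))"
  proof (rule sum.cong[OF refl])
    fix x assume "x \<in> Y"
    obtain i j u where x: "x = (i, j, u)" by (metis surj_pair)
    have "sgn (Im (cnj (g' j u) * g' i u)) = - sgn (Im (cnj (g' i u) * g' j u))"
    proof -
      have "Im (cnj (g' j u) * g' i u) = - Im (cnj (g' i u) * g' j u)" by simp
      then show ?thesis by (simp only: sgn_minus)
    qed
    then show "(case f x of ((i, u), (j, v)) \<Rightarrow> sgn (r i) * sgn (r j) * sgn (Im (cnj (g' i u) * g' j v))) =
      (case x of (i, j, u) \<Rightarrow> (if ht j < ht i then 1 else -1) * sgn (r i) * sgn (r j) *
      sgn (Im (cnj (g' i u) * g' j u)))" by (simp add: x f_def del: mult_minus_left minus_mult_right)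
  qed
  finally show "tangle_writhe k g g' m r Ov = (\<Sum>(i, j, u)\<in>Y. (if ht j < ht i then 1 else -1) * sgn (r i) * sgn (r j) *
      sgn (Im (cnj (g' i u) * g' j u)))" .
qed

context oriented_surface
begin

text \<open>Everything away from the square cancels between the two diagrams; what remains is a
  count in the model, with the orientation of the chart as a common factor.\<close>

lemma reid_at_change:
  assumes D1: "is_diagram S D\<^sub>1" and D2: "is_diagram S D\<^sub>2" and R: "reid_at M S D\<^sub>1 D\<^sub>2 \<phi> m r ht"
    and gsq: "\<And>i u. i < length M \<Longrightarrow> u \<in> {-1..1} \<Longrightarrow> fst (M ! i) u \<in> square \<and> snd (M ! i) u \<in> square"
    and gd1: "\<And>i u. i < length M \<Longrightarrow> (fst (M ! i) has_vector_derivative g1' i u) (at u)"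
    and gd2: "\<And>i u. i < length M \<Longrightarrow> (snd (M ! i) has_vector_derivative g2' i u) (at u)"
    and i1: "\<And>i u j v. ((i, u), (j, v)) \<in> tangle_doubles (length M) (\<lambda>i. fst (M ! i)) m r (snd D\<^sub>1) \<Longrightarrow> u \<in> {-1<..<1} \<and> v \<in> {-1<..<1}"
    and i2: "\<And>i u j v. ((i, u), (j, v)) \<in> tangle_doubles (length M) (\<lambda>i. snd (M ! i)) m r (snd D\<^sub>2) \<Longrightarrow> u \<in> {-1<..<1} \<and> v \<in> {-1<..<1}"
  shows "crossing_number D\<^sub>2 + card (tangle_doubles (length M) (\<lambda>i. fst (M ! i)) m r (snd D\<^sub>1)) =
      crossing_number D\<^sub>1 + card (tangle_doubles (length M) (\<lambda>i. snd (M ! i)) m r (snd D\<^sub>2))"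
    and "writhe \<omega> D\<^sub>2 - writhe \<omega> D\<^sub>1 = chart_sign \<omega> \<phi> *
      (tangle_writhe (length M) (\<lambda>i. snd (M ! i)) g2' m r (snd D\<^sub>2) - tangle_writhe (length M) (\<lambda>i. fst (M ! i)) g1' m r (snd D\<^sub>1))"
proof -
  define k where "k = length M"
  define I where "I = strand_set k m r"
  note R' = R[unfolded reid_at_def, folded k_def]
  have ch: "square_chart S \<phi>" and r: "\<And>i. i < k \<Longrightarrow> r i \<noteq> 0"
    and inj: "inj_on (\<lambda>(i, u). frac (m i + r i * u)) ({..<k} \<times> {-1..1})"
    and c1: "\<And>i u. i < k \<Longrightarrow> u \<in> {-1..1} \<Longrightarrow> fst D\<^sub>1 (m i + r i * u) = \<phi> (fst (M ! i) u)"
    and c2: "\<And>i u. i < k \<Longrightarrow> u \<in> {-1..1} \<Longrightarrow> fst D\<^sub>2 (m i + r i * u) = \<phi> (snd (M ! i) u)"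
    using conjunct1[OF R'] conjunct2[OF R', THEN conjunct1] conjunct2[OF R', THEN conjunct2, THEN conjunct1]
      conjunct2[OF R', THEN conjunct2, THEN conjunct2, THEN conjunct1] by blast+
  have out: "fst D\<^sub>1 t = fst D\<^sub>2 t \<and> fst D\<^sub>1 t \<notin> \<phi> ` square \<and> (t \<in> snd D\<^sub>1 \<longleftrightarrow> t \<in> snd D\<^sub>2)" if "t \<notin> I" for t
    using conjunct2[OF R', THEN conjunct2, THEN conjunct2, THEN conjunct2, THEN conjunct1, rule_format, of t]
      that[unfolded I_def strand_set_def mem_Collect_eq] .
  have out2: "fst D\<^sub>2 t \<notin> \<phi> ` square" if "t \<notin> I" for t using out[OF that] by metis
  have out1: "fst D\<^sub>1 t \<notin> \<phi> ` square" if "t \<notin> I" for t using out[OF that] by metis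
  have ins: "fst D\<^sub>1 t \<in> \<phi> ` square" if "t \<in> I" for t
  proof -
    obtain i u where iu: "i < k" "u \<in> {-1..1}" "t - (m i + r i * u) \<in> \<int>"
      using \<open>t \<in> I\<close> by (auto simp: I_def strand_set_def)
    have "fst D\<^sub>1 t = fst D\<^sub>1 (m i + r i * u)"
      using D1 by (intro periodic_int[OF _ iu(3)] closed_immersionD(2)) (auto intro: is_diagramD(1)[of _ "fst D\<^sub>1" "snd D\<^sub>1"])
    then show ?thesis using c1[OF iu(1,2)] gsq iu k_def by auto
  qed
  have out_eq: "over_params D\<^sub>1 - I = over_params D\<^sub>2 - I"
    "(\<Sum>s\<in>over_params D\<^sub>1 - I. crossing_sign \<omega> (fst D\<^sub>1) s) = (\<Sum>s\<in>over_params D\<^sub>2 - I. crossing_sign \<omega> (fst D\<^sub>2) s)"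
    using outside_crossings[of D\<^sub>1 D\<^sub>2 I "\<phi> ` square", OF D1 D2 out ins] closed_strand_set I_def by blast+
  have D1': "is_diagram S (fst D\<^sub>1, snd D\<^sub>1)" and D2': "is_diagram S (fst D\<^sub>2, snd D\<^sub>2)" using D1 D2 by simp_all
  have gs1: "\<And>i u. i < k \<Longrightarrow> u \<in> {-1..1} \<Longrightarrow> fst (M ! i) u \<in> square"
    and gs2: "\<And>i u. i < k \<Longrightarrow> u \<in> {-1..1} \<Longrightarrow> snd (M ! i) u \<in> square" using gsq k_def by auto
  note L1 = local_crossings[where k = k and g = "\<lambda>i. fst (M ! i)" and g' = g1' and m = m and r = r and Ov = "snd D\<^sub>1"
      and c = "fst D\<^sub>1" and \<phi> = \<phi>, folded tangle_doubles_def I_def, OF D1' ch r inj c1 gs1 gd1[folded k_def] out1, unfolded prod.collapse]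
  have L1': "card (over_params D\<^sub>1 \<inter> I) = card (tangle_doubles k (\<lambda>i. fst (M ! i)) m r (snd D\<^sub>1))"
    by (rule bij_betw_same_card[OF L1(1), symmetric]) (assumption | erule i1[folded k_def])+
  have L1'': "(\<Sum>s\<in>over_params D\<^sub>1 \<inter> I. crossing_sign \<omega> (fst D\<^sub>1) s) =
      (\<Sum>((i, u), (j, v))\<in>tangle_doubles k (\<lambda>i. fst (M ! i)) m r (snd D\<^sub>1). sgn (r i) * sgn (r j) * chart_sign \<omega> \<phi> *
        sgn (Im (cnj (g1' i u) * g1' j v)))"
    by (rule L1(2)) (assumption | erule i1[folded k_def])+
  note L2 = local_crossings[where k = k and g = "\<lambda>i. snd (M ! i)" and g' = g2' and m = m and r = r and Ov = "snd D\<^sub>2"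
      and c = "fst D\<^sub>2" and \<phi> = \<phi>, folded tangle_doubles_def I_def, OF D2' ch r inj c2 gs2 gd2[folded k_def] out2, unfolded prod.collapse]
  have L2': "card (over_params D\<^sub>2 \<inter> I) = card (tangle_doubles k (\<lambda>i. snd (M ! i)) m r (snd D\<^sub>2))"
    by (rule bij_betw_same_card[OF L2(1), symmetric]) (assumption | erule i2[folded k_def])+
  have L2'': "(\<Sum>s\<in>over_params D\<^sub>2 \<inter> I. crossing_sign \<omega> (fst D\<^sub>2) s) =
      (\<Sum>((i, u), (j, v))\<in>tangle_doubles k (\<lambda>i. snd (M ! i)) m r (snd D\<^sub>2). sgn (r i) * sgn (r j) * chart_sign \<omega> \<phi> *
        sgn (Im (cnj (g2' i u) * g2' j v)))"
    by (rule L2(2)) (assumption | erule i2[folded k_def])+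
  have fin: "finite (over_params D\<^sub>1)" "finite (over_params D\<^sub>2)" using finite_over_params D1 D2 by blast+
  have C: "crossing_number D = card (over_params D - I) + card (over_params D \<inter> I)" if "finite (over_params D)" for D :: "'a diagram"
    using sum.Int_Diff[OF that, of "\<lambda>_. 1::nat" I] by (simp add: crossing_number_def)
  have W: "writhe \<omega> D = (\<Sum>s\<in>over_params D - I. crossing_sign \<omega> (fst D) s) + (\<Sum>s\<in>over_params D \<inter> I. crossing_sign \<omega> (fst D) s)"
    if "finite (over_params D)" for D :: "'a diagram"
    unfolding writhe_def using sum.Int_Diff[OF that, of _ I] by (simp add: add.commute)
  show "crossing_number D\<^sub>2 + card (tangle_doubles (length M) (\<lambda>i. fst (M ! i)) m r (snd D\<^sub>1)) =
      crossing_number D\<^sub>1 + card (tangle_doubles (length M) (\<lambda>i. snd (M ! i)) m r (snd D\<^sub>2))"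
    using C[OF fin(1)] C[OF fin(2)] out_eq(1) L1' L2' by (simp add: k_def)
  have s: "(\<Sum>((i, u), (j, v))\<in>X. sgn (r i) * sgn (r j) * chart_sign \<omega> \<phi> * sgn (Im (cnj (g' i u) * g' j v))) =
     chart_sign \<omega> \<phi> * (\<Sum>((i, u), (j, v))\<in>X. sgn (r i) * sgn (r j) * sgn (Im (cnj (g' i u) * g' j v)))" for X g'
    unfolding sum_distrib_left by (rule sum.cong) (auto simp: ac_simps)
  have "(\<Sum>s\<in>over_params D\<^sub>1 \<inter> I. crossing_sign \<omega> (fst D\<^sub>1) s) = chart_sign \<omega> \<phi> * tangle_writhe k (\<lambda>i. fst (M ! i)) g1' m r (snd D\<^sub>1)"
    unfolding tangle_writhe_def s[symmetric] by (rule L1'')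
  moreover have "(\<Sum>s\<in>over_params D\<^sub>2 \<inter> I. crossing_sign \<omega> (fst D\<^sub>2) s) = chart_sign \<omega> \<phi> * tangle_writhe k (\<lambda>i. snd (M ! i)) g2' m r (snd D\<^sub>2)"
    unfolding tangle_writhe_def s[symmetric] by (rule L2'')
  ultimately show "writhe \<omega> D\<^sub>2 - writhe \<omega> D\<^sub>1 = chart_sign \<omega> \<phi> *
      (tangle_writhe (length M) (\<lambda>i. snd (M ! i)) g2' m r (snd D\<^sub>2) - tangle_writhe (length M) (\<lambda>i. fst (M ! i)) g1' m r (snd D\<^sub>1))"
    using W[OF fin(1)] W[OF fin(2)] out_eq(2) by (simp add: k_def right_diff_distrib)
qed

end

section \<open>Calculus of the model strands\<close>

lemma bump_bounds: fixes u :: real assumes "\<bar>u\<bar> \<le> 1"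
  shows "0 \<le> (1 - u\<^sup>2)\<^sup>2" "(1 - u\<^sup>2)\<^sup>2 \<le> 1"
proof -
  have "u\<^sup>2 \<le> 1" using assms by (simp add: abs_square_le_1)
  then show "(1 - u\<^sup>2)\<^sup>2 \<le> 1" by (intro power_le_one) auto
qed simp

lemma bump_eq_iff: fixes u v :: real assumes "\<bar>u\<bar> \<le> 1" "\<bar>v\<bar> \<le> 1"
  shows "(1 - u\<^sup>2)\<^sup>2 = (1 - v\<^sup>2)\<^sup>2 \<longleftrightarrow> u = v \<or> u = - v"
proof -
  have "u\<^sup>2 \<le> 1" "v\<^sup>2 \<le> 1" using assms by (simp_all add: abs_square_le_1)
  then show ?thesis by (simp add: power2_eq_iff_nonneg) (metis power2_eq_iff)
qed

text \<open>Keeps the kink inside the square. With \<open>v = u\<^sup>2\<close> the factorisation of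
  1 - 4 (1 - v)^2 into (2 v - 1) (3 - 2 v) suggests \<open>y = (1 - 2 * v)\<^sup>2\<close> as
  variable: the square of the abscissa becomes a quadratic in \<open>y\<close> that is at most 1 -
  (1 - y)^2.\<close>

lemma kink_abscissa_bound:
  fixes u :: real assumes "\<bar>u\<bar> \<le> 1" shows "\<bar>u - 4 * u * (1 - u\<^sup>2)\<^sup>2\<bar> \<le> 1"
proof -
  define v where "v = u\<^sup>2"
  define y where "y = (1 - 2 * v)\<^sup>2"
  have v: "0 \<le> v" "v \<le> 1" using assms by (simp_all add: v_def abs_square_le_1)
  have "(u - 4 * u * (1 - u\<^sup>2)\<^sup>2)\<^sup>2 = v * (1 - 4 * (1 - v)\<^sup>2)\<^sup>2" by (simp add: v_def power2_eq_square algebra_simps)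
  also have "\<dots> = 2 * y - (2 - v) * y\<^sup>2" unfolding y_def by (simp add: power2_eq_square algebra_simps)
  also have "\<dots> \<le> 2 * y - 1 * y\<^sup>2" using mult_right_mono[of 1 "2 - v" "y\<^sup>2"] v by simp
  also have "\<dots> = 1 - (1 - y)\<^sup>2" by (simp add: power2_eq_square algebra_simps)
  also have "\<dots> \<le> 1" by simp
  finally show ?thesis by (simp add: abs_square_le_1)
qed

text \<open>Equal heights force \<open>v = - u\<close>, and the abscissa is odd, so it must vanish
  at \<open>u\<close>. The factor \<open>s\<close> scales the kink; the move itself has
  \<open>s = 1\<close>, and other values occur while a kink grows.\<close>

lemma R1_double_points:
  fixes u v :: real
  assumes "\<bar>u\<bar> \<le> 1" "\<bar>v\<bar> \<le> 1" "u \<noteq> v" "s \<noteq> 0"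
    "u - 4 * s * u * (1 - u\<^sup>2)\<^sup>2 = v - 4 * s * v * (1 - v\<^sup>2)\<^sup>2" "s * (1 - u\<^sup>2)\<^sup>2 = s * (1 - v\<^sup>2)\<^sup>2"
  shows "v = - u \<and> 4 * s * (1 - u\<^sup>2)\<^sup>2 = 1"
proof -
  have "(1 - u\<^sup>2)\<^sup>2 = (1 - v\<^sup>2)\<^sup>2" using assms by simp
  then have v: "v = - u" using bump_eq_iff[OF assms(1,2)] assms(3) by auto
  then have "2 * u * (1 - 4 * s * (1 - u\<^sup>2)\<^sup>2) = 0" using assms(5) by (simp add: algebra_simps)
  then show ?thesis using v assms(3) by auto
qed

lemma has_vector_derivative_ComplexI:
  assumes "(f has_real_derivative f') (at x)" "(g has_real_derivative g') (at x)"
  shows "((\<lambda>u. Complex (f u) (g u)) has_vector_derivative Complex f' g') (at x)"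
  using assms by (simp add: has_vector_derivative_complex_iff)

lemma bump_derivative: "((\<lambda>u. (1 - u\<^sup>2)\<^sup>2) has_real_derivative - 4 * u * (1 - u\<^sup>2)) (at u)"
  by (auto intro!: derivative_eq_intros simp: algebra_simps power2_eq_square)

text \<open>\<open>a\<close> and \<open>- a\<close> are the abscissae where the bent strand of the
  third model meets the two straight ones; \<open>a\<close> is unique because the bump decreases on
  \<open>[0,1]\<close>.\<close>

lemma R3_height:
  obtains a :: real where "0 < a" "a < 1" "(1 - a\<^sup>2)\<^sup>2 = a"
    "\<And>u. u \<in> {-1..1} \<Longrightarrow> (1 - u\<^sup>2)\<^sup>2 = u \<longleftrightarrow> u = a" "\<And>u. u \<in> {-1..1} \<Longrightarrow> (1 - u\<^sup>2)\<^sup>2 = - u \<longleftrightarrow> u = - a"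
proof -
  have "\<exists>a::real. 0 \<le> a \<and> a \<le> 1 \<and> (\<lambda>a. a - (1 - a\<^sup>2)\<^sup>2) a = 0"
    by (rule IVT') (auto intro!: continuous_intros)
  then obtain a :: real where a: "0 \<le> a" "a \<le> 1" "(1 - a\<^sup>2)\<^sup>2 = a" by auto
  have a01: "0 < a" "a < 1" using a by (auto simp: le_less)
  have uniq: "u = a" if u: "u \<in> {-1..1}" "(1 - u\<^sup>2)\<^sup>2 = u" for u
  proof -
    have u0: "0 \<le> u" using u(2) by (metis zero_le_power2)
    have mono: "(1 - y\<^sup>2)\<^sup>2 \<le> (1 - x\<^sup>2)\<^sup>2" if "0 \<le> x" "x \<le> y" "y \<le> 1" for x y :: real
    proof -
      have "x\<^sup>2 \<le> y\<^sup>2" "y\<^sup>2 \<le> 1" using that by (auto intro: power_mono power_le_one)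
      then show ?thesis by (intro power_mono) auto
    qed
    show ?thesis using mono[of u a] mono[of a u] u u0 a by (cases "u \<le> a") auto
  qed
  have 1: "(1 - u\<^sup>2)\<^sup>2 = u \<longleftrightarrow> u = a" if "u \<in> {-1..1}" for u using uniq[OF that] a(3) by blast
  have 2: "(1 - u\<^sup>2)\<^sup>2 = - u \<longleftrightarrow> u = - a" if "u \<in> {-1..1}" for u
    using 1[of "-u"] that by auto
  show ?thesis using that[OF a01 a(3) 1 2] .
qed

section \<open>The three types of moves\<close>

context oriented_surface
begin

lemma reid_at_height:
  assumes "reid_at M S D\<^sub>1 D\<^sub>2 \<phi> m r ht" "D \<in> {D\<^sub>1, D\<^sub>2}" "i < length M" "j < length M" "i \<noteq> j" "u \<in> {-1..1}"
    "(if D = D\<^sub>1 then fst (M ! i) u else snd (M ! i) u) = (if D = D\<^sub>1 then fst (M ! j) u else snd (M ! j) u)"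
  shows "m i + r i * u \<in> snd D \<longleftrightarrow> ht j < ht i"
proof -
  note R = assms(1)[unfolded reid_at_def, THEN conjunct2, THEN conjunct2, THEN conjunct2]
  note V = R[THEN conjunct1, rule_format]
  have "fst D (m i + r i * u) = fst D (m j + r j * u)"
    using V[OF assms(3,6)] V[OF assms(4,6)] assms(2,7) by (auto split: if_splits)
  then show ?thesis
    using R[THEN conjunct2, THEN conjunct2, THEN conjunct2, rule_format, OF assms(2,3,4,6,6)] assms(5) by blast
qed

text \<open>The loop crosses itself once. Both passages belong to one strand, so its direction
  cancels, and the sign is decided by the orientation of the chart and by which passage is
  over.\<close>

lemma R1_invariants:
  assumes D1: "is_diagram S D\<^sub>1" and D2: "is_diagram S D\<^sub>2" and R: "reid_at R1_model S D\<^sub>1 D\<^sub>2 \<phi> m r ht"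
  shows "crossing_number D\<^sub>2 = crossing_number D\<^sub>1 + 1"
    and "writhe \<omega> D\<^sub>2 - writhe \<omega> D\<^sub>1 = chart_sign \<omega> \<phi> * (if m 0 + r 0 * sqrt (1/2) \<in> snd D\<^sub>2 then 1 else -1)"
proof -
  let ?g1 = "\<lambda>i. fst (R1_model ! i)" and ?g2 = "\<lambda>i. snd (R1_model ! i)"
  \<comment> \<open>Solves \<open>4 * (1 - u\<^sup>2)\<^sup>2 = 1\<close> in \<open>[-1,1]\<close>,
    the condition for the abscissa of the kink to vanish off the centre.\<close>
  define a :: real where "a = sqrt (1/2)"
  have a: "0 < a" "a < 1" "a\<^sup>2 = 1/2" by (auto simp: a_def intro!: real_less_lsqrt)
  define g1' where "g1' = (\<lambda>(i::nat) (u::real). Complex 1 0)"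
  define g2' where "g2' = (\<lambda>(i::nat) u. Complex (1 - (4 * (1 - u\<^sup>2)\<^sup>2 + 4 * u * (- 4 * u * (1 - u\<^sup>2)))) (- 4 * u * (1 - u\<^sup>2) / 2))"
  have len: "length R1_model = 1" by (simp add: R1_model_def)
  have sq: "fst (R1_model ! i) u \<in> square \<and> snd (R1_model ! i) u \<in> square" if "i < length R1_model" "u \<in> {-1..1}" for i u
    using that kink_abscissa_bound[of u] bump_bounds[of u] by (auto simp: R1_model_def square_def abs_le_iff intro: order_trans[OF _ zero_le_power2])
  have d1: "(?g1 i has_vector_derivative g1' i u) (at u)" if "i < length R1_model" for i u
    using that by (auto simp: R1_model_def g1'_def intro!: has_vector_derivative_ComplexI derivative_eq_intros)
  have d2: "(?g2 i has_vector_derivative g2' i u) (at u)" if "i < length R1_model" for i u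
  proof -
    have "((\<lambda>u. u - 4 * u * (1 - u\<^sup>2)\<^sup>2) has_real_derivative
        1 - (4 * (1 - u\<^sup>2)\<^sup>2 + 4 * u * (- 4 * u * (1 - u\<^sup>2)))) (at u)"
      using DERIV_diff[OF DERIV_ident DERIV_mult[OF DERIV_cmult[OF DERIV_ident, of 4] bump_derivative], of u]
      by (simp add: add.commute mult.commute)
    moreover have "((\<lambda>u. (1 - u\<^sup>2)\<^sup>2 / 2) has_real_derivative - 4 * u * (1 - u\<^sup>2) / 2) (at u)"
      by (rule DERIV_cdivide[OF bump_derivative])
    ultimately show ?thesis using that
      by (auto simp: R1_model_def g2'_def intro!: has_vector_derivative_ComplexI)
  qed
  have X1: "tangle_doubles 1 ?g1 m r (snd D\<^sub>1) = {}" by (auto simp: tangle_doubles_def R1_model_def)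
  have w: "(1 - a\<^sup>2)\<^sup>2 = 1/4" unfolding a(3) by (simp add: power2_eq_square)
  have g2a: "snd (R1_model ! 0) a = snd (R1_model ! 0) (- a)" by (simp add: R1_model_def w)
  obtain c Ov where c: "D\<^sub>2 = (c, Ov)" by fastforce
  have X2: "tangle_doubles 1 ?g2 m r Ov = {((0, u), (0, - u)) | u. u \<in> {a, - a} \<and> m 0 + r 0 * u \<in> Ov}"
  proof (intro set_eqI iffI)
    fix x assume "x \<in> tangle_doubles 1 ?g2 m r Ov"
    then obtain u v where x: "x = ((0, u), (0, v))" "u \<in> {-1..1}" "v \<in> {-1..1}" "u \<noteq> v"
      "snd (R1_model ! 0) u = snd (R1_model ! 0) v" "m 0 + r 0 * u \<in> Ov" by (auto simp: tangle_doubles_def)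
    then have h: "v = - u \<and> 4 * 1 * (1 - u\<^sup>2)\<^sup>2 = 1"
      by (intro R1_double_points) (auto simp: R1_model_def)
    have "((2 * (1 - u\<^sup>2)) :: real)\<^sup>2 = 2\<^sup>2 * (1 - u\<^sup>2)\<^sup>2" by (rule power_mult_distrib)
    then have "((2 * (1 - u\<^sup>2)) :: real)\<^sup>2 = 1\<^sup>2" using h by (simp only:) simp
    moreover have "u\<^sup>2 \<le> 1" using x by (auto simp: abs_square_le_1)
    ultimately have "2 * (1 - u\<^sup>2) = 1" by (intro power2_eq_imp_eq[of "2 * (1 - u\<^sup>2)" 1]) auto
    then have "u\<^sup>2 = a\<^sup>2" using a by simp
    then have "u = a \<or> u = - a" by (simp add: power2_eq_iff)
    then show "x \<in> {((0, u), (0, - u)) | u. u \<in> {a, - a} \<and> m 0 + r 0 * u \<in> Ov}" using x h by auto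
  next
    fix x assume "x \<in> {((0::nat, u), (0::nat, - u)) | u. u \<in> {a, - a} \<and> m 0 + r 0 * u \<in> Ov}"
    then show "x \<in> tangle_doubles 1 ?g2 m r Ov" using g2a a by (auto simp: tangle_doubles_def)
  qed
  note R' = R[unfolded reid_at_def]
  have inj: "inj_on (\<lambda>(i, u). frac (m i + r i * u)) ({..<1} \<times> {-1..1})" and "r 0 \<noteq> 0"
    using R'[THEN conjunct2, THEN conjunct1] R'[THEN conjunct2, THEN conjunct2, THEN conjunct1] len by auto
  have r2: "sgn (r 0) * sgn (r 0) = 1" using \<open>r 0 \<noteq> 0\<close> by (simp add: sgn_if)
  have "double_pair c (m 0 + r 0 * a) (m 0 + r 0 * (- a))"
    unfolding double_pair_def
  proof
    show "c (m 0 + r 0 * a) = c (m 0 + r 0 * - a)"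
      using R'[THEN conjunct2, THEN conjunct2, THEN conjunct2, THEN conjunct1, rule_format, of 0 a]
        R'[THEN conjunct2, THEN conjunct2, THEN conjunct2, THEN conjunct1, rule_format, of 0 "-a"] g2a a c len by auto
    show "m 0 + r 0 * a - (m 0 + r 0 * - a) \<notin> \<int>"
      using inj_onD[OF inj, of "(0, a)" "(0, -a)"] a frac_eq_iff_Ints[of "m 0 + r 0 * a" "m 0 + r 0 * - a"] by auto
  qed
  then have one: "m 0 + r 0 * a \<in> Ov \<longleftrightarrow> m 0 + r 0 * (- a) \<notin> Ov" using is_diagramD(8)[OF D2[unfolded c]] by blast
  have X2': "tangle_doubles 1 ?g2 m r Ov = (if m 0 + r 0 * a \<in> Ov then {((0, a), (0, - a))} else {((0, - a), (0, a))})"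
    unfolding X2 using one by (auto simp: minus_equation_iff)
  have i2: "u \<in> {-1<..<1} \<and> v \<in> {-1<..<1}" if "((i, u), (j, v)) \<in> tangle_doubles 1 ?g2 m r (snd D\<^sub>2)" for i u j v
    using that a unfolding c snd_conv X2' by (auto split: if_splits)
  have g2': "g2' 0 u = Complex (1 - (4 * (1 - u\<^sup>2)\<^sup>2 - 16 * u\<^sup>2 * (1 - u\<^sup>2))) (- 2 * u * (1 - u\<^sup>2))" for u
    by (simp add: g2'_def power2_eq_square)
  \<comment> \<open>The tangents at \<open>a\<close> and \<open>- a\<close>, in this order, have
    determinant \<open>8 * a > 0\<close>, so the crossing is positive in the model when the passage
    at \<open>a\<close> is over.\<close>
  have im: "g2' 0 a = Complex 4 (- a)" "g2' 0 (- a) = Complex 4 a"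
    unfolding g2' power2_minus a(3) by (simp_all add: power2_eq_square)
  have w2: "tangle_writhe 1 ?g2 g2' m r (snd D\<^sub>2) = (if m 0 + r 0 * a \<in> Ov then 1 else -1)"
    unfolding tangle_writhe_def c snd_conv X2' using a(1) r2 im by (simp add: sgn_if)
  have w1: "tangle_writhe 1 ?g1 g1' m r (snd D\<^sub>1) = 0" unfolding tangle_writhe_def X1 by simp
  have "card (tangle_doubles 1 ?g2 m r (snd D\<^sub>2)) = 1" unfolding c snd_conv X2' by simp
  moreover have "crossing_number D\<^sub>2 + card ({} :: ((nat \<times> real) \<times> (nat \<times> real)) set) =
      crossing_number D\<^sub>1 + card (tangle_doubles 1 ?g2 m r (snd D\<^sub>2))"
    by (rule reid_at_change(1)[OF D1 D2 R sq d1 d2, unfolded len X1]; (assumption | erule i2 | simp))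
  ultimately show "crossing_number D\<^sub>2 = crossing_number D\<^sub>1 + 1" by simp
  have "writhe \<omega> D\<^sub>2 - writhe \<omega> D\<^sub>1 = chart_sign \<omega> \<phi> *
      (tangle_writhe 1 ?g2 g2' m r (snd D\<^sub>2) - tangle_writhe 1 ?g1 g1' m r (snd D\<^sub>1))"
    by (rule reid_at_change(2)[OF D1 D2 R sq d1 d2, unfolded len X1]; (assumption | erule i2 | simp))
  then show "writhe \<omega> D\<^sub>2 - writhe \<omega> D\<^sub>1 = chart_sign \<omega> \<phi> * (if m 0 + r 0 * sqrt (1/2) \<in> snd D\<^sub>2 then 1 else -1)"
    using w1 w2 by (simp add: a_def c)
qed

text \<open>The same two strands cross twice, at \<open>b\<close> and \<open>- b\<close>, with
  opposite slopes of the pushed strand; the over-strand is the same both times, so the signs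
  cancel.\<close>

lemma R2_invariants:
  assumes D1: "is_diagram S D\<^sub>1" and D2: "is_diagram S D\<^sub>2" and R: "reid_at R2_model S D\<^sub>1 D\<^sub>2 \<phi> m r ht"
  shows "crossing_number D\<^sub>2 = crossing_number D\<^sub>1 + 2" and "writhe \<omega> D\<^sub>2 = writhe \<omega> D\<^sub>1"
proof -
  let ?g1 = "\<lambda>i. fst (R2_model ! i)" and ?g2 = "\<lambda>i. snd (R2_model ! i)"
  \<comment> \<open>Root of \<open>5/4 * (1 - u\<^sup>2)\<^sup>2 = 1\<close>: there the pushed
    strand has come down from height 1/2 to the height -1/2 of the other one.\<close>
  define b :: real where "b = sqrt (1 - sqrt (4/5))"
  have "sqrt (4/5) < sqrt 1" by (rule real_sqrt_less_mono) simp
  then have b: "0 < b" "b < 1" "1 - b\<^sup>2 = sqrt (4/5)" by (auto simp: b_def intro!: real_less_lsqrt)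
  define g1' where "g1' = (\<lambda>(i::nat) (u::real). Complex 1 0)"
  define g2' where "g2' = (\<lambda>(i::nat) u. Complex 1 (if i = 0 then 0 else - (5/4 * (- 4 * u * (1 - u\<^sup>2)))))"
  have len: "length R2_model = 2" by (simp add: R2_model_def)
  have i2: "i = 0 \<or> i = 1" if "i < 2" for i :: nat using that by auto
  have sq: "fst (R2_model ! i) u \<in> square \<and> snd (R2_model ! i) u \<in> square" if "i < length R2_model" "u \<in> {-1..1}" for i u
  proof -
    have "(1 - u\<^sup>2)\<^sup>2 \<le> 1" using that by (intro bump_bounds(2)) auto
    then have "1/2 - 5 * (1 - u\<^sup>2)\<^sup>2 / 4 \<le> 1" "- 1 \<le> 1/2 - 5 * (1 - u\<^sup>2)\<^sup>2 / 4"
      using zero_le_power2[of "1 - u\<^sup>2"] by linarith+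
    then show ?thesis using that i2[of i] by (auto simp: R2_model_def square_def abs_le_iff)
  qed
  have d1: "(?g1 i has_vector_derivative g1' i u) (at u)" if "i < length R2_model" for i u
    using that i2[of i] by (auto simp: R2_model_def g1'_def intro!: has_vector_derivative_ComplexI derivative_eq_intros)
  have d2: "(?g2 i has_vector_derivative g2' i u) (at u)" if "i < length R2_model" for i u
  proof -
    have "((\<lambda>u. 1/2 - 5/4 * (1 - u\<^sup>2)\<^sup>2) has_real_derivative - (5/4 * (- 4 * u * (1 - u\<^sup>2)))) (at u)"
      using DERIV_diff[OF DERIV_const DERIV_cmult[OF bump_derivative], of "1/2" "5/4" u] by simp
    then show ?thesis using that i2[of i]
      by (auto simp: R2_model_def g2'_def intro!: has_vector_derivative_ComplexI)
  qed
  have ht: "inj_on ht {..<2}"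
    using R[unfolded reid_at_def, THEN conjunct2, THEN conjunct2, THEN conjunct2, THEN conjunct2, THEN conjunct2, THEN conjunct1]
    by (simp add: len)
  have ij: "i < j \<and> j < 2 \<and> P \<longleftrightarrow> i = 0 \<and> j = 1 \<and> P" for i j :: nat and P by auto
  have Y1: "{(i, j, u). i < j \<and> j < 2 \<and> u \<in> {-1..1} \<and> ?g1 i u = ?g1 j u} = {}"
    unfolding ij by (auto simp: R2_model_def)
  have eq: "5/4 * (1 - u\<^sup>2)\<^sup>2 = 1 \<longleftrightarrow> u = b \<or> u = - b" if "u \<in> {-1..1}" for u
  proof -
    have "5/4 * (1 - u\<^sup>2)\<^sup>2 = 1 \<longleftrightarrow> (1 - u\<^sup>2)\<^sup>2 = (1 - b\<^sup>2)\<^sup>2" unfolding b(3) by auto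
    then show ?thesis using bump_eq_iff[of u b] that b by auto
  qed
  have Y2: "{(i, j, u). i < j \<and> j < 2 \<and> u \<in> {-1..1} \<and> ?g2 i u = ?g2 j u} = {(0, 1, b), (0, 1, - b)}"
  proof -
    have "?g2 0 u = ?g2 1 u \<longleftrightarrow> 5/4 * (1 - u\<^sup>2)\<^sup>2 = 1" for u by (auto simp: R2_model_def)
    then show ?thesis unfolding ij using eq b by auto
  qed
  have re: "Re (?g1 i u) = u" "Re (?g2 i u) = u" if "i < 2" for i u
    using i2[OF that] by (auto simp: R2_model_def)
  have ov1: "m i + r i * u \<in> snd D\<^sub>1 \<longleftrightarrow> ht j < ht i" if "i < 2" "j < 2" "i \<noteq> j" "u \<in> {-1..1}" "?g1 i u = ?g1 j u" for i j u
    using reid_at_height[OF R, of D\<^sub>1 i j u] that len by simp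
  have ov2: "m i + r i * u \<in> snd D\<^sub>2 \<longleftrightarrow> ht j < ht i" if "i < 2" "j < 2" "i \<noteq> j" "u \<in> {-1..1}" "?g2 i u = ?g2 j u" for i j u
  \<comment> \<open>\<open>reid_at_height\<close> reads the course before the move whenever
    \<open>D = D\<^sub>1\<close>, so coinciding diagrams are treated apart.\<close>
  proof (cases "D\<^sub>2 = D\<^sub>1")
    case False
    then show ?thesis using reid_at_height[OF R, of D\<^sub>2 i j u] that len by simp
  next
    case True
    note V = R[unfolded reid_at_def, THEN conjunct2, THEN conjunct2, THEN conjunct2]
    have "fst D\<^sub>2 (m i + r i * u) = fst D\<^sub>2 (m j + r j * u)"
      using V[THEN conjunct1, rule_format, of i u] V[THEN conjunct1, rule_format, of j u] that len by simp
    then show ?thesis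
      using V[THEN conjunct2, THEN conjunct2, THEN conjunct2, rule_format, of D\<^sub>2 i j u u] that len by simp
  qed
  have G2: "card (tangle_doubles 2 ?g2 m r (snd D\<^sub>2)) = card ({(0, 1, b), (0, 1, - b)} :: (nat \<times> nat \<times> real) set)"
    "tangle_writhe 2 ?g2 g2' m r (snd D\<^sub>2) = (\<Sum>(i, j, u)\<in>{(0, 1, b), (0, 1, - b)}. (if ht j < ht i then 1 else -1) * sgn (r i) * sgn (r j) *
      sgn (Im (cnj (g2' i u) * g2' j u)))"
    by (rule graph_tangle(1)[where g = ?g2 and m = m and r = r and Ov = "snd D\<^sub>2", OF re(2) ht ov2 refl, unfolded Y2]
        graph_tangle(2)[where g = ?g2 and g' = g2' and m = m and r = r and Ov = "snd D\<^sub>2", OF re(2) ht ov2 refl, unfolded Y2];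
        assumption)+
  have c1: "tangle_doubles 2 ?g1 m r (snd D\<^sub>1) = {}"
    by (auto simp: tangle_doubles_def R2_model_def dest!: i2)
  have bnd: "u \<in> {-1<..<1} \<and> v \<in> {-1<..<1}" if x: "((i, u), (j, v)) \<in> tangle_doubles 2 ?g2 m r (snd D\<^sub>2)" for i u j v
  proof -
    have h: "i < 2" "j < 2" "u \<in> {-1..1}" "(i, u) \<noteq> (j, v)" "?g2 i u = ?g2 j v" using x by (auto simp: tangle_doubles_def)
    have "u = v" using re(2)[of i u] re(2)[of j v] h by simp
    then have "5/4 * (1 - u\<^sup>2)\<^sup>2 = 1" using h i2[of i] i2[of j] by (auto simp: R2_model_def)
    then show ?thesis using eq[OF h(3)] b \<open>u = v\<close> by auto
  qed
  have ch1: "crossing_number D\<^sub>2 + card ({} :: ((nat \<times> real) \<times> (nat \<times> real)) set) =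
      crossing_number D\<^sub>1 + card (tangle_doubles 2 ?g2 m r (snd D\<^sub>2))"
    by (rule reid_at_change(1)[OF D1 D2 R sq d1 d2, unfolded len c1]; (assumption | erule bnd | simp))
  have ch2: "writhe \<omega> D\<^sub>2 - writhe \<omega> D\<^sub>1 = chart_sign \<omega> \<phi> *
      (tangle_writhe 2 ?g2 g2' m r (snd D\<^sub>2) - tangle_writhe 2 ?g1 g1' m r (snd D\<^sub>1))"
    by (rule reid_at_change(2)[OF D1 D2 R sq d1 d2, unfolded len c1]; (assumption | erule bnd | simp))
  have "card (tangle_doubles 2 ?g2 m r (snd D\<^sub>2)) = 2" unfolding G2(1) using b(1) by simp
  then show "crossing_number D\<^sub>2 = crossing_number D\<^sub>1 + 2" using ch1 by simp
  have "b\<^sup>2 < 1" using b(1,2) by (simp add: abs_square_less_1)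
  then have "0 < b * (1 - b\<^sup>2)" using b(1) by simp
  moreover have "Im (cnj (g2' 0 u) * g2' 1 u) = 5 * (u * (1 - u\<^sup>2))" for u by (simp add: g2'_def)
  ultimately have "sgn (Im (cnj (g2' 0 b) * g2' 1 b)) = 1" "sgn (Im (cnj (g2' 0 (- b)) * g2' 1 (- b))) = -1"
    by simp_all
  then have "tangle_writhe 2 ?g2 g2' m r (snd D\<^sub>2) = 0"
    unfolding G2(2) using b(1) by simp
  moreover have "tangle_writhe 2 ?g1 g1' m r (snd D\<^sub>1) = 0" unfolding tangle_writhe_def c1 by simp
  ultimately show "writhe \<omega> D\<^sub>2 = writhe \<omega> D\<^sub>1" using ch2 by simp
qed

text \<open>Each pair of strands crosses once before and once after, in the same order of height.
  The crossings with the bent strand move from \<open>a\<close> to \<open>- a\<close> or back while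
  the bend is turned over, so its slope at the crossing is unchanged.\<close>

lemma R3_invariants:
  assumes D1: "is_diagram S D\<^sub>1" and D2: "is_diagram S D\<^sub>2" and R: "reid_at R3_model S D\<^sub>1 D\<^sub>2 \<phi> m r ht"
  shows "crossing_number D\<^sub>2 = crossing_number D\<^sub>1" and "writhe \<omega> D\<^sub>2 = writhe \<omega> D\<^sub>1"
proof -
  let ?g1 = "\<lambda>i. fst (R3_model ! i)" and ?g2 = "\<lambda>i. snd (R3_model ! i)"
  obtain a :: real where a: "0 < a" "a < 1" "(1 - a\<^sup>2)\<^sup>2 = a"
    and a1: "\<And>u. u \<in> {-1..1} \<Longrightarrow> (1 - u\<^sup>2)\<^sup>2 = u \<longleftrightarrow> u = a"
    and a2: "\<And>u. u \<in> {-1..1} \<Longrightarrow> (1 - u\<^sup>2)\<^sup>2 = - u \<longleftrightarrow> u = - a"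
    using R3_height by blast
  define g1' where "g1' = (\<lambda>(i::nat) u. Complex 1 (if i = 0 then 1/2 else if i = 1 then -1/2 else - 4 * u * (1 - u\<^sup>2) / 2))"
  define g2' where "g2' = (\<lambda>(i::nat) u. Complex 1 (if i = 0 then 1/2 else if i = 1 then -1/2 else - (- 4 * u * (1 - u\<^sup>2)) / 2))"
  have len: "length R3_model = 3" by (simp add: R3_model_def)
  have i3: "i = 0 \<or> i = 1 \<or> i = 2" if "i < 3" for i :: nat using that by auto
  have sq: "fst (R3_model ! i) u \<in> square \<and> snd (R3_model ! i) u \<in> square" if "i < length R3_model" "u \<in> {-1..1}" for i u
  proof -
    have "(1 - u\<^sup>2)\<^sup>2 \<le> 1" using that by (intro bump_bounds(2)) auto
    then have "(1 - u\<^sup>2)\<^sup>2 / 2 \<le> 1" "- 1 \<le> (1 - u\<^sup>2)\<^sup>2 / 2" "- 2 \<le> (1 - u\<^sup>2)\<^sup>2"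
      using zero_le_power2[of "1 - u\<^sup>2"] by linarith+
    then show ?thesis using that i3[of i] by (auto simp: R3_model_def square_def abs_le_iff)
  qed
  have hd: "((\<lambda>u. (1 - u\<^sup>2)\<^sup>2 / 2) has_real_derivative - 4 * u * (1 - u\<^sup>2) / 2) (at u)"
     "((\<lambda>u. - ((1 - u\<^sup>2)\<^sup>2) / 2) has_real_derivative - (- 4 * u * (1 - u\<^sup>2)) / 2) (at u)" for u
    by (rule DERIV_cdivide[OF bump_derivative], rule DERIV_cdivide[OF DERIV_minus[OF bump_derivative]])
  have hl: "((\<lambda>u. u / 2) has_real_derivative 1/2) (at u)" "((\<lambda>u. - u / 2) has_real_derivative -1/2) (at u)" for u :: real
    by (auto intro!: derivative_eq_intros)
  have d1: "(?g1 i has_vector_derivative g1' i u) (at u)" if "i < length R3_model" for i u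
    using that i3[of i] has_vector_derivative_ComplexI[OF DERIV_ident hd(1)] has_vector_derivative_ComplexI[OF DERIV_ident hl(1)]
      has_vector_derivative_ComplexI[OF DERIV_ident hl(2)]
    by (auto simp: R3_model_def g1'_def)
  have d2: "(?g2 i has_vector_derivative g2' i u) (at u)" if "i < length R3_model" for i u
    using that i3[of i] has_vector_derivative_ComplexI[OF DERIV_ident hd(2)] has_vector_derivative_ComplexI[OF DERIV_ident hl(1)]
      has_vector_derivative_ComplexI[OF DERIV_ident hl(2)]
    by (auto simp: R3_model_def g2'_def)
  have ht: "inj_on ht {..<3}"
    using R[unfolded reid_at_def, THEN conjunct2, THEN conjunct2, THEN conjunct2, THEN conjunct2, THEN conjunct2, THEN conjunct1]
    by (simp add: len)
  have ij: "i < j \<and> j < 3 \<and> P \<longleftrightarrow> (i = 0 \<and> j = 1 \<or> i = 0 \<and> j = 2 \<or> i = 1 \<and> j = 2) \<and> P" for i j :: nat and P by auto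
  have e1: "?g1 0 u = ?g1 1 u \<longleftrightarrow> u = 0" "?g1 0 u = ?g1 2 u \<longleftrightarrow> (1 - u\<^sup>2)\<^sup>2 = u" "?g1 1 u = ?g1 2 u \<longleftrightarrow> (1 - u\<^sup>2)\<^sup>2 = - u" for u
    by (auto simp: R3_model_def)
  have e2: "?g2 0 u = ?g2 1 u \<longleftrightarrow> u = 0" "?g2 0 u = ?g2 2 u \<longleftrightarrow> (1 - u\<^sup>2)\<^sup>2 = - u" "?g2 1 u = ?g2 2 u \<longleftrightarrow> (1 - u\<^sup>2)\<^sup>2 = u" for u
    by (auto simp: R3_model_def)
  have Y1: "{(i, j, u). i < j \<and> j < 3 \<and> u \<in> {-1..1} \<and> ?g1 i u = ?g1 j u} = {(0, 1, 0), (0, 2, a), (1, 2, - a)}"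
    unfolding ij using e1 a1 a2 a(1,2) by auto
  have Y2: "{(i, j, u). i < j \<and> j < 3 \<and> u \<in> {-1..1} \<and> ?g2 i u = ?g2 j u} = {(0, 1, 0), (0, 2, - a), (1, 2, a)}"
    unfolding ij using e2 a1 a2 a(1,2) by auto
  have re: "Re (?g1 i u) = u" "Re (?g2 i u) = u" if "i < 3" for i u
    using i3[OF that] by (auto simp: R3_model_def)
  note V = R[unfolded reid_at_def, THEN conjunct2, THEN conjunct2, THEN conjunct2]
  have ov1: "m i + r i * u \<in> snd D\<^sub>1 \<longleftrightarrow> ht j < ht i" if "i < 3" "j < 3" "i \<noteq> j" "u \<in> {-1..1}" "?g1 i u = ?g1 j u" for i j u
  proof -
    have "fst D\<^sub>1 (m i + r i * u) = fst D\<^sub>1 (m j + r j * u)"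
      using V[THEN conjunct1, rule_format, of i u] V[THEN conjunct1, rule_format, of j u] that len by simp
    then show ?thesis
      using V[THEN conjunct2, THEN conjunct2, THEN conjunct2, rule_format, of D\<^sub>1 i j u u] that len by simp
  qed
  have ov2: "m i + r i * u \<in> snd D\<^sub>2 \<longleftrightarrow> ht j < ht i" if "i < 3" "j < 3" "i \<noteq> j" "u \<in> {-1..1}" "?g2 i u = ?g2 j u" for i j u
  proof -
    have "fst D\<^sub>2 (m i + r i * u) = fst D\<^sub>2 (m j + r j * u)"
      using V[THEN conjunct1, rule_format, of i u] V[THEN conjunct1, rule_format, of j u] that len by simp
    then show ?thesis
      using V[THEN conjunct2, THEN conjunct2, THEN conjunct2, rule_format, of D\<^sub>2 i j u u] that len by simp
  qed
  have G1: "card (tangle_doubles 3 ?g1 m r (snd D\<^sub>1)) = card ({(0, 1, 0), (0, 2, a), (1, 2, - a)} :: (nat \<times> nat \<times> real) set)"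
    "tangle_writhe 3 ?g1 g1' m r (snd D\<^sub>1) = (\<Sum>(i, j, u)\<in>{(0, 1, 0), (0, 2, a), (1, 2, - a)}. (if ht j < ht i then 1 else -1) * sgn (r i) * sgn (r j) *
      sgn (Im (cnj (g1' i u) * g1' j u)))"
    by (rule graph_tangle(1)[where g = ?g1 and m = m and r = r and Ov = "snd D\<^sub>1", OF re(1) ht ov1 refl, unfolded Y1]
        graph_tangle(2)[where g = ?g1 and g' = g1' and m = m and r = r and Ov = "snd D\<^sub>1", OF re(1) ht ov1 refl, unfolded Y1];
        assumption)+
  have G2: "card (tangle_doubles 3 ?g2 m r (snd D\<^sub>2)) = card ({(0, 1, 0), (0, 2, - a), (1, 2, a)} :: (nat \<times> nat \<times> real) set)"
    "tangle_writhe 3 ?g2 g2' m r (snd D\<^sub>2) = (\<Sum>(i, j, u)\<in>{(0, 1, 0), (0, 2, - a), (1, 2, a)}. (if ht j < ht i then 1 else -1) * sgn (r i) * sgn (r j) *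
      sgn (Im (cnj (g2' i u) * g2' j u)))"
    by (rule graph_tangle(1)[where g = ?g2 and m = m and r = r and Ov = "snd D\<^sub>2", OF re(2) ht ov2 refl, unfolded Y2]
        graph_tangle(2)[where g = ?g2 and g' = g2' and m = m and r = r and Ov = "snd D\<^sub>2", OF re(2) ht ov2 refl, unfolded Y2];
        assumption)+
  have bnd: "u \<in> {-1<..<1} \<and> v \<in> {-1<..<1}"
    if "i < 3" "j < 3" "u \<in> {-1..1}" "(i, u) \<noteq> (j, v)" "g i u = g j v" "\<And>i u. i < 3 \<Longrightarrow> Re (g i u) = u"
      "\<And>i j u. i < j \<and> j < 3 \<and> u \<in> {-1..1} \<and> g i u = g j u \<Longrightarrow> u \<in> {0, a, - a}" for g :: "nat \<Rightarrow> real \<Rightarrow> complex" and i u j v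
  proof -
    have uv: "u = v" using that(5) that(6)[OF that(1), of u] that(6)[OF that(2), of v] by simp
    then have "i \<noteq> j" using \<open>(i, u) \<noteq> (j, v)\<close> by auto
    then consider "i < j" | "j < i" by linarith
    then have "u \<in> {0, a, - a}"
    proof cases
      case 1
      then show ?thesis using that(2,3,5) uv by (intro that(7)[of i j u]) simp
    next
      case 2
      then show ?thesis using that(1,3,5) uv by (intro that(7)[of j i u]) simp
    qed
    then show ?thesis using uv a by auto
  qed
  have b1: "u \<in> {-1<..<1} \<and> v \<in> {-1<..<1}" if x: "((i, u), (j, v)) \<in> tangle_doubles 3 ?g1 m r (snd D\<^sub>1)" for i u j v
    by (rule bnd[where g = ?g1 and i = i and j = j]) (use x re Y1 in \<open>auto simp: tangle_doubles_def set_eq_iff\<close>)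
  have b2: "u \<in> {-1<..<1} \<and> v \<in> {-1<..<1}" if x: "((i, u), (j, v)) \<in> tangle_doubles 3 ?g2 m r (snd D\<^sub>2)" for i u j v
    by (rule bnd[where g = ?g2 and i = i and j = j]) (use x re Y2 in \<open>auto simp: tangle_doubles_def set_eq_iff\<close>)
  have ch1: "crossing_number D\<^sub>2 + card (tangle_doubles 3 ?g1 m r (snd D\<^sub>1)) =
      crossing_number D\<^sub>1 + card (tangle_doubles 3 ?g2 m r (snd D\<^sub>2))"
    by (rule reid_at_change(1)[OF D1 D2 R sq d1 d2, unfolded len]; (assumption | erule b1 | erule b2))
  have ch2: "writhe \<omega> D\<^sub>2 - writhe \<omega> D\<^sub>1 = chart_sign \<omega> \<phi> *
      (tangle_writhe 3 ?g2 g2' m r (snd D\<^sub>2) - tangle_writhe 3 ?g1 g1' m r (snd D\<^sub>1))"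
    by (rule reid_at_change(2)[OF D1 D2 R sq d1 d2, unfolded len]; (assumption | erule b1 | erule b2))
  have "card (tangle_doubles 3 ?g1 m r (snd D\<^sub>1)) = 3" "card (tangle_doubles 3 ?g2 m r (snd D\<^sub>2)) = 3"
    unfolding G1(1) G2(1) by simp_all
  then show "crossing_number D\<^sub>2 = crossing_number D\<^sub>1" using ch1 by simp
  have same: "Im (cnj (g1' 0 0) * g1' 1 0) = Im (cnj (g2' 0 0) * g2' 1 0)"
    "Im (cnj (g1' 0 a) * g1' 2 a) = Im (cnj (g2' 0 (- a)) * g2' 2 (- a))"
    "Im (cnj (g1' 1 (- a)) * g1' 2 (- a)) = Im (cnj (g2' 1 a) * g2' 2 a)"
    by (simp_all add: g1'_def g2'_def)
  have "tangle_writhe 3 ?g1 g1' m r (snd D\<^sub>1) = tangle_writhe 3 ?g2 g2' m r (snd D\<^sub>2)"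
    unfolding G1(2) G2(2) by (simp add: same[unfolded One_nat_def] del: mult_cancel_left mult_cancel_right times_complex.simps)
  then show "writhe \<omega> D\<^sub>2 = writhe \<omega> D\<^sub>1" using ch2 by simp
qed

lemma reid_step_invariants:
  assumes "is_diagram S D\<^sub>1" "is_diagram S D\<^sub>2" "reid_step S D\<^sub>1 D\<^sub>2"
  shows "\<bar>writhe \<omega> D\<^sub>1 - writhe \<omega> D\<^sub>2\<bar> \<le> 1" "\<bar>int (crossing_number D\<^sub>1) - int (crossing_number D\<^sub>2)\<bar> \<le> 2"
proof -
  obtain M \<phi> m r ht where M: "M \<in> {R1_model, R2_model, R3_model}" and R: "reid_at M S D\<^sub>1 D\<^sub>2 \<phi> m r ht"
    using assms(3) unfolding reid_step_def reid_step_via_iff by blast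
  have "\<bar>chart_sign \<omega> \<phi>\<bar> = 1" using R unfolding reid_at_def by (intro square_chart_sign(1)) blast
  then have c: "chart_sign \<omega> \<phi> = 1 \<or> chart_sign \<omega> \<phi> = -1" by linarith
  consider "M = R1_model" | "M = R2_model" | "M = R3_model" using M by blast
  then have "\<bar>writhe \<omega> D\<^sub>1 - writhe \<omega> D\<^sub>2\<bar> \<le> 1 \<and> \<bar>int (crossing_number D\<^sub>1) - int (crossing_number D\<^sub>2)\<bar> \<le> 2"
  proof cases
    case 1
    show ?thesis using R1_invariants[OF assms(1,2) R[unfolded 1]] c by (auto simp: abs_minus_commute split: if_splits)
  next
    case 2
    show ?thesis using R2_invariants[OF assms(1,2) R[unfolded 2]] by simp
  next
    case 3
    show ?thesis using R3_invariants[OF assms(1,2) R[unfolded 3]] by simp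
  qed
  then show "\<bar>writhe \<omega> D\<^sub>1 - writhe \<omega> D\<^sub>2\<bar> \<le> 1" "\<bar>int (crossing_number D\<^sub>1) - int (crossing_number D\<^sub>2)\<bar> \<le> 2"
    by blast+
qed

end

section \<open>The four-point condition\<close>

lemma converse_relpow_sym:
  assumes "sym r" "(a, b) \<in> r ^^ n" shows "(b, a) \<in> r ^^ n"
  using assms(2)
proof (induction n arbitrary: b)
  case (Suc n)
  then obtain c where "(a, c) \<in> r ^^ n" "(c, b) \<in> r" by auto
  then show ?case using Suc.IH[of c] assms(1) by (meson relpow_Suc_I2 symD)
qed simp

lemma sym_adjacency: "sym (adjacency G)"
  unfolding adjacency_def sym_def by (auto simp: insert_commute)

lemma path_dist_le: "(v, w) \<in> adjacency G ^^ n \<Longrightarrow> ereal_of_enat (path_dist G v w) \<le> ereal (real n)"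
proof -
  assume "(v, w) \<in> adjacency G ^^ n"
  then have "path_dist G v w \<le> enat n" unfolding path_dist_def by (auto intro!: Inf_lower)
  then have "ereal_of_enat (path_dist G v w) \<le> ereal_of_enat (enat n)" by (simp only: ereal_of_enat_le_iff)
  then show ?thesis by simp
qed

text \<open>In different components the distance is infinite; otherwise it is attained by a walk,
  since the natural numbers are well-ordered.\<close>

lemma path_dist_ge:
  assumes "\<And>n. (v, w) \<in> adjacency G ^^ n \<Longrightarrow> L \<le> real n"
  shows "ereal L \<le> ereal_of_enat (path_dist G v w)"
proof (cases "{enat n | n. (v, w) \<in> adjacency G ^^ n} = {}")
  case True
  then show ?thesis by (simp add: path_dist_def top_enat_def)
next
  case False
  then have "path_dist G v w \<in> {enat n | n. (v, w) \<in> adjacency G ^^ n}"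
    unfolding path_dist_def by (metis (no_types, lifting) wellorder_InfI ex_in_conv)
  then show ?thesis using assms by auto
qed

text \<open>An edge is a whole class of moves. All its members have isotopic diagrams at their ends,
  possibly in exchanged order, so the union over the class consists of at most two isotopy
  classes.\<close>

lemma reidemeister_graph_ends:
  assumes D: "range (fst D\<^sub>1) \<subseteq> S" "range (fst D\<^sub>2) \<subseteq> S"
  shows "(\<Union>(E\<^sub>1, E\<^sub>2)\<in>same_move S `` {(D\<^sub>1, D\<^sub>2)}. {diagram_isotopy S `` {E\<^sub>1}, diagram_isotopy S `` {E\<^sub>2}}) =
    {diagram_isotopy S `` {D\<^sub>1}, diagram_isotopy S `` {D\<^sub>2}}" (is "?U = ?R")
proof
  have "((D\<^sub>1, D\<^sub>2), (D\<^sub>1, D\<^sub>2)) \<in> same_move S"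
    unfolding same_move_def mem_Collect_eq prod.case using ambient_isotopy_id transports_refl by blast
  then show "?R \<subseteq> ?U" by blast
  show "?U \<subseteq> ?R"
  proof
    fix v assume "v \<in> ?U"
    then obtain E\<^sub>1 E\<^sub>2 where E: "((D\<^sub>1, D\<^sub>2), (E\<^sub>1, E\<^sub>2)) \<in> same_move S"
      "v = diagram_isotopy S `` {E\<^sub>1} \<or> v = diagram_isotopy S `` {E\<^sub>2}" by auto
    obtain H where H: "ambient_isotopy S H"
      "transports (H 1) D\<^sub>1 E\<^sub>1 \<and> transports (H 1) D\<^sub>2 E\<^sub>2 \<or> transports (H 1) D\<^sub>1 E\<^sub>2 \<and> transports (H 1) D\<^sub>2 E\<^sub>1"
      using E(1) unfolding same_move_def by auto
    have c: "diagram_isotopy S `` {E} = diagram_isotopy S `` {D}" if "transports (H 1) D E" "range (fst D) \<subseteq> S" for D E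
      using diagram_isotopy_class_eq[OF H(1) that] .
    from H(2) E(2) show "v \<in> ?R"
      by (elim disjE conjE) (simp_all add: c[OF _ D(1)] c[OF _ D(2)])
  qed
qed

text \<open>Multiplicities of edges are invisible to the path distance, so adjacency can be tested
  on diagrams instead of classes of moves.\<close>

lemma adjacency_reidemeister_graph:
  "adjacency (reidemeister_graph S emb K) = {(v, w). \<exists>D\<^sub>1\<in>diagrams_of S emb K. \<exists>D\<^sub>2\<in>diagrams_of S emb K.
     reid_step S D\<^sub>1 D\<^sub>2 \<and> {v, w} = {diagram_isotopy S `` {D\<^sub>1}, diagram_isotopy S `` {D\<^sub>2}}}" (is "?A = ?B")
proof -
  have r: "range (fst D) \<subseteq> S" if "D \<in> diagrams_of S emb K" for D
    using that is_diagramD(2)[of S "fst D" "snd D"] by (simp add: diagrams_of_def)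
  have e: "ends (reidemeister_graph S emb K) (same_move S `` {(D\<^sub>1, D\<^sub>2)}) = {diagram_isotopy S `` {D\<^sub>1}, diagram_isotopy S `` {D\<^sub>2}}"
    if "D\<^sub>1 \<in> diagrams_of S emb K" "D\<^sub>2 \<in> diagrams_of S emb K" for D\<^sub>1 D\<^sub>2
    unfolding reidemeister_graph_def multigraph.simps using reidemeister_graph_ends[OF r[OF that(1)] r[OF that(2)]] .
  have E: "edges (reidemeister_graph S emb K) = {same_move S `` {(D\<^sub>1, D\<^sub>2)} | D\<^sub>1 D\<^sub>2. D\<^sub>1 \<in> diagrams_of S emb K \<and> D\<^sub>2 \<in> diagrams_of S emb K \<and> reid_step S D\<^sub>1 D\<^sub>2}"
    unfolding reidemeister_graph_def multigraph.simps by (auto simp: quotient_def)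
  show ?thesis
  proof (intro set_eqI iffI)
    fix x assume "x \<in> ?A"
    then obtain v w D\<^sub>1 D\<^sub>2 where x: "x = (v, w)" "D\<^sub>1 \<in> diagrams_of S emb K" "D\<^sub>2 \<in> diagrams_of S emb K" "reid_step S D\<^sub>1 D\<^sub>2"
      "ends (reidemeister_graph S emb K) (same_move S `` {(D\<^sub>1, D\<^sub>2)}) = {v, w}"
      unfolding adjacency_def E by auto
    have "{v, w} = {diagram_isotopy S `` {D\<^sub>1}, diagram_isotopy S `` {D\<^sub>2}}" using e[OF x(2,3)] x(5) by simp
    then show "x \<in> ?B" unfolding x(1) mem_Collect_eq prod.case using x(2-4) by blast
  next
    fix x assume "x \<in> ?B"
    then obtain v w D\<^sub>1 D\<^sub>2 where x: "x = (v, w)" "D\<^sub>1 \<in> diagrams_of S emb K" "D\<^sub>2 \<in> diagrams_of S emb K" "reid_step S D\<^sub>1 D\<^sub>2"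
      "{v, w} = {diagram_isotopy S `` {D\<^sub>1}, diagram_isotopy S `` {D\<^sub>2}}" by auto
    then have "same_move S `` {(D\<^sub>1, D\<^sub>2)} \<in> edges (reidemeister_graph S emb K)" unfolding E by blast
    then show "x \<in> ?A" unfolding adjacency_def x(1) mem_Collect_eq prod.case x(5) using e[OF x(2,3)] by blast
  qed
qed

text \<open>A cube of diagrams indexed by sets of kinks: even indices change the writhe by
  \<open>\<kappa>\<close>, odd ones by \<open>- \<kappa>\<close>. The sign \<open>\<kappa>\<close>
  is left open since it depends on how the chosen form orients the surface.\<close>

definition kink_cube where
  "kink_cube S emb K \<omega> N DD \<kappa> \<longleftrightarrow> \<bar>\<kappa>\<bar> = 1 \<and>
    (\<forall>F\<subseteq>{..<N}. DD F \<in> diagrams_of S emb K) \<and>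
    (\<forall>F\<subseteq>{..<N}. \<forall>k<N. k \<notin> F \<longrightarrow> reid_step S (DD F) (DD (insert k F)) \<and>
      crossing_number (DD (insert k F)) = crossing_number (DD F) + 1 \<and>
      writhe \<omega> (DD (insert k F)) = writhe \<omega> (DD F) + (if even k then \<kappa> else - \<kappa>))"

context oriented_surface
begin

lemma diagram_class_invariants:
  assumes "is_diagram S D" "is_diagram S E" "diagram_isotopy S `` {D} = diagram_isotopy S `` {E}"
  shows "writhe \<omega> D = writhe \<omega> E" "crossing_number D = crossing_number E"
proof -
  have "E \<in> diagram_isotopy S `` {D}" using assms(3) diagram_isotopy_refl by blast
  then obtain H where "ambient_isotopy S H" "transports (H 1) D E" by (auto simp: diagram_isotopy_def)
  from isotopy_invariance[OF assms(1,2) this]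
  show "writhe \<omega> D = writhe \<omega> E" "crossing_number D = crossing_number E" by simp_all
qed

text \<open>Consecutive edges of a walk need not share a diagram, only its isotopy class; the
  invariants descend to classes, so the changes still add up.\<close>

lemma walk_invariants:
  assumes "(v, w) \<in> adjacency (reidemeister_graph S emb K) ^^ n" "is_diagram S D" "v = diagram_isotopy S `` {D}"
    "is_diagram S E" "w = diagram_isotopy S `` {E}"
  shows "\<bar>writhe \<omega> D - writhe \<omega> E\<bar> \<le> real n \<and> \<bar>int (crossing_number D) - int (crossing_number E)\<bar> \<le> 2 * int n"
  using assms(1,4,5)
proof (induction n arbitrary: w E)
  case 0
  then show ?case using diagram_class_invariants[of D E] assms(2,3) by simp
next
  case (Suc n)
  then obtain u where u: "(v, u) \<in> adjacency (reidemeister_graph S emb K) ^^ n" "(u, w) \<in> adjacency (reidemeister_graph S emb K)"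
    by auto
  obtain D\<^sub>1 D\<^sub>2 where D12: "D\<^sub>1 \<in> diagrams_of S emb K" "D\<^sub>2 \<in> diagrams_of S emb K" "reid_step S D\<^sub>1 D\<^sub>2"
    "{u, w} = {diagram_isotopy S `` {D\<^sub>1}, diagram_isotopy S `` {D\<^sub>2}}"
    using u(2) unfolding adjacency_reidemeister_graph by blast
  have d: "is_diagram S D\<^sub>1" "is_diagram S D\<^sub>2" using D12 by (simp_all add: diagrams_of_def)
  note ri = reid_step_invariants[OF d D12(3)]
  from D12(4) consider "u = diagram_isotopy S `` {D\<^sub>1}" "w = diagram_isotopy S `` {D\<^sub>2}"
    | "u = diagram_isotopy S `` {D\<^sub>2}" "w = diagram_isotopy S `` {D\<^sub>1}" by (auto simp: doubleton_eq_iff)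
  then show ?case
  proof cases
    case 1
    show ?thesis using Suc.IH[OF u(1) d(1) 1(1)] ri diagram_class_invariants[OF Suc.prems(2) d(2)] 1(2) Suc.prems(3) by auto
  next
    case 2
    show ?thesis using Suc.IH[OF u(1) d(2) 2(1)] ri diagram_class_invariants[OF Suc.prems(2) d(1)] 2(2) Suc.prems(3) by auto
  qed
qed

theorem not_hyperbolic_if_kinks:
  assumes kinks: "\<And>n::nat. \<exists>DD \<kappa>. kink_cube S emb K \<omega> (2 * n) DD \<kappa>"
  shows "\<not> hyperbolic_graph (reidemeister_graph S emb K)"
proof
  let ?G = "reidemeister_graph S emb K"
  let ?d = "\<lambda>v w. ereal_of_enat (path_dist ?G v w)"
  assume "hyperbolic_graph ?G"
  then obtain \<delta> :: real where \<delta>: "\<And>x y z w. x \<in> verts ?G \<Longrightarrow> y \<in> verts ?G \<Longrightarrow> z \<in> verts ?G \<Longrightarrow> w \<in> verts ?G \<Longrightarrow>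
     ?d x y + ?d z w \<le> max (?d x z + ?d y w) (?d x w + ?d y z) + ereal (2 * \<delta>)"
    unfolding hyperbolic_graph_def Gromov_hyperbolic_def by blast
  obtain n :: nat where n: "real n > 2 * \<delta>" using reals_Archimedean2 by blast
  obtain DD \<kappa> where kc: "kink_cube S emb K \<omega> (2 * n) DD \<kappa>" using kinks by blast
  have \<kappa>: "\<bar>\<kappa>\<bar> = 1" and DD: "\<And>F. F \<subseteq> {..<2*n} \<Longrightarrow> DD F \<in> diagrams_of S emb K"
    and st: "\<And>F k. F\<subseteq>{..<2*n} \<Longrightarrow> k<2*n \<Longrightarrow> k \<notin> F \<Longrightarrow> reid_step S (DD F) (DD (insert k F)) \<and>
      crossing_number (DD (insert k F)) = crossing_number (DD F) + 1 \<and>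
      writhe \<omega> (DD (insert k F)) = writhe \<omega> (DD F) + (if even k then \<kappa> else - \<kappa>)"
    using kc unfolding kink_cube_def by simp_all
  define cl where "cl = (\<lambda>F. diagram_isotopy S `` {DD F})"
  define \<epsilon> where "\<epsilon> = (\<lambda>k::nat. if even k then \<kappa> else - \<kappa>)"
  have dia: "is_diagram S (DD F)" if "F \<subseteq> {..<2*n}" for F using DD[OF that] by (simp add: diagrams_of_def)
  have vert: "cl F \<in> verts ?G" if "F \<subseteq> {..<2*n}" for F
    using DD[OF that] by (auto simp: reidemeister_graph_def cl_def quotientI)
  \<comment> \<open>Kinks can be inserted in any order; the walk adds the elements of
    \<open>A\<close> one by one.\<close>
  have walk: "(cl F, cl (F \<union> A)) \<in> adjacency ?G ^^ card A \<and>
      crossing_number (DD (F \<union> A)) = crossing_number (DD F) + card A \<and>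
      writhe \<omega> (DD (F \<union> A)) = writhe \<omega> (DD F) + sum \<epsilon> A"
    if "finite A" "F \<inter> A = {}" "F \<union> A \<subseteq> {..<2*n}" for F A
    using that
  proof (induction A)
    case empty
    then show ?case by simp
  next
    case (insert k A)
    have FA: "F \<union> A \<subseteq> {..<2*n}" "k < 2*n" "k \<notin> F \<union> A" "F \<union> insert k A \<subseteq> {..<2*n}" using insert by auto
    have "(cl (F \<union> A), cl (F \<union> insert k A)) \<in> adjacency ?G"
      unfolding adjacency_reidemeister_graph cl_def using st[OF FA(1-3)] DD[OF FA(1)] DD[OF FA(4)] by auto
    then show ?case using insert st[OF FA(1-3)] by (auto simp: \<epsilon>_def)
  qed
  define Ev where "Ev = (\<lambda>k. 2 * k) ` {..<n}"
  define Od where "Od = (\<lambda>k. 2 * k + 1) ` {..<n}"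
  have card: "card Ev = n" "card Od = n" unfolding Ev_def Od_def by (subst card_image; auto simp: inj_on_def)+
  have sumE: "sum \<epsilon> Ev = n * \<kappa>" "sum \<epsilon> Od = - (n * \<kappa>)"
    unfolding Ev_def Od_def by (subst sum.reindex; auto simp: inj_on_def \<epsilon>_def)+
  have sub: "Ev \<subseteq> {..<2*n}" "Od \<subseteq> {..<2*n}" and disj: "Ev \<inter> Od = {}" and fin: "finite Ev" "finite Od"
    unfolding Ev_def Od_def by (auto, presburger)
  have subU: "Ev \<union> Od \<subseteq> {..<2*n}" "Od \<union> Ev \<subseteq> {..<2*n}" using sub by auto
  note w1 = walk[OF fin(1), of "{}"] and w2 = walk[OF fin(2), of "{}"] and w3 = walk[OF fin(2), of Ev] and w4 = walk[OF fin(1), of Od]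
  have U: "Od \<union> Ev = Ev \<union> Od" by blast
  have p: "(cl {}, cl Ev) \<in> adjacency ?G ^^ n" "(cl {}, cl Od) \<in> adjacency ?G ^^ n"
    "(cl Ev, cl (Ev \<union> Od)) \<in> adjacency ?G ^^ n" "(cl Od, cl (Ev \<union> Od)) \<in> adjacency ?G ^^ n"
    using w1 w2 w3[OF disj subU(1)] w4[OF _ subU(2)] sub disj card by (simp_all add: U Int_commute)
  have u: "?d (cl {}) (cl Ev) \<le> n" "?d (cl {}) (cl Od) \<le> n"
    "?d (cl (Ev \<union> Od)) (cl Od) \<le> n" "?d (cl (Ev \<union> Od)) (cl Ev) \<le> n"
    by (rule path_dist_le, rule p, rule path_dist_le, rule p,
      (rule path_dist_le, rule converse_relpow_sym[OF sym_adjacency], rule p)+)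
  have l1: "ereal n \<le> ?d (cl {}) (cl (Ev \<union> Od))"
  proof (rule path_dist_ge)
    fix l assume l: "(cl {}, cl (Ev \<union> Od)) \<in> adjacency ?G ^^ l"
    have "crossing_number (DD (Ev \<union> Od)) = crossing_number (DD {}) + 2 * n"
      using w1 w3[OF disj subU(1)] sub card by simp
    then show "real n \<le> real l"
      using walk_invariants[OF l dia[OF empty_subsetI] _ dia[OF subU(1)]] by (simp add: cl_def)
  qed
  have l2: "ereal (2 * n) \<le> ?d (cl Ev) (cl Od)"
  proof (rule path_dist_ge)
    fix l assume l: "(cl Ev, cl Od) \<in> adjacency ?G ^^ l"
    have "writhe \<omega> (DD Ev) - writhe \<omega> (DD Od) = 2 * n * \<kappa>"
      using w1 w2 sub sumE by simp
    then have "\<bar>writhe \<omega> (DD Ev) - writhe \<omega> (DD Od)\<bar> = 2 * n" using \<kappa> by (simp add: abs_mult)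
    then show "real (2 * n) \<le> real l"
      using walk_invariants[OF l dia[OF sub(1)] _ dia[OF sub(2)]] by (simp add: cl_def)
  qed
  note add_mono[OF l1 l2]
  also have "?d (cl {}) (cl (Ev \<union> Od)) + ?d (cl Ev) (cl Od) \<le>
      max (?d (cl {}) (cl Ev) + ?d (cl (Ev \<union> Od)) (cl Od)) (?d (cl {}) (cl Od) + ?d (cl (Ev \<union> Od)) (cl Ev)) + ereal (2 * \<delta>)"
    using \<delta>[OF vert[OF empty_subsetI] vert[OF subU(1)] vert[OF sub(1)] vert[OF sub(2)]] .
  also have "\<dots> \<le> max (ereal n + ereal n) (ereal n + ereal n) + ereal (2 * \<delta>)"
    by (rule add_right_mono[OF max.mono[OF add_mono[OF u(1,3)] add_mono[OF u(2,4)]]])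
  finally have "ereal n + ereal (2 * n) \<le> max (ereal n + ereal n) (ereal n + ereal n) + ereal (2 * \<delta>)" .
  then show False using n by simp
qed

end

section \<open>Isotopies of embedded curves\<close>

lemma indep_Im_nonzero:
  fixes a b :: complex assumes "indep a b" shows "Im (cnj a * b) \<noteq> 0"
proof
  assume "Im (cnj a * b) = 0"
  then have "Re a * Im b = Im a * Re b" by simp
  then have "Re b *\<^sub>R a + (- Re a) *\<^sub>R b = 0" "Im b *\<^sub>R a + (- Im a) *\<^sub>R b = 0"
    by (simp_all add: complex_eq_iff mult.commute)
  then have "a = 0" using assms unfolding indep_def by (metis complex_eqI neg_equal_0_iff_equal zero_complex.sel)
  then show False using indep_nz[OF assms] by blast
qed

text \<open>The standard area form: the determinant of \<open>a\<close> and \<open>b\<close>, the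
  same at all points.\<close>

interpretation plane: oriented_surface "UNIV :: complex set" "\<lambda>p a b. Im (cnj a * b)"
proof (rule oriented_surface.intro)
  show "linear (\<lambda>a. Im (cnj a * b))" "linear (\<lambda>b. Im (cnj a * b))" for a b :: complex
    by (rule linearI; simp; algebra)+
qed (auto intro!: continuous_intros dest: indep_Im_nonzero)

text \<open>The determinant of three vectors of 3-space, expanded along the real coordinate. On the
  unit sphere \<open>p\<close> is also the outward normal, so this is the area form there.\<close>

definition det3 :: "R3 \<Rightarrow> R3 \<Rightarrow> R3 \<Rightarrow> real" where
  "det3 p a b = snd p * Im (cnj (fst a) * fst b) + snd a * Im (cnj (fst b) * fst p) + snd b * Im (cnj (fst p) * fst a)"

lemma surface_velocity_sphere:
  fixes p a :: "'a::euclidean_space"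
  assumes "surface_velocity (sphere 0 1) p a" shows "p \<bullet> p = 1" "p \<bullet> a = 0"
proof -
  show "p \<bullet> p = 1" using surface_velocity_in[OF assms] by (simp add: dot_square_norm)
  obtain f where f: "f 0 = p" "(f has_vector_derivative a) (at (0::real))" "\<forall>\<^sub>F t in nhds 0. f t \<in> sphere 0 1"
    using assms unfolding surface_velocity_def by blast
  have 1: "((\<lambda>t. f t \<bullet> f t) has_vector_derivative (p \<bullet> a + a \<bullet> p)) (at 0)"
    using bounded_bilinear.has_vector_derivative[OF bounded_bilinear_inner f(2) f(2)] f(1) by simp
  have "\<forall>\<^sub>F t in nhds 0. t \<in> UNIV \<longrightarrow> f t \<bullet> f t = 1"
    using f(3) by eventually_elim (simp add: dot_square_norm)
  then have "((\<lambda>t. 1::real) has_vector_derivative (p \<bullet> a + a \<bullet> p)) (at 0)"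
    using has_vector_derivative_cong_ev[of UNIV "\<lambda>t. f t \<bullet> f t" "\<lambda>t. 1" 0] 1 f(1) \<open>p \<bullet> p = 1\<close> by simp
  then have "p \<bullet> a + a \<bullet> p = 0"
    using vector_derivative_unique_at has_vector_derivative_const by blast
  then show "p \<bullet> a = 0" by (simp add: inner_commute)
qed

text \<open>The right-hand side is the Gram determinant of \<open>p\<close>, \<open>a\<close> and
  \<open>b\<close>. For tangent vectors at a point of the unit sphere only the Gram determinant of
  \<open>a\<close> and \<open>b\<close> survives.\<close>

lemma det3_square:
  "(det3 p a b)\<^sup>2 = (p \<bullet> p) * ((a \<bullet> a) * (b \<bullet> b) - (a \<bullet> b)\<^sup>2) - (p \<bullet> a) * ((p \<bullet> a) * (b \<bullet> b) - (a \<bullet> b) * (p \<bullet> b))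
     + (p \<bullet> b) * ((p \<bullet> a) * (a \<bullet> b) - (a \<bullet> a) * (p \<bullet> b))"
proof -
  obtain p1 p2 p3 a1 a2 a3 b1 b2 b3 where e: "p = (Complex p1 p2, p3)" "a = (Complex a1 a2, a3)" "b = (Complex b1 b2, b3)"
    by (metis complex.exhaust surj_pair)
  show ?thesis unfolding e det3_def by (simp add: inner_complex_def power2_eq_square algebra_simps)
qed

interpretation sphere: oriented_surface "sphere 0 1 :: R3 set" det3
proof (rule oriented_surface.intro)
  show "continuous_on UNIV (\<lambda>x. det3 (fst x) (fst (snd x)) (snd (snd x)))"
    unfolding det3_def by (intro continuous_intros)
  show "linear (\<lambda>a. det3 p a b)" "linear (\<lambda>b. det3 p a b)" for p a b
    unfolding det3_def by (rule linearI; simp; algebra)+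
  show "det3 p a a = 0" for p a unfolding det3_def by (simp add: algebra_simps)
  fix p a b :: R3
  assume v: "surface_velocity (sphere 0 1) p a" "surface_velocity (sphere 0 1) p b" and i: "indep a b"
  note pa = surface_velocity_sphere[OF v(1)] and pb = surface_velocity_sphere[OF v(2)]
  show "det3 p a b \<noteq> 0"
  proof
    assume "det3 p a b = 0"
    then have 0: "(a \<bullet> a) * (b \<bullet> b) - (a \<bullet> b)\<^sup>2 = 0" using det3_square[of p a b] pa pb by simp
    \<comment> \<open>The component of \<open>a\<close> orthogonal to \<open>b\<close>, multiplied
      by \<open>b \<bullet> b\<close>; its square is a multiple of the Gram determinant of
      \<open>a\<close> and \<open>b\<close>, which has just been seen to vanish.\<close>
    define e where "e = (b \<bullet> b) *\<^sub>R a + (- (a \<bullet> b)) *\<^sub>R b"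
    have "e \<bullet> e = (b \<bullet> b) * ((a \<bullet> a) * (b \<bullet> b) - (a \<bullet> b)\<^sup>2)"
      unfolding e_def by (simp add: inner_add_left inner_add_right inner_commute[of b a] power2_eq_square algebra_simps)
    then have "e = 0" using 0 by simp
    then have "b \<bullet> b = 0" using i unfolding e_def indep_def by blast
    then have "0 *\<^sub>R a + 1 *\<^sub>R b = 0" by simp
    then show False using i unfolding indep_def by (metis zero_neq_one)
  qed
qed

section \<open>Isotopies through embedded curves\<close>

definition embedding :: "(real \<Rightarrow> 'a::euclidean_space) \<Rightarrow> bool" where
  "embedding g \<longleftrightarrow> closed_immersion g \<and> (\<forall>s t. \<not> double_pair g s t)"

text \<open>The end curves are reached with their own parametrisations, so isotopies can be
  concatenated directly. In the applications \<open>X\<close> is all of 3-space or the unit sphere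
  in dimension 4.\<close>

definition embedded_isotopy :: "'a::euclidean_space set \<Rightarrow> (real \<Rightarrow> 'a) \<Rightarrow> (real \<Rightarrow> 'a) \<Rightarrow> bool" where
  "embedded_isotopy X g g' \<longleftrightarrow> (\<exists>\<Gamma> \<Gamma>'. curve_family \<Gamma> \<Gamma>' \<and>
     (\<forall>s\<in>{0..1}. embedding (\<Gamma> s) \<and> range (\<Gamma> s) \<subseteq> X) \<and> \<Gamma> 0 = g \<and> \<Gamma> 1 = g')"

lemma embedded_isotopyI:
  assumes "curve_family \<Gamma> \<Gamma>'" "\<And>s t. s \<in> {0..1} \<Longrightarrow> \<Gamma> s (t + 1) = \<Gamma> s t"
    "\<And>s t. s \<in> {0..1} \<Longrightarrow> \<Gamma>' s t \<noteq> 0" "\<And>s t u. s \<in> {0..1} \<Longrightarrow> \<Gamma> s t = \<Gamma> s u \<Longrightarrow> t - u \<in> \<int>"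
    "\<And>s t. s \<in> {0..1} \<Longrightarrow> \<Gamma> s t \<in> X"
  shows "embedded_isotopy X (\<Gamma> 0) (\<Gamma> 1)"
  unfolding embedded_isotopy_def
proof (rule exI[of _ \<Gamma>], rule exI[of _ \<Gamma>'], intro conjI ballI)
  show "curve_family \<Gamma> \<Gamma>'" by fact
  fix s :: real assume s: "s \<in> {0..1}"
  show "range (\<Gamma> s) \<subseteq> X" using assms(5)[OF s] by blast
  show "embedding (\<Gamma> s)" unfolding embedding_def double_pair_def
    using closed_immersionI[OF curve_family_member[OF assms(1) s] assms(2)[OF s] assms(3)[OF s]] assms(4)[OF s] by blast
qed simp_all

lemma embedded_isotopy_trans:
  assumes "embedded_isotopy X f g" "embedded_isotopy X g h" shows "embedded_isotopy X f h"
proof -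
  obtain \<Gamma> \<Gamma>' where G: "curve_family \<Gamma> \<Gamma>'" "\<And>s. s\<in>{0..1} \<Longrightarrow> embedding (\<Gamma> s) \<and> range (\<Gamma> s) \<subseteq> X" "\<Gamma> 0 = f" "\<Gamma> 1 = g"
    using assms(1) unfolding embedded_isotopy_def by blast
  obtain \<Delta> \<Delta>' where D: "curve_family \<Delta> \<Delta>'" "\<And>s. s\<in>{0..1} \<Longrightarrow> embedding (\<Delta> s) \<and> range (\<Delta> s) \<subseteq> X" "\<Delta> 0 = g" "\<Delta> 1 = h"
    using assms(2) unfolding embedded_isotopy_def by blast
  obtain \<Theta> \<Theta>' where T: "curve_family \<Theta> \<Theta>'" "\<Theta> 0 = \<Gamma> 0" "\<Theta> 1 = \<Delta> 1" "\<And>s. s\<in>{0..1} \<Longrightarrow> \<Theta> s \<in> \<Gamma> ` {0..1} \<union> \<Delta> ` {0..1}"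
    using curve_family_concat[OF G(1) D(1)] G(4) D(3) by metis
  have "embedding (\<Theta> s) \<and> range (\<Theta> s) \<subseteq> X" if "s \<in> {0..1}" for s
    using T(4)[OF that] G(2) D(2) by (elim UnE imageE) simp_all
  then show ?thesis unfolding embedded_isotopy_def using T(1-3) G(3) D(4) by (intro exI[of _ \<Theta>] exI[of _ \<Theta>']) simp
qed

lemma embedded_isotopy_embedding:
  assumes "embedded_isotopy X f g" shows "embedding f" "embedding g" "range f \<subseteq> X" "range g \<subseteq> X"
  using assms unfolding embedded_isotopy_def by (metis atLeastAtMost_iff order_refl zero_le_one)+

lemma knot_equivI:
  assumes "embedded_isotopy (sphere 0 1) \<gamma> \<gamma>'" shows "(\<gamma>, \<gamma>') \<in> knot_equiv"
proof -
  have k: "is_knot g" if "embedding g" "range g \<subseteq> sphere 0 1" for g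
    using that unfolding is_knot_def embedding_def by blast
  obtain \<Gamma> \<Gamma>' where G: "curve_family \<Gamma> \<Gamma>'" "\<And>s. s\<in>{0..1} \<Longrightarrow> embedding (\<Gamma> s) \<and> range (\<Gamma> s) \<subseteq> sphere 0 1" "\<Gamma> 0 = \<gamma>" "\<Gamma> 1 = \<gamma>'"
    using assms(1) unfolding embedded_isotopy_def by blast
  have "is_knot (\<Gamma> s)" if "s \<in> {0..1}" for s using G(2)[OF that] k by blast
  moreover have "\<gamma>' = \<gamma>' \<circ> (\<lambda>t. t)" by (simp add: o_def)
  ultimately show ?thesis
    unfolding knot_equiv_def mem_Collect_eq prod.case
    using k embedded_isotopy_embedding[OF assms] curve_family_C1_family[OF G(1)] circle_reparam_id G(3,4) by blast
qed

text \<open>Stereographic projection from the centre \<open>(0, 1)\<close> sends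
  \<open>(u, b)\<close> to \<open>u / (1 - b)\<close>.\<close>

lemma stereo_inv_left: "inverse (1 - snd (stereo_inv x)) *\<^sub>R fst (stereo_inv x) = x"
proof -
  define n where "n = (norm x)\<^sup>2"
  have n: "n + 1 > 0" by (simp add: n_def add_nonneg_pos)
  then have "1 - (n - 1) / (n + 1) = 2 / (n + 1)" by (simp add: field_simps)
  then have "inverse (1 - snd (stereo_inv x)) * (2 / (n + 1)) = 1"
    using n by (simp add: stereo_inv_def n_def[symmetric])
  moreover have "fst (stereo_inv x) = (2 / (n + 1)) *\<^sub>R x" by (simp add: stereo_inv_def n_def)
  ultimately show ?thesis by (metis scaleR_one scaleR_scaleR)
qed

lemma stereo_inv_sphere: "stereo_inv x \<in> sphere 0 1" "snd (stereo_inv x) \<noteq> 1"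
proof -
  define n where "n = (norm x)\<^sup>2"
  have n: "n + 1 > 0" by (simp add: n_def add_nonneg_pos)
  have "stereo_inv x \<bullet> stereo_inv x = (2 / (n + 1))\<^sup>2 * (x \<bullet> x) + ((n - 1) / (n + 1))\<^sup>2"
    unfolding stereo_inv_def by (simp add: n_def power2_eq_square)
  also have "\<dots> = (4 * n + (n - 1)\<^sup>2) / (n + 1)\<^sup>2"
    by (simp add: power_divide add_divide_distrib n_def dot_square_norm)
  also have "4 * n + (n - 1)\<^sup>2 = (n + 1)\<^sup>2" by (simp add: power2_eq_square algebra_simps)
  finally show "stereo_inv x \<in> sphere 0 1" using n by (simp add: norm_eq_1)
  have "(n - 1) / (n + 1) \<noteq> 1" using n by simp
  then show "snd (stereo_inv x) \<noteq> 1" by (simp add: stereo_inv_def n_def[symmetric])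
qed

text \<open>The velocity produced is linear in \<open>\<Gamma>'\<close> at every point, whence the
  second clause. Read backwards, it shows that a curve in space is immersed if its image on the
  sphere is.\<close>

lemma curve_family_stereo_inv:
  assumes G: "curve_family \<Gamma> \<Gamma>'"
  shows "\<exists>\<Delta>'. curve_family (\<lambda>s t. stereo_inv (\<Gamma> s t)) \<Delta>' \<and> (\<forall>s t. \<Gamma>' s t = 0 \<longrightarrow> \<Delta>' s t = 0)"
proof -
  have one: "curve_family (\<lambda>s t. k) (\<lambda>s t. 0)" for k :: real by (rule curve_family_param) simp
  note q = curve_family_inner[OF G G]
  have p: "\<Gamma> s t \<bullet> \<Gamma> s t + 1 \<noteq> 0" for s t using inner_ge_zero[of "\<Gamma> s t"] by linarith
  note i = curve_family_inverse[OF curve_family_add[OF q one[of 1]] p]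
  note F = curve_family_Pair[OF curve_family_scaleR[OF curve_family_mult[OF one[of 2] i] G]
      curve_family_mult[OF curve_family_diff[OF q one[of 1]] i]]
  have eq: "(\<lambda>s t. stereo_inv (\<Gamma> s t)) = (\<lambda>s t. ((2 * inverse (\<Gamma> s t \<bullet> \<Gamma> s t + 1)) *\<^sub>R \<Gamma> s t, (\<Gamma> s t \<bullet> \<Gamma> s t - 1) * inverse (\<Gamma> s t \<bullet> \<Gamma> s t + 1)))"
    by (intro ext) (simp add: stereo_inv_def dot_square_norm divide_inverse)
  show ?thesis unfolding eq by (rule exI, rule conjI, rule F) (simp add: zero_prod_def[symmetric])
qed

text \<open>The velocity of \<open>stereo_inv \<circ> \<Gamma>\<close> cannot vanish because \<open>\<Gamma>\<close> is recovered from it by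
  stereographic projection.\<close>

lemma embedded_isotopy_stereo:
  assumes "embedded_isotopy X g g'"
  shows "embedded_isotopy (sphere 0 1) (\<lambda>t. stereo_inv (g t)) (\<lambda>t. stereo_inv (g' t))"
proof -
  obtain \<Gamma> \<Gamma>' where G: "curve_family \<Gamma> \<Gamma>'" "\<And>s. s\<in>{0..1} \<Longrightarrow> embedding (\<Gamma> s) \<and> range (\<Gamma> s) \<subseteq> X" "\<Gamma> 0 = g" "\<Gamma> 1 = g'"
    using assms(1) unfolding embedded_isotopy_def by blast
  have one: "curve_family (\<lambda>s t. k) (\<lambda>s t. 0)" for k :: real by (rule curve_family_param) simp
  obtain \<Delta>' where D: "curve_family (\<lambda>s t. stereo_inv (\<Gamma> s t)) \<Delta>'" using curve_family_stereo_inv[OF G(1)] by blast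
  have "embedded_isotopy (sphere 0 1) (\<lambda>t. stereo_inv (\<Gamma> 0 t)) (\<lambda>t. stereo_inv (\<Gamma> 1 t))"
  proof (rule embedded_isotopyI[OF D])
    fix s t :: real assume s: "s \<in> {0..1}"
    note ci = closed_immersionD[of "\<Gamma> s"]
    have E: "embedding (\<Gamma> s)" using G(2)[OF s] by blast
    then have c: "closed_immersion (\<Gamma> s)" by (simp add: embedding_def)
    show "stereo_inv (\<Gamma> s (t + 1)) = stereo_inv (\<Gamma> s t)" using ci(2)[OF c] by simp
    show "stereo_inv (\<Gamma> s t) \<in> sphere 0 1" by (rule stereo_inv_sphere)
    show "t - u \<in> \<int>" if "stereo_inv (\<Gamma> s t) = stereo_inv (\<Gamma> s u)" for u
    proof -
      have "\<Gamma> s t = \<Gamma> s u" using stereo_inv_left[of "\<Gamma> s t"] stereo_inv_left[of "\<Gamma> s u"] that by metis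
      then show ?thesis using E unfolding embedding_def double_pair_def by blast
    qed
    show "\<Delta>' s t \<noteq> 0"
    proof
      assume 0: "\<Delta>' s t = 0"
      note d = curve_family_const[OF curve_family_member[OF D s]]
      have ds: "curve_family (\<lambda>s' t. snd (stereo_inv (\<Gamma> s t))) (\<lambda>s' t. snd (\<Delta>' s t))"
        "curve_family (\<lambda>s' t. fst (stereo_inv (\<Gamma> s t))) (\<lambda>s' t. fst (\<Delta>' s t))"
        by (rule curve_family_linear[OF bounded_linear_snd d], rule curve_family_linear[OF bounded_linear_fst d])
      have nz: "1 - snd (stereo_inv (\<Gamma> s t)) \<noteq> 0" for t using stereo_inv_sphere(2)[of "\<Gamma> s t"] by simp
      note B = curve_family_scaleR[OF curve_family_inverse[OF curve_family_diff[OF one[of 1] ds(1)] nz] ds(2)]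
      have "vector_derivative (\<lambda>t. inverse (1 - snd (stereo_inv (\<Gamma> s t))) *\<^sub>R fst (stereo_inv (\<Gamma> s t))) (at t) = 0"
        using C1_curve_vd[OF curve_family_member[OF B, of 0], of t] 0 by simp
      then have "vector_derivative (\<Gamma> s) (at t) = 0" unfolding stereo_inv_left .
      then show False using ci(3)[OF c] by blast
    qed
  qed
  then show ?thesis using G(3,4) by simp
qed

section \<open>Perturbation of embeddings\<close>

lemma periodic_uniformly_continuous:
  fixes f :: "real \<Rightarrow> 'a::metric_space"
  assumes "continuous_on UNIV f" "\<And>t. f (t + 1) = f t" "0 < e"
  obtains d where "0 < d" "\<And>x y. \<bar>x - y\<bar> < d \<Longrightarrow> dist (f x) (f y) < e"
proof -
  \<comment> \<open>Shifting \<open>x\<close> into \<open>[0,1)\<close> keeps \<open>y\<close>, less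
    than 1 away, inside \<open>[-1,2]\<close>.\<close>
  have "uniformly_continuous_on {-1..2} f"
    using assms(1) by (intro compact_uniformly_continuous continuous_on_subset[OF assms(1)]) auto
  then obtain d where d: "0 < d" "\<And>x y. x \<in> {-1..2} \<Longrightarrow> y \<in> {-1..2} \<Longrightarrow> dist y x < d \<Longrightarrow> dist (f y) (f x) < e"
    using assms(3) unfolding uniformly_continuous_on_def by metis
  show ?thesis
  proof (rule that[of "min d 1"])
    show "0 < min d 1" using d by simp
    fix x y :: real assume xy: "\<bar>x - y\<bar> < min d 1"
    define n where "n = \<lfloor>x\<rfloor>"
    have n: "0 \<le> x - n" "x - n < 1" unfolding n_def by linarith+
    have "f x = f (x - n)" "f y = f (y - n)" using periodic_int[of f, OF assms(2)] by (simp_all)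
    moreover have "dist (f (x - n)) (f (y - n)) < e"
    proof (rule d(2))
      have "\<bar>x - y\<bar> < 1" using xy by simp
      then show "x - n \<in> {-1..2}" "y - n \<in> {-1..2}" using n by (simp_all; linarith)+
      show "dist (x - n) (y - n) < d" using xy by (simp add: dist_real_def)
    qed
    ultimately show "dist (f x) (f y) < e" by simp
  qed
qed

lemma periodic_norm_bounded_below:
  fixes f :: "real \<Rightarrow> 'a::real_normed_vector"
  assumes "continuous_on UNIV f" "\<And>t. f (t + 1) = f t" "\<And>t. f t \<noteq> 0"
  obtains m where "0 < m" "\<And>t. m \<le> norm (f t)"
proof -
  have "\<exists>x\<in>{0..1}. \<forall>y\<in>{0..1::real}. norm (f x) \<le> norm (f y)"
    using assms(1) by (intro continuous_attains_inf continuous_on_norm continuous_on_subset[OF assms(1)]) auto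
  then obtain x where x: "\<And>y. y \<in> {0..1::real} \<Longrightarrow> norm (f x) \<le> norm (f y)" by blast
  show ?thesis
  proof (rule that[of "norm (f x)"])
    show "0 < norm (f x)" using assms(3) by simp
    fix t
    have "f t = f (frac t)" using periodic_int[of f, OF assms(2)] frac_diff_Ints Ints_diff_sym by metis
    then show "norm (f x) \<le> norm (f t)" using x[of "frac t"] frac_in_unit[of t] by simp
  qed
qed

lemma C1_curve_linearization:
  assumes "C1_curve c c'" "\<And>x. x \<in> closed_segment a b \<Longrightarrow> norm (c' x - c' a) \<le> B"
  shows "norm (c b - c a - (b - a) *\<^sub>R c' a) \<le> \<bar>b - a\<bar> * B"
  using vector_differentiable_bound_linearization[of "closed_segment a b" c c' a b a B] assms
  by (auto simp: C1_curve_def intro: has_vector_derivative_at_within)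

text \<open>Within distance \<open>d\<close> the velocity changes by less than half of its least
  norm, so a chord keeps at least half of the length of the tangent step.\<close>

lemma immersion_local_bound:
  assumes "closed_immersion c"
  obtains d m where "0 < d" "0 < m" "\<And>s t. \<bar>s - t\<bar> < d \<Longrightarrow> m * \<bar>s - t\<bar> \<le> norm (c s - c t)"
    "\<And>t. m \<le> norm (vector_derivative c (at t))"
proof -
  note ci = closed_immersionD[OF assms]
  define c' where "c' = (\<lambda>t. vector_derivative c (at t))"
  have C: "C1_curve c c'" and p: "\<And>t. c' (t + 1) = c' t" and nz: "\<And>t. c' t \<noteq> 0" using ci by (simp_all add: c'_def)
  have cont: "continuous_on UNIV c'" using C by (simp add: C1_curve_def)
  obtain m where m: "0 < m" "\<And>t. m \<le> norm (c' t)" using periodic_norm_bounded_below[OF cont p nz] by blast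
  obtain d where d: "0 < d" "\<And>x y. \<bar>x - y\<bar> < d \<Longrightarrow> dist (c' x) (c' y) < m / 2"
    using periodic_uniformly_continuous[OF cont p, of "m / 2"] m(1) by auto
  show ?thesis
  proof (rule that[of d "m / 2"])
    show "m / 2 \<le> norm (vector_derivative c (at t))" for t using m(2)[of t] m(1) by (simp add: c'_def)
    fix s t :: real assume st: "\<bar>s - t\<bar> < d"
    have "norm (c' x - c' t) \<le> m / 2" if "x \<in> closed_segment t s" for x
    proof -
      have "\<bar>x - t\<bar> < d" using that st by (auto simp: closed_segment_eq_real_ivl split: if_splits)
      then show ?thesis using d(2)[of x t] by (simp add: dist_norm)
    qed
    from C1_curve_linearization[OF C this]
    have "norm (c s - c t - (s - t) *\<^sub>R c' t) \<le> \<bar>s - t\<bar> * (m / 2)" by blast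
    moreover have "norm ((s - t) *\<^sub>R c' t) \<ge> \<bar>s - t\<bar> * m" using m(2)[of t] by (simp add: mult_left_mono)
    moreover have "norm ((s - t) *\<^sub>R c' t) \<le> norm (c s - c t) + norm (c s - c t - (s - t) *\<^sub>R c' t)"
      using norm_triangle_ineq4[of "c s - c t" "c s - c t - (s - t) *\<^sub>R c' t"] by simp
    ultimately show "m / 2 * \<bar>s - t\<bar> \<le> norm (c s - c t)" by (simp add: field_simps)
  qed (use d m in auto)
qed

text \<open>Any two points of the circle have representatives at distance at most 1/2, and among
  these an integer difference is 0.\<close>

lemma shift_near:
  obtains n :: int where "\<bar>s - t - of_int n\<bar> \<le> 1/2" "(s::real) - t \<in> \<int> \<longleftrightarrow> s - of_int n = t"
proof (rule that[of "round (s - t)"])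
  show "\<bar>s - t - of_int (round (s - t))\<bar> \<le> 1/2"
    using of_int_round_abs_le[of "s - t"] by (simp add: abs_minus_commute)
  show "s - t \<in> \<int> \<longleftrightarrow> s - of_int (round (s - t)) = t"
    by (auto elim!: Ints_cases) (metis Ints_of_int add_diff_cancel_left' diff_add_cancel)
qed

text \<open>Near the diagonal the immersion bound applies; away from it two points of an embedded
  circle keep a positive distance by compactness. Distance 1/2 is as far apart as representatives
  need to be.\<close>

lemma embedding_bilipschitz:
  assumes "embedding g"
  obtains m where "0 < m" "\<And>s t. \<bar>s - t\<bar> \<le> 1/2 \<Longrightarrow> m * \<bar>s - t\<bar> \<le> norm (g s - g t)"
    "\<And>t. m \<le> norm (vector_derivative g (at t))"
proof -
  have ci: "closed_immersion g" and ndp: "\<And>s t. \<not> double_pair g s t" using assms by (auto simp: embedding_def)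
  obtain d m where dm: "0 < d" "0 < m" "\<And>s t. \<bar>s - t\<bar> < d \<Longrightarrow> m * \<bar>s - t\<bar> \<le> norm (g s - g t)"
    "\<And>t. m \<le> norm (vector_derivative g (at t))" using immersion_local_bound[OF ci] by blast
  note per = closed_immersionD(2)[OF ci]
  have gc: "continuous_on UNIV g" by (rule C1_curve_cont[OF closed_immersionD(1)[OF ci]])
  have gc2: "continuous_on A (\<lambda>x. norm (g (fst x) - g (snd x)))" for A
    by (intro continuous_intros continuous_on_compose2[OF gc]) auto
  \<comment> \<open>The box contains an integer translate of each pair at distance at most
    1/2.\<close>
  define A where "A = {x \<in> {-1..2} \<times> {0..1}. \<bar>fst x - snd x\<bar> \<le> 1/2 \<and> d \<le> \<bar>fst x - snd x\<bar>}"
  obtain k where k: "0 < k" "\<And>x. x \<in> A \<Longrightarrow> k \<le> norm (g (fst x) - g (snd x))"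
  proof (cases "A = {}")
    case True
    then show ?thesis using that[of 1] by simp
  next
    case False
    have "A = ({-1..2} \<times> {0..1}) \<inter> {x. \<bar>fst x - snd x\<bar> \<le> 1/2} \<inter> {x. d \<le> \<bar>fst x - snd x\<bar>}" by (auto simp: A_def)
    moreover have "closed {x :: real \<times> real. \<bar>fst x - snd x\<bar> \<le> 1/2}" "closed {x :: real \<times> real. d \<le> \<bar>fst x - snd x\<bar>}"
      by (intro closed_Collect_le continuous_intros)+
    ultimately have "compact A" by (auto intro: compact_Int_closed compact_Times)
    then obtain x where x: "x \<in> A" "\<And>y. y \<in> A \<Longrightarrow> norm (g (fst x) - g (snd x)) \<le> norm (g (fst y) - g (snd y))"
      using continuous_attains_inf[OF _ False gc2] by blast
    have "fst x - snd x \<notin> \<int>"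
    proof
      assume "fst x - snd x \<in> \<int>"
      then obtain n :: int where n: "fst x - snd x = of_int n" by (auto elim: Ints_cases)
      then have "\<bar>real_of_int n\<bar> \<le> 1/2" "0 < \<bar>real_of_int n\<bar>" using x(1) dm(1) by (auto simp: A_def)
      then have "real_of_int \<bar>n\<bar> < 1" "n \<noteq> 0" by auto
      then show False by simp
    qed
    then have "g (fst x) \<noteq> g (snd x)" using ndp unfolding double_pair_def by blast
    then show ?thesis using that[of "norm (g (fst x) - g (snd x))"] x(2) by simp
  qed
  show ?thesis
  proof (rule that[of "min m k"])
    show "0 < min m k" using dm k by simp
    show "min m k \<le> norm (vector_derivative g (at t))" for t using dm(4)[of t] by simp
    fix s t :: real assume st: "\<bar>s - t\<bar> \<le> 1/2"
    show "min m k * \<bar>s - t\<bar> \<le> norm (g s - g t)"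
    proof (cases "\<bar>s - t\<bar> < d")
      case True
      have "min m k * \<bar>s - t\<bar> \<le> m * \<bar>s - t\<bar>" by (intro mult_right_mono) auto
      then show ?thesis using dm(3)[OF True] by linarith
    next
      case False
      define n where "n = \<lfloor>t\<rfloor>"
      have n: "0 \<le> t - n" "t - n < 1" unfolding n_def by linarith+
      have "-1 \<le> s - n" "s - n \<le> 2" using n st by linarith+
      then have "(s - n, t - n) \<in> A" using n st False by (simp add: A_def)
      from k(2)[OF this] have "k \<le> norm (g (s - n) - g (t - n))" by simp
      moreover have "g s = g (s - n)" "g t = g (t - n)" using periodic_int[of g, OF per] by simp_all
      ultimately have "k \<le> norm (g s - g t)" by simp
      moreover have "min m k * \<bar>s - t\<bar> \<le> k * 1" using k st by (intro mult_mono) auto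
      ultimately show ?thesis by simp
    qed
  qed
qed

text \<open>Along the straight interpolation from \<open>g\<close> to \<open>f\<close> the added
  displacement has Lipschitz constant \<open>m / 2\<close>, half the rate at which \<open>g\<close>
  separates points. Displacements enter through differences, so it is the closeness of velocities
  that counts.\<close>

lemma embedding_perturb:
  assumes "embedding g"
  obtains m where "0 < m" "\<And>f f'. C1_curve f f' \<Longrightarrow> (\<And>t. f (t + 1) = f t) \<Longrightarrow> (\<And>t. norm (f' t - vector_derivative g (at t)) < m) \<Longrightarrow>
     embedded_isotopy UNIV g f"
proof -
  obtain m where m: "0 < m" "\<And>s t. \<bar>s - t\<bar> \<le> 1/2 \<Longrightarrow> m * \<bar>s - t\<bar> \<le> norm (g s - g t)"
    "\<And>t. m \<le> norm (vector_derivative g (at t))" using embedding_bilipschitz[OF assms] by metis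
  note ci = closed_immersionD[OF assms[unfolded embedding_def, THEN conjunct1]]
  show ?thesis
  proof (rule that[of "m / 2"])
    fix f f' assume f: "C1_curve f f'" "\<And>t. f (t + 1) = f t" "\<And>t. norm (f' t - vector_derivative g (at t)) < m / 2"
    define D where "D = (\<lambda>t. f t - g t)"
    define D' where "D' = (\<lambda>t. f' t - vector_derivative g (at t))"
    note cg = curve_family_const[OF ci(1)] and cf = curve_family_const[OF f(1)]
    note cD = curve_family_diff[OF cf cg]
    have CD: "C1_curve D D'" using curve_family_member[OF cD, of 0] by (simp add: D_def D'_def)
    have on: "onorm (\<lambda>h. h *\<^sub>R D' x) \<le> m / 2" for x
    proof (rule onorm_le)
      fix h :: real
      have "\<bar>h\<bar> * norm (D' x) \<le> \<bar>h\<bar> * (m / 2)" using f(3)[of x] by (intro mult_left_mono) (auto simp: D'_def)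
      then show "norm (h *\<^sub>R D' x) \<le> m / 2 * norm h" by (simp add: mult.commute)
    qed
    have lip: "norm (D s - D t) \<le> m / 2 * \<bar>s - t\<bar>" for s t
    proof -
      have "norm (D s - D t) \<le> m / 2 * norm (s - t)"
        by (rule differentiable_bound[of UNIV D "\<lambda>t h. h *\<^sub>R D' t"])
          (use CD on in \<open>auto simp: C1_curve_def has_vector_derivative_def\<close>)
      then show ?thesis by simp
    qed
    have s0: "curve_family (\<lambda>s t. s) (\<lambda>s t. 0::real)" by (rule curve_family_param) (rule continuous_on_id)
    note F = curve_family_add[OF cg curve_family_scaleR[OF s0 cD]]
    have "embedded_isotopy UNIV (\<lambda>t. g t + 0 *\<^sub>R (f t - g t)) (\<lambda>t. g t + 1 *\<^sub>R (f t - g t))"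
    proof (rule embedded_isotopyI[OF F])
      fix s t :: real assume s: "s \<in> {0..1}"
      show "g (t + 1) + s *\<^sub>R (f (t + 1) - g (t + 1)) = g t + s *\<^sub>R (f t - g t)" using f(2) ci(2) by simp
      have "norm (s *\<^sub>R D' t) \<le> 1 * (m / 2)"
        unfolding norm_scaleR using s f(3)[of t] by (intro mult_mono) (auto simp: D'_def less_imp_le)
      then have "norm (s *\<^sub>R D' t) < norm (vector_derivative g (at t))" using m(1) m(3)[of t] by linarith
      then show "vector_derivative g (at t) + (s *\<^sub>R (f' t - vector_derivative g (at t)) + 0 *\<^sub>R (f t - g t)) \<noteq> 0"
        unfolding D'_def by (metis add_eq_0_iff norm_minus_cancel order_less_irrefl add.right_neutral scaleR_zero_left)
      show "t - u \<in> \<int>" if eq: "g t + s *\<^sub>R (f t - g t) = g u + s *\<^sub>R (f u - g u)" for u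
      proof -
        obtain n :: int where n: "\<bar>t - u - of_int n\<bar> \<le> 1/2" "t - u \<in> \<int> \<longleftrightarrow> t - of_int n = u" by (rule shift_near)
        define t' where "t' = t - of_int n"
        have "f t = f t'" "g t = g t'" using periodic_int[of f t t', OF f(2)] periodic_int[of g t t', OF ci(2)] by (simp_all add: t'_def)
        then have "g t' - g u = - (s *\<^sub>R (D t' - D u))" using eq by (simp add: D_def algebra_simps)
        then have "norm (g t' - g u) = \<bar>s\<bar> * norm (D t' - D u)" by (metis norm_minus_cancel norm_scaleR)
        also have "\<dots> \<le> 1 * (m / 2 * \<bar>t' - u\<bar>)" using s lip[of t' u] m(1) by (intro mult_mono) auto
        finally have "norm (g t' - g u) \<le> m / 2 * \<bar>t' - u\<bar>" by simp
        moreover have "m * \<bar>t' - u\<bar> \<le> norm (g t' - g u)" using n(1) by (intro m(2)) (simp add: t'_def algebra_simps)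
        ultimately have "m / 2 * \<bar>t' - u\<bar> \<le> 0" by simp
        then have "t' = u" using m(1) by (simp add: mult_le_0_iff)
        then show ?thesis using n(2) by (simp add: t'_def)
      qed
    qed simp
    then show "embedded_isotopy UNIV g f" by simp
  qed (use m in simp)
qed

text \<open>Averaging over a short interval turns a \<open>C\<^sup>1\<close> curve into a \<open>C\<^sup>1\<close>-close \<open>C\<^sup>2\<close> curve.\<close>

lemma embedding_smoothing:
  fixes g :: "real \<Rightarrow> 'a::euclidean_space"
  assumes "embedding g"
  obtains f f' where "embedded_isotopy UNIV g f" "C1_curve f f'" "\<And>t. f' differentiable (at t)"
proof -
  obtain m where m: "0 < m" "\<And>f f'. C1_curve f f' \<Longrightarrow> (\<And>t. f (t + 1) = f t) \<Longrightarrow>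
     (\<And>t. norm (f' t - vector_derivative g (at t)) < m) \<Longrightarrow> embedded_isotopy UNIV g f"
    using embedding_perturb[OF assms] by metis
  note ci = closed_immersionD[OF assms[unfolded embedding_def, THEN conjunct1]]
  define g' where "g' = (\<lambda>t. vector_derivative g (at t))"
  have C: "C1_curve g g'" and p: "\<And>t. g' (t + 1) = g' t" using ci by (simp_all add: g'_def)
  have gd: "(g has_vector_derivative g' t) (at t)" for t using C by (simp add: C1_curve_def)
  have cont: "continuous_on UNIV g'" and gc: "continuous_on UNIV g" using C C1_curve_cont by (auto simp: C1_curve_def)
  obtain d where d: "0 < d" "\<And>x y. \<bar>x - y\<bar> < d \<Longrightarrow> dist (g' x) (g' y) < m / 2"
    using periodic_uniformly_continuous[OF cont p, of "m / 2"] m(1) by auto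
  \<comment> \<open>Strictly below \<open>d\<close>, so that all velocities entering the average are
    within \<open>m / 2\<close> of the one at \<open>t\<close>.\<close>
  define e where "e = d / 2"
  have e: "0 < e" "e < d" using d by (auto simp: e_def)
  define f where "f = (\<lambda>t. integral (cbox 0 1) (\<lambda>x. g (t + e * x)))"
  \<comment> \<open>The average of \<open>g'\<close> over the interval from \<open>t\<close> to
    \<open>t + e\<close> is a difference quotient of \<open>g\<close>, hence differentiable.\<close>
  define f' where "f' = (\<lambda>t. (1 / e) *\<^sub>R (g (t + e) - g t))"
  have shift: "((\<lambda>t. g (t + a)) has_vector_derivative g' (t + a)) (at t)" for a t
  proof -
    have "((\<lambda>t. t + a) has_vector_derivative 1) (at t)" by (auto intro!: derivative_eq_intros)
    from vector_diff_chain_at[OF this gd] show ?thesis by (simp add: o_def)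
  qed
  have fd: "(f has_vector_derivative f' t) (at t)" for t
  proof -
    have "(f has_vector_derivative integral (cbox 0 1) (\<lambda>x. g' (t + e * x))) (at t)"
      unfolding f_def
    proof (rule leibniz_rule_vector_derivative[where U = UNIV, simplified])
      show "((\<lambda>t. g (t + e * x)) has_vector_derivative g' (t + e * x)) (at t)" for t x by (rule shift)
      show "(\<lambda>x. g (t + e * x)) integrable_on cbox 0 1" for t
        by (intro integrable_continuous continuous_on_compose2[OF gc] continuous_intros) auto
      show "continuous_on (UNIV \<times> cbox 0 1) (\<lambda>(t, x). g' (t + e * x))"
        unfolding case_prod_unfold by (intro continuous_on_compose2[OF cont] continuous_intros) auto
    qed
    moreover have "((\<lambda>x. g' (t + e * x)) has_integral ((1 / e) *\<^sub>R g (t + e * 1) - (1 / e) *\<^sub>R g (t + e * 0))) {0..1}"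
    proof (rule fundamental_theorem_of_calculus)
      fix x :: real
      have "((\<lambda>x. t + e * x) has_vector_derivative e) (at x)" by (auto intro!: derivative_eq_intros)
      from vector_diff_chain_at[OF this gd] have "((\<lambda>x. g (t + e * x)) has_vector_derivative e *\<^sub>R g' (t + e * x)) (at x)"
        by (simp add: o_def)
      from bounded_linear.has_vector_derivative[OF bounded_linear_scaleR_right this, of "1 / e"]
      show "((\<lambda>x. (1 / e) *\<^sub>R g (t + e * x)) has_vector_derivative g' (t + e * x)) (at x within {0..1})"
        using e by (auto intro: has_vector_derivative_at_within)
    qed simp
    then have "integral (cbox 0 1) (\<lambda>x. g' (t + e * x)) = f' t"
      using integral_unique by (force simp: f'_def scaleR_diff_right)
    ultimately show ?thesis by simp
  qed
  have f'd: "(f' has_vector_derivative (1 / e) *\<^sub>R (g' (t + e) - g' t)) (at t)" for t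
    unfolding f'_def
    by (intro bounded_linear.has_vector_derivative[OF bounded_linear_scaleR_right] has_vector_derivative_diff shift gd)
  have "isCont f' t" for t by (rule has_vector_derivative_continuous[OF f'd])
  then have Cf: "C1_curve f f'" unfolding C1_curve_def
    using fd by (auto intro!: continuous_at_imp_continuous_on)
  have per: "f (t + 1) = f t" for t
  proof -
    have "g (t + 1 + e * x) = g (t + e * x)" for x using ci(2)[of "t + e * x"] by (simp add: algebra_simps)
    then show ?thesis by (simp add: f_def)
  qed
  have close: "norm (f' t - vector_derivative g (at t)) < m" for t
  proof -
    have "norm (g' x - g' t) \<le> m / 2" if "x \<in> closed_segment t (t + e)" for x
    proof -
      have "\<bar>x - t\<bar> < d" using that e by (auto simp: closed_segment_eq_real_ivl)
      then show ?thesis using d(2)[of x t] by (simp add: dist_norm)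
    qed
    then have "norm (g (t + e) - g t - ((t + e) - t) *\<^sub>R g' t) \<le> \<bar>(t + e) - t\<bar> * (m / 2)"
      by (rule C1_curve_linearization[OF C])
    then have "norm (g (t + e) - g t - e *\<^sub>R g' t) \<le> e * (m / 2)" using e by simp
    moreover have "f' t - g' t = (1 / e) *\<^sub>R (g (t + e) - g t - e *\<^sub>R g' t)" using e by (simp add: f'_def scaleR_diff_right)
    ultimately have "norm (f' t - g' t) \<le> (1 / e) * (e * (m / 2))"
      using e by (simp only: norm_scaleR) (simp add: field_simps)
    then show ?thesis using e m(1) by (simp add: g'_def)
  qed
  show ?thesis
    by (rule that[OF m(2)[OF Cf per close] Cf]) (use f'd in \<open>auto intro: differentiableI_vector\<close>)
qed

section \<open>Generic projections\<close>

text \<open>Sard's theorem for maps between planes, where plain differentiability is enough. It is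
  transported to coordinates in \<open>real^2\<close> by linear isomorphisms.\<close>

lemma negligible_plane_critical_values:
  fixes f :: "real \<times> real \<Rightarrow> complex"
  assumes d: "\<And>x. x \<in> S \<Longrightarrow> (f has_derivative f' x) (at x)" and ni: "\<And>x. x \<in> S \<Longrightarrow> \<not> inj (f' x)"
  shows "negligible (f ` S)"
proof -
  define e :: "real^2 \<Rightarrow> real \<times> real" where "e = (\<lambda>x. (x $ 1, x $ 2))"
  define k :: "complex \<Rightarrow> real^2" where "k = (\<lambda>z. vector [Re z, Im z])"
  define k' :: "real^2 \<Rightarrow> complex" where "k' = (\<lambda>x. Complex (x $ 1) (x $ 2))"
  define e' :: "real \<times> real \<Rightarrow> real^2" where "e' = (\<lambda>x. vector [fst x, snd x])"
  have le: "linear e" unfolding e_def by (rule linearI) auto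
  have lk: "linear k" unfolding k_def by (rule linearI) (auto simp: vec_eq_iff forall_2)
  have lk': "linear k'" unfolding k'_def by (rule linearI) (auto simp: complex_eq_iff)
  have inv: "k' (k z) = z" "e (e' x) = x" "e' (e y) = y" for z x y
    by (auto simp: k_def k'_def e_def e'_def vec_eq_iff forall_2)
  have injk: "inj k" by (metis inv(1) injI)
  have "negligible ((\<lambda>x. k (f (e x))) ` (e -` S))"
  proof (rule baby_Sard[where f' = "\<lambda>x v. k (f' (e x) (e v))"])
    fix x assume "x \<in> e -` S"
    then have x: "e x \<in> S" by simp
    have "(f \<circ> e has_derivative f' (e x) \<circ> e) (at x)"
      by (rule diff_chain_at[OF linear_imp_has_derivative[OF le] d[OF x]])
    from diff_chain_at[OF this linear_imp_has_derivative[OF lk]]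
    show D: "((\<lambda>x. k (f (e x))) has_derivative (\<lambda>v. k (f' (e x) (e v)))) (at x within e -` S)"
      by (auto simp: o_def intro: has_derivative_at_withinI)
    have lin: "linear (\<lambda>v. k (f' (e x) (e v)))" by (rule has_derivative_linear[OF D])
    have "\<not> inj (\<lambda>v. k (f' (e x) (e v)))"
    proof
      assume i: "inj (\<lambda>v. k (f' (e x) (e v)))"
      have "inj (f' (e x))"
      proof (rule injI)
        fix a b assume "f' (e x) a = f' (e x) b"
        then have "k (f' (e x) (e (e' a))) = k (f' (e x) (e (e' b)))" by (simp add: inv)
        from injD[OF i this] show "a = b" by (metis inv(2))
      qed
      then show False using ni[OF x] by blast
    qed
    then show "rank (matrix (\<lambda>v. k (f' (e x) (e v)))) < CARD(2)"
      using det_nz_iff_inj[OF lin] det_eq_0_rank[of "matrix (\<lambda>v. k (f' (e x) (e v)))"] by simp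
  qed simp
  then have "negligible (k' ` ((\<lambda>x. k (f (e x))) ` (e -` S)))"
    by (rule negligible_differentiable_image_negligible[rotated])
      (use lk' in \<open>auto intro: linear_imp_differentiable_on\<close>)
  moreover have "k' ` ((\<lambda>x. k (f (e x))) ` (e -` S)) = f ` S"
  proof -
    have "f x \<in> (\<lambda>x. f (e x)) ` (e -` S)" if "x \<in> S" for x
      by (rule image_eqI[of _ _ "e' x"]) (use that inv in auto)
    then show ?thesis by (auto simp: image_image inv)
  qed
  ultimately show ?thesis by simp
qed

lemma negligible_AE_lborel: "negligible N \<Longrightarrow> AE x in lborel. x \<notin> N"
  unfolding negligible_iff_null_sets by (metis AE_completion_iff AE_not_in)

text \<open>By Fubini almost every slice of \<open>N\<close> is null. After such a \<open>v\<close>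
  is fixed, \<open>w\<close> has to avoid two null sets. This order of choice allows the second set
  to depend on \<open>v\<close> arbitrarily.\<close>

lemma generic_pair:
  fixes N :: "('a::euclidean_space \<times> 'b::euclidean_space) set"
  assumes "negligible N" "\<And>v. negligible (B v)"
  obtains v w where "(v, w) \<notin> N" "w \<notin> B v"
proof -
  have ex: "\<exists>x. P x" if "AE x in lborel. P x" for P :: "'c::euclidean_space \<Rightarrow> bool"
  proof -
    have "ae_filter (lborel :: 'c measure) \<noteq> bot" by (simp add: ae_filter_eq_bot_iff)
    then show ?thesis using that eventually_happens by blast
  qed
  have "AE x in (lborel :: 'a measure) \<Otimes>\<^sub>M (lborel :: 'b measure). x \<notin> N"
    unfolding lborel_prod by (rule negligible_AE_lborel[OF assms(1)])
  then have "AE v in lborel. AE w in lborel. (v, w) \<notin> N" by (rule lborel_pair.AE_pair)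
  from ex[OF this] obtain v where v: "AE w in lborel. (v, w) \<notin> N" by blast
  have "AE w in lborel. (v, w) \<notin> N \<and> w \<notin> B v"
    using v negligible_AE_lborel[OF assms(2)[of v]] by eventually_elim simp
  from ex[OF this] show ?thesis using that by blast
qed

text \<open>The linear part grows at rate at least \<open>B\<close>, while near \<open>x\<close> the
  remainder is at most half of that, so no other zero fits.\<close>

lemma isolated_zero_of_injective_derivative:
  fixes f :: "'a::euclidean_space \<Rightarrow> 'b::euclidean_space"
  assumes "(f has_derivative f') (at x)" "inj f'" "f x = 0"
  obtains d where "0 < d" "\<And>y. dist y x < d \<Longrightarrow> f y = 0 \<Longrightarrow> y = x"
proof -
  have bl: "bounded_linear f'" using assms(1) has_derivative_bounded_linear by blast
  obtain B where B: "B > 0" "\<And>x. B * norm x \<le> norm (f' x)"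
    using linear_inj_bounded_below_pos[OF bounded_linear.linear[OF bl] assms(2)] by blast
  obtain d where d: "d > 0" "\<And>y. norm (y - x) < d \<Longrightarrow> norm (f y - f x - f' (y - x)) \<le> B / 2 * norm (y - x)"
    using assms(1) B(1) unfolding has_derivative_at_alt by (metis half_gt_zero)
  show ?thesis
  proof (rule that[OF d(1)])
    fix y assume y: "dist y x < d" "f y = 0"
    have "norm (f' (y - x)) \<le> B / 2 * norm (y - x)" using d(2)[of y] y assms(3) by (simp add: dist_norm)
    then have "B * norm (y - x) \<le> B / 2 * norm (y - x)" using B(2)[of "y - x"] by linarith
    then have "norm (y - x) \<le> 0" using B(1) by simp
    then show "y = x" by simp
  qed
qed

text \<open>A crossing is a zero of \<open>c s - c t\<close>; transversality says that the
  derivative of this map is injective, so zeros are isolated. The immersion bound keeps them away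
  from the diagonal, hence in a compact set.\<close>

lemma finite_double_points:
  fixes c :: "real \<Rightarrow> 'a::euclidean_space"
  assumes ci: "closed_immersion c"
    and tr: "\<And>s t. double_pair c s t \<Longrightarrow> indep (vector_derivative c (at s)) (vector_derivative c (at t))"
  shows "finite {s\<in>{0..<1}. \<exists>t. double_pair c s t}"
proof -
  note cd = closed_immersionD[OF ci]
  obtain d m where dm: "0 < d" "0 < m" "\<And>s t. \<bar>s - t\<bar> < d \<Longrightarrow> m * \<bar>s - t\<bar> \<le> norm (c s - c t)"
    using immersion_local_bound[OF ci] by metis
  have cc: "continuous_on UNIV c" by (rule C1_curve_cont[OF cd(1)])
  \<comment> \<open>The bound \<open>1 - d\<close> keeps the pair away from the diagonal across the
    seam of the circle, where 0 and 1 are one point.\<close>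
  define P where "P = {x \<in> {0..1} \<times> {0..1}. c (fst x) = c (snd x) \<and> d \<le> \<bar>fst x - snd x\<bar> \<and> \<bar>fst x - snd x\<bar> \<le> 1 - d}"
  have near: "s = t" if "c s = c t" "\<bar>s - t\<bar> < d" for s t
    using dm(3)[OF that(2)] that(1) dm(2) by (auto simp: mult_le_0_iff)
  have Pdp: "double_pair c (fst x) (snd x)" if "x \<in> P" for x
  proof -
    have "fst x - snd x \<notin> \<int>"
    proof
      assume "fst x - snd x \<in> \<int>"
      then obtain n :: int where n: "fst x - snd x = of_int n" by (auto elim: Ints_cases)
      then have "real_of_int \<bar>n\<bar> < 1" "n \<noteq> 0" using that dm(1) by (auto simp: P_def)
      then show False by simp
    qed
    then show ?thesis using that by (simp add: P_def double_pair_def)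
  qed
  have "compact P"
  proof -
    have "compact ({0..1::real} \<times> {0..1::real})" by (intro compact_Times) auto
    moreover have "closed {x. c (fst x) = c (snd x)}"
      by (intro closed_Collect_eq continuous_on_compose2[OF cc] continuous_intros) auto
    moreover have "closed {x :: real \<times> real. d \<le> \<bar>fst x - snd x\<bar>}" "closed {x :: real \<times> real. \<bar>fst x - snd x\<bar> \<le> 1 - d}"
      by (intro closed_Collect_le continuous_intros)+
    ultimately have "compact (({0..1} \<times> {0..1}) \<inter> {x. c (fst x) = c (snd x)} \<inter> {x. d \<le> \<bar>fst x - snd x\<bar>} \<inter> {x. \<bar>fst x - snd x\<bar> \<le> 1 - d})"
      by (intro compact_Int_closed)
    also have "({0..1} \<times> {0..1}) \<inter> {x. c (fst x) = c (snd x)} \<inter> {x. d \<le> \<bar>fst x - snd x\<bar>} \<inter> {x. \<bar>fst x - snd x\<bar> \<le> 1 - d} = P"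
      by (auto simp: P_def)
    finally show ?thesis .
  qed
  have "finite P"
  proof (rule ccontr)
    assume "infinite P"
    then obtain x where x: "x \<in> P" "x islimpt P"
      using \<open>compact P\<close> unfolding compact_eq_Bolzano_Weierstrass by blast
    let ?G = "\<lambda>y. c (fst y) - c (snd y)"
    let ?G' = "\<lambda>y. fst y *\<^sub>R vector_derivative c (at (fst x)) - snd y *\<^sub>R vector_derivative c (at (snd x))"
    have cdv: "(c has_derivative (\<lambda>h. h *\<^sub>R vector_derivative c (at t))) (at t)" for t
      using cd(1) by (simp add: C1_curve_def has_vector_derivative_def)
    have "(?G has_derivative ?G') (at x)"
      using has_derivative_diff[OF
          diff_chain_at[OF bounded_linear_imp_has_derivative[OF bounded_linear_fst] cdv]
          diff_chain_at[OF bounded_linear_imp_has_derivative[OF bounded_linear_snd] cdv], of x]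
      by (simp add: o_def)
    moreover have "inj ?G'"
    proof (rule injI)
      fix y z assume "?G' y = ?G' z"
      then have "(fst y - fst z) *\<^sub>R vector_derivative c (at (fst x)) + (snd z - snd y) *\<^sub>R vector_derivative c (at (snd x)) = 0"
        by (simp add: algebra_simps)
      then have "fst y - fst z = 0 \<and> snd z - snd y = 0" using tr[OF Pdp[OF x(1)]] unfolding indep_def by blast
      then show "y = z" by (simp add: prod_eq_iff)
    qed
    moreover have "?G x = 0" using x(1) by (simp add: P_def)
    ultimately obtain e where e: "0 < e" "\<And>y. dist y x < e \<Longrightarrow> ?G y = 0 \<Longrightarrow> y = x"
      using isolated_zero_of_injective_derivative[of ?G ?G' x] by blast
    obtain y where "y \<in> P" "y \<noteq> x" "dist y x < e" using x(2) e(1) unfolding islimpt_approachable by blast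
    then show False using e(2)[of y] by (simp add: P_def)
  qed
  moreover have "{s\<in>{0..<1}. \<exists>t. double_pair c s t} \<subseteq> fst ` P"
  proof
    fix s assume "s \<in> {s\<in>{0..<1}. \<exists>t. double_pair c s t}"
    then obtain t where s: "0 \<le> s" "s < 1" "double_pair c s t" by auto
    define u where "u = frac t"
    have u: "0 \<le> u" "u < 1" using frac_in_unit[of t] by (auto simp: u_def)
    have dp: "double_pair c s u" using s(3) double_pair_cong[of c s s t u, OF cd(2)] frac_diff_Ints[of t]
      by (simp add: u_def Ints_diff_sym)
    then have ce: "c s = c u" and ni: "s - u \<notin> \<int>" by (simp_all add: double_pair_def)
    have "\<not> \<bar>s - u\<bar> < d" using near[OF ce] ni by auto
    moreover have "\<not> \<bar>s - (u + 1)\<bar> < d"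
      using near[of s "u + 1"] ce cd(2)[of u] ni by auto
    moreover have "\<not> \<bar>s - (u - 1)\<bar> < d"
      using near[of s "u - 1"] ce cd(2)[of "u - 1"] ni by auto
    ultimately have "(s, u) \<in> P" using s u ce by (auto simp: P_def abs_if split: if_splits)
    then show "s \<in> fst ` P" by force
  qed
  ultimately show ?thesis by (meson finite_imageI finite_subset)
qed

text \<open>Generic shears \<open>(z, h) \<mapsto> (z - w h - v h\<^sup>2, h)\<close>: a triple point determines \<open>(v, w)\<close> from three
  parameters, so it occurs only on a null set of the four-dimensional parameter space. For fixed \<open>v\<close>,
  a non-transverse crossing makes \<open>w\<close> a critical value of the slope
  \<open>(Z s - Z t) / (h s - h t)\<close> with \<open>Z = z - v h\<^sup>2\<close>, and a stationary point makes \<open>w\<close> a value of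
  \<open>Z' / h'\<close>.\<close>

lemma generic_shear:
  fixes z :: "real \<Rightarrow> complex" and h :: "real \<Rightarrow> real"
  assumes zd: "\<And>t. (z has_vector_derivative z' t) (at t)" and hd: "\<And>t. (h has_vector_derivative h' t) (at t)"
    and z'd: "\<And>t. z' differentiable (at t)" and h'd: "\<And>t. h' differentiable (at t)"
    and imm: "\<And>t. h' t = 0 \<Longrightarrow> z' t \<noteq> 0"
  obtains v w where
    "\<And>t. z' t - (2 * h t * h' t) *\<^sub>R v - h' t *\<^sub>R w \<noteq> 0"
    "\<And>s t. h s \<noteq> h t \<Longrightarrow> z s - (h s)\<^sup>2 *\<^sub>R v - h s *\<^sub>R w = z t - (h t)\<^sup>2 *\<^sub>R v - h t *\<^sub>R w \<Longrightarrow>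
      indep (z' s - (2 * h s * h' s) *\<^sub>R v - h' s *\<^sub>R w) (z' t - (2 * h t * h' t) *\<^sub>R v - h' t *\<^sub>R w)"
    "\<And>s t r. h s \<noteq> h t \<Longrightarrow> h t \<noteq> h r \<Longrightarrow> h s \<noteq> h r \<Longrightarrow>
      z s - (h s)\<^sup>2 *\<^sub>R v - h s *\<^sub>R w = z t - (h t)\<^sup>2 *\<^sub>R v - h t *\<^sub>R w \<Longrightarrow>
      z t - (h t)\<^sup>2 *\<^sub>R v - h t *\<^sub>R w = z r - (h r)\<^sup>2 *\<^sub>R v - h r *\<^sub>R w \<Longrightarrow> False"
proof -
  have zdi: "z differentiable (at t)" and hdi: "h differentiable (at t)" for t
    using zd hd differentiableI_vector by blast+
  \<comment> \<open>First and second divided differences of \<open>z\<close> with respect to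
    \<open>h\<close>. At a triple point of the sheared curve \<open>z\<close> agrees with a
    quadratic polynomial in \<open>h\<close> at three heights, so its coefficients \<open>v\<close>
    and \<open>w\<close> are recovered from these quotients.\<close>
  define Aq where "Aq = (\<lambda>s t. inverse (h s - h t) *\<^sub>R (z s - z t))"
  define Vq where "Vq = (\<lambda>s t r. inverse (h s - h r) *\<^sub>R (Aq s t - Aq t r))"
  define T where "T = {x :: real \<times> real \<times> real. h (fst x) \<noteq> h (fst (snd x)) \<and> h (fst (snd x)) \<noteq> h (snd (snd x)) \<and> h (fst x) \<noteq> h (snd (snd x))}"
  define f where "f = (\<lambda>x :: real \<times> real \<times> real. (Vq (fst x) (fst (snd x)) (snd (snd x)),
     Aq (fst x) (fst (snd x)) - (h (fst x) + h (fst (snd x))) *\<^sub>R Vq (fst x) (fst (snd x)) (snd (snd x))))"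
  have cmp: "(\<lambda>x. z (p x)) differentiable (at x)" "(\<lambda>x. h (p x)) differentiable (at x)"
    if "p differentiable (at x)" for p :: "real \<times> real \<times> real \<Rightarrow> real" and x
    using differentiable_compose[OF zdi that] differentiable_compose[OF hdi that] .
  have pr: "(\<lambda>x::real \<times> real \<times> real. fst x) differentiable (at x)" "(\<lambda>x::real \<times> real \<times> real. fst (snd x)) differentiable (at x)"
    "(\<lambda>x::real \<times> real \<times> real. snd (snd x)) differentiable (at x)" for x
    by (auto intro!: bounded_linear_imp_differentiable bounded_linear_fst bounded_linear_compose[OF bounded_linear_fst bounded_linear_snd]
      bounded_linear_compose[OF bounded_linear_snd bounded_linear_snd])
  have "f differentiable (at x)" if "x \<in> T" for x
    using that unfolding f_def Vq_def Aq_def T_def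
    by (intro differentiable_Pair differentiable_diff differentiable_scaleR differentiable_inverse differentiable_add cmp pr) auto
  then have "f differentiable_on T" by (simp add: differentiable_at_imp_differentiable_on)
  \<comment> \<open>Three real parameters against the four real dimensions of the pairs
    \<open>(v, w)\<close>.\<close>
  then have N: "negligible (f ` T)" by (rule negligible_differentiable_image_lowdim[rotated]) simp
  define Z where "Z = (\<lambda>v t. z t - (h t)\<^sup>2 *\<^sub>R v)"
  define Z' where "Z' = (\<lambda>v t. z' t - (2 * h t * h' t) *\<^sub>R v)"
  have Zd: "(Z v has_derivative (\<lambda>x. x *\<^sub>R Z' v t)) (at t)" for v t
  proof -
    have "((\<lambda>t. (h t)\<^sup>2) has_vector_derivative 2 * h t * h' t) (at t)"
      using hd[of t] unfolding has_real_derivative_iff_has_vector_derivative[symmetric]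
      by (auto intro!: derivative_eq_intros)
    from has_vector_derivative_diff[OF zd bounded_linear.has_vector_derivative[OF bounded_linear_scaleR_left this]]
    show ?thesis by (simp add: Z_def Z'_def has_vector_derivative_def)
  qed
  have hdv: "(h has_derivative (\<lambda>x. x *\<^sub>R h' t)) (at t)" for t using hd[of t] by (simp add: has_vector_derivative_def)
  define \<Phi> where "\<Phi> = (\<lambda>v x. inverse (h (fst x) - h (snd x)) *\<^sub>R (Z v (fst x) - Z v (snd x)))"
  \<comment> \<open>The derivative of the slope in a form that displays the tangents of the curve
    sheared with \<open>w = \<Phi> v x\<close>; injectivity of it is transversality at the
    crossing.\<close>
  define \<Phi>' where "\<Phi>' = (\<lambda>v x y. inverse (h (fst x) - h (snd x)) *\<^sub>R (fst y *\<^sub>R (Z' v (fst x) - h' (fst x) *\<^sub>R \<Phi> v x) - snd y *\<^sub>R (Z' v (snd x) - h' (snd x) *\<^sub>R \<Phi> v x)))"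
  have \<Phi>d: "(\<Phi> v has_derivative \<Phi>' v x) (at x)" if "h (fst x) \<noteq> h (snd x)" for v x
  proof -
    let ?a = "h (fst x) - h (snd x)"
    have D1: "((\<lambda>x. h (fst x) - h (snd x)) has_derivative (\<lambda>y. fst y *\<^sub>R h' (fst x) - snd y *\<^sub>R h' (snd x))) (at x)"
      using has_derivative_diff[OF
          diff_chain_at[OF bounded_linear_imp_has_derivative[OF bounded_linear_fst] hdv]
          diff_chain_at[OF bounded_linear_imp_has_derivative[OF bounded_linear_snd] hdv], of x] by (simp add: o_def)
    have D2: "((\<lambda>x. Z v (fst x) - Z v (snd x)) has_derivative (\<lambda>y. fst y *\<^sub>R Z' v (fst x) - snd y *\<^sub>R Z' v (snd x))) (at x)"
      using has_derivative_diff[OF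
          diff_chain_at[OF bounded_linear_imp_has_derivative[OF bounded_linear_fst] Zd[of v]]
          diff_chain_at[OF bounded_linear_imp_has_derivative[OF bounded_linear_snd] Zd[of v]], of x] by (simp add: o_def)
    have nz: "?a \<noteq> 0" using that by simp
    have "(\<Phi> v has_derivative (\<lambda>y. inverse ?a *\<^sub>R (fst y *\<^sub>R Z' v (fst x) - snd y *\<^sub>R Z' v (snd x)) +
        (- (inverse ?a * (fst y *\<^sub>R h' (fst x) - snd y *\<^sub>R h' (snd x)) * inverse ?a)) *\<^sub>R (Z v (fst x) - Z v (snd x)))) (at x)"
      unfolding \<Phi>_def by (rule has_derivative_scaleR[OF Deriv.has_derivative_inverse[OF nz D1] D2])
    moreover have "(\<lambda>y. inverse ?a *\<^sub>R (fst y *\<^sub>R Z' v (fst x) - snd y *\<^sub>R Z' v (snd x)) +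
        (- (inverse ?a * (fst y *\<^sub>R h' (fst x) - snd y *\<^sub>R h' (snd x)) * inverse ?a)) *\<^sub>R (Z v (fst x) - Z v (snd x))) = \<Phi>' v x"
    proof
      fix y
      have e: "Z v (fst x) - Z v (snd x) = ?a *\<^sub>R \<Phi> v x" using nz by (simp add: \<Phi>_def)
      show "inverse ?a *\<^sub>R (fst y *\<^sub>R Z' v (fst x) - snd y *\<^sub>R Z' v (snd x)) +
        (- (inverse ?a * (fst y *\<^sub>R h' (fst x) - snd y *\<^sub>R h' (snd x)) * inverse ?a)) *\<^sub>R (Z v (fst x) - Z v (snd x)) = \<Phi>' v x y"
      proof -
        define i where "i = inverse ?a"
        have "i * ?a = 1" using nz by (simp add: i_def)
        then have cancel: "(- (i * q * i)) *\<^sub>R (?a *\<^sub>R \<Phi> v x) = - ((i * q) *\<^sub>R \<Phi> v x)" for q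
          by (metis mult.assoc mult.right_neutral mult_minus_left scaleR_minus_left scaleR_scaleR)
        show ?thesis unfolding e \<Phi>'_def i_def[symmetric] cancel by (simp add: algebra_simps)
      qed
    qed
    ultimately show ?thesis by simp
  qed
  define B1 where "B1 = (\<lambda>v. \<Phi> v ` {x. h (fst x) \<noteq> h (snd x) \<and> \<not> inj (\<Phi>' v x)})"
  \<comment> \<open>The values of \<open>w\<close> for which the sheared velocity vanishes
    somewhere. They are the image of a subset of the line in the plane under a differentiable map,
    which is where differentiable velocities are used.\<close>
  define B2 where "B2 = (\<lambda>v. (\<lambda>t. inverse (h' t) *\<^sub>R Z' v t) ` {t. h' t \<noteq> 0})"
  have "negligible (B1 v)" for v
    unfolding B1_def by (rule negligible_plane_critical_values[of _ _ "\<Phi>' v"]) (use \<Phi>d in auto)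
  moreover have "negligible (B2 v)" for v
    unfolding B2_def
  proof (rule negligible_differentiable_image_lowdim)
    have "(\<lambda>t. inverse (h' t) *\<^sub>R Z' v t) differentiable (at t)" if "h' t \<noteq> 0" for t
      using that unfolding Z'_def
      by (intro differentiable_scaleR differentiable_inverse differentiable_diff differentiable_mult z'd h'd hdi) auto
    then show "(\<lambda>t. inverse (h' t) *\<^sub>R Z' v t) differentiable_on {t. h' t \<noteq> 0}"
      by (intro differentiable_at_imp_differentiable_on) auto
  qed simp
  ultimately have "\<And>v. negligible (B1 v \<union> B2 v)" by simp
  then obtain v w where vw: "(v, w) \<notin> f ` T" "w \<notin> B1 v \<union> B2 v"
    using generic_pair[OF N, of "\<lambda>v. B1 v \<union> B2 v"] by blast
  show ?thesis
  proof (rule that[of v w])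
    fix t
    show "z' t - (2 * h t * h' t) *\<^sub>R v - h' t *\<^sub>R w \<noteq> 0"
    proof
      assume 0: "z' t - (2 * h t * h' t) *\<^sub>R v - h' t *\<^sub>R w = 0"
      show False
      proof (cases "h' t = 0")
        case True
        then show ?thesis using 0 imm by simp
      next
        case False
        then have "w = inverse (h' t) *\<^sub>R (h' t *\<^sub>R w)" by simp
        also have "h' t *\<^sub>R w = Z' v t" using 0 by (simp add: Z'_def)
        finally show ?thesis using vw(2) False by (auto simp: B2_def)
      qed
    qed
  next
    fix s t assume h: "h s \<noteq> h t" and e: "z s - (h s)\<^sup>2 *\<^sub>R v - h s *\<^sub>R w = z t - (h t)\<^sup>2 *\<^sub>R v - h t *\<^sub>R w"
    have "Z v s - Z v t = (h s - h t) *\<^sub>R w" using e by (simp add: Z_def algebra_simps)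
    then have w: "\<Phi> v (s, t) = w" using h by (simp add: \<Phi>_def)
    \<comment> \<open>\<open>w\<close> is a regular value of the slope map, and
      \<open>(s, t)\<close> is one of its preimages.\<close>
    have i: "inj (\<Phi>' v (s, t))" using vw(2) w h unfolding B1_def by force
    show "indep (z' s - (2 * h s * h' s) *\<^sub>R v - h' s *\<^sub>R w) (z' t - (2 * h t * h' t) *\<^sub>R v - h' t *\<^sub>R w)"
      unfolding indep_def Z'_def[symmetric]
    proof (intro allI impI)
      fix x y assume "x *\<^sub>R (z' s - (2 * h s * h' s) *\<^sub>R v - h' s *\<^sub>R w) + y *\<^sub>R (z' t - (2 * h t * h' t) *\<^sub>R v - h' t *\<^sub>R w) = 0"
      then have "\<Phi>' v (s, t) (x, - y) = \<Phi>' v (s, t) (0, 0)" unfolding \<Phi>'_def w by (simp add: Z'_def)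
      from injD[OF i this] show "x = 0 \<and> y = 0" by simp
    qed
  next
    fix s t r assume h: "h s \<noteq> h t" "h t \<noteq> h r" "h s \<noteq> h r"
      and e: "z s - (h s)\<^sup>2 *\<^sub>R v - h s *\<^sub>R w = z t - (h t)\<^sup>2 *\<^sub>R v - h t *\<^sub>R w"
        "z t - (h t)\<^sup>2 *\<^sub>R v - h t *\<^sub>R w = z r - (h r)\<^sup>2 *\<^sub>R v - h r *\<^sub>R w"
    have A: "Aq s t = w + (h s + h t) *\<^sub>R v" if "h s \<noteq> h t" "z s - (h s)\<^sup>2 *\<^sub>R v - h s *\<^sub>R w = z t - (h t)\<^sup>2 *\<^sub>R v - h t *\<^sub>R w" for s t
    proof -
      have "z s - z t = (h s - h t) *\<^sub>R (w + (h s + h t) *\<^sub>R v)"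
        using that(2) by (simp add: algebra_simps power2_eq_square)
      then show ?thesis using that(1) by (simp add: Aq_def)
    qed
    have "Aq s t - Aq t r = (h s - h r) *\<^sub>R v" using A[OF h(1) e(1)] A[OF h(2) e(2)] by (simp add: algebra_simps)
    then have V: "Vq s t r = v" using h(3) by (simp add: Vq_def)
    have "f (s, t, r) = (v, w)" unfolding f_def using V A[OF h(1) e(1)] by simp
    moreover have "(s, t, r) \<in> T" using h by (simp add: T_def)
    ultimately show False using vw(1) by (metis image_eqI)
  qed
qed

section \<open>Moving a knot into 3-space\<close>

text \<open>A knot missing the point \<open>p\<close> is carried off the centre \<open>(0, 1)\<close> of the stereographic
  projection by rotations in a plane containing \<open>p\<close> and \<open>(0, 1)\<close>.\<close>

lemma plane_rotation_isometry:
  fixes p e x :: "'a::real_inner"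
  assumes "p \<bullet> p = 1" "e \<bullet> e = 1" "p \<bullet> e = 0" "C\<^sup>2 + S\<^sup>2 = 1"
  defines "A \<equiv> (C - 1) * (p \<bullet> x) - S * (e \<bullet> x)" and "B \<equiv> S * (p \<bullet> x) + (C - 1) * (e \<bullet> x)"
  shows "(x + A *\<^sub>R p + B *\<^sub>R e) \<bullet> (x + A *\<^sub>R p + B *\<^sub>R e) = x \<bullet> x"
proof -
  have "(x + A *\<^sub>R p + B *\<^sub>R e) \<bullet> (x + A *\<^sub>R p + B *\<^sub>R e) = x \<bullet> x + 2 * A * (p \<bullet> x) + 2 * B * (e \<bullet> x) + A\<^sup>2 + B\<^sup>2"
    using assms(1-3) by (simp add: inner_add_left inner_add_right inner_commute[of x p] inner_commute[of x e]
        inner_commute[of e p] power2_eq_square algebra_simps)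
  also have "2 * A * (p \<bullet> x) + 2 * B * (e \<bullet> x) + A\<^sup>2 + B\<^sup>2 = (C\<^sup>2 + S\<^sup>2 - 1) * ((p \<bullet> x)\<^sup>2 + (e \<bullet> x)\<^sup>2)"
    unfolding A_def B_def by (simp add: power2_eq_square algebra_simps)
  then have "x \<bullet> x + 2 * A * (p \<bullet> x) + 2 * B * (e \<bullet> x) + A\<^sup>2 + B\<^sup>2 = x \<bullet> x" using assms(4) by simp
  finally show ?thesis .
qed

lemma stereo_inv_right:
  assumes "y \<in> sphere 0 1" "snd y \<noteq> 1" shows "stereo_inv (inverse (1 - snd y) *\<^sub>R fst y) = y"
proof -
  obtain u b where y: "y = (u, b)" by fastforce
  have n: "u \<bullet> u = 1 - b\<^sup>2" and b: "1 - b \<noteq> 0" using assms by (auto simp: y norm_eq_1 power2_eq_square)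
  define i where "i = inverse (1 - b)"
  have i: "i * (1 - b) = 1" using b by (simp add: i_def)
  have i': "i * b = i - 1" using i by (simp add: algebra_simps)
  have q: "(norm (i *\<^sub>R u))\<^sup>2 = 2 * i - 1"
  proof -
    have "(norm (i *\<^sub>R u))\<^sup>2 = i * i * (u \<bullet> u)" unfolding power2_norm_eq_inner by simp
    also have "\<dots> = (i * (1 - b)) * (i + i * b)" unfolding n by (simp add: power2_eq_square algebra_simps)
    finally show ?thesis using i i' by simp
  qed
  have i0: "i \<noteq> 0" using b by (simp add: i_def)
  have "stereo_inv (i *\<^sub>R u) = ((2 / (2 * i)) *\<^sub>R (i *\<^sub>R u), (2 * i - 2) / (2 * i))"
    unfolding stereo_inv_def q by simp
  also have "\<dots> = (u, b)" using i0 i' by (simp add: field_simps)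
  finally show ?thesis by (simp add: y i_def)
qed

lemma knot_in_R3:
  assumes "is_knot \<gamma>"
  obtains g :: "real \<Rightarrow> R3" where "embedding g" "embedded_isotopy (sphere 0 1) \<gamma> (\<lambda>t. stereo_inv (g t))"
proof -
  have E: "embedding \<gamma>" and S: "range \<gamma> \<subseteq> sphere 0 1" using assms by (auto simp: is_knot_def embedding_def)
  note ci = closed_immersionD[OF E[unfolded embedding_def, THEN conjunct1]]
  define nu :: R4 where "nu = (0, 1)"
  have \<gamma>d: "\<gamma> differentiable (at t)" for t using ci(1) unfolding C1_curve_def by (blast intro: differentiableI_vector)
  \<comment> \<open>The cone over the knot is the image of a plane in a space of dimension 4, hence
    null; a vector \<open>q\<close> off this cone and off the axis of \<open>nu\<close> gives the
    missed point \<open>p\<close>.\<close>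
  have "(\<lambda>x. fst x *\<^sub>R \<gamma> (snd x)) differentiable (at x)" for x :: "real \<times> real"
    by (intro differentiable_scaleR differentiable_compose[OF \<gamma>d] bounded_linear_imp_differentiable bounded_linear_fst bounded_linear_snd)
  then have "negligible ((\<lambda>x::real \<times> real. fst x *\<^sub>R \<gamma> (snd x)) ` UNIV)"
    by (intro negligible_differentiable_image_lowdim differentiable_at_imp_differentiable_on) auto
  moreover have "negligible ((\<lambda>x::real. x *\<^sub>R nu) ` UNIV)"
    by (intro negligible_differentiable_image_lowdim differentiable_at_imp_differentiable_on
        bounded_linear_imp_differentiable bounded_linear_scaleR_left) auto
  ultimately have "negligible (range (\<lambda>x::real \<times> real. fst x *\<^sub>R \<gamma> (snd x)) \<union> range (\<lambda>x::real. x *\<^sub>R nu))" by simp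
  then have "range (\<lambda>x::real \<times> real. fst x *\<^sub>R \<gamma> (snd x)) \<union> range (\<lambda>x::real. x *\<^sub>R nu) \<noteq> UNIV"
    using non_negligible_UNIV by metis
  then obtain q where q: "q \<notin> range (\<lambda>x::real \<times> real. fst x *\<^sub>R \<gamma> (snd x))" "q \<notin> range (\<lambda>x::real. x *\<^sub>R nu)" by blast
  have "0 \<in> range (\<lambda>x::real. x *\<^sub>R nu)" by (rule range_eqI[of _ _ 0]) simp
  then have q0: "q \<noteq> 0" using q(2) by blast
  define p where "p = inverse (norm q) *\<^sub>R q"
  have pq: "q = norm q *\<^sub>R p" using q0 by (simp add: p_def)
  have "norm p = 1" using q0 by (simp add: p_def)
  then have p: "p \<bullet> p = 1" by (simp only: norm_eq_1)
  have p\<gamma>: "\<gamma> t \<noteq> p" for t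
  proof
    assume "\<gamma> t = p"
    then have "q = fst (norm q, t) *\<^sub>R \<gamma> (snd (norm q, t))" using pq by simp
    then have "q \<in> range (\<lambda>x::real \<times> real. fst x *\<^sub>R \<gamma> (snd x))" by (rule range_eqI)
    then show False using q(1) by contradiction
  qed
  define c where "c = p \<bullet> nu"
  \<comment> \<open>The part of \<open>nu\<close> orthogonal to \<open>p\<close>, nonzero because
    \<open>q\<close> is off the axis.\<close>
  define e0 where "e0 = nu - c *\<^sub>R p"
  have nn: "nu \<bullet> nu = 1" by (simp add: nu_def)
  have e0: "e0 \<bullet> e0 = 1 - c\<^sup>2" "p \<bullet> e0 = 0"
    using p nn by (simp_all add: e0_def c_def inner_diff_left inner_diff_right inner_commute[of nu p] power2_eq_square)
  have e0nz: "e0 \<noteq> 0"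
  proof
    assume "e0 = 0"
    then have n: "nu = c *\<^sub>R p" by (simp add: e0_def)
    then have "c \<noteq> 0" using nn by auto
    then have "p = inverse c *\<^sub>R nu" using n by simp
    then have "norm q *\<^sub>R p = (norm q * inverse c) *\<^sub>R nu" by simp
    then have "q = (norm q * inverse c) *\<^sub>R nu" using pq by simp
    then have "q \<in> range (\<lambda>x::real. x *\<^sub>R nu)" by (rule range_eqI)
    then show False using q(2) by contradiction
  qed
  define s where "s = norm e0"
  define e where "e = inverse s *\<^sub>R e0"
  have s: "s \<noteq> 0" "s\<^sup>2 = 1 - c\<^sup>2" using e0nz e0(1) by (simp_all add: s_def power2_norm_eq_inner)
  have "norm e = 1" using e0nz by (simp add: e_def s_def)
  then have e: "e \<bullet> e = 1" "p \<bullet> e = 0" using e0(2) by (simp_all only: norm_eq_1) (simp add: e_def)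
  have nu: "nu = c *\<^sub>R p + s *\<^sub>R e" using s by (simp add: e_def e0_def)
  obtain \<theta> where th: "c = cos \<theta>" "s = sin \<theta>" using sincos_total_2pi[of c s] s(2) by auto
  \<comment> \<open>Rotation by \<open>\<phi>\<close> in the plane of \<open>p\<close> and
    \<open>e\<close>, the identity on its orthogonal complement. It is linear, so velocities are
    rotated as well.\<close>
  define R where "R = (\<lambda>\<phi> x. x + ((cos \<phi> - 1) * (p \<bullet> x) - sin \<phi> * (e \<bullet> x)) *\<^sub>R p + (sin \<phi> * (p \<bullet> x) + (cos \<phi> - 1) * (e \<bullet> x)) *\<^sub>R e)"
  have iso: "R \<phi> x \<bullet> R \<phi> x = x \<bullet> x" for \<phi> x
    unfolding R_def by (rule plane_rotation_isometry[OF p e]) simp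
  have lin: "R \<phi> x - R \<phi> y = R \<phi> (x - y)" for \<phi> x y
    by (simp add: R_def inner_diff_right algebra_simps)
  have inj: "x = y" if "R \<phi> x = R \<phi> y" for \<phi> x y
    using lin[of \<phi> x y] iso[of \<phi> "x - y"] that by simp
  have Rp: "R \<theta> p = nu"
    using p e(2) unfolding nu by (simp add: R_def th inner_commute[of e p] algebra_simps)
  have cs: "continuous_on {0..1} (\<lambda>x. cos (x * \<theta>) - 1)" "continuous_on {0..1} (\<lambda>x. sin (x * \<theta>))"
    by (intro continuous_intros)+
  note G = curve_family_const[OF ci(1)]
  note fc = curve_family_param[OF cs(1)] and fs = curve_family_param[OF cs(2)]
  note pg = curve_family_linear[OF bounded_linear_inner_right G, of p] and eg = curve_family_linear[OF bounded_linear_inner_right G, of e]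
  note F = curve_family_add[OF curve_family_add[OF G curve_family_linear[OF bounded_linear_scaleR_left
      curve_family_diff[OF curve_family_mult[OF fc pg] curve_family_mult[OF fs eg]], of p]]
      curve_family_linear[OF bounded_linear_scaleR_left curve_family_add[OF curve_family_mult[OF fs pg] curve_family_mult[OF fc eg]], of e]]
  have "curve_family (\<lambda>x t. R (x * \<theta>) (\<gamma> t)) (\<lambda>x t. R (x * \<theta>) (vector_derivative \<gamma> (at t)))"
    using F by (simp add: R_def)
  then have "embedded_isotopy (sphere 0 1) (\<lambda>t. R (0 * \<theta>) (\<gamma> t)) (\<lambda>t. R (1 * \<theta>) (\<gamma> t))"
  proof (rule embedded_isotopyI)
    fix x t u :: real
    show "R (x * \<theta>) (\<gamma> (t + 1)) = R (x * \<theta>) (\<gamma> t)" using ci(2) by simp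
    show "R (x * \<theta>) (vector_derivative \<gamma> (at t)) \<noteq> 0"
      using iso[of "x * \<theta>" "vector_derivative \<gamma> (at t)"] ci(3)[of t] by auto
    show "t - u \<in> \<int>" if "R (x * \<theta>) (\<gamma> t) = R (x * \<theta>) (\<gamma> u)"
      using inj[OF that] E unfolding embedding_def double_pair_def by blast
    show "R (x * \<theta>) (\<gamma> t) \<in> sphere 0 1" using iso[of "x * \<theta>" "\<gamma> t"] S by (auto simp: norm_eq_1 image_subset_iff)
  qed
  moreover have "R 0 x = x" for x by (simp add: R_def)
  ultimately have I: "embedded_isotopy (sphere 0 1) \<gamma> (\<lambda>t. R \<theta> (\<gamma> t))" by simp
  define d where "d = (\<lambda>t. R \<theta> (\<gamma> t))"
  have Ed: "embedding d" and Sd: "range d \<subseteq> sphere 0 1" using embedded_isotopy_embedding[OF I] by (simp_all add: d_def)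
  note di = closed_immersionD[OF Ed[unfolded embedding_def, THEN conjunct1]]
  \<comment> \<open>A point of the sphere with last coordinate 1 is \<open>nu\<close>, the image of
    \<open>p\<close>, and \<open>\<gamma>\<close> misses \<open>p\<close>.\<close>
  have dn: "snd (d t) \<noteq> 1" for t
  proof
    assume 1: "snd (d t) = 1"
    have "d t \<bullet> d t = 1" using Sd by (auto simp: norm_eq_1 image_subset_iff)
    then have "fst (d t) \<bullet> fst (d t) = 0" using 1 by (simp add: inner_prod_def)
    then have "d t = R \<theta> p" using 1 unfolding Rp nu_def by (simp add: prod_eq_iff)
    then show False using inj p\<gamma> unfolding d_def by blast
  qed
  define g where "g = (\<lambda>t. inverse (1 - snd (d t)) *\<^sub>R fst (d t))"
  have sg: "stereo_inv (g t) = d t" for t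
    unfolding g_def by (rule stereo_inv_right[OF subsetD[OF Sd rangeI] dn])
  note D = curve_family_const[OF di(1)]
  have one: "curve_family (\<lambda>s t. 1) (\<lambda>s t. 0::real)" by (rule curve_family_param) simp
  have nz: "1 - snd (d t) \<noteq> 0" for t using dn[of t] by simp
  note gF = curve_family_scaleR[OF curve_family_inverse[OF curve_family_diff[OF one curve_family_linear[OF bounded_linear_snd D]] nz]
      curve_family_linear[OF bounded_linear_fst D]]
  obtain \<Gamma>' where gF': "curve_family (\<lambda>s. g) \<Gamma>'" using gF unfolding g_def by blast
  obtain \<Delta>' where \<Delta>: "curve_family (\<lambda>s t. stereo_inv (g t)) \<Delta>'" "\<forall>s t. \<Gamma>' s t = 0 \<longrightarrow> \<Delta>' s t = 0"
    using curve_family_stereo_inv[OF gF'] by blast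
  have Cg: "C1_curve g (\<Gamma>' 0)" and Cd: "C1_curve d (\<Delta>' 0)"
    using curve_family_member[OF gF', of 0] curve_family_member[OF \<Delta>(1), of 0] sg by simp_all
  have "embedding g" unfolding embedding_def
  proof
    have "\<Gamma>' 0 t \<noteq> 0" for t using \<Delta>(2)[rule_format, of 0 t] C1_curve_vd[OF Cd, of t] di(3)[of t] by auto
    then show "closed_immersion g" by (rule closed_immersionI[OF Cg, rotated]) (simp add: g_def di(2))
    show "\<forall>s t. \<not> double_pair g s t"
    proof (intro allI notI)
      fix x y assume "double_pair g x y"
      then have "double_pair d x y" unfolding double_pair_def by (simp add: sg[symmetric])
      then show False using Ed by (simp add: embedding_def)
    qed
  qed
  moreover have "embedded_isotopy (sphere 0 1) \<gamma> (\<lambda>t. stereo_inv (g t))" using I by (simp add: sg d_def)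
  ultimately show ?thesis using that by blast
qed

text \<open>After smoothing, the shear is performed gradually. It keeps heights and moves each
  horizontal level by a translation, so it carries embedded curves to embedded curves. Two points
  above one crossing have different heights, which gives the over/under data.\<close>

lemma generic_planar_diagram:
  fixes g :: "real \<Rightarrow> R3"
  assumes "embedding g"
  obtains c h Ov where "is_diagram UNIV (c, Ov)" "embedded_isotopy UNIV g (\<lambda>t. (c t, h t))"
    "\<And>s t. double_pair c s t \<Longrightarrow> s \<in> Ov \<Longrightarrow> h t < h s"
proof -
  obtain f f' where gf: "embedded_isotopy UNIV g f" and f: "C1_curve f f'" "\<And>t. f' differentiable (at t)"
    using embedding_smoothing[OF assms] by metis
  have Ef: "embedding f" using embedded_isotopy_embedding[OF gf] by blast
  note fi = closed_immersionD[OF Ef[unfolded embedding_def, THEN conjunct1]]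
  define z where "z = (\<lambda>t. fst (f t))"
  define h where "h = (\<lambda>t. snd (f t))"
  define z' where "z' = (\<lambda>t. fst (f' t))"
  define h' where "h' = (\<lambda>t. snd (f' t))"
  have fd: "(f has_vector_derivative f' t) (at t)" for t using f(1) by (simp add: C1_curve_def)
  have zd: "(z has_vector_derivative z' t) (at t)" and hd: "(h has_vector_derivative h' t) (at t)" for t
    unfolding z_def h_def z'_def h'_def
    using bounded_linear.has_vector_derivative[OF bounded_linear_fst fd] bounded_linear.has_vector_derivative[OF bounded_linear_snd fd] by blast+
  have dd: "z' differentiable (at t)" "h' differentiable (at t)" for t
    unfolding z'_def h'_def
    using differentiable_compose[OF bounded_linear_imp_differentiable[OF bounded_linear_fst] f(2)]
      differentiable_compose[OF bounded_linear_imp_differentiable[OF bounded_linear_snd] f(2)] by blast+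
  have imm: "z' t \<noteq> 0" if "h' t = 0" for t
  proof
    assume "z' t = 0"
    then have "f' t = 0" using that by (simp add: z'_def h'_def prod_eq_iff)
    then show False using fi(3)[of t] C1_curve_vd[OF f(1), of t] by simp
  qed
  obtain v w where vw: "\<And>t. z' t - (2 * h t * h' t) *\<^sub>R v - h' t *\<^sub>R w \<noteq> 0"
    "\<And>s t. h s \<noteq> h t \<Longrightarrow> z s - (h s)\<^sup>2 *\<^sub>R v - h s *\<^sub>R w = z t - (h t)\<^sup>2 *\<^sub>R v - h t *\<^sub>R w \<Longrightarrow>
      indep (z' s - (2 * h s * h' s) *\<^sub>R v - h' s *\<^sub>R w) (z' t - (2 * h t * h' t) *\<^sub>R v - h' t *\<^sub>R w)"
    "\<And>s t r. h s \<noteq> h t \<Longrightarrow> h t \<noteq> h r \<Longrightarrow> h s \<noteq> h r \<Longrightarrow>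
      z s - (h s)\<^sup>2 *\<^sub>R v - h s *\<^sub>R w = z t - (h t)\<^sup>2 *\<^sub>R v - h t *\<^sub>R w \<Longrightarrow>
      z t - (h t)\<^sup>2 *\<^sub>R v - h t *\<^sub>R w = z r - (h r)\<^sup>2 *\<^sub>R v - h r *\<^sub>R w \<Longrightarrow> False"
    using generic_shear[OF zd hd dd imm] by blast
  define c where "c = (\<lambda>t. z t - (h t)\<^sup>2 *\<^sub>R v - h t *\<^sub>R w)"
  define c' where "c' = (\<lambda>t. z' t - (2 * h t * h' t) *\<^sub>R v - h' t *\<^sub>R w)"
  have per: "z (t + 1) = z t" "h (t + 1) = h t" for t using fi(2) by (simp_all add: z_def h_def)
  have sep: "t - u \<in> \<int>" if "z t = z u" "h t = h u" for t u
  proof -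
    have "f t = f u" using that by (simp add: z_def h_def prod_eq_iff)
    then show ?thesis using Ef unfolding embedding_def double_pair_def by blast
  qed
  note F = curve_family_const[OF f(1)]
  note zF = curve_family_linear[OF bounded_linear_fst F, folded z_def z'_def]
    and hF = curve_family_linear[OF bounded_linear_snd F, folded h_def h'_def]
  have sF: "curve_family (\<lambda>s t. s) (\<lambda>s t. 0::real)" by (rule curve_family_param) (rule continuous_on_id)
  note lF = curve_family_add[OF curve_family_linear[OF bounded_linear_scaleR_left curve_family_mult[OF hF hF], of v]
      curve_family_linear[OF bounded_linear_scaleR_left hF, of w]]
  note GF = curve_family_Pair[OF curve_family_diff[OF zF curve_family_scaleR[OF sF lF]] hF]
  have "embedded_isotopy UNIV (\<lambda>t. (z t - 0 *\<^sub>R ((h t * h t) *\<^sub>R v + h t *\<^sub>R w), h t)) (\<lambda>t. (z t - 1 *\<^sub>R ((h t * h t) *\<^sub>R v + h t *\<^sub>R w), h t))"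
    by (rule embedded_isotopyI[OF GF]) (auto simp: per sep zero_prod_def[symmetric] prod_eq_iff dest: imm)
  then have I: "embedded_isotopy UNIV f (\<lambda>t. (c t, h t))"
    by (simp add: z_def h_def c_def power2_eq_square diff_diff_eq)
  have "((\<lambda>t. (h t)\<^sup>2) has_vector_derivative 2 * h t * h' t) (at t)" for t
    using hd[of t] unfolding has_real_derivative_iff_has_vector_derivative[symmetric] by (auto intro!: derivative_eq_intros)
  then have cd: "(c has_vector_derivative c' t) (at t)" for t
    unfolding c_def c'_def
    by (intro has_vector_derivative_diff bounded_linear.has_vector_derivative[OF bounded_linear_scaleR_left] zd hd)
  have conts: "continuous_on UNIV z'" "continuous_on UNIV h'" "continuous_on UNIV h"
    using differentiable_imp_continuous_within[OF dd(1)] differentiable_imp_continuous_within[OF dd(2)]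
      has_vector_derivative_continuous[OF hd] by (simp_all add: continuous_at_imp_continuous_on)
  have Cc: "C1_curve c c'" unfolding C1_curve_def c'_def using cd conts by (auto simp: c'_def intro!: continuous_intros)
  have ci: "closed_immersion c" by (rule closed_immersionI[OF Cc]) (use vw(1) per in \<open>simp_all add: c_def c'_def\<close>)
  have hne: "h s \<noteq> h t" if "double_pair c s t" for s t
  proof
    assume "h s = h t"
    moreover from this have "z s = z t" using that by (simp add: double_pair_def c_def)
    ultimately show False using sep[of s t] that by (simp add: double_pair_def)
  qed
  have vdc: "vector_derivative c (at t) = c' t" for t using C1_curve_vd[OF Cc] .
  have tr: "indep (vector_derivative c (at s)) (vector_derivative c (at t))" if "double_pair c s t" for s t
    unfolding vdc c'_def by (rule vw(2)[OF hne[OF that]]) (use that in \<open>simp add: double_pair_def c_def\<close>)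
  define Ov where "Ov = {s. \<exists>t. double_pair c s t \<and> h t < h s}"
  \<comment> \<open>A third passage through the crossing would have a third height, giving a triple
    point excluded by the choice of \<open>v\<close> and \<open>w\<close>.\<close>
  have uniq: "t - r \<in> \<int>" if "double_pair c s t" "double_pair c s r" for s t r
  proof (rule ccontr)
    assume n: "t - r \<notin> \<int>"
    have "double_pair c t r" using that n by (simp add: double_pair_def)
    then show False
      using vw(3)[of t s r] hne[OF that(1)] hne[OF that(2)] hne[of t r] that by (auto simp: double_pair_def c_def)
  qed
  have uh: "h t = h r" if "double_pair c s t" "double_pair c s r" for s t r
    using periodic_int[of h, OF per(2) uniq[OF that]] .
  have Ov_iff: "s \<in> Ov \<longleftrightarrow> h t < h s" if "double_pair c s t" for s t
  proof
    assume "s \<in> Ov"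
    then obtain u where "double_pair c s u" "h u < h s" by (auto simp: Ov_def)
    then show "h t < h s" using uh[OF that, of u] by simp
  next
    assume "h t < h s"
    then show "s \<in> Ov" unfolding Ov_def using that by blast
  qed
  have "is_diagram UNIV (c, Ov)" unfolding is_diagram_def prod.case
  proof (intro conjI allI impI)
    show "closed_immersion c" by (rule ci)
    show "vector_derivative c (at t) \<notin> span {vector_derivative c (at s)}" if "double_pair c s t" for s t
      using tr[OF that] by (rule indep_notin_span)
    show "t - r \<in> \<int>" if "double_pair c s t \<and> double_pair c s r" for s t r using uniq that by blast
    show "finite {s \<in> {0..<1}. \<exists>t. double_pair c s t}" by (rule finite_double_points[OF ci tr])
    show "Ov \<subseteq> {s. \<exists>t. double_pair c s t}" by (auto simp: Ov_def)
    show "(t + 1 \<in> Ov) = (t \<in> Ov)" for t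
      using double_pair_cong[of c "t + 1" t u u for u, OF closed_immersionD(2)[OF ci]] per(2) by (auto simp: Ov_def)
    show "(s \<in> Ov) = (t \<notin> Ov)" if "double_pair c s t" for s t
      using Ov_iff[OF that] Ov_iff[OF double_pair_sym[OF that]] hne[OF that] by linarith
  qed simp
  moreover have "h t < h s" if "double_pair c s t" "s \<in> Ov" for s t
    using Ov_iff[OF that(1)] that(2) by blast
  ultimately show ?thesis using that[of c Ov h] embedded_isotopy_trans[OF gf I] by blast
qed

section \<open>Inserting kinks\<close>

text \<open>A thin strip around a piece of the curve in which \<open>(x, y)\<close> are coordinates
  and which the curve meets only in its core. Projection to the tangent line at a non-crossing point
  \<open>m\<close> is strictly monotone along the curve near \<open>m\<close>, and
  \<open>\<nu>\<close> is normal to that line, so the projection recovers \<open>x\<close> and then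
  \<open>y\<close>.\<close>

lemma clear_arc:
  fixes c :: "real \<Rightarrow> complex"
  assumes D: "is_diagram S (c, Ov)" and C: "C1_curve c c'" and L: "0 < L"
  obtains m \<rho> \<nu> where "0 < \<rho>" "2 * \<rho> * L < 1"
    "\<And>x y x' y'. \<bar>x\<bar> < L \<Longrightarrow> \<bar>x'\<bar> < L \<Longrightarrow> c (m + \<rho> * x) + of_real y * \<nu> = c (m + \<rho> * x') + of_real y' * \<nu> \<Longrightarrow> x = x' \<and> y = y'"
    "\<And>x. \<bar>x\<bar> < L \<Longrightarrow> 0 < Im (cnj (c' (m + \<rho> * x)) * \<nu>)"
    "\<And>t x y. \<bar>x\<bar> < L \<Longrightarrow> \<bar>y\<bar> < 2 \<Longrightarrow> c t = c (m + \<rho> * x) + of_real y * \<nu> \<Longrightarrow> t - (m + \<rho> * x) \<in> \<int>"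
proof -
  note Dd = is_diagramD[OF D]
  note ci = closed_immersionD[OF Dd(1)]
  have vd: "vector_derivative c (at t) = c' t" for t using C1_curve_vd[OF C] .
  have "infinite ({0..<1::real} - {s\<in>{0..<1}. \<exists>t. double_pair c s t})"
    by (rule Diff_infinite_finite[OF Dd(5)]) (simp add: infinite_Ico)
  then obtain m where m: "m \<in> {0..<1}" "\<And>t. \<not> double_pair c m t" using infinite_imp_nonempty by blast
  define d where "d = c' m"
  have d: "d \<noteq> 0" using ci(3)[of m] vd by (simp add: d_def)
  have cc': "continuous_on UNIV c'" and cc: "continuous_on UNIV c" using C C1_curve_cont by (auto simp: C1_curve_def)
  have "isCont c' m" "isCont c m" using cc' cc by (simp_all add: continuous_on_eq_continuous_at)
  \<comment> \<open>Here the velocity deviates from \<open>d\<close> by less than the norm of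
    \<open>d\<close>, so its component along \<open>d\<close> is positive.\<close>
  then obtain \<delta>0 where \<delta>0: "0 < \<delta>0" "\<And>t. \<bar>t - m\<bar> < \<delta>0 \<Longrightarrow> dist (c' t) d < norm d"
    unfolding continuous_at_eps_delta d_def[symmetric] using d by (metis dist_real_def zero_less_norm_iff)
  define \<delta> where "\<delta> = min \<delta>0 (1/4)"
  have \<delta>: "0 < \<delta>" "\<delta> \<le> 1/4" "\<And>t. \<bar>t - m\<bar> < \<delta> \<Longrightarrow> dist (c' t) d < norm d" using \<delta>0 by (auto simp: \<delta>_def)
  define u where "u = (\<lambda>t. Re (cnj d * c t))"
  have pos: "0 < Re (cnj d * c' t)" if "\<bar>t - m\<bar> < \<delta>" for t
  proof -
    have "\<bar>Re (cnj d * (c' t - d))\<bar> \<le> norm d * norm (c' t - d)" using abs_Re_le_cmod[of "cnj d * (c' t - d)"] by (simp add: norm_mult)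
    also have "\<dots> < norm d * norm d" using \<delta>(3)[OF that] d by (simp add: dist_norm)
    also have "norm d * norm d = Re (cnj d * d)" by (simp add: cmod_power2 power2_eq_square[symmetric])
    finally show ?thesis by (simp add: algebra_simps)
  qed
  have udv: "(u has_real_derivative Re (cnj d * c' t)) (at t)" for t
  proof -
    have "(c has_vector_derivative c' t) (at t)" using C by (simp add: C1_curve_def)
    from bounded_linear.has_vector_derivative[OF bounded_linear_compose[OF bounded_linear_Re bounded_linear_mult_right[of "cnj d"]] this]
    show ?thesis by (simp add: u_def has_real_derivative_iff_has_vector_derivative)
  qed
  have umono: "u s < u t" if "s < t" "\<bar>s - m\<bar> < \<delta>" "\<bar>t - m\<bar> < \<delta>" for s t
  proof (rule DERIV_pos_imp_increasing[OF that(1)])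
    fix x assume "s \<le> x" "x \<le> t"
    then have "\<bar>x - m\<bar> < \<delta>" using that by linarith
    then show "\<exists>y. (u has_real_derivative y) (at x) \<and> 0 < y" using udv pos by blast
  qed
  have uinj: "s = t" if "u s = u t" "\<bar>s - m\<bar> < \<delta>" "\<bar>t - m\<bar> < \<delta>" for s t
    using umono[of s t] umono[of t s] that by (cases s t rule: linorder_cases) simp_all
  \<comment> \<open>On the rest of its period the curve keeps a positive distance from the
    non-crossing point \<open>c m\<close>.\<close>
  obtain \<epsilon> where \<epsilon>: "0 < \<epsilon>" "\<And>t. t \<in> {m + \<delta>..m + 1 - \<delta>} \<Longrightarrow> \<epsilon> \<le> norm (c t - c m)"
  proof -
    have ne: "{m + \<delta>..m + 1 - \<delta>} \<noteq> {}" using \<delta>(2) by auto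
    have "\<exists>x\<in>{m + \<delta>..m + 1 - \<delta>}. \<forall>y\<in>{m + \<delta>..m + 1 - \<delta>}. norm (c x - c m) \<le> norm (c y - c m)"
      by (rule continuous_attains_inf[OF _ ne]) (auto intro!: continuous_intros continuous_on_subset[OF cc])
    then obtain x where x: "x \<in> {m + \<delta>..m + 1 - \<delta>}" "\<And>y. y\<in>{m + \<delta>..m + 1 - \<delta>} \<Longrightarrow> norm (c x - c m) \<le> norm (c y - c m)" by blast
    have "m - x \<notin> \<int>"
    proof
      assume "m - x \<in> \<int>"
      then obtain n :: int where n: "m - x = of_int n" by (auto elim: Ints_cases)
      then have "-1 < real_of_int n" "real_of_int n < 0" using x(1) \<delta>(1) by auto
      then show False by simp
    qed
    then have "c m \<noteq> c x" using m(2)[of x] by (simp add: double_pair_def)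
    then show ?thesis using that[of "norm (c x - c m)"] x(2) by simp
  qed
  obtain \<delta>1 where \<delta>1: "0 < \<delta>1" "\<And>t. \<bar>t - m\<bar> < \<delta>1 \<Longrightarrow> dist (c t) (c m) < \<epsilon> / 2"
    using \<open>isCont c m\<close> \<epsilon>(1) unfolding continuous_at_eps_delta by (metis dist_real_def half_gt_zero)
  \<comment> \<open>Keeps all parameters of the strip in the monotone window and its core within
    half of \<epsilon> of \<open>c m\<close>.\<close>
  define \<rho> where "\<rho> = min \<delta> \<delta>1 / L"
  have \<rho>: "0 < \<rho>" "\<rho> * L \<le> \<delta>" "\<rho> * L \<le> \<delta>1" using \<delta>(1) \<delta>1(1) L by (auto simp: \<rho>_def)
  have near: "\<bar>m + \<rho> * x - m\<bar> < \<delta>" "\<bar>m + \<rho> * x - m\<bar> < \<delta>1" if "\<bar>x\<bar> < L" for x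
  proof -
    have "\<bar>\<rho> * x\<bar> < \<rho> * L" using that \<rho>(1) by (simp add: abs_mult)
    then show "\<bar>m + \<rho> * x - m\<bar> < \<delta>" "\<bar>m + \<rho> * x - m\<bar> < \<delta>1" using \<rho> by auto
  qed
  \<comment> \<open>Makes \<open>\<nu>\<close> of length \<epsilon> / 8, so that offsets with
    \<open>\<bar>y\<bar> < 2\<close> stay below \<epsilon> / 2.\<close>
  define \<kappa> where "\<kappa> = \<epsilon> / (8 * norm d)"
  have \<kappa>: "0 < \<kappa>" "2 * (\<kappa> * norm d) < \<epsilon> / 2" using \<epsilon>(1) d by (simp_all add: \<kappa>_def field_simps)
  define \<nu> where "\<nu> = \<i> * of_real \<kappa> * d"
  have \<nu>: "Re (cnj d * \<nu>) = 0" "norm \<nu> = \<kappa> * norm d" using \<kappa>(1) by (simp_all add: \<nu>_def norm_mult algebra_simps)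
  have \<nu>0: "\<nu> \<noteq> 0" using d \<kappa>(1) by (simp add: \<nu>_def)
  have uy: "Re (cnj d * (c t + of_real y * \<nu>)) = u t" for t y
  proof -
    have "Re (cnj d * (c t + of_real y * \<nu>)) = Re (cnj d * c t) + y * Re (cnj d * \<nu>)" by (simp add: algebra_simps)
    then show ?thesis using \<nu>(1) by (simp add: u_def)
  qed
  show ?thesis
  proof (rule that[of \<rho> m \<nu>])
    show "0 < \<rho>" by (rule \<rho>(1))
    show "2 * \<rho> * L < 1" using \<rho>(2) \<delta>(2) by linarith
    show "x = x' \<and> y = y'" if "\<bar>x\<bar> < L" "\<bar>x'\<bar> < L" "c (m + \<rho> * x) + of_real y * \<nu> = c (m + \<rho> * x') + of_real y' * \<nu>" for x y x' y'
    proof -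
      have "u (m + \<rho> * x) = u (m + \<rho> * x')" using uy that(3) by metis
      then have "m + \<rho> * x = m + \<rho> * x'" using near(1)[OF that(1)] near(1)[OF that(2)] by (rule uinj)
      then show ?thesis using \<rho>(1) that(3) \<nu>0 by simp
    qed
    show "0 < Im (cnj (c' (m + \<rho> * x)) * \<nu>)" if "\<bar>x\<bar> < L" for x
    proof -
      have "Im (cnj (c' (m + \<rho> * x)) * \<nu>) = \<kappa> * Re (cnj d * c' (m + \<rho> * x))" by (simp add: \<nu>_def algebra_simps)
      then show ?thesis using pos[OF near(1)[OF that]] \<kappa>(1) by simp
    qed
    show "t - (m + \<rho> * x) \<in> \<int>" if a: "\<bar>x\<bar> < L" "\<bar>y\<bar> < 2" "c t = c (m + \<rho> * x) + of_real y * \<nu>" for t x y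
    proof -
      \<comment> \<open>The representative of \<open>t\<close> in the turn starting at
        \<open>m\<close>. Its image is closer than \<epsilon> to \<open>c m\<close>, so it is near
        the start or the end of this turn.\<close>
      define t' where "t' = m + frac (t - m)"
      have tt: "t - t' \<in> \<int>" by (simp add: t'_def frac_def)
      then have ct: "c t = c t'" using periodic_int[of c t t', OF ci(2)] by blast
      have t': "m \<le> t'" "t' < m + 1" using frac_in_unit[of "t - m"] by (auto simp: t'_def)
      have "norm (c t' - c m) < \<epsilon>"
      proof -
        have "c t' - c m = (c (m + \<rho> * x) - c m) + of_real y * \<nu>" using a(3) ct by simp
        then have "norm (c t' - c m) \<le> norm (c (m + \<rho> * x) - c m) + norm (of_real y * \<nu>)" by (metis norm_triangle_ineq)
        moreover have "norm (of_real y * \<nu>) \<le> 2 * (\<kappa> * norm d)"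
          unfolding norm_mult \<nu>(2) using a(2) \<kappa>(1) by (intro mult_mono) auto
        ultimately show ?thesis using \<delta>1(2)[OF near(2)[OF a(1)]] \<kappa>(2) by (simp add: dist_norm)
      qed
      then have "t' \<notin> {m + \<delta>..m + 1 - \<delta>}" using \<epsilon>(2)[of t'] by fastforce
      then consider "\<bar>t' - m\<bar> < \<delta>" | "\<bar>t' - 1 - m\<bar> < \<delta>" using t' \<delta>(1) by fastforce
      then obtain t2 where t2: "\<bar>t2 - m\<bar> < \<delta>" "t - t2 \<in> \<int>"
      proof cases
        case 1
        then show ?thesis using that tt by blast
      next
        case 2
        have "t - (t' - 1) = (t - t') + 1" by simp
        then have "t - (t' - 1) \<in> \<int>" using tt by (metis Ints_1 Ints_add)
        then show ?thesis using that 2 by blast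
      qed
      have "c t2 = c t" using periodic_int[of c t t2, OF ci(2) t2(2)] by simp
      then have "u t2 = u (m + \<rho> * x)" using uy[of "m + \<rho> * x" y] a(3) by (simp add: u_def)
      then have "t2 = m + \<rho> * x" using t2(1) near(1)[OF a(1)] by (rule uinj)
      then show ?thesis using t2(2) by simp
    qed
  qed
qed

text \<open>The nearest integer centres each period at a translate of \<open>m\<close>, so a profile
  supported in the middle of the period is not cut by the jumps of \<open>round\<close>.\<close>

definition periodize :: "real \<Rightarrow> real \<Rightarrow> (real \<Rightarrow> real) \<Rightarrow> real \<Rightarrow> real" where
  "periodize m \<rho> b t = b ((t - m - of_int (round (t - m))) / \<rho>)"

lemma periodize_period: "periodize m \<rho> b (t + 1) = periodize m \<rho> b t"
proof -
  have "t + 1 - m + 1 / 2 = (t - m + 1 / 2) + 1" by simp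
  then have "round (t + 1 - m) = round (t - m) + 1" unfolding round_def by (metis floor_add_int of_int_1)
  then have "t + 1 - m - of_int (round (t + 1 - m)) = t - m - of_int (round (t - m))" by simp
  then show ?thesis unfolding periodize_def by (simp only:)
qed

text \<open>A window of radius \<open>1 - \<rho> * l\<close> around copy \<open>n\<close> of
  \<open>m\<close> ends where the supports of the neighbouring copies begin, so one formula is valid
  across the jumps of \<open>round\<close>.\<close>

lemma periodize_local:
  assumes "0 < \<rho>" "2 * \<rho> * l < 1" "\<And>x. l \<le> \<bar>x\<bar> \<Longrightarrow> b x = 0" "\<bar>t - m - of_int n\<bar> < 1 - \<rho> * l"
  shows "periodize m \<rho> b t = b ((t - m - of_int n) / \<rho>)"
proof (cases "round (t - m) = n")
  case True
  then show ?thesis by (simp add: periodize_def)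
next
  case False
  define k where "k = round (t - m)"
  have k: "\<bar>t - m - of_int k\<bar> \<le> 1/2" using of_int_round_abs_le[of "t - m"] by (simp add: k_def abs_minus_commute)
  have "1 \<le> \<bar>real_of_int k - of_int n\<bar>" using False unfolding k_def by (simp add: of_int_diff[symmetric] del: of_int_diff)
  then have "\<rho> * l \<le> \<bar>t - m - of_int n\<bar>" "\<rho> * l \<le> \<bar>t - m - of_int k\<bar>" using k assms(2,4) by linarith+
  then have "l \<le> \<bar>(t - m - of_int n) / \<rho>\<bar>" "l \<le> \<bar>(t - m - of_int k) / \<rho>\<bar>"
    using assms(1) by (simp_all add: pos_le_divide_eq mult.commute)
  then show ?thesis using assms(3) by (simp add: periodize_def k_def)
qed

lemma periodize_at:
  assumes "0 < \<rho>" "2 * \<rho> * l < 1" "\<And>x. l \<le> \<bar>x\<bar> \<Longrightarrow> b x = 0" "2 * \<rho> * \<bar>x\<bar> < 1" "t - (m + \<rho> * x) \<in> \<int>"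
  shows "periodize m \<rho> b t = b x"
proof -
  obtain n :: int where n: "t = m + \<rho> * x + of_int n" using assms(5) by (auto elim!: Ints_cases simp: algebra_simps)
  have "\<bar>t - m - of_int n\<bar> < 1 - \<rho> * l" using assms(1,2,4) by (simp add: n abs_mult)
  from periodize_local[OF assms(1-3) this] show ?thesis using assms(1) by (simp add: n)
qed

lemma periodize_outside:
  assumes "0 < \<rho>" "\<And>x. l \<le> \<bar>x\<bar> \<Longrightarrow> b x = 0" "\<And>x. \<bar>x\<bar> < l \<Longrightarrow> t - (m + \<rho> * x) \<in> \<int> \<Longrightarrow> b x = 0"
  shows "periodize m \<rho> b t = 0"
proof -
  let ?x = "(t - m - of_int (round (t - m))) / \<rho>"
  have "t - (m + \<rho> * ?x) \<in> \<int>" using assms(1) by simp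
  then show ?thesis unfolding periodize_def using assms(2)[of ?x] assms(3)[of ?x] by (cases "\<bar>?x\<bar> < l") auto
qed

text \<open>Near every parameter the periodic function coincides with a single rescaled copy of
  \<open>b\<close>, from which the derivative is inherited without gluing.\<close>

lemma C1_curve_periodize:
  assumes "0 < \<rho>" "2 * \<rho> * l < 1" "\<And>x. l \<le> \<bar>x\<bar> \<Longrightarrow> b x = 0" "\<And>x. l \<le> \<bar>x\<bar> \<Longrightarrow> b' x = 0" and C: "C1_curve b b'"
  shows "C1_curve (periodize m \<rho> b) (\<lambda>t. periodize m \<rho> b' t / \<rho>)"
proof -
  have bd: "(b has_real_derivative b' x) (at x)" and b'c: "isCont b' x" for x
    using C by (simp_all add: C1_curve_def has_real_derivative_iff_has_vector_derivative continuous_on_eq_continuous_at)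
  have *: "(periodize m \<rho> b has_real_derivative periodize m \<rho> b' t / \<rho>) (at t) \<and> isCont (\<lambda>t. periodize m \<rho> b' t / \<rho>) t" for t
  proof -
    define n where "n = round (t - m)"
    define U where "U = {s. \<bar>s - m - of_int n\<bar> < 1 - \<rho> * l}"
    have "open U" unfolding U_def by (intro open_Collect_less continuous_intros)
    moreover have tU: "t \<in> U"
      using of_int_round_abs_le[of "t - m"] assms(2) by (simp add: U_def n_def abs_minus_commute)
    ultimately have ev: "\<forall>\<^sub>F s in nhds t. s \<in> U" by (rule eventually_nhds_in_open)
    have loc: "periodize m \<rho> b s = b ((s - m - of_int n) / \<rho>)" "periodize m \<rho> b' s = b' ((s - m - of_int n) / \<rho>)" if "s \<in> U" for s
      using periodize_local[OF assms(1,2,3)] periodize_local[OF assms(1,2,4)] that by (simp_all add: U_def)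
    have "((\<lambda>s. b ((s - m - of_int n) / \<rho>)) has_real_derivative b' ((t - m - of_int n) / \<rho>) * (1 / \<rho>)) (at t)"
      by (rule DERIV_chain2[OF bd]) (use assms(1) in \<open>auto intro!: derivative_eq_intros\<close>)
    moreover have "((\<lambda>s. b ((s - m - of_int n) / \<rho>)) has_real_derivative d) (at t) \<longleftrightarrow> (periodize m \<rho> b has_real_derivative d) (at t)" for d
      by (rule DERIV_cong_ev[OF refl eventually_mono[OF ev] refl]) (simp add: loc)
    ultimately have 1: "(periodize m \<rho> b has_real_derivative periodize m \<rho> b' t / \<rho>) (at t)"
      by (simp add: loc(2)[OF tU])
    have "isCont (\<lambda>s. b' ((s - m - of_int n) / \<rho>) / \<rho>) t"
      using assms(1) by (intro continuous_intros isCont_o2[OF _ b'c]) auto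
    moreover have "isCont (\<lambda>s. b' ((s - m - of_int n) / \<rho>) / \<rho>) t \<longleftrightarrow> isCont (\<lambda>t. periodize m \<rho> b' t / \<rho>) t"
      by (rule isCont_cong[OF eventually_mono[OF ev]]) (simp add: loc)
    ultimately show ?thesis using 1 by blast
  qed
  then show ?thesis unfolding C1_curve_def
    by (auto simp: has_real_derivative_iff_has_vector_derivative intro!: continuous_at_imp_continuous_on)
qed

section \<open>The profile of a kink\<close>

definition bump :: "real \<Rightarrow> real" where "bump u = (if \<bar>u\<bar> \<le> 1 then (1 - u\<^sup>2)\<^sup>2 else 0)"
definition bump' :: "real \<Rightarrow> real" where "bump' u = (if \<bar>u\<bar> \<le> 1 then - 4 * u * (1 - u\<^sup>2) else 0)"

text \<open>The profile is the square of the positive part of \<open>1 - u\<^sup>2\<close>; squaring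
  makes it C^1 at the cut-off points.\<close>

lemma C1_curve_bump: "C1_curve bump bump'"
proof -
  have b: "bump = (\<lambda>u. (max 0 (1 - u\<^sup>2))\<^sup>2)" and b': "bump' = (\<lambda>u. - 4 * u * max 0 (1 - u\<^sup>2))"
    using abs_square_le_1 by (auto simp: bump_def bump'_def fun_eq_iff max_def)
  have p: "((\<lambda>x. (max 0 x)\<^sup>2) has_real_derivative 2 * max 0 x) (at x)" for x :: real
  proof (cases x "0 :: real" rule: linorder_cases)
    case less
    have "\<forall>\<^sub>F y in nhds x. (max 0 y)\<^sup>2 = (0::real)"
      using eventually_nhds_in_open[of "{..<0}" x] less by (auto elim!: eventually_mono)
    then have "((\<lambda>x. (max 0 x)\<^sup>2) has_real_derivative 0) (at x) \<longleftrightarrow> ((\<lambda>x. 0) has_real_derivative (0::real)) (at x)"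
      by (intro DERIV_cong_ev refl)
    then show ?thesis using less by simp
  next
    case equal
    have "(\<lambda>h::real. ((max 0 (0 + h))\<^sup>2 - (max 0 0)\<^sup>2) / h) = (\<lambda>h. max 0 h)"
      by (auto simp: fun_eq_iff max_def power2_eq_square)
    moreover have "((\<lambda>h::real. max 0 h) \<longlongrightarrow> max 0 0) (at 0)" by (intro tendsto_intros)
    ultimately have "((\<lambda>h::real. ((max 0 (0 + h))\<^sup>2 - (max 0 0)\<^sup>2) / h) \<longlongrightarrow> 0) (at 0)" by simp
    then show ?thesis using equal by (simp add: DERIV_def)
  next
    case greater
    have "\<forall>\<^sub>F y in nhds x. (max 0 y)\<^sup>2 = y\<^sup>2"
      using eventually_nhds_in_open[of "{0<..}" x] greater by (auto elim!: eventually_mono simp: max_def)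
    then have "((\<lambda>x. (max 0 x)\<^sup>2) has_real_derivative 2 * x) (at x) \<longleftrightarrow> ((\<lambda>x. x\<^sup>2) has_real_derivative 2 * x) (at x)"
      by (intro DERIV_cong_ev refl)
    moreover have "((\<lambda>x. x\<^sup>2) has_real_derivative 2 * x) (at x)" by (auto intro!: derivative_eq_intros)
    ultimately show ?thesis using greater by simp
  qed
  have "((\<lambda>u. (max 0 (1 - u\<^sup>2))\<^sup>2) has_real_derivative 2 * max 0 (1 - u\<^sup>2) * (- 2 * u)) (at u)" for u :: real
    by (rule DERIV_chain2[OF p]) (auto intro!: derivative_eq_intros)
  then have "(bump has_vector_derivative bump' u) (at u)" for u
    unfolding has_real_derivative_iff_has_vector_derivative[symmetric] b b' by (simp add: mult_ac)
  moreover have "continuous_on UNIV bump'" unfolding b' by (intro continuous_intros)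
  ultimately show ?thesis by (simp add: C1_curve_def)
qed

text \<open>On \<open>[-1,1]\<close> the model kink has abscissa \<open>u - 4 * kink u\<close> and
  ordinate \<open>bump u / 2\<close>; outside both corrections vanish.\<close>

definition kink :: "real \<Rightarrow> real" where "kink u = u * bump u"
definition kink' :: "real \<Rightarrow> real" where "kink' u = bump u + u * bump' u"

lemma C1_curve_kink: "C1_curve kink kink'"
proof -
  have "((\<lambda>u. u * bump u) has_real_derivative 1 * bump u + bump' u * u) (at u)" for u
    using C1_curve_bump by (intro DERIV_mult DERIV_ident) (simp add: C1_curve_def has_real_derivative_iff_has_vector_derivative)
  then have "(kink has_vector_derivative kink' u) (at u)" for u
    by (simp add: kink_def[abs_def] kink'_def has_real_derivative_iff_has_vector_derivative mult.commute)
  moreover have "continuous_on UNIV kink'"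
    using C1_curve_bump C1_curve_cont[OF C1_curve_bump] unfolding kink'_def[abs_def] C1_curve_def by (auto intro!: continuous_intros)
  ultimately show ?thesis by (simp add: C1_curve_def)
qed

lemma bump_outside: "1 \<le> \<bar>u\<bar> \<Longrightarrow> bump u = 0" "1 \<le> \<bar>u\<bar> \<Longrightarrow> bump' u = 0"
proof -
  assume "1 \<le> \<bar>u\<bar>"
  then have "u\<^sup>2 = 1" if "\<bar>u\<bar> \<le> 1" using that by (simp add: power2_eq_1_iff) linarith
  then show "bump u = 0" "bump' u = 0" by (auto simp: bump_def bump'_def)
qed

lemma kink_outside: "1 \<le> \<bar>u\<bar> \<Longrightarrow> kink u = 0" "1 \<le> \<bar>u\<bar> \<Longrightarrow> kink' u = 0"
  using bump_outside[of u] by (simp_all add: kink_def kink'_def)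

lemma bump_range: "0 \<le> bump u" "bump u \<le> 1"
  using bump_bounds[of u] by (auto simp: bump_def)

lemma bump_minus: "bump (- u) = bump u" "kink (- u) = - kink u" "bump' (- u) = - bump' u" "kink' (- u) = kink' u"
  by (auto simp: bump_def kink_def kink'_def bump'_def)

lemma kink_eq: "\<bar>u\<bar> \<le> 1 \<Longrightarrow> kink u = u * (1 - u\<^sup>2)\<^sup>2" by (simp add: kink_def bump_def)
lemma bump_eq: "\<bar>u\<bar> \<le> 1 \<Longrightarrow> bump u = (1 - u\<^sup>2)\<^sup>2" by (simp add: bump_def)

text \<open>The abscissa of a partly grown kink is a convex combination of those of the straight
  strand and of the full kink.\<close>

lemma kink_bound:
  assumes "\<bar>u\<bar> \<le> 1" "0 \<le> s" "s \<le> 1" shows "\<bar>u - 4 * s * kink u\<bar> \<le> 1"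
proof -
  have "u - 4 * s * kink u = (1 - s) * u + s * (u - 4 * u * (1 - u\<^sup>2)\<^sup>2)" using assms(1) by (simp add: kink_eq algebra_simps)
  then have "\<bar>u - 4 * s * kink u\<bar> \<le> \<bar>(1 - s) * u\<bar> + \<bar>s * (u - 4 * u * (1 - u\<^sup>2)\<^sup>2)\<bar>" by (simp only: abs_triangle_ineq)
  also have "\<dots> \<le> (1 - s) * 1 + s * 1"
    unfolding abs_mult using assms kink_abscissa_bound[OF assms(1)] by (intro add_mono mult_mono) auto
  finally show ?thesis by simp
qed

text \<open>Applies to all stages of growth: \<open>bump\<close> is below 1 off the centre, so a
  loop exists for \<open>s > 1/4\<close> only, after the cusp at \<open>s = 1/4\<close>.\<close>

lemma kink_double:
  assumes "\<bar>u\<bar> \<le> 1" "\<bar>v\<bar> \<le> 1" "u \<noteq> v" "u - 4 * s * kink u = v - 4 * s * kink v" "s * bump u = s * bump v"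
  shows "v = - u \<and> u \<noteq> 0 \<and> 4 * s * bump u = 1"
proof -
  have "s \<noteq> 0" using assms(3,4) by auto
  moreover have "u - 4 * s * u * (1 - u\<^sup>2)\<^sup>2 = v - 4 * s * v * (1 - v\<^sup>2)\<^sup>2"
    using assms(4) unfolding kink_eq[OF assms(1)] kink_eq[OF assms(2)] by (simp only: mult.assoc)
  moreover have "s * (1 - u\<^sup>2)\<^sup>2 = s * (1 - v\<^sup>2)\<^sup>2"
    using assms(5) unfolding bump_eq[OF assms(1)] bump_eq[OF assms(2)] .
  ultimately have "v = - u \<and> 4 * s * (1 - u\<^sup>2)\<^sup>2 = 1" by (rule R1_double_points[OF assms(1,2,3)])
  then show ?thesis using assms(1,3) by (auto simp: bump_eq)
qed

text \<open>The parameter at which the finished kink crosses itself; the other passage is at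
  \<open>- kink_apex\<close>.\<close>

definition kink_apex :: real where "kink_apex = sqrt (1/2)"

lemma kink_apex: "0 < kink_apex" "kink_apex < 1" "kink_apex\<^sup>2 = 1/2"
  by (auto simp: kink_apex_def intro!: real_less_lsqrt)

lemma kink_apex_values:
  "bump kink_apex = 1/4" "kink' kink_apex = - 3/4" "bump' kink_apex = - 2 * kink_apex" "4 * kink kink_apex = kink_apex"
proof -
  have a: "\<bar>kink_apex\<bar> \<le> 1" using kink_apex by simp
  show b: "bump kink_apex = 1/4" unfolding bump_eq[OF a] kink_apex(3) by (simp add: power2_eq_square)
  show b': "bump' kink_apex = - 2 * kink_apex" using a by (simp add: bump'_def kink_apex(3))
  have "kink_apex * bump' kink_apex = - 2 * kink_apex\<^sup>2" unfolding b' by (simp add: power2_eq_square)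
  then show "kink' kink_apex = - 3/4" unfolding kink_apex(3) by (simp add: kink'_def b)
  show "4 * kink kink_apex = kink_apex" by (simp add: kink_def b)
qed

lemma kink_apex_iff:
  assumes "\<bar>u\<bar> \<le> 1" "4 * bump u = 1" shows "u = kink_apex \<or> u = - kink_apex"
proof -
  have "(1 - u\<^sup>2)\<^sup>2 = 1/4" using assms(2) unfolding bump_eq[OF assms(1)] by simp
  moreover have "(1 - kink_apex\<^sup>2)\<^sup>2 = 1/4" unfolding kink_apex(3) by (simp add: power2_eq_square)
  ultimately have "(1 - u\<^sup>2)\<^sup>2 = (1 - kink_apex\<^sup>2)\<^sup>2" by simp
  then show ?thesis using bump_eq_iff[of u kink_apex] assms(1) kink_apex by auto
qed

section \<open>A train of kinks on a clear arc\<close>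

text \<open>Kink \<open>k\<close> occupies the parameters within \<open>\<rho>\<close> of \<open>m + 3 \<rho> k\<close>. Its height profile, of
  slope \<open>M / \<rho>\<close>, dominates the variation of \<open>h\<close> there, so that \<open>\<sigma> k\<close> decides which
  branch passes over.\<close>

locale kink_site =
  fixes c c' :: "real \<Rightarrow> complex" and Ov :: "real set" and h h' :: "real \<Rightarrow> real" and m \<rho> M :: real
    and \<nu> :: complex and N :: nat and \<sigma> :: "nat \<Rightarrow> real"
  assumes diagram: "is_diagram UNIV (c, Ov)" and C: "C1_curve c c'" and Hc: "C1_curve h h'"
    and h_period: "h (t + 1) = h t"
    and h_over: "double_pair c s t \<Longrightarrow> s \<in> Ov \<Longrightarrow> h t < h s"
    and \<rho>: "0 < \<rho>" "2 * \<rho> * (3 * real N + 2) < 1"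
    and chart_inj: "\<bar>x\<bar> < 3 * real N + 2 \<Longrightarrow> \<bar>x'\<bar> < 3 * real N + 2 \<Longrightarrow>
      c (m + \<rho> * x) + of_real y * \<nu> = c (m + \<rho> * x') + of_real y' * \<nu> \<Longrightarrow> x = x' \<and> y = y'"
    and chart_pos: "\<bar>x\<bar> < 3 * real N + 2 \<Longrightarrow> 0 < Im (cnj (c' (m + \<rho> * x)) * \<nu>)"
    and clear: "\<bar>x\<bar> < 3 * real N + 2 \<Longrightarrow> \<bar>y\<bar> < 2 \<Longrightarrow> c t = c (m + \<rho> * x) + of_real y * \<nu> \<Longrightarrow> t - (m + \<rho> * x) \<in> \<int>"
    and M: "4 * \<rho> * \<bar>h' t\<bar> < M"
    and \<sigma>: "\<bar>\<sigma> k\<bar> = 1"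
begin

lemmas Dd = is_diagramD[OF diagram]
lemmas ci = closed_immersionD[OF Dd(1)]

lemma vd: "vector_derivative c (at t) = c' t" using C1_curve_vd[OF C] .
lemma c'_period: "c' (t + 1) = c' t" using ci(4)[of t] vd by simp

definition \<Phi> :: "real \<Rightarrow> real \<Rightarrow> complex" where "\<Phi> x y = c (m + \<rho> * x) + of_real y * \<nu>"

text \<open>The profile \<open>b\<close> is placed at the sites \<open>3 * real k\<close>, in units
  of \<rho>. For profiles supported in \<open>[-1,1]\<close> the copies are disjoint with gaps
  between them. The weights are 1 for the plane curve and \<open>\<sigma>\<close> for the
  heights.\<close>

definition train :: "(nat \<Rightarrow> real) \<Rightarrow> nat set \<Rightarrow> (real \<Rightarrow> real) \<Rightarrow> real \<Rightarrow> real" where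
  "train w F b = periodize m \<rho> (\<lambda>x. \<Sum>k\<in>F. w k * b (x - 3 * real k))"

definition arcs :: "nat set \<Rightarrow> real set" where
  "arcs F = {t. \<exists>k\<in>F. \<exists>u. \<bar>u\<bar> \<le> 1 \<and> t - (m + \<rho> * (3 * real k + u)) \<in> \<int>}"

lemma site_range:
  assumes "k < N" "\<bar>u\<bar> \<le> 1" shows "\<bar>3 * real k + u\<bar> < 3 * real N + 2" "2 * \<rho> * \<bar>3 * real k + u\<bar> < 1"
proof -
  show 1: "\<bar>3 * real k + u\<bar> < 3 * real N + 2" using assms by auto
  have "2 * \<rho> * \<bar>3 * real k + u\<bar> \<le> 2 * \<rho> * (3 * real N + 2)" using 1 \<rho>(1) by (intro mult_left_mono) auto
  then show "2 * \<rho> * \<bar>3 * real k + u\<bar> < 1" using \<rho>(2) by linarith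
qed

lemma support: "2 * \<rho> * (3 * real N) < 1" using \<rho> by (simp add: algebra_simps)

lemma train_support:
  assumes "F \<subseteq> {..<N}" "\<And>u. 1 \<le> \<bar>u\<bar> \<Longrightarrow> b u = 0" "3 * real N \<le> \<bar>x\<bar>"
  shows "(\<Sum>k\<in>F. w k * b (x - 3 * real k)) = (0::real)"
proof (rule sum.neutral, rule ballI)
  fix k assume "k \<in> F"
  then have "real k + 1 \<le> real N" using assms(1) by auto
  then have "1 \<le> \<bar>x - 3 * real k\<bar>" using assms(3) by linarith
  then show "w k * b (x - 3 * real k) = 0" using assms(2) by simp
qed

lemma train_site:
  assumes F: "F \<subseteq> {..<N}" and b: "\<And>u. 1 \<le> \<bar>u\<bar> \<Longrightarrow> b u = 0"
    and k: "k \<in> F" "\<bar>u\<bar> \<le> 1" "t - (m + \<rho> * (3 * real k + u)) \<in> \<int>"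
  shows "train w F b t = w k * b u"
proof -
  have "finite F" using F finite_subset by blast
  have "train w F b t = (\<Sum>j\<in>F. w j * b (3 * real k + u - 3 * real j))"
    unfolding train_def by (rule periodize_at[OF \<rho>(1) support train_support[OF F b] _ k(3)]) (use site_range[of k u] k F in auto)
  also have "\<dots> = (\<Sum>j\<in>F. if j = k then w k * b u else 0)"
  proof (rule sum.cong[OF refl])
    fix j
    show "w j * b (3 * real k + u - 3 * real j) = (if j = k then w k * b u else 0)"
    proof (cases "j = k")
      case False
      then have "1 \<le> \<bar>real k - real j\<bar>" by linarith
      then have "1 \<le> \<bar>3 * real k + u - 3 * real j\<bar>" using k(2) by linarith
      then show ?thesis using b False by simp
    qed simp
  qed
  also have "\<dots> = w k * b u" using \<open>finite F\<close> k(1) by simp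
  finally show ?thesis .
qed

lemma train_off:
  assumes F: "F \<subseteq> {..<N}" and b: "\<And>u. 1 \<le> \<bar>u\<bar> \<Longrightarrow> b u = 0" and t: "t \<notin> arcs F"
  shows "train w F b t = 0"
  unfolding train_def
proof (rule periodize_outside[OF \<rho>(1) train_support[OF F b]])
  fix x assume x: "t - (m + \<rho> * x) \<in> \<int>"
  show "(\<Sum>k\<in>F. w k * b (x - 3 * real k)) = 0"
  proof (rule sum.neutral, rule ballI)
    fix k assume k: "k \<in> F"
    have "\<not> \<bar>x - 3 * real k\<bar> \<le> 1"
    proof
      assume "\<bar>x - 3 * real k\<bar> \<le> 1"
      then have "t \<in> arcs F" unfolding arcs_def using k x by (intro CollectI bexI[of _ k] exI[of _ "x - 3 * real k"]) simp_all
      then show False using t by simp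
    qed
    then show "w k * b (x - 3 * real k) = 0" using b by simp
  qed
qed

lemma C1_curve_train:
  assumes F: "F \<subseteq> {..<N}" and b: "\<And>u. 1 \<le> \<bar>u\<bar> \<Longrightarrow> b u = 0" "\<And>u. 1 \<le> \<bar>u\<bar> \<Longrightarrow> b' u = 0" and Cb: "C1_curve b b'"
  shows "C1_curve (train w F b) (\<lambda>t. train w F b' t / \<rho>)"
  unfolding train_def
proof (rule C1_curve_periodize[OF \<rho>(1) support train_support[OF F b(1)] train_support[OF F b(2)]])
  have bd: "(b has_real_derivative b' x) (at x)" for x
    using Cb by (simp add: C1_curve_def has_real_derivative_iff_has_vector_derivative)
  have "((\<lambda>x. \<Sum>k\<in>F. w k * b (x - 3 * real k)) has_real_derivative (\<Sum>k\<in>F. w k * b' (x - 3 * real k))) (at x)" for x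
  proof (intro DERIV_sum DERIV_cmult)
    fix k
    show "((\<lambda>x. b (x - 3 * real k)) has_real_derivative b' (x - 3 * real k)) (at x)"
    proof -
      have "((\<lambda>x. x - 3 * real k) has_real_derivative 1) (at x)" by (auto intro!: derivative_eq_intros)
      from DERIV_chain2[OF bd this] show ?thesis by simp
    qed
  qed
  moreover have "continuous_on UNIV (\<lambda>x. \<Sum>k\<in>F. w k * b' (x - 3 * real k))"
  proof -
    have cb: "continuous_on UNIV b'" using Cb by (simp add: C1_curve_def)
    have "continuous_on UNIV (\<lambda>x. b' (x - 3 * real k))" for k
      by (rule continuous_on_compose2[OF cb]) (auto intro!: continuous_intros)
    then show ?thesis by (intro continuous_on_sum continuous_on_mult continuous_on_const)
  qed
  ultimately show "C1_curve (\<lambda>x. \<Sum>k\<in>F. w k * b (x - 3 * real k)) (\<lambda>x. \<Sum>k\<in>F. w k * b' (x - 3 * real k))"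
    by (simp add: C1_curve_def has_real_derivative_iff_has_vector_derivative)
qed

lemma train_period: "train w F b (t + 1) = train w F b t"
  unfolding train_def by (rule periodize_period)

text \<open>In the strip coordinates each site shows the model of the first move, scaled by
  \<open>s\<close>: the abscissa is changed by sliding along \<open>c\<close>, the ordinate by the
  multiple of \<open>\<nu>\<close>.\<close>

definition kinked :: "nat set \<Rightarrow> real \<Rightarrow> real \<Rightarrow> complex" where
  "kinked F s t = c (t - s * (4 * \<rho> * train (\<lambda>_. 1) F kink t)) + (s * (train (\<lambda>_. 1) F bump t / 2)) *\<^sub>R \<nu>"

definition kinked' :: "nat set \<Rightarrow> real \<Rightarrow> real \<Rightarrow> complex" where
  "kinked' F s t = (1 - 4 * s * train (\<lambda>_. 1) F kink' t) *\<^sub>R c' (t - s * (4 * \<rho> * train (\<lambda>_. 1) F kink t)) +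
     (s * (train (\<lambda>_. 1) F bump' t / (2 * \<rho>))) *\<^sub>R \<nu>"

text \<open>\<open>kink\<close> is odd, so it raises one branch of the loop and lowers the other;
  \<open>\<sigma> k\<close> selects which.\<close>

definition raised :: "nat set \<Rightarrow> real \<Rightarrow> real \<Rightarrow> real" where
  "raised F s t = h t + s * (M * train \<sigma> F kink t)"

definition raised' :: "nat set \<Rightarrow> real \<Rightarrow> real \<Rightarrow> real" where
  "raised' F s t = h' t + s * (M * train \<sigma> F kink' t / \<rho>)"

lemma curve_family_kinked:
  assumes F: "F \<subseteq> {..<N}" shows "curve_family (kinked F) (kinked' F)"
proof -
  note A = curve_family_const[OF C1_curve_train[OF F kink_outside C1_curve_kink, of "\<lambda>_. 1"]]
    and B = curve_family_const[OF C1_curve_train[OF F bump_outside C1_curve_bump, of "\<lambda>_. 1"]]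
  have sF: "curve_family (\<lambda>s t. s) (\<lambda>s t. 0::real)" by (rule curve_family_param) (rule continuous_on_id)
  have kF: "curve_family (\<lambda>s t. k) (\<lambda>s t. 0::real)" for k by (rule curve_family_param) simp
  have tF: "curve_family (\<lambda>s t. t) (\<lambda>s t. 1::real)"
    by (rule curve_family_const) (simp add: C1_curve_def has_vector_derivative_id)
  note th = curve_family_diff[OF tF curve_family_mult[OF sF curve_family_mult[OF kF[of "4 * \<rho>"] A]]]
  note B2 = curve_family_linear[OF bounded_linear_scaleR_left curve_family_mult[OF sF curve_family_mult[OF B kF[of "1/2"]]], of \<nu>]
  note F = curve_family_add[OF curve_family_compose[OF curve_family_const[OF C] th] B2]
  show ?thesis using F \<rho>(1) unfolding kinked_def[abs_def] kinked'_def[abs_def] by (simp add: field_simps)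
qed

lemma curve_family_raised:
  assumes F: "F \<subseteq> {..<N}" shows "curve_family (raised F) (raised' F)"
proof -
  note A = curve_family_const[OF C1_curve_train[OF F kink_outside C1_curve_kink, of \<sigma>]]
  have sF: "curve_family (\<lambda>s t. s) (\<lambda>s t. 0::real)" by (rule curve_family_param) (rule continuous_on_id)
  have kF: "curve_family (\<lambda>s t. k) (\<lambda>s t. 0::real)" for k by (rule curve_family_param) simp
  note R = curve_family_add[OF curve_family_const[OF Hc] curve_family_mult[OF sF curve_family_mult[OF kF[of M] A]]]
  show ?thesis using R unfolding raised_def[abs_def] raised'_def[abs_def] by simp
qed

lemma kinked_period: "kinked F s (t + 1) = kinked F s t"
proof -
  have "c (t + 1 - a) = c (t - a)" for a using ci(2)[of "t - a"] by (simp add: algebra_simps)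
  then show ?thesis by (simp add: kinked_def train_period)
qed

lemma raised_period: "raised F s (t + 1) = raised F s t"
  by (simp add: raised_def train_period h_period)

lemma kinked_site:
  assumes "F \<subseteq> {..<N}" "k \<in> F" "\<bar>u\<bar> \<le> 1" "t - (m + \<rho> * (3 * real k + u)) \<in> \<int>"
  shows "kinked F s t = \<Phi> (3 * real k + (u - 4 * s * kink u)) (s * (bump u / 2))"
    and "kinked' F s t = (1 - 4 * s * kink' u) *\<^sub>R c' (m + \<rho> * (3 * real k + (u - 4 * s * kink u))) + (s * (bump' u / (2 * \<rho>))) *\<^sub>R \<nu>"
    and "raised F s t = h t + s * (M * (\<sigma> k * kink u))"
    and "raised' F s t = h' t + s * (M * (\<sigma> k * kink' u) / \<rho>)"
proof -
  note T = train_site[OF assms(1) _ assms(2-4)]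
  have eq: "t - s * (4 * \<rho> * kink u) - (m + \<rho> * (3 * real k + (u - 4 * s * kink u))) = t - (m + \<rho> * (3 * real k + u))"
    by (simp add: algebra_simps)
  have i: "t - s * (4 * \<rho> * kink u) - (m + \<rho> * (3 * real k + (u - 4 * s * kink u))) \<in> \<int>" unfolding eq by (rule assms(4))
  have "c (t - s * (4 * \<rho> * kink u)) = c (m + \<rho> * (3 * real k + (u - 4 * s * kink u)))"
    "c' (t - s * (4 * \<rho> * kink u)) = c' (m + \<rho> * (3 * real k + (u - 4 * s * kink u)))"
    using periodic_int[of c, OF ci(2) i] periodic_int[of c', OF c'_period i] .
  then show "kinked F s t = \<Phi> (3 * real k + (u - 4 * s * kink u)) (s * (bump u / 2))"
    "kinked' F s t = (1 - 4 * s * kink' u) *\<^sub>R c' (m + \<rho> * (3 * real k + (u - 4 * s * kink u))) + (s * (bump' u / (2 * \<rho>))) *\<^sub>R \<nu>"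
    using T[OF kink_outside(1), where w = "\<lambda>_. 1"] T[OF bump_outside(1), where w = "\<lambda>_. 1"] T[OF kink_outside(2), where w = "\<lambda>_. 1"] T[OF bump_outside(2), where w = "\<lambda>_. 1"]
    by (simp_all add: kinked_def kinked'_def \<Phi>_def scaleR_conv_of_real)
  show "raised F s t = h t + s * (M * (\<sigma> k * kink u))" "raised' F s t = h' t + s * (M * (\<sigma> k * kink' u) / \<rho>)"
    using T[OF kink_outside(1), where w = \<sigma>] T[OF kink_outside(2), where w = \<sigma>] by (simp_all add: raised_def raised'_def)
qed

lemma kinked_off:
  assumes "F \<subseteq> {..<N}" "t \<notin> arcs F"
  shows "kinked F s t = c t" "kinked' F s t = c' t" "raised F s t = h t" "raised' F s t = h' t"
  using train_off[OF assms(1) _ assms(2)] kink_outside bump_outside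
  by (simp_all add: kinked_def kinked'_def raised_def raised'_def)

lemma \<Phi>_clear: "\<bar>x\<bar> < 3 * real N + 2 \<Longrightarrow> \<bar>y\<bar> < 2 \<Longrightarrow> c t = \<Phi> x y \<Longrightarrow> t - (m + \<rho> * x) \<in> \<int>"
  unfolding \<Phi>_def by (rule clear)

lemma \<Phi>_inj: "\<bar>x\<bar> < 3 * real N + 2 \<Longrightarrow> \<bar>x'\<bar> < 3 * real N + 2 \<Longrightarrow> \<Phi> x y = \<Phi> x' y' \<Longrightarrow> x = x' \<and> y = y'"
  unfolding \<Phi>_def by (rule chart_inj)

lemma indep_\<nu>: assumes "\<bar>x\<bar> < 3 * real N + 2" shows "indep (c' (m + \<rho> * x)) \<nu>"
  unfolding indep_def
proof (intro allI impI)
  fix a b assume e: "a *\<^sub>R c' (m + \<rho> * x) + b *\<^sub>R \<nu> = 0"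
  let ?d = "c' (m + \<rho> * x)"
  have "Im (cnj ?d * (a *\<^sub>R ?d + b *\<^sub>R \<nu>)) = b * Im (cnj ?d * \<nu>)" "Im (cnj (a *\<^sub>R ?d + b *\<^sub>R \<nu>) * \<nu>) = a * Im (cnj ?d * \<nu>)"
    by (simp_all add: algebra_simps)
  then show "a = 0 \<and> b = 0" using chart_pos[OF assms] unfolding e by simp
qed

lemma site_value_range:
  assumes "k < N" "\<bar>u\<bar> \<le> 1" "s \<in> {0..1}"
  shows "\<bar>3 * real k + (u - 4 * s * kink u)\<bar> < 3 * real N + 2" "\<bar>s * (bump u / 2)\<bar> < 2" "\<bar>u - 4 * s * kink u\<bar> \<le> 1"
proof -
  show 1: "\<bar>u - 4 * s * kink u\<bar> \<le> 1" using kink_bound assms by simp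
  show "\<bar>3 * real k + (u - 4 * s * kink u)\<bar> < 3 * real N + 2" by (rule site_range(1)[OF assms(1) 1])
  have "\<bar>s * (bump u / 2)\<bar> \<le> 1 * 1" unfolding abs_mult using assms(3) bump_range[of u] by (intro mult_mono) auto
  then show "\<bar>s * (bump u / 2)\<bar> < 2" by simp
qed

text \<open>An arc with a kink stays in the strip over its own site, where the rest of the curve
  does not enter. New double points are therefore those of a single kink.\<close>

lemma kinked_double_pair:
  assumes F: "F \<subseteq> {..<N}" and s: "s \<in> {0..1}" and dp: "double_pair (kinked F s) t t'"
  obtains (off) "t \<notin> arcs F" "t' \<notin> arcs F" "double_pair c t t'"
    | (site) k u where "k \<in> F" "\<bar>u\<bar> \<le> 1" "u \<noteq> 0" "4 * s * bump u = 1"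
      "t - (m + \<rho> * (3 * real k + u)) \<in> \<int>" "t' - (m + \<rho> * (3 * real k + - u)) \<in> \<int>"
proof -
  have e: "kinked F s t = kinked F s t'" and ni: "t - t' \<notin> \<int>" using dp by (auto simp: double_pair_def)
  have mixed: "y \<in> arcs F" if x: "x \<in> arcs F" and eq: "kinked F s x = kinked F s y" for x y
  proof (rule ccontr)
    assume y: "y \<notin> arcs F"
    obtain k u where k: "k \<in> F" "\<bar>u\<bar> \<le> 1" "x - (m + \<rho> * (3 * real k + u)) \<in> \<int>" using x by (auto simp: arcs_def)
    have kN: "k < N" using k(1) F by auto
    note r = site_value_range[OF kN k(2) s]
    have "c y = \<Phi> (3 * real k + (u - 4 * s * kink u)) (s * (bump u / 2))"
      using kinked_site(1)[OF F k] kinked_off(1)[OF F y] eq by simp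
    from \<Phi>_clear[OF r(1,2) this] have "y \<in> arcs F" unfolding arcs_def using k(1) r(3) by blast
    then show False using y by simp
  qed
  show thesis
  proof (cases "t \<in> arcs F")
    case False
    then have "t' \<notin> arcs F" using mixed[of t' t] e by auto
    then show thesis using off False kinked_off(1)[OF F] e ni by (simp add: double_pair_def)
  next
    case True
    then have t': "t' \<in> arcs F" using mixed e by blast
    obtain k u where k: "k \<in> F" "\<bar>u\<bar> \<le> 1" "t - (m + \<rho> * (3 * real k + u)) \<in> \<int>" using True by (auto simp: arcs_def)
    obtain j v where j: "j \<in> F" "\<bar>v\<bar> \<le> 1" "t' - (m + \<rho> * (3 * real j + v)) \<in> \<int>" using t' by (auto simp: arcs_def)
    have kN: "k < N" "j < N" using k(1) j(1) F by auto
    note r = site_value_range[OF kN(1) k(2) s] and q = site_value_range[OF kN(2) j(2) s]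
    have eq: "3 * real k + (u - 4 * s * kink u) = 3 * real j + (v - 4 * s * kink v) \<and> s * (bump u / 2) = s * (bump v / 2)"
      using e unfolding kinked_site(1)[OF F k] kinked_site(1)[OF F j] by (rule \<Phi>_inj[OF r(1) q(1)])
    \<comment> \<open>Both abscissae stay within 1 of their centres, and distinct centres are at
      least 3 apart.\<close>
    then have "\<bar>real k - real j\<bar> < 1" using r(3) q(3) by linarith
    then have jk: "j = k" by linarith
    have "u \<noteq> v"
    proof
      assume "u = v"
      then have "frac t = frac (m + \<rho> * (3 * real k + u))" "frac t' = frac (m + \<rho> * (3 * real k + u))"
        using k(3) j(3) jk frac_eq_iff_Ints by auto
      then show False using ni frac_eq_iff_Ints by metis
    qed
    then have "v = - u \<and> u \<noteq> 0 \<and> 4 * s * bump u = 1"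
      using eq jk by (intro kink_double k j) simp_all
    then show thesis using site[of k u] k j jk by simp
  qed
qed

text \<open>Clearance of the strip with \<open>y = 0\<close>: the arcs carry no crossings of the
  original diagram.\<close>

lemma double_pair_c_off:
  assumes F: "F \<subseteq> {..<N}" and dp: "double_pair c t t'" shows "t \<notin> arcs F"
proof
  assume "t \<in> arcs F"
  then obtain k u where k: "k \<in> F" "\<bar>u\<bar> \<le> 1" "t - (m + \<rho> * (3 * real k + u)) \<in> \<int>" by (auto simp: arcs_def)
  have kN: "k < N" using k(1) F by auto
  have "c t' = c (m + \<rho> * (3 * real k + u))" using dp periodic_int[of c, OF ci(2) k(3)] by (simp add: double_pair_def)
  then have "c t' = \<Phi> (3 * real k + u) 0" by (simp add: \<Phi>_def)
  from \<Phi>_clear[OF site_range(1)[OF kN k(2)] _ this] have "t' - (m + \<rho> * (3 * real k + u)) \<in> \<int>" by simp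
  then have "t - t' \<in> \<int>" using k(3) frac_eq_iff_Ints by metis
  then show False using dp by (simp add: double_pair_def)
qed

lemma h_double_pair: "double_pair c s t \<Longrightarrow> h s \<noteq> h t"
  using h_over[of s t] h_over[of t s] Dd(8)[of s t] double_pair_sym[of c s t] by force

text \<open>The profile separates the two branches by \<open>2 * M * \<bar>u\<bar> * bump u\<close>,
  at least \<open>M / 2 * \<bar>u\<bar>\<close>, whereas \<open>h\<close> varies by less than this
  over the parameter distance \<open>2 * \<rho> * \<bar>u\<bar>\<close>.\<close>

lemma raised_site_less:
  assumes F: "F \<subseteq> {..<N}" and k: "k \<in> F" "\<bar>u\<bar> \<le> 1" "1 \<le> 4 * bump u" "0 < \<sigma> k * u"
    and t: "t - (m + \<rho> * (3 * real k + u)) \<in> \<int>" "t' - (m + \<rho> * (3 * real k + - u)) \<in> \<int>"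
  shows "raised F 1 t' < raised F 1 t"
proof -
  let ?p = "m + \<rho> * (3 * real k + u)" and ?q = "m + \<rho> * (3 * real k + - u)"
  have u0: "u \<noteq> 0" using k(4) by auto
  have su: "\<sigma> k * u = \<bar>u\<bar>" using k(4) \<sigma>[of k] by (metis abs_mult abs_of_pos mult_1)
  have hd: "(h has_real_derivative h' x) (at x)" for x
    using Hc by (simp add: C1_curve_def has_real_derivative_iff_has_vector_derivative)
  have lip1: "\<bar>h y - h x\<bar> < M / (4 * \<rho>) * (y - x)" if "x < y" for x y
  proof -
    obtain z where z: "h y - h x = (y - x) * h' z" using MVT2[OF \<open>x < y\<close>, of h h'] hd by blast
    have "\<bar>h' z\<bar> < M / (4 * \<rho>)" using M[of z] \<rho>(1) by (simp add: field_simps)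
    then have "\<bar>h' z\<bar> * (y - x) < M / (4 * \<rho>) * (y - x)" using that by (intro mult_strict_right_mono) auto
    then show ?thesis unfolding z abs_mult using that by (simp add: mult.commute)
  qed
  have lip: "\<bar>h y - h x\<bar> < M / (4 * \<rho>) * \<bar>y - x\<bar>" if "x \<noteq> y" for x y
  proof (cases "x < y")
    case True
    then show ?thesis using lip1[OF True] by simp
  next
    case False
    then have "y < x" using that by simp
    then show ?thesis using lip1[OF \<open>y < x\<close>] by (simp add: abs_minus_commute)
  qed
  have "?p \<noteq> ?q" using u0 \<rho>(1) by simp
  then have "\<bar>h ?q - h ?p\<bar> < M / (4 * \<rho>) * \<bar>?q - ?p\<bar>" by (rule lip)
  also have "?q - ?p = - (2 * \<rho> * u)" by (simp add: algebra_simps)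
  also have "M / (4 * \<rho>) * \<bar>- (2 * \<rho> * u)\<bar> = M / 2 * \<bar>u\<bar>" using \<rho>(1) by (simp add: abs_mult)
  finally have hb: "h ?q - h ?p < M / 2 * \<bar>u\<bar>" by linarith
  have "0 \<le> 4 * \<rho> * \<bar>h' 0\<bar>" using \<rho>(1) by simp
  then have M0: "0 < M" using M[of 0] by linarith
  have ht: "h t = h ?p" "h t' = h ?q" using periodic_int[of h, OF h_period t(1)] periodic_int[of h, OF h_period t(2)] .
  have mu: "\<bar>- u\<bar> \<le> 1" using k(2) by simp
  have "raised F 1 t - raised F 1 t' = h ?p - h ?q + 2 * M * (\<sigma> k * kink u)"
    unfolding kinked_site(3)[OF F k(1,2) t(1)] kinked_site(3)[OF F k(1) mu t(2)] ht by (simp add: bump_minus algebra_simps)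
  also have "\<sigma> k * kink u = \<bar>u\<bar> * bump u" using su by (simp add: kink_def mult.assoc[symmetric])
  finally have 1: "raised F 1 t - raised F 1 t' = h ?p - h ?q + M * \<bar>u\<bar> / 2 * (4 * bump u)" by simp
  have "M * \<bar>u\<bar> / 2 * 1 \<le> M * \<bar>u\<bar> / 2 * (4 * bump u)" using M0 k(3) by (intro mult_left_mono) auto
  then show ?thesis using 1 hb by simp
qed

end

context kink_site
begin

text \<open>Tangent and \<open>\<nu>\<close> are independent, so both coefficients vanish. At the
  ends of the arc the tangent has coefficient 1; what is left is the centre, where a cusp forms at
  the moment \<open>s = 1/4\<close>.\<close>

lemma kinked'_zero:
  assumes F: "F \<subseteq> {..<N}" and s: "s \<in> {0..1}" and z: "kinked' F s t = 0"
  obtains k where "k \<in> F" "t - (m + \<rho> * (3 * real k + 0)) \<in> \<int>" "4 * s = 1"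
proof (cases "t \<in> arcs F")
  case False
  then show ?thesis using z kinked_off(2)[OF F] ci(3)[of t] vd by simp
next
  case True
  then obtain k u where k: "k \<in> F" "\<bar>u\<bar> \<le> 1" "t - (m + \<rho> * (3 * real k + u)) \<in> \<int>" by (auto simp: arcs_def)
  have kN: "k < N" using k(1) F by auto
  have "1 - 4 * s * kink' u = 0 \<and> s * (bump' u / (2 * \<rho>)) = 0"
    using indep_\<nu>[OF site_value_range(1)[OF kN k(2) s]] z unfolding kinked_site(2)[OF F k] indep_def by blast
  then have 1: "4 * s * kink' u = 1" and 2: "bump' u = 0" using \<rho>(1) by auto
  have "u = 0"
  proof (rule ccontr)
    assume "u \<noteq> 0"
    then have "u\<^sup>2 = 1" using 2 k(2) by (simp add: bump'_def)
    then have "bump u = 0" using k(2) by (simp add: bump_def)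
    then show False using 1 2 by (simp add: kink'_def)
  qed
  then show ?thesis using that[of k] k 1 by (simp add: kink'_def bump_def)
qed

text \<open>Heights change while the plane curve rests, which is harmless because old crossings are
  off the arcs. The kinks grow under the final heights: these separate the branches of a loop and
  supply vertical velocity at the cusp.\<close>

lemma kinked_isotopy:
  assumes F: "F \<subseteq> {..<N}"
  shows "embedded_isotopy UNIV (\<lambda>t. (c t, h t)) (\<lambda>t. (kinked F 1 t, raised F 1 t))"
proof -
  note R = curve_family_raised[OF F]
  have A: "embedded_isotopy UNIV (\<lambda>t. (c t, raised F 0 t)) (\<lambda>t. (c t, raised F 1 t))"
  proof (rule embedded_isotopyI[OF curve_family_Pair[OF curve_family_const[OF C] R]])
    fix s t u :: real
    show "(c (t + 1), raised F s (t + 1)) = (c t, raised F s t)" using ci(2) by (simp add: raised_period)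
    show "(c' t, raised' F s t) \<noteq> 0" using ci(3)[of t] vd by (simp add: zero_prod_def)
    show "t - u \<in> \<int>" if e: "(c t, raised F s t) = (c u, raised F s u)"
    proof (rule ccontr)
      assume "t - u \<notin> \<int>"
      then have dp: "double_pair c t u" using e by (simp add: double_pair_def)
      have "h t = h u" using e kinked_off(3)[OF F double_pair_c_off[OF F dp]]
          kinked_off(3)[OF F double_pair_c_off[OF F double_pair_sym[OF dp]]] by simp
      then show False using h_double_pair[OF dp] by simp
    qed
  qed simp
  have B: "embedded_isotopy UNIV (\<lambda>t. (kinked F 0 t, raised F 1 t)) (\<lambda>t. (kinked F 1 t, raised F 1 t))"
  proof (rule embedded_isotopyI[OF curve_family_Pair[OF curve_family_kinked[OF F] curve_family_const[OF curve_family_member[OF R, of 1]]]])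
    fix s t u :: real assume s: "s \<in> {0..1}"
    show "(kinked F s (t + 1), raised F 1 (t + 1)) = (kinked F s t, raised F 1 t)" by (simp add: raised_period kinked_period)
    show "(kinked' F s t, raised' F 1 t) \<noteq> 0"
    proof
      assume "(kinked' F s t, raised' F 1 t) = 0"
      then have z: "kinked' F s t = 0" "raised' F 1 t = 0" by (simp_all add: zero_prod_def)
      obtain k where k: "k \<in> F" "t - (m + \<rho> * (3 * real k + 0)) \<in> \<int>" using kinked'_zero[OF F s z(1)] by blast
      \<comment> \<open>At the centre the profile contributes vertical velocity of size
        \<open>M / \<rho>\<close>, which \<open>h'\<close> is too small to cancel.\<close>
      have "h' t + M * \<sigma> k / \<rho> = 0"
        using z(2) unfolding kinked_site(4)[OF F k(1) _ k(2), simplified] by (simp add: kink'_def bump_def)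
      then have "M * \<sigma> k = - \<rho> * h' t" using \<rho>(1) by (simp add: field_simps)
      then have "\<bar>M\<bar> * \<bar>\<sigma> k\<bar> = \<rho> * \<bar>h' t\<bar>" using \<rho>(1) by (metis abs_minus_cancel abs_mult abs_of_pos)
      then have "M \<le> \<rho> * \<bar>h' t\<bar>" using \<sigma>[of k] by simp
      moreover have "\<rho> * \<bar>h' t\<bar> \<le> 4 * \<rho> * \<bar>h' t\<bar>" using \<rho>(1) by simp
      ultimately show False using M[of t] by linarith
    qed
    show "t - u \<in> \<int>" if e: "(kinked F s t, raised F 1 t) = (kinked F s u, raised F 1 u)"
    proof (rule ccontr)
      assume "t - u \<notin> \<int>"
      then have dp: "double_pair (kinked F s) t u" using e by (simp add: double_pair_def)
      then show False
      proof (rule kinked_double_pair[OF F s])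
        assume a: "t \<notin> arcs F" "u \<notin> arcs F" "double_pair c t u"
        show False using e kinked_off(3)[OF F a(1)] kinked_off(3)[OF F a(2)] h_double_pair[OF a(3)] by simp
      next
        fix k v assume a: "k \<in> F" "\<bar>v\<bar> \<le> 1" "v \<noteq> 0" "4 * s * bump v = 1"
          "t - (m + \<rho> * (3 * real k + v)) \<in> \<int>" "u - (m + \<rho> * (3 * real k + - v)) \<in> \<int>"
        have "s * bump v \<le> 1 * bump v" using s bump_range(1)[of v] by (intro mult_right_mono) auto
        then have b: "1 \<le> 4 * bump v" using a(4) by linarith
        have "\<sigma> k \<noteq> 0" using \<sigma>[of k] by auto
        then have "\<sigma> k * v \<noteq> 0" using a(3) by simp
        then consider "0 < \<sigma> k * v" | "0 < \<sigma> k * (- v)" unfolding mult_minus_right by linarith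
        then show False
        proof cases
          case 1
          show ?thesis using raised_site_less[OF F a(1,2) b 1 a(5,6)] e by simp
        next
          case 2
          have "raised F 1 t < raised F 1 u"
            by (rule raised_site_less[OF F a(1), of "- v"]) (use a b 2 in \<open>simp_all add: bump_minus\<close>)
          then show ?thesis using e by simp
        qed
      qed
    qed
  qed simp_all
  have "raised F 0 = h" "kinked F 0 = c" by (auto simp: raised_def kinked_def fun_eq_iff)
  then show ?thesis using embedded_isotopy_trans[OF A] B by simp
qed

text \<open>At a kink the over-passage is the one lifted by the height profile.\<close>

definition over :: "nat set \<Rightarrow> real set" where
  "over F = Ov \<union> {t. \<exists>k\<in>F. t - (m + \<rho> * (3 * real k + \<sigma> k * kink_apex)) \<in> \<int>}"

lemma \<sigma>_apex: "\<bar>\<sigma> k * kink_apex\<bar> \<le> 1"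
  using \<sigma>[of k] kink_apex by (simp add: abs_mult)

lemma site_unique:
  assumes "k < N" "j < N" "\<bar>u\<bar> \<le> 1" "\<bar>v\<bar> \<le> 1"
    "t - (m + \<rho> * (3 * real k + u)) \<in> \<int>" "t - (m + \<rho> * (3 * real j + v)) \<in> \<int>"
  shows "k = j \<and> u = v"
proof -
  have "c t = \<Phi> (3 * real k + u) 0" "c t = \<Phi> (3 * real j + v) 0"
    using periodic_int[of c, OF ci(2) assms(5)] periodic_int[of c, OF ci(2) assms(6)] by (simp_all add: \<Phi>_def)
  then have e: "3 * real k + u = 3 * real j + v"
    using \<Phi>_inj[OF site_range(1)[OF assms(1,3)] site_range(1)[OF assms(2,4)]] by metis
  then have "\<bar>real k - real j\<bar> < 1" using assms(3,4) by linarith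
  then have "k = j" by linarith
  then show ?thesis using e by simp
qed

lemma over_off:
  assumes "t \<notin> arcs F" shows "t \<in> over F \<longleftrightarrow> t \<in> Ov"
proof -
  have "t \<in> arcs F" if "k \<in> F" "t - (m + \<rho> * (3 * real k + \<sigma> k * kink_apex)) \<in> \<int>" for k
    unfolding arcs_def using that \<sigma>_apex by blast
  then show ?thesis using assms by (auto simp: over_def)
qed

lemma Ov_off: assumes "F \<subseteq> {..<N}" "t \<in> Ov" shows "t \<notin> arcs F"
  using Dd(6)[OF assms(2)] double_pair_c_off[OF assms(1)] by blast

lemma over_site:
  assumes F: "F \<subseteq> {..<N}" and k: "k \<in> F" "\<bar>u\<bar> \<le> 1" "t - (m + \<rho> * (3 * real k + u)) \<in> \<int>"
  shows "t \<in> over F \<longleftrightarrow> u = \<sigma> k * kink_apex"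
proof
  assume "t \<in> over F"
  moreover have "t \<in> arcs F" using k by (auto simp: arcs_def)
  ultimately obtain j where j: "j \<in> F" "t - (m + \<rho> * (3 * real j + \<sigma> j * kink_apex)) \<in> \<int>"
    using Ov_off[OF F] by (auto simp: over_def)
  have "k < N" "j < N" using F k(1) j(1) by auto
  from site_unique[OF this k(2) \<sigma>_apex k(3) j(2)] show "u = \<sigma> k * kink_apex" by auto
next
  assume "u = \<sigma> k * kink_apex"
  then show "t \<in> over F" using k by (auto simp: over_def)
qed

lemma C1_curve_kinked: assumes F: "F \<subseteq> {..<N}" shows "C1_curve (kinked F 1) (kinked' F 1)"
  using curve_family_member[OF curve_family_kinked[OF F], of 1] by simp

lemma kinked_immersion: assumes F: "F \<subseteq> {..<N}" shows "closed_immersion (kinked F 1)"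
proof (rule closed_immersionI[OF C1_curve_kinked[OF F] kinked_period])
  show "kinked' F 1 t \<noteq> 0" for t
  proof
    assume "kinked' F 1 t = 0"
    then show False using kinked'_zero[OF F, of 1 t] by auto
  qed
qed

lemma kinked_double_pair_1:
  assumes F: "F \<subseteq> {..<N}" and dp: "double_pair (kinked F 1) t t'"
  obtains (off) "t \<notin> arcs F" "t' \<notin> arcs F" "double_pair c t t'"
    | (site) k u where "k \<in> F" "\<bar>u\<bar> \<le> 1" "u = kink_apex \<or> u = - kink_apex"
      "t - (m + \<rho> * (3 * real k + u)) \<in> \<int>" "t' - (m + \<rho> * (3 * real k + - u)) \<in> \<int>"
proof (rule kinked_double_pair[OF F _ dp])
  show thesis if "t \<notin> arcs F" "t' \<notin> arcs F" "double_pair c t t'" using off that .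
  show thesis if "k \<in> F" "\<bar>u\<bar> \<le> 1" "u \<noteq> 0" "4 * 1 * bump u = 1" "t - (m + \<rho> * (3 * real k + u)) \<in> \<int>" "t' - (m + \<rho> * (3 * real k + - u)) \<in> \<int>" for k u
    using site[OF that(1,2) kink_apex_iff[OF that(2)] that(5,6)] that(4) by simp
qed simp

lemma kinked_indep:
  assumes F: "F \<subseteq> {..<N}" and dp: "double_pair (kinked F 1) t t'"
  shows "indep (vector_derivative (kinked F 1) (at t)) (vector_derivative (kinked F 1) (at t'))"
  unfolding C1_curve_vd[OF C1_curve_kinked[OF F]]
  using dp
proof (rule kinked_double_pair_1[OF F])
  assume a: "t \<notin> arcs F" "t' \<notin> arcs F" "double_pair c t t'"
  show "indep (kinked' F 1 t) (kinked' F 1 t')"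
    using Dd(3)[OF a(3)] kinked_off(2)[OF F a(1)] kinked_off(2)[OF F a(2)] vd by simp
next
  fix k u assume a: "k \<in> F" "\<bar>u\<bar> \<le> 1" "u = kink_apex \<or> u = - kink_apex"
    "t - (m + \<rho> * (3 * real k + u)) \<in> \<int>" "t' - (m + \<rho> * (3 * real k + - u)) \<in> \<int>"
  have kN: "k < N" using a(1) F by auto
  have mu: "\<bar>- u\<bar> \<le> 1" using a(2) by simp
  have v: "kink' u = - 3/4" "4 * kink u = u" "bump' u = - 2 * u" "u \<noteq> 0"
    using a(3) kink_apex_values kink_apex(1) by (auto simp: bump_minus)
  define d where "d = c' (m + \<rho> * (3 * real k + 0))"
  define \<beta> where "\<beta> = - (u / \<rho>)"
  have i: "indep d \<nu>" unfolding d_def by (rule indep_\<nu>[OF site_range(1)[OF kN]]) simp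
  have x0: "u - 4 * 1 * kink u = 0" "- u - 4 * 1 * kink (- u) = 0" using v(2) by (simp_all add: bump_minus)
  \<comment> \<open>Both passages lie over the centre of the site, with tangents symmetric about
    \<open>d\<close>.\<close>
  have e: "kinked' F 1 t = 4 *\<^sub>R d + \<beta> *\<^sub>R \<nu>" "kinked' F 1 t' = 4 *\<^sub>R d + (- \<beta>) *\<^sub>R \<nu>"
    unfolding kinked_site(2)[OF F a(1,2,4)] kinked_site(2)[OF F a(1) mu a(5)] x0 bump_minus(1,3,4) v(1,3) d_def \<beta>_def
    using \<rho>(1) by (simp_all add: field_simps)
  show "indep (kinked' F 1 t) (kinked' F 1 t')" unfolding e indep_def
  proof (intro allI impI)
    fix x y assume "x *\<^sub>R (4 *\<^sub>R d + \<beta> *\<^sub>R \<nu>) + y *\<^sub>R (4 *\<^sub>R d + (- \<beta>) *\<^sub>R \<nu>) = 0"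
    then have "(4 * (x + y)) *\<^sub>R d + (\<beta> * (x - y)) *\<^sub>R \<nu> = 0" by (simp add: algebra_simps)
    then have "4 * (x + y) = 0 \<and> \<beta> * (x - y) = 0" using i unfolding indep_def by blast
    moreover have "\<beta> \<noteq> 0" using v(4) \<rho>(1) by (simp add: \<beta>_def)
    ultimately show "x = 0 \<and> y = 0" by auto
  qed
qed

lemma kinked_site_double:
  assumes F: "F \<subseteq> {..<N}" and k: "k \<in> F" and u: "u = kink_apex \<or> u = - kink_apex" and t: "t - (m + \<rho> * (3 * real k + u)) \<in> \<int>"
  shows "double_pair (kinked F 1) t (m + \<rho> * (3 * real k + - u))"
proof -
  have kN: "k < N" using k F by auto
  have b: "\<bar>u\<bar> \<le> 1" "\<bar>- u\<bar> \<le> 1" "u \<noteq> - u" using u kink_apex by auto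
  have v: "4 * kink u = u" using u kink_apex_values by (auto simp: bump_minus)
  have x0: "u - 4 * 1 * kink u = 0" "- u - 4 * 1 * kink (- u) = 0" using v by (simp_all add: bump_minus)
  let ?t' = "m + \<rho> * (3 * real k + - u)"
  have t': "?t' - (m + \<rho> * (3 * real k + - u)) \<in> \<int>" by simp
  have "kinked F 1 t = kinked F 1 ?t'"
    unfolding kinked_site(1)[OF F k b(1) t] kinked_site(1)[OF F k b(2) t'] x0 bump_minus(1) ..
  moreover have "t - ?t' \<notin> \<int>"
    using site_unique[OF kN kN b(1,2) t] b(3) by (metis Ints_minus add_diff_cancel_left' diff_add_cancel minus_diff_eq)
  ultimately show ?thesis by (simp add: double_pair_def)
qed

text \<open>Old crossings lie off the arcs and new ones on them, so the conditions on over-passages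
  and triple points can be checked separately for each kind.\<close>

lemma kinked_diagram:
  assumes F: "F \<subseteq> {..<N}" shows "is_diagram UNIV (kinked F 1, over F)"
  unfolding is_diagram_def prod.case
proof (intro conjI allI impI)
  show "closed_immersion (kinked F 1)" by (rule kinked_immersion[OF F])
  show "vector_derivative (kinked F 1) (at t) \<notin> span {vector_derivative (kinked F 1) (at s)}" if "double_pair (kinked F 1) s t" for s t
    using kinked_indep[OF F that] by (rule indep_notin_span)
  show "finite {s \<in> {0..<1}. \<exists>t. double_pair (kinked F 1) s t}"
    by (rule finite_double_points[OF kinked_immersion[OF F] kinked_indep[OF F]])
  show "over F \<subseteq> {s. \<exists>t. double_pair (kinked F 1) s t}"
  proof
    fix s assume "s \<in> over F"
    then consider "s \<in> Ov" | k where "k \<in> F" "s - (m + \<rho> * (3 * real k + \<sigma> k * kink_apex)) \<in> \<int>" by (auto simp: over_def)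
    then show "s \<in> {s. \<exists>t. double_pair (kinked F 1) s t}"
    proof cases
      case 1
      then obtain t where t: "double_pair c s t" using Dd(6) by blast
      have "double_pair (kinked F 1) s t"
        using t kinked_off(1)[OF F double_pair_c_off[OF F t]] kinked_off(1)[OF F double_pair_c_off[OF F double_pair_sym[OF t]]]
        by (simp add: double_pair_def)
      then show ?thesis by blast
    next
      case 2
      have "\<sigma> k * kink_apex = kink_apex \<or> \<sigma> k * kink_apex = - kink_apex" using \<sigma>[of k] by (auto simp: abs_if split: if_splits)
      from kinked_site_double[OF F 2(1) this 2(2)] show ?thesis by blast
    qed
  qed
  show "(t + 1 \<in> over F) = (t \<in> over F)" for t
  proof -
    have "t + 1 - a \<in> \<int> \<longleftrightarrow> t - a \<in> \<int>" for a
    proof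
      have e: "t + 1 - a - 1 = t - a" "t - a + 1 = t + 1 - a" by simp_all
      show "t - a \<in> \<int>" if "t + 1 - a \<in> \<int>" using Ints_diff[OF that Ints_1] unfolding e .
      show "t + 1 - a \<in> \<int>" if "t - a \<in> \<int>" using Ints_add[OF that Ints_1] unfolding e .
    qed
    then show ?thesis using Dd(7)[of t] by (simp add: over_def)
  qed
  fix s t
  show "t - r \<in> \<int>" if h: "double_pair (kinked F 1) s t \<and> double_pair (kinked F 1) s r" for r
    using conjunct1[OF h]
  proof (rule kinked_double_pair_1[OF F])
    assume a: "s \<notin> arcs F" "t \<notin> arcs F" "double_pair c s t"
    show ?thesis using conjunct2[OF h]
    proof (rule kinked_double_pair_1[OF F])
      assume "double_pair c s r" then show ?thesis using Dd(4) a(3) by blast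
    next
      fix k u assume "k \<in> F" "\<bar>u\<bar> \<le> 1" "s - (m + \<rho> * (3 * real k + u)) \<in> \<int>"
      then show ?thesis using a(1) by (auto simp: arcs_def)
    qed
  next
    fix k u assume a: "k \<in> F" "\<bar>u\<bar> \<le> 1" "s - (m + \<rho> * (3 * real k + u)) \<in> \<int>" "t - (m + \<rho> * (3 * real k + - u)) \<in> \<int>"
    show ?thesis using conjunct2[OF h]
    proof (rule kinked_double_pair_1[OF F])
      assume "s \<notin> arcs F" then show ?thesis using a by (auto simp: arcs_def)
    next
      fix j v assume b: "j \<in> F" "\<bar>v\<bar> \<le> 1" "s - (m + \<rho> * (3 * real j + v)) \<in> \<int>" "r - (m + \<rho> * (3 * real j + - v)) \<in> \<int>"
      have "k < N" "j < N" using F a(1) b(1) by auto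
      from site_unique[OF this a(2) b(2) a(3) b(3)] have "j = k" "v = u" by auto
      then show ?thesis using a(4) b(4) frac_eq_iff_Ints by metis
    qed
  qed
  show "(s \<in> over F) = (t \<notin> over F)" if h: "double_pair (kinked F 1) s t"
    using h
  proof (rule kinked_double_pair_1[OF F])
    assume a: "s \<notin> arcs F" "t \<notin> arcs F" "double_pair c s t"
    show ?thesis using Dd(8)[OF a(3)] over_off[OF a(1)] over_off[OF a(2)] by blast
  next
    fix k u assume a: "k \<in> F" "\<bar>u\<bar> \<le> 1" "u = kink_apex \<or> u = - kink_apex"
      "s - (m + \<rho> * (3 * real k + u)) \<in> \<int>" "t - (m + \<rho> * (3 * real k + - u)) \<in> \<int>"
    have mu: "\<bar>- u\<bar> \<le> 1" using a(2) by simp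
    show ?thesis unfolding over_site[OF F a(1,2,4)] over_site[OF F a(1) mu a(5)]
      using a(3) \<sigma>[of k] kink_apex(1) by (auto simp: abs_if split: if_splits)
  qed
qed simp

text \<open>The combinatorial choice in \<open>over\<close> agrees with the heights, so the isotopic
  space curve witnesses which knot the kinked diagram represents.\<close>

lemma raised_over:
  assumes F: "F \<subseteq> {..<N}" and dp: "double_pair (kinked F 1) s t" and s: "s \<in> over F"
  shows "raised F 1 t < raised F 1 s"
  using dp
proof (rule kinked_double_pair_1[OF F])
  assume a: "s \<notin> arcs F" "t \<notin> arcs F" "double_pair c s t"
  show ?thesis using h_over[OF a(3)] s over_off[OF a(1)] kinked_off(3)[OF F a(1)] kinked_off(3)[OF F a(2)] by simp
next
  fix k u assume a: "k \<in> F" "\<bar>u\<bar> \<le> 1" "u = kink_apex \<or> u = - kink_apex"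
    "s - (m + \<rho> * (3 * real k + u)) \<in> \<int>" "t - (m + \<rho> * (3 * real k + - u)) \<in> \<int>"
  have "u = \<sigma> k * kink_apex" using over_site[OF F a(1,2,4)] s by simp
  then have "\<sigma> k * u = \<bar>\<sigma> k\<bar> * \<bar>\<sigma> k\<bar> * kink_apex" by simp
  then have pos: "0 < \<sigma> k * u" using \<sigma>[of k] kink_apex(1) by simp
  have "1 \<le> 4 * bump u" using a(3) kink_apex_values(1) by (auto simp: bump_minus)
  from raised_site_less[OF F a(1,2) this pos a(4,5)] show ?thesis .
qed

section \<open>The kinks as moves of type 1\<close>

definition site_chart :: "nat \<Rightarrow> complex \<Rightarrow> complex" where
  "site_chart k z = \<Phi> (3 * real k + Re z) (Im z)"

definition site_chart' :: "nat \<Rightarrow> complex \<Rightarrow> complex \<Rightarrow>\<^sub>L complex" where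
  "site_chart' k z = (blinfun_scaleR_left (\<rho> *\<^sub>R c' (m + \<rho> * (3 * real k + Re z))) o\<^sub>L Blinfun Re) +
     (blinfun_scaleR_left \<nu> o\<^sub>L Blinfun Im)"

lemma site_chart'_apply: "site_chart' k z v = Re v *\<^sub>R (\<rho> *\<^sub>R c' (m + \<rho> * (3 * real k + Re z))) + Im v *\<^sub>R \<nu>"
  by (simp add: site_chart'_def blinfun.add_left blinfun_compose.rep_eq bounded_linear_Blinfun_apply bounded_linear_Re bounded_linear_Im)

lemma site_chart_derivative: "(site_chart k has_derivative site_chart' k z) (at z)"
proof -
  have "((\<lambda>z. m + \<rho> * (3 * real k + Re z)) has_derivative (\<lambda>v. \<rho> * Re v)) (at z)"
    by (auto intro!: derivative_eq_intros)
  moreover have "(c has_derivative (\<lambda>x. x *\<^sub>R c' (m + \<rho> * (3 * real k + Re z)))) (at (m + \<rho> * (3 * real k + Re z)))"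
    using C by (simp add: C1_curve_def has_vector_derivative_def)
  ultimately have "((\<lambda>z. c (m + \<rho> * (3 * real k + Re z))) has_derivative (\<lambda>v. (\<rho> * Re v) *\<^sub>R c' (m + \<rho> * (3 * real k + Re z)))) (at z)"
    using diff_chain_at by (fastforce simp: o_def)
  moreover have "((\<lambda>z. Im z *\<^sub>R \<nu>) has_derivative (\<lambda>v. Im v *\<^sub>R \<nu>)) (at z)"
    by (intro bounded_linear_imp_has_derivative bounded_linear_scaleR_const bounded_linear_Im)
  ultimately have "((\<lambda>z. c (m + \<rho> * (3 * real k + Re z)) + Im z *\<^sub>R \<nu>) has_derivative
      (\<lambda>v. (\<rho> * Re v) *\<^sub>R c' (m + \<rho> * (3 * real k + Re z)) + Im v *\<^sub>R \<nu>)) (at z)"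
    by (rule has_derivative_add)
  then show ?thesis
    by (simp add: site_chart_def[abs_def] \<Phi>_def site_chart'_apply[abs_def] scaleR_conv_of_real mult_ac)
qed

lemma site_chart_square: assumes k: "k < N" shows "square_chart UNIV (site_chart k)"
proof -
  \<comment> \<open>Slightly larger than the square and still inside the strip.\<close>
  define U where "U = {z. \<bar>Re z\<bar> < 3/2 \<and> \<bar>Im z\<bar> < 3/2}"
  have "U = {z. \<bar>Re z\<bar> < 3/2} \<inter> {z. \<bar>Im z\<bar> < 3/2}" by (auto simp: U_def)
  moreover have "open {z. \<bar>Re z\<bar> < 3/2}" "open {z. \<bar>Im z\<bar> < 3/2}" by (intro open_Collect_less continuous_intros)+
  ultimately have "open U" by auto
  have r: "\<bar>3 * real k + Re z\<bar> < 3 * real N + 2" if "z \<in> U" for z using that k by (auto simp: U_def)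
  have "inj_on (site_chart k) U"
  proof (rule inj_onI)
    fix z w assume zw: "z \<in> U" "w \<in> U" "site_chart k z = site_chart k w"
    then have "3 * real k + Re z = 3 * real k + Re w \<and> Im z = Im w"
      unfolding site_chart_def by (intro \<Phi>_inj r)
    then show "z = w" by (simp add: complex_eq_iff)
  qed
  moreover have "inj (site_chart' k z)" if "z \<in> U" for z
  proof (rule injI)
    fix v w assume "site_chart' k z v = site_chart' k z w"
    then have "((Re v - Re w) * \<rho>) *\<^sub>R c' (m + \<rho> * (3 * real k + Re z)) + (Im v - Im w) *\<^sub>R \<nu> = 0"
      by (simp add: site_chart'_apply algebra_simps)
    then have "(Re v - Re w) * \<rho> = 0 \<and> Im v - Im w = 0" using indep_\<nu>[OF r[OF that]] unfolding indep_def by blast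
    then show "v = w" using \<rho>(1) by (simp add: complex_eq_iff)
  qed
  moreover have "continuous_on U (site_chart' k)"
  proof -
    have cc': "continuous_on UNIV c'" using C by (simp add: C1_curve_def)
    have "continuous_on U (\<lambda>z. c' (m + \<rho> * (3 * real k + Re z)))"
      by (rule continuous_on_compose2[OF cc']) (auto intro!: continuous_intros)
    then show ?thesis unfolding site_chart'_def[abs_def]
      by (intro continuous_on_add continuous_on_const bounded_bilinear.continuous_on[OF bounded_bilinear_blinfun_compose]
        bounded_linear.continuous_on[OF bounded_linear_blinfun_scaleR_left] continuous_on_scaleR)
  qed
  moreover have "square \<subseteq> U" by (auto simp: square_def U_def)
  ultimately show ?thesis unfolding square_chart_def using \<open>open U\<close> site_chart_derivative by blast
qed

text \<open>Inserting kink \<open>k\<close> alters the curve on its own arc only, where the strip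
  coordinates show the model literally. Other kinks remain over their own sites, so they do not
  enter the square of \<open>k\<close>.\<close>

lemma site_reid_at:
  assumes F: "F \<subseteq> {..<N}" and k: "k < N" "k \<notin> F"
  shows "reid_at R1_model UNIV (kinked F 1, over F) (kinked (insert k F) 1, over (insert k F)) (site_chart k)
     (\<lambda>_. m + \<rho> * (3 * real k)) (\<lambda>_. \<rho>) (\<lambda>i. i)"
proof -
  let ?G = "insert k F"
  have G: "?G \<subseteq> {..<N}" using F k by auto
  have pe: "m + \<rho> * (3 * real k) + \<rho> * u = m + \<rho> * (3 * real k + u)" for u by (simp add: distrib_left)
  have len: "length R1_model = 1" by (simp add: R1_model_def)
  have notF: "t \<notin> arcs F" if "\<bar>u\<bar> \<le> 1" "t - (m + \<rho> * (3 * real k + u)) \<in> \<int>" for t u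
  proof
    assume "t \<in> arcs F"
    then obtain j v where j: "j \<in> F" "\<bar>v\<bar> \<le> 1" "t - (m + \<rho> * (3 * real j + v)) \<in> \<int>" by (auto simp: arcs_def)
    have "j < N" using j(1) F by auto
    from site_unique[OF k(1) this that(1) j(2) that(2) j(3)] show False using j(1) k(2) by simp
  qed
  have strand: "kinked F 1 (m + \<rho> * (3 * real k + u)) = site_chart k (fst (R1_model ! 0) u)"
    "kinked ?G 1 (m + \<rho> * (3 * real k + u)) = site_chart k (snd (R1_model ! 0) u)" if "\<bar>u\<bar> \<le> 1" for u
  proof -
    show "kinked F 1 (m + \<rho> * (3 * real k + u)) = site_chart k (fst (R1_model ! 0) u)"
      using kinked_off(1)[OF F notF[OF that]] by (simp add: R1_model_def site_chart_def \<Phi>_def)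
    have "kinked ?G 1 (m + \<rho> * (3 * real k + u)) = \<Phi> (3 * real k + (u - 4 * 1 * kink u)) (1 * (bump u / 2))"
      by (rule kinked_site(1)[OF G _ that]) simp_all
    then show "kinked ?G 1 (m + \<rho> * (3 * real k + u)) = site_chart k (snd (R1_model ! 0) u)"
      using that by (simp add: R1_model_def site_chart_def kink_eq bump_eq mult.assoc)
  qed
  have outside: "kinked F 1 t = kinked ?G 1 t \<and> kinked F 1 t \<notin> site_chart k ` square \<and> (t \<in> over F \<longleftrightarrow> t \<in> over ?G)"
    if n: "\<And>u. \<bar>u\<bar> \<le> 1 \<Longrightarrow> t - (m + \<rho> * (3 * real k + u)) \<notin> \<int>" for t
  proof -
    have sq: "site_chart k z = \<Phi> (3 * real k + Re z) (Im z)" "\<bar>3 * real k + Re z\<bar> < 3 * real N + 2" "\<bar>Im z\<bar> < 2" "\<bar>Re z\<bar> \<le> 1" if "z \<in> square" for z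
      using that site_range(1)[OF k(1), of "Re z"] by (auto simp: square_def site_chart_def)
    have ov: "t \<in> over F \<longleftrightarrow> t \<in> over ?G"
      using n[OF \<sigma>_apex[of k]] by (auto simp: over_def)
    show ?thesis
    proof (cases "t \<in> arcs F")
      case False
      then have "t \<notin> arcs ?G" using n by (auto simp: arcs_def)
      then have "kinked F 1 t = c t" "kinked ?G 1 t = c t" using False kinked_off(1)[OF F] kinked_off(1)[OF G] by simp_all
      moreover have "c t \<notin> site_chart k ` square"
      proof
        assume "c t \<in> site_chart k ` square"
        then obtain z where z: "z \<in> square" "c t = site_chart k z" by blast
        have "t - (m + \<rho> * (3 * real k + Re z)) \<in> \<int>" using \<Phi>_clear[OF sq(2,3)[OF z(1)]] z sq(1) by metis
        then show False using n sq(4)[OF z(1)] by blast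
      qed
      ultimately show ?thesis using ov by simp
    next
      case True
      then obtain j v where j: "j \<in> F" "\<bar>v\<bar> \<le> 1" "t - (m + \<rho> * (3 * real j + v)) \<in> \<int>" by (auto simp: arcs_def)
      have jN: "j < N" "j \<noteq> k" "j \<in> ?G" using j(1) F k by auto
      have r: "\<bar>3 * real j + (v - 4 * 1 * kink v)\<bar> < 3 * real N + 2" "\<bar>v - 4 * 1 * kink v\<bar> \<le> 1"
        using site_value_range(1,3)[OF jN(1) j(2), of 1] by simp_all
      have e: "kinked F 1 t = \<Phi> (3 * real j + (v - 4 * 1 * kink v)) (1 * (bump v / 2))"
        "kinked ?G 1 t = \<Phi> (3 * real j + (v - 4 * 1 * kink v)) (1 * (bump v / 2))"
        using kinked_site(1)[OF F j] kinked_site(1)[OF G jN(3) j(2,3)] by blast+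
      have "kinked F 1 t \<notin> site_chart k ` square"
      proof
        assume "kinked F 1 t \<in> site_chart k ` square"
        then obtain z where z: "z \<in> square" "kinked F 1 t = site_chart k z" by blast
        have "3 * real j + (v - 4 * 1 * kink v) = 3 * real k + Re z"
          using \<Phi>_inj[OF r(1) sq(2)[OF z(1)]] z(2) unfolding e(1) sq(1)[OF z(1)] by blast
        then have "\<bar>real j - real k\<bar> < 1" using r(2) sq(4)[OF z(1)] by linarith
        then show False using jN(2) by linarith
      qed
      then show ?thesis using e ov by simp
    qed
  qed
  have inj: "inj_on (\<lambda>(i::nat, u). frac (m + \<rho> * (3 * real k) + \<rho> * u)) ({..<1} \<times> {-1..1})"
  proof (rule inj_onI)
    fix x y :: "nat \<times> real" assume xy: "x \<in> {..<1} \<times> {-1..1}" "y \<in> {..<1} \<times> {-1..1}"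
      "(case x of (i, u) \<Rightarrow> frac (m + \<rho> * (3 * real k) + \<rho> * u)) = (case y of (i, u) \<Rightarrow> frac (m + \<rho> * (3 * real k) + \<rho> * u))"
    have "m + \<rho> * (3 * real k + snd x) - (m + \<rho> * (3 * real k + snd y)) \<in> \<int>"
      using xy(3) unfolding pe frac_eq_iff_Ints case_prod_unfold .
    moreover have "\<bar>snd x\<bar> \<le> 1" "\<bar>snd y\<bar> \<le> 1" using xy by auto
    ultimately have "snd x = snd y"
      using site_unique[OF k(1) k(1), of "snd x" "snd y" "m + \<rho> * (3 * real k + snd x)"] by simp
    then show "x = y" using xy by (auto simp: prod_eq_iff)
  qed
  show ?thesis
    unfolding reid_at_def len
  proof (intro conjI)
    show "square_chart UNIV (site_chart k)" by (rule site_chart_square[OF k(1)])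
    show "\<forall>i<1. \<rho> \<noteq> 0" using \<rho>(1) by simp
    show "inj_on (\<lambda>(i, u). frac (m + \<rho> * (3 * real k) + \<rho> * u)) ({..<1::nat} \<times> {-1..1})" by (rule inj)
    show "\<forall>i<1. \<forall>u\<in>{-1..1}. fst (kinked F 1, over F) (m + \<rho> * (3 * real k) + \<rho> * u) = site_chart k (fst (R1_model ! i) u) \<and>
       fst (kinked ?G 1, over ?G) (m + \<rho> * (3 * real k) + \<rho> * u) = site_chart k (snd (R1_model ! i) u)"
      unfolding pe using strand by (auto simp: abs_le_iff)
    show "\<forall>t. (\<nexists>i u. i < (1::nat) \<and> u \<in> {-1..1} \<and> t - (m + \<rho> * (3 * real k) + \<rho> * u) \<in> \<int>) \<longrightarrow>
       fst (kinked F 1, over F) t = fst (kinked ?G 1, over ?G) t \<and> fst (kinked F 1, over F) t \<notin> site_chart k ` square \<and>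
       (t \<in> snd (kinked F 1, over F)) = (t \<in> snd (kinked ?G 1, over ?G))"
      unfolding pe fst_conv snd_conv
    proof (intro allI impI)
      fix t assume a: "\<nexists>i u. i < (1::nat) \<and> u \<in> {-1..1} \<and> t - (m + \<rho> * (3 * real k + u)) \<in> \<int>"
      show "kinked F 1 t = kinked ?G 1 t \<and> kinked F 1 t \<notin> site_chart k ` square \<and> (t \<in> over F) = (t \<in> over ?G)"
      proof (rule outside)
        fix u :: real assume "\<bar>u\<bar> \<le> 1"
        then have "(0::nat) < 1 \<and> u \<in> {-1..1}" by auto
        then show "t - (m + \<rho> * (3 * real k + u)) \<notin> \<int>" using a by blast
      qed
    qed
  qed auto
qed

text \<open>The passage inspected here is the one that decides the change of writhe in
  \<open>R1_invariants\<close>.\<close>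

lemma site_over_apex:
  assumes "insert k F \<subseteq> {..<N}"
  shows "m + \<rho> * (3 * real k) + \<rho> * sqrt (1/2) \<in> over (insert k F) \<longleftrightarrow> \<sigma> k = 1"
proof -
  have "\<bar>kink_apex\<bar> \<le> 1" using kink_apex by simp
  from over_site[OF assms _ this, of k "m + \<rho> * (3 * real k + kink_apex)"]
  show ?thesis using kink_apex(1) by (simp add: distrib_left kink_apex_def[symmetric] add.assoc)
qed

lemma kinked_height:
  assumes F: "F \<subseteq> {..<N}"
  shows "raised F 1 C1_differentiable_on UNIV" "raised F 1 (t + 1) = raised F 1 t"
  using curve_family_member[OF curve_family_raised[OF F], of 1] C1_curve_iff raised_period by auto

end

section \<open>The cube of kinked diagrams\<close>

lemma periodic_bounded:
  fixes f :: "real \<Rightarrow> 'a::real_normed_vector"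
  assumes "continuous_on UNIV f" "\<And>t. f (t + 1) = f t"
  obtains B where "\<And>t. norm (f t) \<le> B"
proof -
  have "bounded (f ` {0..1})"
    using assms(1) by (intro compact_imp_bounded compact_continuous_image) (auto intro: continuous_on_subset)
  then obtain B where B: "\<And>x. x \<in> f ` {0..1} \<Longrightarrow> norm x \<le> B" unfolding bounded_iff by blast
  have "norm (f t) \<le> B" for t
  proof -
    have "t - frac t \<in> \<int>" by (simp add: frac_def)
    from periodic_int[of f, OF assms(2) this] have "f t = f (frac t)" .
    moreover have "frac t \<in> {0..1}" using frac_ge_0[of t] frac_lt_1[of t] by simp
    ultimately show ?thesis using B by simp
  qed
  then show thesis by (rule that)
qed

lemma C1_curve_linear: "bounded_linear f \<Longrightarrow> C1_curve c c' \<Longrightarrow> C1_curve (\<lambda>t. f (c t)) (\<lambda>t. f (c' t))"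
  using curve_family_member[OF curve_family_linear[OF _ curve_family_const[of c c']], of f 0] by simp

text \<open>The plane and the sphere share this step. All kinks have charts of the same sign
  \<kappa>, hence the change of writhe alternates with the over-passage, that is, with the parity of
  \<open>k\<close>.\<close>

lemma (in oriented_surface) kink_cubeI:
  assumes K: "K = knot_equiv `` {\<gamma>}" and \<kappa>: "\<bar>\<kappa>\<bar> = 1"
    and D: "\<And>F. F \<subseteq> {..<N} \<Longrightarrow> is_diagram S (C F, Ov F)"
    and H: "\<And>F. F \<subseteq> {..<N} \<Longrightarrow> H F C1_differentiable_on UNIV" "\<And>F t. F \<subseteq> {..<N} \<Longrightarrow> H F (t + 1) = H F t"
    and o: "\<And>F s t. F \<subseteq> {..<N} \<Longrightarrow> double_pair (C F) s t \<Longrightarrow> s \<in> Ov F \<Longrightarrow> H F t < H F s"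
    and i: "\<And>F. F \<subseteq> {..<N} \<Longrightarrow> embedded_isotopy (sphere 0 1) \<gamma> (\<lambda>t. stereo_inv (emb (C F t) (H F t)))"
    and r: "\<And>F k. F \<subseteq> {..<N} \<Longrightarrow> k < N \<Longrightarrow> k \<notin> F \<Longrightarrow>
      reid_at R1_model S (C F, Ov F) (C (insert k F), Ov (insert k F)) (\<phi> k) (\<lambda>_. a k) (\<lambda>_. b) (\<lambda>i. i)"
    and s: "\<And>k. k < N \<Longrightarrow> chart_sign \<omega> (\<phi> k) = \<kappa>"
    and x: "\<And>F k. F \<subseteq> {..<N} \<Longrightarrow> k < N \<Longrightarrow> a k + b * sqrt (1/2) \<in> Ov (insert k F) \<longleftrightarrow> even k"
  shows "kink_cube S emb K \<omega> N (\<lambda>F. (C F, Ov F)) \<kappa>"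
  unfolding kink_cube_def
proof (intro conjI allI impI)
  show "\<bar>\<kappa>\<bar> = 1" by fact
  show "(C F, Ov F) \<in> diagrams_of S emb K" if F: "F \<subseteq> {..<N}" for F
    unfolding diagrams_of_def represents_def mem_Collect_eq prod.case
  proof (intro conjI exI[of _ "H F"] allI impI)
    show "(\<lambda>t. stereo_inv (emb (C F t) (H F t))) \<in> K" unfolding K using knot_equivI[OF i[OF F]] by blast
  qed (use D[OF F] H[OF F] o[OF F] in blast)+
  fix F k assume F: "F \<subseteq> {..<N}" and k: "k < N" "k \<notin> F"
  have G: "insert k F \<subseteq> {..<N}" using F k by simp
  note R = r[OF F k]
  show "reid_step S (C F, Ov F) (C (insert k F), Ov (insert k F))"
    unfolding reid_step_def reid_step_via_iff using R by blast
  note I = R1_invariants[OF D[OF F] D[OF G] R]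
  show "crossing_number (C (insert k F), Ov (insert k F)) = crossing_number (C F, Ov F) + 1" by (rule I(1))
  show "writhe \<omega> (C (insert k F), Ov (insert k F)) = writhe \<omega> (C F, Ov F) + (if even k then \<kappa> else - \<kappa>)"
    using I(2) x[OF F k(1)] s[OF k(1)] by (cases "even k") (simp_all add: diff_eq_eq)
qed

text \<open>The strip has to hold \<open>N\<close> kinks, so its scale is chosen after
  \<open>N\<close>. The embedding in space is part of the result because the passage to the sphere
  starts from it.\<close>

lemma planar_kinks:
  fixes N :: nat
  assumes "K \<in> knot_types"
  obtains \<gamma> C H Ov \<phi> a b where "K = knot_equiv `` {\<gamma>}"
    "\<And>F. F \<subseteq> {..<N} \<Longrightarrow> is_diagram UNIV (C F, Ov F)"
    "\<And>F. F \<subseteq> {..<N} \<Longrightarrow> H F C1_differentiable_on UNIV" "\<And>F t. F \<subseteq> {..<N} \<Longrightarrow> H F (t + 1) = H F t"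
    "\<And>F s t. F \<subseteq> {..<N} \<Longrightarrow> double_pair (C F) s t \<Longrightarrow> s \<in> Ov F \<Longrightarrow> H F t < H F s"
    "\<And>F. F \<subseteq> {..<N} \<Longrightarrow> embedding (\<lambda>t. (C F t, H F t))"
    "\<And>F. F \<subseteq> {..<N} \<Longrightarrow> embedded_isotopy (sphere 0 1) \<gamma> (\<lambda>t. stereo_inv (C F t, H F t))"
    "\<And>F k. F \<subseteq> {..<N} \<Longrightarrow> k < N \<Longrightarrow> k \<notin> F \<Longrightarrow>
      reid_at R1_model UNIV (C F, Ov F) (C (insert k F), Ov (insert k F)) (\<phi> k) (\<lambda>_. a k) (\<lambda>_. b) (\<lambda>i. i)"
    "\<And>k. k < N \<Longrightarrow> chart_sign (\<lambda>p a b. Im (cnj a * b)) (\<phi> k) = 1"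
    "\<And>F k. F \<subseteq> {..<N} \<Longrightarrow> k < N \<Longrightarrow> a k + b * sqrt (1/2) \<in> Ov (insert k F) \<longleftrightarrow> even k"
proof -
  obtain \<gamma> where \<gamma>: "is_knot \<gamma>" "K = knot_equiv `` {\<gamma>}"
    using assms unfolding knot_types_def by (elim quotientE) simp
  obtain g :: "real \<Rightarrow> R3" where g: "embedding g" "embedded_isotopy (sphere 0 1) \<gamma> (\<lambda>t. stereo_inv (g t))"
    using knot_in_R3[OF \<gamma>(1)] .
  obtain c Ov h where D: "is_diagram UNIV (c, Ov)" and gi: "embedded_isotopy UNIV g (\<lambda>t. (c t, h t))"
    and ho: "\<And>s t. double_pair c s t \<Longrightarrow> s \<in> Ov \<Longrightarrow> h t < h s" by (rule generic_planar_diagram[OF g(1)], rule that)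
  have "closed_immersion (\<lambda>t. (c t, h t))"
    using embedded_isotopy_embedding(2)[OF gi] unfolding embedding_def by blast
  note ci = closed_immersionD[OF this]
  define c' h' where "c' = (\<lambda>t. fst (vector_derivative (\<lambda>t. (c t, h t)) (at t)))"
    and "h' = (\<lambda>t. snd (vector_derivative (\<lambda>t. (c t, h t)) (at t)))"
  have C: "C1_curve c c'" and Hc: "C1_curve h h'"
    using C1_curve_linear[OF bounded_linear_fst ci(1)] C1_curve_linear[OF bounded_linear_snd ci(1)]
    by (simp_all add: c'_def h'_def)
  have hp: "h (t + 1) = h t" for t using ci(2)[of t] by simp
  have "h' (t + 1) = h' t" for t unfolding h'_def ci(4) ..
  then obtain B where B: "\<And>t. norm (h' t) \<le> B" using periodic_bounded[of h'] Hc unfolding C1_curve_def by blast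
  have L: "0 < 3 * real N + 2" by simp
  obtain m \<rho> \<nu> where \<rho>: "0 < \<rho>" "2 * \<rho> * (3 * real N + 2) < 1"
    and inj: "\<And>x y x' y'. \<bar>x\<bar> < 3 * real N + 2 \<Longrightarrow> \<bar>x'\<bar> < 3 * real N + 2 \<Longrightarrow> c (m + \<rho> * x) + of_real y * \<nu> = c (m + \<rho> * x') + of_real y' * \<nu> \<Longrightarrow> x = x' \<and> y = y'"
    and pos: "\<And>x. \<bar>x\<bar> < 3 * real N + 2 \<Longrightarrow> 0 < Im (cnj (c' (m + \<rho> * x)) * \<nu>)"
    and clear: "\<And>t x y. \<bar>x\<bar> < 3 * real N + 2 \<Longrightarrow> \<bar>y\<bar> < 2 \<Longrightarrow> c t = c (m + \<rho> * x) + of_real y * \<nu> \<Longrightarrow> t - (m + \<rho> * x) \<in> \<int>"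
    by (rule clear_arc[OF D C L], rule that)
  \<comment> \<open>\<open>B\<close> bounds the slope of \<open>h\<close>, so the profile dominates
    it everywhere.\<close>
  define M where "M = 4 * \<rho> * B + 1"
  define \<sigma> :: "nat \<Rightarrow> real" where "\<sigma> k = (if even k then 1 else - 1)" for k
  have Mb: "4 * \<rho> * \<bar>h' t\<bar> < M" for t
  proof -
    have "4 * \<rho> * \<bar>h' t\<bar> \<le> 4 * \<rho> * B" by (rule mult_left_mono) (use B[of t] \<rho>(1) in simp_all)
    then show ?thesis by (simp add: M_def)
  qed
  have sb: "\<bar>\<sigma> k\<bar> = 1" for k by (simp add: \<sigma>_def)
  interpret kink_site c c' Ov h h' m \<rho> M \<nu> N \<sigma>
    by (rule kink_site.intro) (fact D C Hc hp ho \<rho> inj pos clear Mb sb)+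
  have iso: "embedded_isotopy UNIV g (\<lambda>t. (kinked F 1 t, raised F 1 t))" if "F \<subseteq> {..<N}" for F
    using embedded_isotopy_trans[OF gi kinked_isotopy[OF that]] .
  show thesis
  proof (rule that[of \<gamma> "\<lambda>F. kinked F 1" over "\<lambda>F. raised F 1" site_chart "\<lambda>k. m + \<rho> * (3 * real k)" \<rho>])
    show "K = knot_equiv `` {\<gamma>}" by (rule \<gamma>(2))
    fix F assume F: "F \<subseteq> {..<N}"
    show "is_diagram UNIV (kinked F 1, over F)" by (rule kinked_diagram[OF F])
    show "raised F 1 C1_differentiable_on UNIV" "raised F 1 (t + 1) = raised F 1 t" for t using kinked_height[OF F] by blast+
    show "raised F 1 t < raised F 1 s" if "double_pair (kinked F 1) s t" "s \<in> over F" for s t using raised_over[OF F that] .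
    show "embedding (\<lambda>t. (kinked F 1 t, raised F 1 t))" using embedded_isotopy_embedding(2)[OF iso[OF F]] .
    show "embedded_isotopy (sphere 0 1) \<gamma> (\<lambda>t. stereo_inv (kinked F 1 t, raised F 1 t))"
      by (rule embedded_isotopy_trans[OF g(2) embedded_isotopy_stereo[OF iso[OF F]]])
    fix k assume k: "k < N"
    show "reid_at R1_model UNIV (kinked F 1, over F) (kinked (insert k F) 1, over (insert k F)) (site_chart k) (\<lambda>_. m + \<rho> * (3 * real k)) (\<lambda>_. \<rho>) (\<lambda>i. i)"
      if "k \<notin> F" by (rule site_reid_at[OF F k that])
    have "insert k F \<subseteq> {..<N}" using F k by simp
    from site_over_apex[OF this] show "(m + \<rho> * (3 * real k) + \<rho> * sqrt (1/2) \<in> over (insert k F)) = even k"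
      by (simp add: \<sigma>_def)
  next
    fix k assume k: "k < N"
    have "\<bar>3 * real k + 0\<bar> < 3 * real N + 2" using site_range(1)[OF k, of 0] by simp
    \<comment> \<open>The chart is oriented by the tangent and \<open>\<nu>\<close>, whose
      determinant is positive at every site.\<close>
    from pos[OF this] have "0 < \<rho> * Im (cnj (c' (m + \<rho> * (3 * real k))) * \<nu>)" using \<rho>(1) by simp
    moreover have "chart_sign (\<lambda>p a b. Im (cnj a * b)) (site_chart k) = sgn (\<rho> * Im (cnj (c' (m + \<rho> * (3 * real k))) * \<nu>))"
      unfolding chart_sign_def frechet_derivative_at[OF site_chart_derivative, symmetric]
      by (simp add: site_chart'_apply algebra_simps)
    ultimately show "chart_sign (\<lambda>p a b. Im (cnj a * b)) (site_chart k) = 1" by simp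
  qed
qed

section \<open>From the plane to the sphere\<close>

text \<open>Inverse stereographic projection from the pole \<open>(0, -1)\<close>, scaled so that 0
  goes to \<open>(0, 1)\<close> with derivative \<open>v \<mapsto> (v, 0)\<close>. This
  normalisation, which causes the factor 1/4, makes zooming in at 0 converge to the
  identity.\<close>

definition sph :: "complex \<Rightarrow> R3" where
  "sph z = (inverse (1 + z \<bullet> z / 4) *\<^sub>R z, 2 * inverse (1 + z \<bullet> z / 4) - 1)"

definition sph' :: "complex \<Rightarrow> complex \<Rightarrow>\<^sub>L R3" where
  "sph' z = Blinfun (\<lambda>v. (inverse (1 + z \<bullet> z / 4) *\<^sub>R v - ((inverse (1 + z \<bullet> z / 4))\<^sup>2 * (z \<bullet> v) / 2) *\<^sub>R z,
     - ((inverse (1 + z \<bullet> z / 4))\<^sup>2 * (z \<bullet> v))))"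

lemma sph_denominator: "1 + z \<bullet> z / 4 > (0::real)" for z :: complex
  using inner_ge_zero[of z] by linarith

lemma sph'_apply: "sph' z v = (inverse (1 + z \<bullet> z / 4) *\<^sub>R v - ((inverse (1 + z \<bullet> z / 4))\<^sup>2 * (z \<bullet> v) / 2) *\<^sub>R z,
     - ((inverse (1 + z \<bullet> z / 4))\<^sup>2 * (z \<bullet> v)))"
proof -
  have "bounded_linear (\<lambda>v. (inverse (1 + z \<bullet> z / 4) *\<^sub>R v - ((inverse (1 + z \<bullet> z / 4))\<^sup>2 * (z \<bullet> v) / 2) *\<^sub>R z,
     - ((inverse (1 + z \<bullet> z / 4))\<^sup>2 * (z \<bullet> v))))"
    unfolding linear_conv_bounded_linear[symmetric]
    by (rule linearI) (simp_all add: inner_add_right add_divide_distrib algebra_simps)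
  then show ?thesis by (simp add: sph'_def bounded_linear_Blinfun_apply)
qed

lemma sph_derivative: "(sph has_derivative sph' z) (at z)"
proof -
  have q: "((\<lambda>z::complex. inverse (1 + z \<bullet> z / 4)) has_derivative (\<lambda>v. - ((inverse (1 + z \<bullet> z / 4))\<^sup>2 * (z \<bullet> v) / 2))) (at z)"
    using sph_denominator[of z]
    by (auto intro!: derivative_eq_intros simp: power2_eq_square inner_commute algebra_simps)
  show ?thesis unfolding sph_def[abs_def] sph'_apply[abs_def]
    by (rule has_derivative_eq_rhs[OF has_derivative_Pair[OF has_derivative_scaleR[OF q has_derivative_ident]
          has_derivative_diff[OF has_derivative_mult_right[OF q] has_derivative_const]]])
      (auto simp: algebra_simps)
qed

lemma sph_sphere: "sph z \<bullet> sph z = 1" and sph_tangent: "sph z \<bullet> sph' z v = 0"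
proof -
  define i where "i = inverse (1 + z \<bullet> z / 4)"
  \<comment> \<open>Eliminates \<open>z \<bullet> z\<close> in favour of the inverse denominator
    \<open>i\<close>, so that only polynomial identities remain.\<close>
  have zz: "i * (z \<bullet> z) = 4 - 4 * i" using sph_denominator[of z] by (simp add: i_def field_simps)
  have "sph z \<bullet> sph z = i * (i * (z \<bullet> z)) + (2 * i - 1) * (2 * i - 1)" by (simp add: sph_def i_def[symmetric])
  then show "sph z \<bullet> sph z = 1" unfolding zz by algebra
  have "sph z \<bullet> sph' z v = i\<^sup>2 * (z \<bullet> v) - i\<^sup>2 * (z \<bullet> v) / 2 * (i * (z \<bullet> z)) - (2 * i - 1) * (i\<^sup>2 * (z \<bullet> v))"
    by (simp add: sph_def sph'_apply i_def[symmetric] inner_diff_right power2_eq_square algebra_simps)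
  then show "sph z \<bullet> sph' z v = 0" unfolding zz by (simp add: field_simps)
qed

lemma sph_in: "sph z \<in> sphere 0 1"
  using sph_sphere[of z] by (simp add: norm_eq_1)

lemma inj_sph: "inj sph"
proof (rule injI)
  fix z w assume e: "sph z = sph w"
  then have "inverse (1 + z \<bullet> z / 4) = inverse (1 + w \<bullet> w / 4)" by (simp add: sph_def)
  moreover from this have "inverse (1 + z \<bullet> z / 4) *\<^sub>R z = inverse (1 + z \<bullet> z / 4) *\<^sub>R w" using e by (simp add: sph_def)
  ultimately show "z = w" using sph_denominator[of z] by simp
qed

text \<open>The real coordinate of the derivative removes the term with
  \<open>z \<bullet> v\<close>, after which the complex one is a positive multiple of
  \<open>v\<close>.\<close>

lemma sph'_zero: assumes "sph' z v = 0" shows "v = 0"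
proof -
  have "(inverse (1 + z \<bullet> z / 4))\<^sup>2 * (z \<bullet> v) = 0" using assms by (simp add: sph'_apply zero_prod_def)
  then have "inverse (1 + z \<bullet> z / 4) *\<^sub>R v = 0" using assms by (simp add: sph'_apply zero_prod_def)
  then show ?thesis using sph_denominator[of z] by simp
qed

lemma inj_sph': "inj (sph' z)"
proof (rule injI)
  fix v w assume "sph' z v = sph' z w"
  then have "sph' z (v - w) = 0" by (simp add: blinfun.diff_right)
  from sph'_zero[OF this] show "v = w" by simp
qed

lemma continuous_on_sph': "continuous_on A sph'"
proof (rule continuous_on_blinfun_componentwise)
  have i: "continuous_on A (\<lambda>z::complex. inverse (1 + z \<bullet> z / 4))"
    using sph_denominator by (intro continuous_intros) (auto simp: less_imp_neq[symmetric])
  show "continuous_on A (\<lambda>z. sph' z v)" for v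
    unfolding sph'_apply
    by (intro continuous_on_Pair continuous_on_diff continuous_on_minus continuous_on_scaleR continuous_on_mult
        continuous_on_divide continuous_on_power continuous_on_inner continuous_on_id continuous_on_const i) simp_all
qed

lemma C1_curve_sph: assumes "C1_curve c c'" shows "C1_curve (\<lambda>t. sph (c t)) (\<lambda>t. sph' (c t) (c' t))"
  unfolding C1_curve_def
proof
  show "\<forall>t. ((\<lambda>t. sph (c t)) has_vector_derivative sph' (c t) (c' t)) (at t)"
  proof
    fix t
    have "(c has_vector_derivative c' t) (at t)" using assms by (simp add: C1_curve_def)
    from vector_derivative_diff_chain_within[OF this has_derivative_at_withinI[OF sph_derivative]]
    show "((\<lambda>t. sph (c t)) has_vector_derivative sph' (c t) (c' t)) (at t)" by (simp add: o_def)
  qed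
  have c: "continuous_on UNIV c" "continuous_on UNIV c'" using C1_curve_cont[OF assms] assms by (simp_all add: C1_curve_def)
  show "continuous_on UNIV (\<lambda>t. sph' (c t) (c' t))"
    by (intro bounded_bilinear.continuous_on[OF bounded_bilinear_blinfun_apply] c(2) continuous_on_compose2[OF continuous_on_sph'[of UNIV] c(1)]) simp
qed

lemma double_pair_sph: "double_pair (\<lambda>t. sph (c t)) s t \<longleftrightarrow> double_pair c s t"
  using inj_sph by (simp add: double_pair_def inj_eq)

text \<open>\<open>sph\<close> is an injective immersion of the plane, so it creates no crossings
  and keeps tangents independent.\<close>

lemma is_diagram_sph:
  assumes "is_diagram UNIV (c, Ov)" shows "is_diagram (sphere 0 1) (\<lambda>t. sph (c t), Ov)"
proof -
  note Dd = is_diagramD[OF assms]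
  note ci = closed_immersionD[OF Dd(1)]
  let ?v = "\<lambda>t. vector_derivative c (at t)"
  have v: "vector_derivative (\<lambda>t. sph (c t)) (at t) = sph' (c t) (?v t)" for t by (rule C1_curve_vd[OF C1_curve_sph[OF ci(1)]])
  have i: "indep (sph' (c s) (?v s)) (sph' (c t) (?v t))" if "double_pair c s t" for s t
  proof -
    have "c s = c t" using that by (simp add: double_pair_def)
    then show ?thesis using indep_linear_image[OF _ inj_sph' Dd(3)[OF that], of "c t"]
      by (simp add: bounded_linear.linear[OF blinfun.bounded_linear_right])
  qed
  show ?thesis unfolding is_diagram_def prod.case double_pair_sph
  proof (intro conjI allI impI)
    show "closed_immersion (\<lambda>t. sph (c t))"
    proof (rule closed_immersionI[OF C1_curve_sph[OF ci(1)]])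
      show "sph' (c t) (?v t) \<noteq> 0" for t using sph'_zero ci(3) by blast
    qed (simp add: ci(2))
    show "range (\<lambda>t. sph (c t)) \<subseteq> sphere 0 1" using sph_in by blast
    show "vector_derivative (\<lambda>t. sph (c t)) (at t) \<notin> span {vector_derivative (\<lambda>t. sph (c t)) (at s)}" if "double_pair c s t" for s t
      unfolding v using i[OF that] by (rule indep_notin_span)
    show "Ov \<subseteq> {s. \<exists>t. double_pair c s t}" using Dd(6) by blast
  qed (use Dd(4,5,7,8) in blast)+
qed

lemma square_chart_sph:
  assumes "square_chart UNIV \<phi>" shows "square_chart (sphere 0 1) (\<lambda>z. sph (\<phi> z))"
proof -
  obtain U \<phi>' where U: "open U" "square \<subseteq> U" "inj_on \<phi> U" "continuous_on U \<phi>'"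
    and d: "\<And>z. z \<in> U \<Longrightarrow> (\<phi> has_derivative blinfun_apply (\<phi>' z)) (at z)"
    and i: "\<And>z. z \<in> U \<Longrightarrow> inj (blinfun_apply (\<phi>' z))"
    using assms unfolding square_chart_def by blast
  have c: "continuous_on U \<phi>" using d by (intro continuous_at_imp_continuous_on) (blast intro: has_derivative_continuous)
  show ?thesis unfolding square_chart_def
  proof (intro exI[of _ U] exI[of _ "\<lambda>z. sph' (\<phi> z) o\<^sub>L \<phi>' z"] conjI ballI)
    show "(\<lambda>z. sph (\<phi> z)) ` U \<subseteq> sphere 0 1" using sph_in by blast
    show "inj_on (\<lambda>z. sph (\<phi> z)) U" using U(3) inj_sph by (simp add: inj_on_def)
    show "((\<lambda>z. sph (\<phi> z)) has_derivative blinfun_apply (sph' (\<phi> z) o\<^sub>L \<phi>' z)) (at z)" if "z \<in> U" for z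
      using diff_chain_at[OF d[OF that] sph_derivative] by (simp add: o_def blinfun_compose.rep_eq)
    show "inj (blinfun_apply (sph' (\<phi> z) o\<^sub>L \<phi>' z))" if "z \<in> U" for z
      unfolding blinfun_compose.rep_eq using inj_sph' i[OF that] by (rule inj_compose)
    show "continuous_on U (\<lambda>z. sph' (\<phi> z) o\<^sub>L \<phi>' z)"
      by (intro bounded_bilinear.continuous_on[OF bounded_bilinear_blinfun_compose] U(4) continuous_on_compose2[OF continuous_on_sph'[of UNIV] c]) simp
  qed (use U in blast)+
qed

text \<open>Since \<open>sph\<close> is injective, each clause about equal or avoided points is
  equivalent to its planar form; the chart is composed with \<open>sph\<close>.\<close>

lemma reid_at_sph:
  assumes "reid_at M UNIV (c\<^sub>1, O\<^sub>1) (c\<^sub>2, O\<^sub>2) \<phi> m r ht"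
  shows "reid_at M (sphere 0 1) (\<lambda>t. sph (c\<^sub>1 t), O\<^sub>1) (\<lambda>t. sph (c\<^sub>2 t), O\<^sub>2) (\<lambda>z. sph (\<phi> z)) m r ht"
proof -
  have e: "sph x = sph y \<longleftrightarrow> x = y" for x y using inj_sph by (simp add: inj_eq)
  have im: "sph x \<in> (\<lambda>z. sph (\<phi> z)) ` square \<longleftrightarrow> x \<in> \<phi> ` square" for x by (auto simp: image_iff e)
  show ?thesis using assms unfolding reid_at_def ball_simps fst_conv snd_conv e im
    by (elim conjE) (intro conjI square_chart_sph; (rule TrueI | assumption))
qed

text \<open>The plane is connected, so \<open>sph\<close> changes orientation by one sign for all
  charts. The sign may stay unknown, as at worst the two kinds of kinks are exchanged.\<close>

lemma chart_sign_sph: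
  obtains \<kappa> where "\<bar>\<kappa>\<bar> = 1"
    "\<And>\<phi>. square_chart UNIV \<phi> \<Longrightarrow> chart_sign det3 (\<lambda>z. sph (\<phi> z)) = \<kappa> * chart_sign (\<lambda>p a b. Im (cnj a * b)) \<phi>"
proof -
  note co = sphere.chart_orientation[OF open_UNIV subset_UNIV connected_UNIV _ continuous_on_sph' sph_derivative inj_sph' UNIV_I UNIV_I, where ?z0.0 = 0]
  have s: "range sph \<subseteq> sphere 0 1" using sph_in by blast
  define \<kappa> where "\<kappa> = sgn (det3 (sph 0) (sph' 0 1) (sph' 0 \<i>))"
  have "\<bar>\<kappa>\<bar> = 1" using co(2)[OF s] by (simp add: \<kappa>_def sgn_if)
  moreover have "chart_sign det3 (\<lambda>z. sph (\<phi> z)) = \<kappa> * chart_sign (\<lambda>p a b. Im (cnj a * b)) \<phi>" if "square_chart UNIV \<phi>" for \<phi>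
  proof -
    obtain U \<phi>' where "square \<subseteq> U" "\<And>z. z \<in> U \<Longrightarrow> (\<phi> has_derivative blinfun_apply (\<phi>' z)) (at z)"
      using \<open>square_chart UNIV \<phi>\<close> unfolding square_chart_def by blast
    then have d: "(\<phi> has_derivative \<phi>' 0) (at 0)" using square_connected(2) by blast
    have f: "frechet_derivative \<phi> (at 0) = \<phi>' 0" "frechet_derivative (\<lambda>z. sph (\<phi> z)) (at 0) = (\<lambda>v. sph' (\<phi> 0) (\<phi>' 0 v))"
      using frechet_derivative_at[OF d] frechet_derivative_at[OF diff_chain_at[OF d sph_derivative]] by (simp_all add: o_def)
    show ?thesis unfolding chart_sign_def f \<kappa>_def by (rule co(1)[OF s])
  qed
  ultimately show thesis by (rule that)
qed


text \<open>The quotient is extended by its limit, so that \<open>h * expq (s * h)\<close>, which is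
  \<open>(exp (s * h) - 1) / s\<close> for nonzero \<open>s\<close>, stays continuous at
  \<open>s = 0\<close>.\<close>

definition expq :: "real \<Rightarrow> real" where "expq x = (if x = 0 then 1 else (exp x - 1) / x)"

lemma expq_mult: "x * expq x = exp x - 1" by (simp add: expq_def)

lemma continuous_on_expq: "continuous_on UNIV expq"
proof (intro continuous_at_imp_continuous_on ballI)
  fix x :: real
  show "isCont expq x"
  proof (cases "x = 0")
    case True
    have "((\<lambda>h. (exp (0 + h) - exp 0) / h) \<longlongrightarrow> exp 0) (at (0::real))" using DERIV_exp unfolding DERIV_def .
    then have "((\<lambda>h. (exp h - 1) / h) \<longlongrightarrow> expq 0) (at 0)" by (simp add: expq_def)
    then have "(expq \<longlongrightarrow> expq 0) (at 0)"
      by (rule Lim_transform_eventually) (auto simp: expq_def eventually_at_filter)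
    then show ?thesis using True by (simp add: isCont_def)
  next
    case False
    have "isCont (\<lambda>x. (exp x - 1) / x) x" using False by (intro continuous_intros)
    moreover have "\<forall>\<^sub>F y in nhds x. (exp y - 1) / y = expq y"
      using t1_space_nhds[OF False] by eventually_elim (simp add: expq_def)
    ultimately show ?thesis by (rule isCont_cong[THEN iffD1, rotated])
  qed
qed

text \<open>The division by \<open>s\<close> disappears on differentiation in \<open>t\<close>, so
  one formula gives the velocity for all \<open>s\<close>, the limit case 0 included.\<close>

lemma curve_family_expq:
  assumes h: "C1_curve h h'"
  shows "curve_family (\<lambda>s t. h t * expq (s * h t)) (\<lambda>s t. exp (s * h t) * h' t)"
  unfolding curve_family_def
proof (intro conjI ballI allI)
  note ch = C1_curve_cont[OF h]
  have ch': "continuous_on UNIV h'" using h by (simp add: C1_curve_def)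
  have 1: "continuous_on ({0..1} \<times> UNIV) (\<lambda>x::real \<times> real. h (snd x))" "continuous_on ({0..1} \<times> UNIV) (\<lambda>x::real \<times> real. h' (snd x))"
    by (rule continuous_on_compose2[OF ch continuous_on_snd[OF continuous_on_id]], simp,
        rule continuous_on_compose2[OF ch' continuous_on_snd[OF continuous_on_id]], simp)
  have 2: "continuous_on ({0..1} \<times> UNIV) (\<lambda>x::real \<times> real. fst x * h (snd x))"
    by (intro continuous_on_mult continuous_on_fst continuous_on_id 1)
  show "continuous_on ({0..1} \<times> UNIV) (\<lambda>x. h (snd x) * expq (fst x * h (snd x)))"
    by (intro continuous_on_mult 1 continuous_on_compose2[OF continuous_on_expq 2]) simp
  show "continuous_on ({0..1} \<times> UNIV) (\<lambda>x. exp (fst x * h (snd x)) * h' (snd x))"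
    by (intro continuous_on_mult continuous_on_exp 1 2)
  fix s t :: real
  have d: "(h has_real_derivative h' t) (at t)"
    using h by (simp add: C1_curve_def has_real_derivative_iff_has_vector_derivative)
  have "((\<lambda>t. h t * expq (s * h t)) has_real_derivative exp (s * h t) * h' t) (at t)"
  proof (cases "s = 0")
    case True
    then show ?thesis using d by (simp add: expq_def)
  next
    case False
    have "((\<lambda>t. (exp (s * h t) - 1) / s) has_real_derivative exp (s * h t) * (s * h' t) / s) (at t)"
      using False d by (auto intro!: derivative_eq_intros)
    moreover have "h t * expq (s * h t) = (exp (s * h t) - 1) / s" for t
      using expq_mult[of "s * h t"] False by (simp add: field_simps)
    ultimately show ?thesis using False by simp
  qed
  then show "((\<lambda>t. h t * expq (s * h t)) has_vector_derivative exp (s * h t) * h' t) (at t)"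
    by (simp add: has_real_derivative_iff_has_vector_derivative)
qed

text \<open>Zooming into the sphere at the point \<open>(0, 1)\<close>: for \<open>s > 0\<close> the map
  \<open>(z, h) \<mapsto> (exp (s h) \<cdot> sph (s z) - (0, 1)) / s\<close> is an embedding, and it tends to the identity for
  \<open>s \<rightarrow> 0\<close>.\<close>

lemma embedded_isotopy_sph:
  assumes "embedding (\<lambda>t. (c t, h t))"
  shows "embedded_isotopy UNIV (\<lambda>t. (c t, h t)) (\<lambda>t. exp (h t) *\<^sub>R sph (c t))"
proof -
  have im: "closed_immersion (\<lambda>t. (c t, h t))" using assms by (simp add: embedding_def)
  have inj: "t - u \<in> \<int>" if "(c t, h t) = (c u, h u)" for t u
    using assms that unfolding embedding_def double_pair_def by blast
  note ci = closed_immersionD[OF im]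
  define c' h' where "c' = (\<lambda>t. fst (vector_derivative (\<lambda>t. (c t, h t)) (at t)))"
    and "h' = (\<lambda>t. snd (vector_derivative (\<lambda>t. (c t, h t)) (at t)))"
  have C: "C1_curve c c'" and Hc: "C1_curve h h'"
    using C1_curve_linear[OF bounded_linear_fst ci(1)] C1_curve_linear[OF bounded_linear_snd ci(1)]
    by (simp_all add: c'_def h'_def)
  have nz: "\<not> (c' t = 0 \<and> h' t = 0)" for t using ci(3)[of t] by (simp add: c'_def h'_def prod_eq_iff)
  have per: "c (t + 1) = c t" "h (t + 1) = h t" for t using ci(2)[of t] by simp_all
  have par: "curve_family (\<lambda>s t. s) (\<lambda>s t. 0::real)" and one: "curve_family (\<lambda>s t. k) (\<lambda>s t. 0)" for k :: real
    by (rule curve_family_param, rule continuous_on_id, rule curve_family_param, rule continuous_on_const)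
  define q where "q = (\<lambda>s t. 1 + s * s * (c t \<bullet> c t) * (1/4))"
  \<comment> \<open>The division by \<open>s\<close> is carried out, so the formula extends to
    \<open>s = 0\<close>. The final summand \<open>s\<close> of the second component vanishes there
    and compensates the subtracted \<open>(0, 1)\<close> at \<open>s = 1\<close>.\<close>
  define \<Gamma> where "\<Gamma> = (\<lambda>s t. ((exp (s * h t) * inverse (q s t)) *\<^sub>R c t,
    h t * expq (s * h t) - exp (s * h t) * inverse (q s t) * (s * (c t \<bullet> c t) * (1/2)) + s))"
  note FC = curve_family_const[OF C] and FH = curve_family_const[OF Hc]
  note cc = curve_family_inner[OF FC FC]
  note Fq = curve_family_add[OF one[of 1] curve_family_mult[OF curve_family_mult[OF curve_family_mult[OF par par] cc] one[of "1/4"]]]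
  have qp: "q s t > 0" for s t
  proof -
    have "0 \<le> s * s * (c t \<bullet> c t)" by simp
    then show ?thesis unfolding q_def by linarith
  qed
  note Fe = curve_family_mult[OF curve_family_exp[OF curve_family_mult[OF par FH]] curve_family_inverse[OF Fq]]
  have q0: "1 + s * s * (c t \<bullet> c t) * (1/4) \<noteq> 0" for s t using qp[of s t] by (simp add: q_def)
  note F = curve_family_Pair[OF curve_family_scaleR[OF Fe[OF q0] FC]
    curve_family_add[OF curve_family_diff[OF curve_family_expq[OF Hc]
      curve_family_mult[OF Fe[OF q0] curve_family_mult[OF curve_family_mult[OF par cc] one[of "1/2"]]]] par]]
  obtain \<Gamma>' where G: "curve_family \<Gamma> \<Gamma>'" unfolding \<Gamma>_def q_def using F by blast
  \<comment> \<open>For \<open>s > 0\<close> this recovers the scaled spherical curve, from which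
    injectivity and immersion are read off.\<close>
  have key: "s *\<^sub>R (\<Gamma> s t - (0, s)) + (0, 1) = exp (s * h t) *\<^sub>R sph (s *\<^sub>R c t)" for s t
  proof -
    have q: "1 + (s *\<^sub>R c t) \<bullet> (s *\<^sub>R c t) / 4 = q s t" by (simp add: q_def mult.assoc)
    have "s * s * (c t \<bullet> c t) = 4 * (q s t - 1)" by (simp add: q_def)
    then have e: "inverse (q s t) * (s * s * (c t \<bullet> c t)) = 4 - 4 * inverse (q s t)" using qp[of s t] by (simp add: field_simps)
    have "s * (h t * expq (s * h t)) = exp (s * h t) - 1" using expq_mult[of "s * h t"] by (simp add: mult.assoc)
    moreover have "s * (exp (s * h t) * inverse (q s t) * (s * (c t \<bullet> c t) * (1/2))) = exp (s * h t) * (inverse (q s t) * (s * s * (c t \<bullet> c t))) / 2"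
      by simp
    ultimately have "s * (h t * expq (s * h t) - exp (s * h t) * inverse (q s t) * (s * (c t \<bullet> c t) * (1/2))) + 1
        = exp (s * h t) * (2 * inverse (q s t) - 1)"
      unfolding e right_diff_distrib by (simp add: algebra_simps)
    then show ?thesis unfolding sph_def q \<Gamma>_def by (simp add: mult.commute mult.left_commute)
  qed
  have "embedded_isotopy UNIV (\<Gamma> 0) (\<Gamma> 1)"
  proof (rule embedded_isotopyI[OF G])
    fix s t :: real assume s: "s \<in> {0..1}"
    show "\<Gamma> s (t + 1) = \<Gamma> s t" by (simp add: \<Gamma>_def q_def per)
    show "t - u \<in> \<int>" if "\<Gamma> s t = \<Gamma> s u" for u
    proof (cases "s = 0")
      case True
      then show ?thesis using that inj[of t u] by (simp add: \<Gamma>_def q_def expq_def)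
    next
      case False
      have e: "exp (s * h t) *\<^sub>R sph (s *\<^sub>R c t) = exp (s * h u) *\<^sub>R sph (s *\<^sub>R c u)" unfolding key[symmetric] that ..
      \<comment> \<open>Points of the sphere have norm 1, so the norm of the curve yields the
        height.\<close>
      have "norm (sph z) = 1" for z using sph_in[of z] by simp
      then have "exp (s * h t) = exp (s * h u)" using arg_cong[OF e, of norm] by simp
      then have hh: "h t = h u" using False by simp
      then have "sph (s *\<^sub>R c t) = sph (s *\<^sub>R c u)" using e by simp
      then have "h t = h u" "c t = c u" using hh False inj_sph by (simp_all add: inj_eq)
      then show ?thesis using inj by simp
    qed
    show "\<Gamma>' s t \<noteq> 0"
    proof
      assume 0: "\<Gamma>' s t = 0"
      have d: "(\<Gamma> s has_vector_derivative 0) (at t)" using G s 0 unfolding curve_family_def by metis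
      show False
      proof (cases "s = 0")
        case True
        have "\<Gamma> s = (\<lambda>t. (c t, h t))" by (simp add: True \<Gamma>_def q_def expq_def)
        then show False using vector_derivative_at[OF d] ci(3)[of t] by simp
      next
        case False
        define P Q where "P = sph (s *\<^sub>R c t)" and "Q = sph' (s *\<^sub>R c t) (s *\<^sub>R c' t)"
        have "((\<lambda>t. s *\<^sub>R (\<Gamma> s t - (0, s)) + (0, 1)) has_vector_derivative s *\<^sub>R (0 - 0) + 0) (at t)"
          by (intro has_vector_derivative_add has_vector_derivative_const has_vector_derivative_diff d
              bounded_linear.has_vector_derivative[OF bounded_linear_scaleR_right])
        then have 1: "((\<lambda>t. exp (s * h t) *\<^sub>R sph (s *\<^sub>R c t)) has_vector_derivative 0) (at t)" unfolding key by simp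
        have hd: "(h has_real_derivative h' t) (at t)"
          using Hc by (simp add: C1_curve_def has_real_derivative_iff_has_vector_derivative)
        have "((\<lambda>t. exp (s * h t)) has_real_derivative exp (s * h t) * (s * h' t)) (at t)"
          by (rule DERIV_fun_exp[OF DERIV_cmult[OF hd]])
        moreover have "((\<lambda>t. sph (s *\<^sub>R c t)) has_vector_derivative Q) (at t)"
          using C1_curve_sph[OF C1_curve_linear[OF bounded_linear_scaleR_right C, of s]] by (simp add: C1_curve_def Q_def)
        ultimately have "((\<lambda>t. exp (s * h t) *\<^sub>R sph (s *\<^sub>R c t)) has_vector_derivative
            exp (s * h t) *\<^sub>R Q + (exp (s * h t) * (s * h' t)) *\<^sub>R P) (at t)"
          unfolding P_def by (rule has_vector_derivative_scaleR)
        then have 2: "exp (s * h t) *\<^sub>R Q + (exp (s * h t) * (s * h' t)) *\<^sub>R P = 0"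
          using vector_derivative_unique_at 1 by blast
        \<comment> \<open>The radial direction \<open>P\<close> is a unit vector orthogonal to the
          tangent \<open>Q\<close>, so the inner product isolates the change of height.\<close>
        have "P \<bullet> (exp (s * h t) *\<^sub>R Q + (exp (s * h t) * (s * h' t)) *\<^sub>R P) = exp (s * h t) * (s * h' t)"
          by (simp add: inner_add_right P_def Q_def sph_tangent sph_sphere)
        then have h0: "h' t = 0" unfolding 2 using False by simp
        then have "Q = 0" using 2 by simp
        then have "s *\<^sub>R c' t = 0" unfolding Q_def by (rule sph'_zero)
        then show False using nz[of t] h0 False by simp
      qed
    qed
  qed simp
  moreover have "\<Gamma> 0 = (\<lambda>t. (c t, h t))" by (simp add: \<Gamma>_def q_def expq_def)
  moreover have "\<Gamma> 1 = (\<lambda>t. exp (h t) *\<^sub>R sph (c t))"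
  proof
    fix t
    have "\<Gamma> 1 t = 1 *\<^sub>R (\<Gamma> 1 t - (0, 1)) + (0, 1)" by simp
    also have "\<dots> = exp (h t) *\<^sub>R sph (c t)" using key[of 1 t] by simp
    finally show "\<Gamma> 1 t = exp (h t) *\<^sub>R sph (c t)" .
  qed
  ultimately show ?thesis by simp
qed


theorem proposition4p1:
  fixes K :: "(real \<Rightarrow> (complex \<times> real) \<times> real) set"
  assumes "K \<in> knot_types"
  shows "\<not> hyperbolic_graph (planar_reidemeister_graph K) \<and>
         \<not> hyperbolic_graph (spherical_reidemeister_graph K)"
proof
  show "\<not> hyperbolic_graph (planar_reidemeister_graph K)"
    unfolding planar_reidemeister_graph_def
  proof (rule plane.not_hyperbolic_if_kinks)
    fix n :: nat
    obtain \<gamma> C H Ov \<phi> a b where k: "K = knot_equiv `` {\<gamma>}"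
      "\<And>F. F \<subseteq> {..<2 * n} \<Longrightarrow> is_diagram UNIV (C F, Ov F)"
      "\<And>F. F \<subseteq> {..<2 * n} \<Longrightarrow> H F C1_differentiable_on UNIV" "\<And>F t. F \<subseteq> {..<2 * n} \<Longrightarrow> H F (t + 1) = H F t"
      "\<And>F s t. F \<subseteq> {..<2 * n} \<Longrightarrow> double_pair (C F) s t \<Longrightarrow> s \<in> Ov F \<Longrightarrow> H F t < H F s"
      "\<And>F. F \<subseteq> {..<2 * n} \<Longrightarrow> embedding (\<lambda>t. (C F t, H F t))"
      "\<And>F. F \<subseteq> {..<2 * n} \<Longrightarrow> embedded_isotopy (sphere 0 1) \<gamma> (\<lambda>t. stereo_inv (C F t, H F t))"
      "\<And>F k. F \<subseteq> {..<2 * n} \<Longrightarrow> k < 2 * n \<Longrightarrow> k \<notin> F \<Longrightarrow>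
        reid_at R1_model UNIV (C F, Ov F) (C (insert k F), Ov (insert k F)) (\<phi> k) (\<lambda>_. a k) (\<lambda>_. b) (\<lambda>i. i)"
      "\<And>k. k < 2 * n \<Longrightarrow> chart_sign (\<lambda>p a b. Im (cnj a * b)) (\<phi> k) = 1"
      "\<And>F k. F \<subseteq> {..<2 * n} \<Longrightarrow> k < 2 * n \<Longrightarrow> a k + b * sqrt (1/2) \<in> Ov (insert k F) \<longleftrightarrow> even k"
      by (rule planar_kinks[OF assms, of "2 * n"], rule that)
    have "kink_cube UNIV Pair K (\<lambda>p a b. Im (cnj a * b)) (2 * n) (\<lambda>F. (C F, Ov F)) 1"
      by (rule plane.kink_cubeI[of K \<gamma> 1 "2 * n" C Ov H Pair \<phi> a b]) (fact k abs_one)+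
    then show "\<exists>DD \<kappa>. kink_cube UNIV Pair K (\<lambda>p a b. Im (cnj a * b)) (2 * n) DD \<kappa>" by blast
  qed
  show "\<not> hyperbolic_graph (spherical_reidemeister_graph K)"
    unfolding spherical_reidemeister_graph_def
  proof (rule sphere.not_hyperbolic_if_kinks)
    fix n :: nat
    obtain \<gamma> C H Ov \<phi> a b where k: "K = knot_equiv `` {\<gamma>}"
      and d: "\<And>F. F \<subseteq> {..<2 * n} \<Longrightarrow> is_diagram UNIV (C F, Ov F)"
      and h: "\<And>F. F \<subseteq> {..<2 * n} \<Longrightarrow> H F C1_differentiable_on UNIV" "\<And>F t. F \<subseteq> {..<2 * n} \<Longrightarrow> H F (t + 1) = H F t"
      and o: "\<And>F s t. F \<subseteq> {..<2 * n} \<Longrightarrow> double_pair (C F) s t \<Longrightarrow> s \<in> Ov F \<Longrightarrow> H F t < H F s"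
      and e: "\<And>F. F \<subseteq> {..<2 * n} \<Longrightarrow> embedding (\<lambda>t. (C F t, H F t))"
      and i: "\<And>F. F \<subseteq> {..<2 * n} \<Longrightarrow> embedded_isotopy (sphere 0 1) \<gamma> (\<lambda>t. stereo_inv (C F t, H F t))"
      and r: "\<And>F k. F \<subseteq> {..<2 * n} \<Longrightarrow> k < 2 * n \<Longrightarrow> k \<notin> F \<Longrightarrow>
        reid_at R1_model UNIV (C F, Ov F) (C (insert k F), Ov (insert k F)) (\<phi> k) (\<lambda>_. a k) (\<lambda>_. b) (\<lambda>i. i)"
      and c: "\<And>k. k < 2 * n \<Longrightarrow> chart_sign (\<lambda>p a b. Im (cnj a * b)) (\<phi> k) = 1"
      and x: "\<And>F k. F \<subseteq> {..<2 * n} \<Longrightarrow> k < 2 * n \<Longrightarrow> a k + b * sqrt (1/2) \<in> Ov (insert k F) \<longleftrightarrow> even k"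
      by (rule planar_kinks[OF assms, of "2 * n"], rule that)
    \<comment> \<open>One sign serves all sites, as \<open>kink_cube\<close> demands.\<close>
    obtain \<kappa> where \<kappa>: "\<bar>\<kappa>\<bar> = 1"
      "\<And>\<phi>. square_chart UNIV \<phi> \<Longrightarrow> chart_sign det3 (\<lambda>z. sph (\<phi> z)) = \<kappa> * chart_sign (\<lambda>p a b. Im (cnj a * b)) \<phi>"
      by (rule chart_sign_sph, rule that)
    have "kink_cube (sphere 0 1) (\<lambda>u h. exp h *\<^sub>R u) K det3 (2 * n) (\<lambda>F. (\<lambda>t. sph (C F t), Ov F)) \<kappa>"
    proof (rule sphere.kink_cubeI[of K \<gamma> \<kappa> "2 * n" "\<lambda>F t. sph (C F t)" Ov H "\<lambda>u h. exp h *\<^sub>R u" "\<lambda>k z. sph (\<phi> k z)" a b])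
      fix F assume F: "F \<subseteq> {..<2 * n}"
      show "is_diagram (sphere 0 1) (\<lambda>t. sph (C F t), Ov F)" by (rule is_diagram_sph[OF d[OF F]])
      show "H F t < H F s" if "double_pair (\<lambda>t. sph (C F t)) s t" "s \<in> Ov F" for s t
        using o[OF F] that unfolding double_pair_sph by blast
      \<comment> \<open>The planar position of the knot is joined to the spherical one in 3-space,
        and this isotopy is pushed to the 3-sphere.\<close>
      show "embedded_isotopy (sphere 0 1) \<gamma> (\<lambda>t. stereo_inv (exp (H F t) *\<^sub>R sph (C F t)))"
        by (rule embedded_isotopy_trans[OF i[OF F] embedded_isotopy_stereo[OF embedded_isotopy_sph[OF e[OF F]]]])
      fix k assume kn: "k < 2 * n"
      show "reid_at R1_model (sphere 0 1) (\<lambda>t. sph (C F t), Ov F) (\<lambda>t. sph (C (insert k F) t), Ov (insert k F))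
          (\<lambda>z. sph (\<phi> k z)) (\<lambda>_. a k) (\<lambda>_. b) (\<lambda>i. i)" if "k \<notin> F"
        by (rule reid_at_sph[OF r[OF F kn that]])
    next
      fix k assume kn: "k < 2 * n"
      have "square_chart UNIV (\<phi> k)" using r[OF empty_subsetI kn] unfolding reid_at_def by blast
      then show "chart_sign det3 (\<lambda>z. sph (\<phi> k z)) = \<kappa>" using \<kappa>(2) c[OF kn] by simp
    qed (fact k \<kappa>(1) h x)+
    then show "\<exists>DD \<kappa>. kink_cube (sphere 0 1) (\<lambda>u h. exp h *\<^sub>R u) K det3 (2 * n) DD \<kappa>" by blast
  qed
qed

end
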